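(* Let $\mu_1,\dots,\mu_m\in L^\infty(\mathbb R^n)$ be non-negative with compact, pairwise disjoint supports, and suppose there exist $c>1$ and nonempty bounded open sets $A_j$ with $c\chi_{A_j}\le\mu_j\le\|\mu_j\|_{L^\infty}\chi_{A_j}$ a.e. for each $j$. Let $\boldsymbol\mu=(\mu_1,\dots,\mu_m)$, $f_j=\mu_j-1$, and let $\mathbf u_*=(u_{*,1},\dots,u_{*,m})$ be the unique minimizer of $\mathcal J_{\mathbf f}$ over $\mathcal S_{m,\boldsymbol\mu}$, taken in its lower semicontinuous representative which vanishes identically on $\bigcup_{\ell\ne j}\operatorname{supp}(\mu_\ell)$ for each $j$. Let $$R_1>\operatorname{diam}\Big(\bigcup_{i=1}^m\operatorname{supp}(\mu_i)\Big),\qquad M=\max_i\mu_i(\mathbb R^n),\qquad R_2=R_1+\Big(\frac{M}{|B_1|}\Big)^{1/n}.$$ Let $j\in\{1,\dots,m\}$, $x\in\operatorname{supp}(\mu_j)$ and $R>0$ be such that $\mu_\ell(B_{2R}(x))=0$ for all $\ell\ne j$. If there is $\delta\in(0,R)$ with $B_\delta(x)\subset A_j$ and $\mu_j\ge C$ a.e. in $B_\delta(x)$, where $$C>1+\frac{M\big(\Psi(R)-\Psi(2R_2)\big)}{\Psi(\delta)-\Psi(R)}\cdot\frac{1}{|B_\delta|},$$ then $\overline{B_\delta(x)}\subset\{u_{*,j}>0\}$.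
   Context: We work in $\mathbb R^n$, $n\ge2$, with Lebesgue measure $\mathsf m$; $|B_r|$ is the volume of a ball of radius $r$. $\Psi(r)=-\frac1{2\pi}\log r$ if $n=2$ and $\Psi(r)=\frac{1}{n(n-2)|B_1|r^{n-2}}$ if $n\ge3$. For $f\in L^\infty$ and $v\in H^1(\mathbb R^n)$, $J_f(v)=\int(|\nabla v|^2-2fv)\,d\mathsf m$ (values in $(-\infty,+\infty]$); $\mathcal J_{\mathbf f}(\mathbf u)=\sum_iJ_{f_i}(u_i)$. $\mathcal S_m=\{\mathbf u\in(H^1(\mathbb R^n))^m:u_i\ge0,\ u_iu_j=0\text{ a.e. for }i\ne j\}$ and $\mathcal S_{m,\boldsymbol\mu}=\{\mathbf u\in\mathcal S_m:\int_{\{u_i=0\}}\mu_i\,d\mathsf m=0\text{ for all }i\}$. Under the stated hypotheses a minimizer over $\mathcal S_{m,\boldsymbol\mu}$ exists, is unique, and has a representative in which each $u_{*,j}$ is lower semicontinuous, vanishes on $\bigcup_{\ell\ne j}\operatorname{supp}\mu_\ell$, and $\{u_{*,j}>0\}$ is open.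
   Formalization: The lower semicontinuous representative is not unique (lowering it to 0 at one point of the ball keeps all stated properties but breaks the claim), so it is fixed as the one equal at every point to its essential lower limit. *)

theory Defs
  imports "HOL-Analysis.Analysis" "HOL-Probability.Essential_Supremum"
begin

fun Ck :: "nat \<Rightarrow> ('a::euclidean_space \<Rightarrow> real) set" where
  "Ck 0 = {f. continuous_on UNIV f}"
| "Ck (Suc k) = {f. (\<forall>x. f differentiable (at x)) \<and>
      (\<forall>i\<in>Basis. (\<lambda>x. frechet_derivative f (at x) i) \<in> Ck k)}"

definition test_fun :: "('a::euclidean_space \<Rightarrow> real) \<Rightarrow> bool" where
  "test_fun \<phi> \<longleftrightarrow> (\<forall>k. \<phi> \<in> Ck k) \<and> compact (closure {x. \<phi> x \<noteq> 0})"

definition L2 :: "('a::euclidean_space \<Rightarrow> real) \<Rightarrow> bool" where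
  "L2 u \<longleftrightarrow> u \<in> borel_measurable lebesgue \<and> integrable lebesgue (\<lambda>x. (u x)\<^sup>2)"

definition weak_gradient :: "('a::euclidean_space \<Rightarrow> real) \<Rightarrow> ('a \<Rightarrow> 'a) \<Rightarrow> bool" where
  "weak_gradient u g \<longleftrightarrow> g \<in> borel_measurable lebesgue \<and>
     (\<forall>\<phi>. test_fun \<phi> \<longrightarrow> (\<forall>i\<in>Basis.
        integrable lebesgue (\<lambda>x. u x * frechet_derivative \<phi> (at x) i) \<and>
        integrable lebesgue (\<lambda>x. (g x \<bullet> i) * \<phi> x) \<and>
        (\<integral>x. u x * frechet_derivative \<phi> (at x) i \<partial>lebesgue)
          = - (\<integral>x. (g x \<bullet> i) * \<phi> x \<partial>lebesgue)))"

definition H1 :: "('a::euclidean_space \<Rightarrow> real) \<Rightarrow> bool" where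
  "H1 u \<longleftrightarrow> L2 u \<and> (\<exists>g. weak_gradient u g \<and> (\<forall>i\<in>Basis. L2 (\<lambda>x. g x \<bullet> i)))"

definition wgrad :: "('a::euclidean_space \<Rightarrow> real) \<Rightarrow> 'a \<Rightarrow> 'a" where
  "wgrad u = (SOME g. weak_gradient u g \<and> (\<forall>i\<in>Basis. L2 (\<lambda>x. g x \<bullet> i)))"

definition J :: "('a::euclidean_space \<Rightarrow> real) \<Rightarrow> ('a \<Rightarrow> real) \<Rightarrow> ereal" where
  "J f v = (let h = (\<lambda>x. (norm (wgrad v x))\<^sup>2 - 2 * f x * v x) in
      enn2ereal (\<integral>\<^sup>+x. ennreal (h x) \<partial>lebesgue)
      - enn2ereal (\<integral>\<^sup>+x. ennreal (- h x) \<partial>lebesgue))"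

definition JJ :: "nat \<Rightarrow> (nat \<Rightarrow> 'a::euclidean_space \<Rightarrow> real) \<Rightarrow> (nat \<Rightarrow> 'a \<Rightarrow> real) \<Rightarrow> ereal" where
  "JJ m f u = (\<Sum>i\<in>{1..m}. J (f i) (u i))"

definition S_m :: "nat \<Rightarrow> (nat \<Rightarrow> 'a::euclidean_space \<Rightarrow> real) set" where
  "S_m m = {u. (\<forall>i\<in>{1..m}. H1 (u i) \<and> (AE x in lebesgue. u i x \<ge> 0)) \<and>
      (\<forall>i\<in>{1..m}. \<forall>j\<in>{1..m}. i \<noteq> j \<longrightarrow> (AE x in lebesgue. u i x * u j x = 0))}"

definition S_m_mu :: "nat \<Rightarrow> (nat \<Rightarrow> 'a::euclidean_space \<Rightarrow> real) \<Rightarrow> (nat \<Rightarrow> 'a \<Rightarrow> real) set" where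
  "S_m_mu m \<mu> = {u \<in> S_m m. \<forall>i\<in>{1..m}.
      (set_lebesgue_integral lebesgue {x. u i x = 0} (\<mu> i)) = 0}"

definition Linf :: "('a::euclidean_space \<Rightarrow> real) \<Rightarrow> bool" where
  "Linf f \<longleftrightarrow> f \<in> borel_measurable lebesgue \<and> (\<exists>B. AE x in lebesgue. \<bar>f x\<bar> \<le> B)"

definition Linf_norm :: "('a::euclidean_space \<Rightarrow> real) \<Rightarrow> real" where
  "Linf_norm f = real_of_ereal (esssup lebesgue (\<lambda>x. ereal \<bar>f x\<bar>))"

text \<open>Support of the measure f dx (f \<ge> 0): the complement of the largest open set
  on which f vanishes a.e.\<close>
definition supp :: "('a::euclidean_space \<Rightarrow> real) \<Rightarrow> 'a set" where
  "supp f = {x. \<forall>r>0. \<not> (AE y in lebesgue. y \<in> ball x r \<longrightarrow> f y = 0)}"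

definition meas_of :: "('a::euclidean_space \<Rightarrow> real) \<Rightarrow> 'a set \<Rightarrow> real" where
  "meas_of f S = set_lebesgue_integral lebesgue S f"

definition vol_ball :: "'a::euclidean_space itself \<Rightarrow> real \<Rightarrow> real" where
  "vol_ball _ r = measure lebesgue (ball (0::'a) r)"

text \<open>Fundamental solution profile \<Psi>, n = DIM('a).\<close>
definition Psi :: "'a::euclidean_space itself \<Rightarrow> real \<Rightarrow> real" where
  "Psi T r = (if DIM('a) = 2 then - ln r / (2 * pi)
     else 1 / (real DIM('a) * (real DIM('a) - 2) * vol_ball T 1 * r ^ (DIM('a) - 2)))"

definition lsc :: "('a::topological_space \<Rightarrow> real) \<Rightarrow> bool" where
  "lsc u \<longleftrightarrow> (\<forall>x t. t < u x \<longrightarrow> (\<forall>\<^sub>F y in at x. t < u y))"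

text \<open>The canonical lower semicontinuous representative: u(x) equals the essential
  lim inf of u at x.\<close>
definition ess_liminf_rep :: "('a::euclidean_space \<Rightarrow> real) \<Rightarrow> bool" where
  "ess_liminf_rep u \<longleftrightarrow> (\<forall>x. ereal (u x) =
     (SUP r\<in>{0<..}. - esssup (restrict_space lebesgue (ball x r)) (\<lambda>y. - ereal (u y))))"

end

(* The energy of a competitor is compared with that of u without passing through the
   Euler-Lagrange equations.

   Upper bound for the foreign phases. Let e_a be the fundamental solution averaged over a ball of
   radius a, and let b = (M/|B_1|)^(1/n). The potential psi_a of mu_l with kernel e_a - e_b is
   non-negative and -Laplace psi_a is at least (the mean of mu_l over balls of radius a) - 1,
   because |B_b| = M. Shrinking u_l in the direction of (u_l - psi_a)^+, cut off at infinity, shows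
   that the gradient of (u_l - psi_a)^+ tends to 0 in L2_loc as a -> 0, whence u_l is bounded by the
   limit of psi_a, and thus by M (Psi(R) - Psi(2 R2)) on the ball B_R(x).

   Lower bound for u_j. Put w = u_j - (sum of the other phases). The radial function q with
   -Laplace q = C on B_delta minus 1 on B_rho, q = 0 on the sphere of radius rho > delta, lies below
   w near the boundary of B_R(x) for a suitable rho; this is what the hypothesis on C provides.
   Replacing w by max w q and splitting it again into phases gives an admissible competitor whose
   energy is smaller by the Dirichlet energy of (q - w)^+. So u_j >= q > 0 on B_rho(x). *)
theory Submission
  imports Defs
begin

section \<open>Smooth functions and test functions\<close>

text \<open>Admissibility shapes both comparisons. A competitor stays segregated and is non-zero
  almost everywhere on its density. So \<open>u l\<close> is lowered only by fractions of itself,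
  and raising \<open>u j\<close> has to lower the other phases, which is harmless near x because
  their densities vanish on the ball of radius 2 R. For the upper bound -Laplace = \<mu> - 1 is
  enough of an equation. This slack of 1 pays for subtracting the mean over balls of radius b, and
  in return the kernel has compact support; for n = 2 the full kernel has no sign at infinity.
  Averaging at scale a makes the kernel C^1, so that its gradient can be tested against. The
  constant in the hypothesis on C balances charges. Outside the sphere of radius \<rho> the function
  q is the potential of the charge C |B_\<delta>| - |B_\<rho>|, that is, minus this charge times
  \<Psi>(\<rho>) - \<Psi>(r). As \<rho> tends to \<delta> and r to R, its size tends to (C - 1)
  |B_\<delta>| (\<Psi>(\<delta>) - \<Psi>(R)), and the hypothesis says that this exceeds the bound M
  (\<Psi>(R) - \<Psi>(2 R2)) of the foreign phases.\<close>

abbreviation pd :: "'a::euclidean_space \<Rightarrow> ('a \<Rightarrow> real) \<Rightarrow> 'a \<Rightarrow> real" where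
  "pd i f \<equiv> (\<lambda>x. frechet_derivative f (at x) i)"

definition smooth :: "('a::euclidean_space \<Rightarrow> real) \<Rightarrow> bool" where
  "smooth f \<longleftrightarrow> (\<forall>k. f \<in> Ck k)"

lemma Ck_SucD: "f \<in> Ck (Suc k) \<Longrightarrow> f \<in> Ck k"
proof (induction k arbitrary: f)
  case 0
  then have "\<forall>x. f differentiable (at x)" by simp
  then show ?case
    by (simp add: continuous_on_eq_continuous_within differentiable_imp_continuous_within)
next
  case (Suc k)
  have "f \<in> Ck (Suc (Suc k)) \<Longrightarrow> pd i f \<in> Ck (Suc k)" if "i \<in> Basis" for i
    using that unfolding Ck.simps(2)[of "Suc k"] by blast
  with Suc show ?case unfolding Ck.simps(2)[of k] Ck.simps(2)[of "Suc k"] by blast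
qed

lemma Ck_const: "(\<lambda>x. c) \<in> Ck k"
  by (induction k arbitrary: c) (auto simp: frechet_derivative_const)

lemma pd_eq: "(f has_derivative f') (at x) \<Longrightarrow> pd i f x = f' i"
  by (metis frechet_derivative_at)

lemma Ck_inner: "(\<lambda>x. x \<bullet> i) \<in> Ck k"
proof -
  have d: "((\<lambda>x. x \<bullet> i) has_derivative (\<lambda>h. h \<bullet> i)) (at x)" for x :: 'a
    by (auto intro!: derivative_eq_intros)
  show ?thesis
    using d by (cases k) (auto simp: pd_eq[OF d] Ck_const differentiable_def intro!: continuous_intros)
qed

lemma Ck_add: "f \<in> Ck k \<Longrightarrow> g \<in> Ck k \<Longrightarrow> (\<lambda>x. f x + g x) \<in> Ck k"
proof (induction k arbitrary: f g)
  case 0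
  then show ?case by (auto intro: continuous_intros)
next
  case (Suc k)
  then have d: "f differentiable (at x)" "g differentiable (at x)" for x by auto
  have "pd i (\<lambda>x. f x + g x) = (\<lambda>x. pd i f x + pd i g x)" for i
    by (rule ext, rule pd_eq) (auto intro!: derivative_eq_intros d[unfolded frechet_derivative_works])
  then show ?case using Suc d by auto
qed

lemma Ck_mult: "f \<in> Ck k \<Longrightarrow> g \<in> Ck k \<Longrightarrow> (\<lambda>x. f x * g x) \<in> Ck k"
proof (induction k arbitrary: f g)
  case 0
  then show ?case by (auto intro: continuous_intros)
next
  case (Suc k)
  then have d: "f differentiable (at x)" "g differentiable (at x)" for x by auto
  have "pd i (\<lambda>x. f x * g x) = (\<lambda>x. f x * pd i g x + pd i f x * g x)" for i
    by (rule ext, rule pd_eq) (auto intro!: derivative_eq_intros d[unfolded frechet_derivative_works])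
  moreover have "(\<lambda>x. f x * pd i g x + pd i f x * g x) \<in> Ck k" if "i \<in> Basis" for i
    using Suc that by (intro Ck_add Suc.IH) (auto intro: Ck_SucD)
  ultimately show ?case using d by auto
qed

lemma smooth_const [simp]: "smooth (\<lambda>x. c)" by (simp add: smooth_def Ck_const)
lemma smooth_inner [simp]: "smooth (\<lambda>x. x \<bullet> i)" by (simp add: smooth_def Ck_inner)
lemma smooth_add: "smooth f \<Longrightarrow> smooth g \<Longrightarrow> smooth (\<lambda>x. f x + g x)" by (simp add: smooth_def Ck_add)
lemma smooth_mult: "smooth f \<Longrightarrow> smooth g \<Longrightarrow> smooth (\<lambda>x. f x * g x)" by (simp add: smooth_def Ck_mult)
lemma smooth_minus: "smooth f \<Longrightarrow> smooth (\<lambda>x. - f x)"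
  using smooth_mult[of "\<lambda>x. - 1" f] by simp
lemma smooth_diff: "smooth f \<Longrightarrow> smooth g \<Longrightarrow> smooth (\<lambda>x. f x - g x)"
  using smooth_add[of f "\<lambda>x. - g x"] smooth_minus[of g] by simp
lemma smooth_power: "smooth f \<Longrightarrow> smooth (\<lambda>x. f x ^ p)"
  by (induction p) (auto intro: smooth_mult)
lemma smooth_sum: "(\<And>i. i \<in> I \<Longrightarrow> smooth (f i)) \<Longrightarrow> smooth (\<lambda>x. \<Sum>i\<in>I. f i x)"
  by (induction I rule: infinite_finite_induct) (auto intro: smooth_add)

lemma smooth_differentiable: "smooth f \<Longrightarrow> f differentiable (at x)"
  using Ck.simps(2)[of 0] unfolding smooth_def by blast

lemma smooth_has_derivative: "smooth f \<Longrightarrow> (f has_derivative frechet_derivative f (at x)) (at x)"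
  using smooth_differentiable frechet_derivative_works by blast

lemma smooth_pd: "smooth f \<Longrightarrow> i \<in> Basis \<Longrightarrow> smooth (pd i f)"
proof -
  assume a: "smooth f" "i \<in> Basis"
  have "pd i f \<in> Ck k" for k
    using a(1)[unfolded smooth_def, rule_format, of "Suc k"] a(2) unfolding Ck.simps(2) by blast
  then show ?thesis by (simp add: smooth_def)
qed

lemma smooth_continuous: "smooth f \<Longrightarrow> continuous_on S f"
  by (meson continuous_at_imp_continuous_on differentiable_imp_continuous_within smooth_differentiable)

lemma smooth_sqdist: "smooth (\<lambda>y::'a::euclidean_space. (y - x) \<bullet> (y - x))"
proof -
  have "smooth (\<lambda>y::'a. \<Sum>i\<in>Basis. (y \<bullet> i - x \<bullet> i) * (y \<bullet> i - x \<bullet> i))"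
    by (intro smooth_sum smooth_mult smooth_diff smooth_inner smooth_const)
  then show ?thesis by (subst euclidean_inner) (simp add: inner_diff_left)
qed

lemma pd_mult: "smooth f \<Longrightarrow> smooth g \<Longrightarrow> pd i (\<lambda>x. f x * g x) x = f x * pd i g x + pd i f x * g x"
  by (rule pd_eq) (auto intro!: derivative_eq_intros smooth_has_derivative)

text \<open>Differentiating once changes the outer function, so the induction runs over a whole
  family closed under differentiation; \<open>D\<close> sends an index to that of the derivative.
  Powers are indexed by pairs (coefficient, exponent), flat functions by polynomials.\<close>

lemma smooth_family_comp:
  fixes \<psi> :: "'p \<Rightarrow> real \<Rightarrow> real"
  assumes d: "\<And>p t. t \<in> S \<Longrightarrow> (\<psi> p has_real_derivative \<psi> (D p) t) (at t)"
    and f: "smooth f" and S: "\<And>x. f x \<in> S"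
  shows "smooth (\<lambda>x. \<psi> p (f x))"
proof -
  have hd: "((\<lambda>x. \<psi> p (f x)) has_derivative (\<lambda>h. \<psi> (D p) (f x) * frechet_derivative f (at x) h)) (at x)"
    for p x
    using has_derivative_compose[OF smooth_has_derivative[OF f, of x] d[OF S, of p, unfolded has_field_derivative_def]] .
  have "\<forall>p. (\<lambda>x. \<psi> p (f x)) \<in> Ck k" for k
  proof (induction k)
    case 0
    have "continuous (at x) (\<lambda>x. \<psi> p (f x))" for p x
      using has_derivative_continuous[OF hd] .
    then show ?case by (auto intro!: continuous_at_imp_continuous_on)
  next
    case (Suc k)
    have "pd i (\<lambda>x. \<psi> p (f x)) = (\<lambda>x. \<psi> (D p) (f x) * pd i f x)" for p i
      using pd_eq[OF hd] by auto
    moreover have "(\<lambda>x. \<psi> (D p) (f x) * pd i f x) \<in> Ck k" if "i \<in> Basis" for p i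
      using Suc smooth_pd[OF f that] by (intro Ck_mult) (auto simp: smooth_def)
    moreover have "(\<lambda>x. \<psi> p (f x)) differentiable (at x)" for p x
      using hd[of p x] unfolding differentiable_def by blast
    ultimately show ?case by auto
  qed
  then show ?thesis by (simp add: smooth_def)
qed

lemma smooth_powr:
  assumes "smooth f" "\<And>x. f x > 0"
  shows "smooth (\<lambda>x. f x powr q)"
proof -
  define \<psi> where "\<psi> p t = fst p * t powr snd p" for p :: "real \<times> real" and t
  have "smooth (\<lambda>x. \<psi> (1, q) (f x))"
  proof (rule smooth_family_comp[where \<psi>=\<psi> and S="{0<..}" and D="\<lambda>p. (fst p * snd p, snd p - 1)"])
    fix p :: "real \<times> real" and t :: real
    assume "t \<in> {0<..}"
    then show "(\<psi> p has_real_derivative \<psi> (fst p * snd p, snd p - 1) t) (at t)"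
      unfolding \<psi>_def by (auto intro!: derivative_eq_intros)
  qed (use assms in auto)
  then show ?thesis by (simp add: \<psi>_def)
qed

section \<open>The flat function exp(-1/t) and its derivatives\<close>

definition flat :: "real poly \<Rightarrow> real \<Rightarrow> real" where
  "flat p t = (if t > 0 then poly p (1 / t) * exp (- (1 / t)) else 0)"

lemma poly_times_exp_minus: "((\<lambda>x::real. poly p x * exp (- x)) \<longlongrightarrow> 0) at_top"
proof -
  have "((\<lambda>x. \<Sum>i\<le>degree p. coeff p i * (x ^ i / exp x)) \<longlongrightarrow> (\<Sum>i\<le>degree p. coeff p i * 0)) at_top"
    by (intro tendsto_intros tendsto_power_div_exp_0)
  moreover have "(\<Sum>i\<le>degree p. coeff p i * (x ^ i / exp x)) = poly p x * exp (- x)" for x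
    by (simp add: poly_altdef sum_distrib_right exp_minus divide_simps)
  ultimately show ?thesis by simp
qed

lemma flat_tendsto_0: "(flat p \<longlongrightarrow> 0) (at 0)"
proof -
  have "((\<lambda>t. poly p (inverse t) * exp (- (inverse t))) \<longlongrightarrow> 0) (at_right 0)"
    using filterlim_compose[OF poly_times_exp_minus filterlim_inverse_at_top_right] .
  moreover have "\<forall>\<^sub>F t in at_right 0. poly p (inverse t) * exp (- (inverse t)) = flat p t"
    unfolding eventually_at_filter by (rule always_eventually) (auto simp: flat_def field_simps)
  ultimately have "(flat p \<longlongrightarrow> 0) (at_right 0)"
    using tendsto_cong by fastforce
  moreover have "(flat p \<longlongrightarrow> 0) (at_left 0)"
    by (rule tendsto_eventually) (auto simp: eventually_at_filter flat_def)
  ultimately show ?thesis by (simp add: filterlim_split_at)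
qed

text \<open>With x = 1/t the derivative of p(x) exp(-x) is x^2 (p - p')(x) exp(-x), which has the
  same form with another polynomial; this closure is what \<open>smooth_family_comp\<close> asks
  for.\<close>

lemma flat_deriv: "(flat p has_real_derivative flat ([:0, 0, 1:] * (p - pderiv p)) t) (at t)"
proof (cases t "0::real" rule: linorder_cases)
  case less
  have "((\<lambda>_. 0::real) has_real_derivative 0) (at t)" by simp
  then have "(flat p has_real_derivative 0) (at t)"
    by (rule has_field_derivative_transform_within_open[where S="{..<0}"]) (use less in \<open>auto simp: flat_def\<close>)
  then show ?thesis using less by (simp add: flat_def)
next
  case equal
  \<comment> \<open>Dividing by h multiplies the polynomial in 1/h by its variable, so the
    difference quotient at 0 is itself a flat function and tends to 0.\<close>
  have "(\<lambda>h. (flat p (0 + h) - flat p 0) / h) = flat (pCons 0 p)"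
    by (auto simp: flat_def fun_eq_iff)
  then have "(flat p has_real_derivative 0) (at 0)"
    using flat_tendsto_0[of "pCons 0 p"] by (simp add: DERIV_def)
  then show ?thesis using equal by (simp add: flat_def)
next
  case greater
  have "((\<lambda>t. poly p (1 / t) * exp (- (1 / t))) has_real_derivative
      poly ([:0, 0, 1:] * (p - pderiv p)) (1 / t) * exp (- (1 / t))) (at t)"
    using greater
    by (auto intro!: derivative_eq_intros DERIV_chain2[OF poly_DERIV] simp: power2_eq_square field_simps)
  then have "(flat p has_real_derivative poly ([:0, 0, 1:] * (p - pderiv p)) (1 / t) * exp (- (1 / t))) (at t)"
    by (rule has_field_derivative_transform_within_open[where S="{0<..}"]) (use greater in \<open>auto simp: flat_def\<close>)
  then show ?thesis using greater by (simp add: flat_def)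
qed

abbreviation "flat1 \<equiv> flat 1"

lemma smooth_flat: "smooth f \<Longrightarrow> smooth (\<lambda>x. flat p (f x))"
  by (rule smooth_family_comp[where S=UNIV and \<psi>=flat and D="\<lambda>p. [:0, 0, 1:] * (p - pderiv p)"])
    (auto intro: flat_deriv simp del: mult_pCons_left)

lemma flat1_pos: "t > 0 \<Longrightarrow> flat1 t > 0" and flat1_0: "t \<le> 0 \<Longrightarrow> flat1 t = 0" and flat1_nonneg: "flat1 t \<ge> 0"
  by (auto simp: flat_def)

section \<open>Test functions and cutoffs\<close>

lemma test_fun_iff: "test_fun \<phi> \<longleftrightarrow> smooth \<phi> \<and> (\<exists>r. \<forall>x. norm x > r \<longrightarrow> \<phi> x = 0)"
proof
  assume t: "test_fun \<phi>"
  then have "bounded (closure {x. \<phi> x \<noteq> 0})" by (simp add: test_fun_def compact_imp_bounded)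
  then obtain r where "\<And>x. x \<in> closure {x. \<phi> x \<noteq> 0} \<Longrightarrow> norm x \<le> r"
    by (auto simp: bounded_iff)
  moreover have "\<phi> x \<noteq> 0 \<Longrightarrow> x \<in> closure {x. \<phi> x \<noteq> 0}" for x
    using closure_subset by fastforce
  ultimately have "\<forall>x. norm x > r \<longrightarrow> \<phi> x = 0" using linorder_not_less by blast
  then show "smooth \<phi> \<and> (\<exists>r. \<forall>x. norm x > r \<longrightarrow> \<phi> x = 0)"
    using t unfolding test_fun_def smooth_def by blast
next
  assume "smooth \<phi> \<and> (\<exists>r. \<forall>x. norm x > r \<longrightarrow> \<phi> x = 0)"
  then obtain r where r: "smooth \<phi>" "\<And>x. norm x > r \<Longrightarrow> \<phi> x = 0" by blast
  have "bounded {x. \<phi> x \<noteq> 0}"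
    unfolding bounded_iff using r(2) by (metis (mono_tags, lifting) linorder_not_less mem_Collect_eq)
  then show "test_fun \<phi>" using r(1) by (simp add: test_fun_def smooth_def compact_closure)
qed

lemma test_funI: "smooth \<phi> \<Longrightarrow> (\<And>x. norm x > r \<Longrightarrow> \<phi> x = 0) \<Longrightarrow> test_fun \<phi>"
  by (auto simp: test_fun_iff)

lemma test_fun_smooth: "test_fun \<phi> \<Longrightarrow> smooth \<phi>" by (simp add: test_fun_iff)

lemma pd_zero_off_support:
  assumes "\<And>x. norm x > r \<Longrightarrow> \<phi> x = 0" "norm x > r"
  shows "pd i \<phi> x = 0"
proof -
  have "open {x::'a. norm x > r}" by (simp add: open_Collect_less continuous_on_norm continuous_on_id)
  then have "(\<phi> has_derivative (\<lambda>h. 0)) (at x)"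
    using has_derivative_transform_within_open[of "\<lambda>x. 0" "\<lambda>h. 0" x UNIV "{x. norm x > r}" \<phi>] assms by auto
  then show ?thesis using pd_eq by blast
qed

lemma test_fun_pd: "test_fun \<phi> \<Longrightarrow> i \<in> Basis \<Longrightarrow> test_fun (pd i \<phi>)"
  unfolding test_fun_iff using smooth_pd pd_zero_off_support by blast

lemma test_fun_mult: "test_fun \<phi> \<Longrightarrow> smooth f \<Longrightarrow> test_fun (\<lambda>x. f x * \<phi> x)"
  unfolding test_fun_iff by (auto intro: smooth_mult)

lemma test_fun_bounded:
  assumes "test_fun \<phi>"
  obtains B where "B > 0" "\<And>x. \<bar>\<phi> x\<bar> \<le> B"
proof -
  obtain r where r: "smooth \<phi>" "\<And>x. norm x > r \<Longrightarrow> \<phi> x = 0" using assms by (auto simp: test_fun_iff)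
  have "bounded (\<phi> ` cball 0 r)"
    by (intro compact_imp_bounded compact_continuous_image smooth_continuous r) simp
  then obtain B where B: "\<And>x. x \<in> cball 0 r \<Longrightarrow> \<bar>\<phi> x\<bar> \<le> B" unfolding bounded_iff by (metis image_eqI real_norm_def)
  have "\<bar>\<phi> x\<bar> \<le> max B 1" for x
    using B[of x] r(2)[of x] by (cases "norm x \<le> r") auto
  then show ?thesis using that[of "max B 1"] by auto
qed

lemma test_fun_continuous: "test_fun \<phi> \<Longrightarrow> continuous_on S \<phi>"
  using smooth_continuous test_fun_smooth by blast

lemma test_fun_translate:
  assumes "test_fun \<phi>"
  shows "test_fun (\<lambda>x. \<phi> (x + z))" and "pd i (\<lambda>x. \<phi> (x + z)) = (\<lambda>x. pd i \<phi> (x + z))"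
proof -
  have hd: "((\<lambda>x. \<psi> (x + z)) has_derivative frechet_derivative \<psi> (at (x + z))) (at x)"
    if "\<psi> differentiable (at (x + z))" for \<psi> :: "'a \<Rightarrow> real" and x
  proof -
    have "((\<lambda>x. x + z) has_derivative (\<lambda>h. h)) (at x)" by (auto intro!: derivative_eq_intros)
    from has_derivative_compose[OF this that[unfolded frechet_derivative_works]] show ?thesis .
  qed
  have pd: "pd i (\<lambda>x. \<psi> (x + z)) = (\<lambda>x. pd i \<psi> (x + z))"
    if "\<And>x. \<psi> differentiable (at x)" for \<psi> :: "'a \<Rightarrow> real" and i
    using pd_eq[OF hd] that by auto
  show "pd i (\<lambda>x. \<phi> (x + z)) = (\<lambda>x. pd i \<phi> (x + z))"
    using pd assms smooth_differentiable test_fun_smooth by blast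
  have "\<forall>\<psi>. \<psi> \<in> Ck k \<longrightarrow> (\<lambda>x. \<psi> (x + z)) \<in> Ck k" for k
  proof (induction k)
    case 0
    then show ?case by (auto intro!: continuous_on_compose2[of UNIV _ _ "\<lambda>x. x + z"] continuous_intros)
  next
    case (Suc k)
    have "(\<lambda>x. \<psi> (x + z)) differentiable (at x)" if "\<And>x. \<psi> differentiable (at x)" for \<psi> :: "'a \<Rightarrow> real" and x
      using hd[of \<psi> x] that unfolding differentiable_def by blast
    moreover have "pd i (\<lambda>x. \<psi> (x + z)) \<in> Ck k" if "\<And>x. \<psi> differentiable (at x)" "pd i \<psi> \<in> Ck k"
      for \<psi> :: "'a \<Rightarrow> real" and i
      unfolding pd[OF that(1)] using Suc.IH that(2) by blast
    ultimately show ?case by simp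
  qed
  then have "smooth (\<lambda>x. \<phi> (x + z))" using assms by (auto simp: test_fun_def smooth_def)
  moreover obtain r where r: "\<And>x. norm x > r \<Longrightarrow> \<phi> x = 0" using assms by (auto simp: test_fun_iff)
  have "\<phi> (x + z) = 0" if "norm x > r + norm z" for x
    by (rule r) (use that norm_triangle_ineq4[of "x + z" z] in auto)
  ultimately show "test_fun (\<lambda>x. \<phi> (x + z))" by (rule test_funI)
qed

text \<open>The quotient p / (p + q) of two flat functions of the squared distance, which is smooth
  also at the centre. Here p vanishes beyond b and q within a, never both, because a < b.\<close>

lemma cutoff_exists:
  fixes x :: "'a::euclidean_space"
  assumes "0 \<le> a" "a < b"
  obtains \<theta> where "test_fun \<theta>" "\<And>y. 0 \<le> \<theta> y \<and> \<theta> y \<le> 1" "\<And>y. dist x y \<le> a \<Longrightarrow> \<theta> y = 1"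
    "\<And>y. dist x y \<ge> b \<Longrightarrow> \<theta> y = 0"
proof -
  define s where "s y = (y - x) \<bullet> (y - x)" for y
  have s: "s y = (dist x y)\<^sup>2" for y by (simp add: s_def dist_norm power2_norm_eq_inner[symmetric] norm_minus_commute)
  define p where "p y = flat1 (b\<^sup>2 - s y)" for y
  define q where "q y = flat1 (s y - a\<^sup>2)" for y
  have ab: "a\<^sup>2 < b\<^sup>2" using assms by (simp add: power_strict_mono)
  have sm: "smooth s" unfolding s_def by (rule smooth_sqdist)
  have sp: "smooth p" "smooth q" unfolding p_def q_def by (intro smooth_flat smooth_diff smooth_const sm)+
  have pos: "p y + q y > 0" for y
    using flat1_pos[of "b\<^sup>2 - s y"] flat1_pos[of "s y - a\<^sup>2"] ab flat1_nonneg
    unfolding p_def q_def by (smt (verit))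
  \<comment> \<open>Written with a power so that \<open>smooth_powr\<close> yields smoothness; the
    quotient form follows since p + q > 0.\<close>
  define \<theta> where "\<theta> y = p y * (p y + q y) powr (- 1)" for y
  have th: "\<theta> y = p y / (p y + q y)" for y
    unfolding \<theta>_def using pos[of y] by (simp add: powr_minus_divide)
  have nn: "p y \<ge> 0" "q y \<ge> 0" for y by (auto simp: p_def q_def flat1_nonneg)
  show ?thesis
  proof
    have sm\<theta>: "smooth \<theta>" unfolding \<theta>_def by (intro smooth_mult smooth_powr smooth_add sp pos)
    show z: "\<theta> y = 0" if "dist x y \<ge> b" for y
    proof -
      have "b\<^sup>2 \<le> s y" unfolding s using that assms by (intro power_mono) auto
      then show ?thesis by (simp add: th p_def flat1_0)
    qed
    show "0 \<le> \<theta> y \<and> \<theta> y \<le> 1" for y using nn[of y] pos[of y] by (auto simp: th divide_simps)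
    show "\<theta> y = 1" if "dist x y \<le> a" for y
    proof -
      have "s y \<le> a\<^sup>2" unfolding s using that by (intro power_mono) auto
      then have "q y = 0" by (simp add: q_def flat1_0)
      then show ?thesis using pos[of y] by (simp add: th)
    qed
    show "test_fun \<theta>"
    proof (rule test_funI[OF sm\<theta>, of "norm x + b"])
      fix y :: 'a assume "norm x + b < norm y"
      then have "dist x y \<ge> b" using norm_triangle_ineq2[of y x] by (simp add: dist_norm norm_minus_commute)
      then show "\<theta> y = 0" by (rule z)
    qed
  qed
qed

lemma smooth_line_deriv:
  assumes "smooth f"
  shows "((\<lambda>t. f (x + t *\<^sub>R i)) has_real_derivative pd i f (x + t *\<^sub>R i)) (at t)"
proof -
  have "((\<lambda>t. x + t *\<^sub>R i) has_derivative (\<lambda>h. h *\<^sub>R i)) (at t)"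
    by (auto intro!: derivative_eq_intros)
  from has_derivative_compose[OF this smooth_has_derivative[OF assms]]
  have "((\<lambda>t. f (x + t *\<^sub>R i)) has_derivative (\<lambda>h. frechet_derivative f (at (x + t *\<^sub>R i)) (h *\<^sub>R i))) (at t)" .
  moreover have "frechet_derivative f (at y) (h *\<^sub>R i) = h * pd i f y" for y h
    using linear_frechet_derivative[OF smooth_differentiable[OF assms]] by (simp add: linear_cmul)
  ultimately show ?thesis by (simp add: has_field_derivative_def mult.commute[of _ "pd i f _"])
qed

section \<open>Mollification\<close>

lemma lborel_translate:
  fixes f :: "'a::euclidean_space \<Rightarrow> real"
  assumes [measurable]: "f \<in> borel_measurable borel"
  shows "integrable lborel (\<lambda>x. f (x + z)) \<longleftrightarrow> integrable lborel f"
    and "(\<integral>x. f (x + z) \<partial>lborel) = (\<integral>x. f x \<partial>lborel)"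
proof -
  have d: "distr lborel borel (\<lambda>x. x + z) = (lborel :: 'a measure)"
    using lborel_distr_plus[of z] by (simp add: add.commute[of z, abs_def])
  have m: "(\<lambda>x. x + z) \<in> lborel \<rightarrow>\<^sub>M borel" by simp
  show "integrable lborel (\<lambda>x. f (x + z)) \<longleftrightarrow> integrable lborel f"
    using integrable_distr_eq[OF m, of f] by (simp add: d)
  show "(\<integral>x. f (x + z) \<partial>lborel) = (\<integral>x. f x \<partial>lborel)"
    using integral_distr[OF m, of f] by (simp add: d)
qed

text \<open>For an open set, domination handles the points that leave it, and translation invariance of
  the measure the points that enter it.\<close>
lemma translation_continuous_open:
  fixes U :: "'a::euclidean_space set"
  assumes U: "open U" "emeasure lborel U < \<infinity>" and Z: "Z \<longlonglongrightarrow> 0"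
  shows "(\<lambda>n. \<integral>x. \<bar>indicator U (x + Z n) - indicator U x\<bar> \<partial>lborel) \<longlonglongrightarrow> (0::real)"
proof -
  have [measurable]: "U \<in> sets borel" using U by simp
  have i: "integrable lborel (indicator U :: 'a \<Rightarrow> real)" using U by simp
  have it: "integrable lborel (\<lambda>x. indicator U (x + z) :: real)" for z
    using lborel_translate(1)[of "indicator U"] i by simp
  define p where "p n = (\<integral>x. max (0::real) (indicator U x - indicator U (x + Z n)) \<partial>lborel)" for n :: nat
  have ip: "integrable lborel (\<lambda>x. max 0 (indicator U x - indicator U (x + z)) :: real)" for z
    by (intro integrable_max integrable_zero Bochner_Integration.integrable_diff i it)
  have "(\<lambda>n. \<integral>x. max (0::real) (indicator U x - indicator U (x + Z n)) \<partial>lborel) \<longlonglongrightarrow> (\<integral>x. (0::real) \<partial>(lborel :: 'a measure))"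
  proof (rule integral_dominated_convergence[where w="\<lambda>x. indicator U x"
        and s="\<lambda>n x. max 0 (indicator U x - indicator U (x + Z n))" and f="\<lambda>x. 0"])
    show "AE x in lborel. (\<lambda>n. max 0 (indicator U x - indicator U (x + Z n))) \<longlonglongrightarrow> (0::real)"
    proof (rule AE_I2)
      fix x :: 'a
      show "(\<lambda>n. max 0 (indicator U x - indicator U (x + Z n))) \<longlonglongrightarrow> (0::real)"
      proof (cases "x \<in> U")
        case True
        have "(\<lambda>n. x + Z n) \<longlonglongrightarrow> x" using tendsto_add[OF tendsto_const Z, of x] by simp
        then have "\<forall>\<^sub>F n in sequentially. x + Z n \<in> U" using True U(1) topological_tendstoD by blast
        then have "\<forall>\<^sub>F n in sequentially. max 0 (indicator U x - indicator U (x + Z n)) = (0::real)"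
          by eventually_elim (use True in auto)
        then show ?thesis by (rule tendsto_eventually)
      qed auto
    qed
    show "AE x in lborel. norm (max (0::real) (indicator U x - indicator U (x + Z n))) \<le> indicator U x" for n
      by (rule AE_I2) (auto simp: indicator_def)
  qed (use i in auto)
  then have "p \<longlonglongrightarrow> 0" by (simp add: p_def[abs_def])
  moreover have "(\<integral>x. \<bar>indicator U (x + Z n) - indicator U x :: real\<bar> \<partial>lborel) = 2 * p n" for n
  proof -
    have "(\<integral>x. \<bar>indicator U (x + Z n) - indicator U x :: real\<bar> \<partial>lborel) =
        (\<integral>x. 2 * max 0 (indicator U x - indicator U (x + Z n)) + (indicator U (x + Z n) - indicator U x) \<partial>lborel)"
      by (rule Bochner_Integration.integral_cong) (auto simp: indicator_def)
    also have "\<dots> = 2 * p n + ((\<integral>x. indicator U (x + Z n) \<partial>lborel) - (\<integral>x. indicator U x \<partial>lborel))"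
      unfolding p_def using ip it i by (subst Bochner_Integration.integral_add) auto
    also have "(\<integral>x. indicator U (x + Z n) \<partial>lborel) = (\<integral>x. indicator U x \<partial>lborel :: real)"
      by (rule lborel_translate(2)) simp
    finally show ?thesis by simp
  qed
  ultimately show ?thesis by (simp add: tendsto_mult_right_zero)
qed

lemma integral_abs_triangle:
  fixes f g h :: "'a \<Rightarrow> real"
  assumes "integrable M f" "integrable M g" "integrable M h"
  shows "(\<integral>x. \<bar>f x - h x\<bar> \<partial>M) \<le> (\<integral>x. \<bar>f x - g x\<bar> \<partial>M) + (\<integral>x. \<bar>g x - h x\<bar> \<partial>M)"
proof -
  have "(\<integral>x. \<bar>f x - h x\<bar> \<partial>M) \<le> (\<integral>x. \<bar>f x - g x\<bar> + \<bar>g x - h x\<bar> \<partial>M)"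
    using assms by (intro integral_mono) auto
  then show ?thesis using assms by simp
qed

text \<open>The difference f(x + z) - f(x) is compared through g(x + z) and g(x). By translation
  invariance both errors equal the L1 distance of f and g, hence the factor 2.\<close>

lemma translation_osc_perturb:
  fixes f g :: "'a::euclidean_space \<Rightarrow> real"
  assumes f: "integrable lborel f" and g: "integrable lborel g"
  shows "(\<integral>x. \<bar>f (x + z) - f x\<bar> \<partial>lborel) \<le>
    (\<integral>x. \<bar>g (x + z) - g x\<bar> \<partial>lborel) + 2 * (\<integral>x. \<bar>f x - g x\<bar> \<partial>lborel)"
proof -
  have [measurable]: "f \<in> borel_measurable borel" "g \<in> borel_measurable borel" using f g by auto
  have t: "integrable lborel (\<lambda>x. f (x + z))" "integrable lborel (\<lambda>x. g (x + z))"
    using f g by (auto simp: lborel_translate)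
  have "(\<integral>x. \<bar>f (x + z) - f x\<bar> \<partial>lborel) \<le>
    (\<integral>x. \<bar>f (x + z) - g (x + z)\<bar> \<partial>lborel) + (\<integral>x. \<bar>g (x + z) - f x\<bar> \<partial>lborel)"
    by (rule integral_abs_triangle) (use f g t in auto)
  also have "(\<integral>x. \<bar>f (x + z) - g (x + z)\<bar> \<partial>lborel) = (\<integral>x. \<bar>f x - g x\<bar> \<partial>lborel)"
    by (rule lborel_translate(2)[of "\<lambda>x. \<bar>f x - g x\<bar>"]) simp
  also have "(\<integral>x. \<bar>g (x + z) - f x\<bar> \<partial>lborel) \<le> (\<integral>x. \<bar>g (x + z) - g x\<bar> \<partial>lborel) + (\<integral>x. \<bar>g x - f x\<bar> \<partial>lborel)"
    by (rule integral_abs_triangle) (use f g t in auto)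
  finally show ?thesis by (simp add: abs_minus_commute)
qed

text \<open>Induction over integrable functions. By \<open>translation_osc_perturb\<close> a
  measurable set may be replaced by an open superset of nearly equal measure, and an L1 limit by one
  of its approximants.\<close>

lemma translation_continuous_L1:
  fixes f :: "'a::euclidean_space \<Rightarrow> real"
  assumes "integrable lborel f" "Z \<longlonglongrightarrow> 0"
  shows "(\<lambda>n. \<integral>x. \<bar>f (x + Z n) - f x\<bar> \<partial>lborel) \<longlonglongrightarrow> 0"
  using assms(1)
proof (induction rule: integrable_induct)
  case (base A c)
  then have [measurable]: "A \<in> sets borel" by simp
  have "(\<lambda>n. \<integral>x. \<bar>indicator A (x + Z n) - indicator A x\<bar> \<partial>lborel) \<longlonglongrightarrow> (0::real)"
  proof (rule LIMSEQ_I)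
    fix e :: real assume e: "e > 0"
    have "A \<in> sets lebesgue" by simp
    then obtain U where U: "open U" "A \<subseteq> U" "U - A \<in> lmeasurable" "emeasure lebesgue (U - A) < ennreal (e / 4)"
      using sets_lebesgue_outer_open[of A "e / 4"] e by auto
    have [measurable]: "U \<in> sets borel" using U by simp
    have UA: "emeasure lborel (U - A) < ennreal (e / 4)" using U(4) by simp
    have "emeasure lborel U = emeasure lborel (U - A) + emeasure lborel A"
      using U(2) by (subst plus_emeasure) (auto intro!: arg_cong[where f="emeasure lborel"])
    then have fin: "emeasure lborel U < \<infinity>" using UA base(2) by (auto simp: less_top[symmetric] top_unique)
    have iA: "integrable lborel (indicator A :: 'a \<Rightarrow> real)" "integrable lborel (indicator U :: 'a \<Rightarrow> real)"
      using base fin by auto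
    have "(\<integral>x. \<bar>indicator A x - indicator U x\<bar> \<partial>lborel) = (\<integral>x. indicator (U - A) x \<partial>lborel :: real)"
      using U(2) by (intro Bochner_Integration.integral_cong) (auto simp: indicator_def)
    also have "\<dots> = measure lborel (U - A)" by simp
    also have "\<dots> < e / 4"
      unfolding measure_def using enn2real_less_iff[of "emeasure lborel (U - A)" "e / 4"] UA ennreal_less_top
      by (meson less_trans)
    finally have d: "(\<integral>x. \<bar>indicator A x - indicator U x\<bar> \<partial>lborel) < e / 4" .
    obtain N where N: "\<And>n. n \<ge> N \<Longrightarrow> norm ((\<integral>x. \<bar>indicator U (x + Z n) - indicator U x\<bar> \<partial>lborel) - 0 :: real) < e / 2"
      using LIMSEQ_D[OF translation_continuous_open[OF U(1) fin assms(2)], of "e / 2"] e by (metis half_gt_zero)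
    have "norm ((\<integral>x. \<bar>indicator A (x + Z n) - indicator A x\<bar> \<partial>lborel) - 0 :: real) < e" if "n \<ge> N" for n
    proof -
      have "(\<integral>x. \<bar>indicator U (x + Z n) - indicator U x\<bar> \<partial>lborel) < e / 2" using N[OF that] by auto
      then have "(\<integral>x. \<bar>indicator A (x + Z n) - indicator A x\<bar> \<partial>lborel) < e"
        using translation_osc_perturb[OF iA, of "Z n"] d by linarith
      then show ?thesis by simp
    qed
    then show "\<exists>N. \<forall>n\<ge>N. norm ((\<integral>x. \<bar>indicator A (x + Z n) - indicator A x\<bar> \<partial>lborel) - 0 :: real) < e" by blast
  qed
  then have "(\<lambda>n. \<bar>c\<bar> * (\<integral>x. \<bar>indicator A (x + Z n) - indicator A x\<bar> \<partial>lborel)) \<longlonglongrightarrow> 0"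
    by (rule tendsto_mult_right_zero)
  moreover have "\<bar>indicator A (x + z) *\<^sub>R c - indicator A x *\<^sub>R c\<bar> = \<bar>c\<bar> * \<bar>indicator A (x + z) - indicator A x\<bar>" for x z
    by (simp add: abs_mult[symmetric] algebra_simps)
  ultimately show ?case by simp
next
  case (add f g)
  have t: "integrable lborel (\<lambda>x. f (x + z))" "integrable lborel (\<lambda>x. g (x + z))" for z
    using add(1,2) by (auto simp: lborel_translate)
  show ?case
  proof (rule tendsto_sandwich[OF _ _ tendsto_const tendsto_add_zero[OF add(3,4)]])
    show "\<forall>\<^sub>F n in sequentially. (\<integral>x. \<bar>f (x + Z n) + g (x + Z n) - (f x + g x)\<bar> \<partial>lborel)
        \<le> (\<integral>x. \<bar>f (x + Z n) - f x\<bar> \<partial>lborel) + (\<integral>x. \<bar>g (x + Z n) - g x\<bar> \<partial>lborel)"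
    proof (rule always_eventually, rule allI)
      fix n
      have "(\<integral>x. \<bar>f (x + Z n) + g (x + Z n) - (f x + g x)\<bar> \<partial>lborel) \<le>
         (\<integral>x. \<bar>f (x + Z n) - f x\<bar> + \<bar>g (x + Z n) - g x\<bar> \<partial>lborel)"
        using t add by (intro integral_mono) auto
      then show "(\<integral>x. \<bar>f (x + Z n) + g (x + Z n) - (f x + g x)\<bar> \<partial>lborel)
        \<le> (\<integral>x. \<bar>f (x + Z n) - f x\<bar> \<partial>lborel) + (\<integral>x. \<bar>g (x + Z n) - g x\<bar> \<partial>lborel)"
        using t add by simp
    qed
  qed auto
next
  case (lim f s)
  have "(\<lambda>i. \<integral>x. \<bar>f x - s i x\<bar> \<partial>lborel) \<longlonglongrightarrow> (\<integral>x. 0 \<partial>(lborel::'a measure))"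
  \<comment> \<open>The approximants supplied by \<open>integrable_induct\<close> satisfy |s i x|
    \<le> 2 |f x|, hence the factor 3.\<close>
  proof (rule integral_dominated_convergence[where w="\<lambda>x. 3 * \<bar>f x\<bar>"])
    show "AE x in lborel. (\<lambda>i. \<bar>f x - s i x\<bar>) \<longlonglongrightarrow> 0"
    proof (rule AE_I2)
      fix x :: 'a
      have "(\<lambda>i. \<bar>f x - s i x\<bar>) \<longlonglongrightarrow> \<bar>f x - f x\<bar>" by (intro tendsto_intros lim) simp
      then show "(\<lambda>i. \<bar>f x - s i x\<bar>) \<longlonglongrightarrow> 0" by simp
    qed
    show "AE x in lborel. norm \<bar>f x - s i x\<bar> \<le> 3 * \<bar>f x\<bar>" for i
    proof (rule AE_I2)
      fix x :: 'a
      show "norm \<bar>f x - s i x\<bar> \<le> 3 * \<bar>f x\<bar>" using lim(3)[of x i] by auto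
    qed
  qed (use lim in auto)
  then have c: "(\<lambda>i. \<integral>x. \<bar>f x - s i x\<bar> \<partial>lborel) \<longlonglongrightarrow> 0" by simp
  show ?case
  proof (rule LIMSEQ_I)
    fix e :: real assume e: "e > 0"
    obtain i where i: "(\<integral>x. \<bar>f x - s i x\<bar> \<partial>lborel) < e / 4"
      using LIMSEQ_D[OF c, of "e / 4"] e by force
    obtain N where N: "\<And>n. n \<ge> N \<Longrightarrow> norm ((\<integral>x. \<bar>s i (x + Z n) - s i x\<bar> \<partial>lborel) - 0) < e / 2"
      using LIMSEQ_D[OF lim(5)[of i], of "e / 2"] e by (metis half_gt_zero)
    have "norm ((\<integral>x. \<bar>f (x + Z n) - f x\<bar> \<partial>lborel) - 0) < e" if "n \<ge> N" for n
    proof -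
      have "(\<integral>x. \<bar>s i (x + Z n) - s i x\<bar> \<partial>lborel) < e / 2" using N[OF that] by auto
      then have "(\<integral>x. \<bar>f (x + Z n) - f x\<bar> \<partial>lborel) < e"
        using translation_osc_perturb[OF lim(4,1), of "Z n" i] i by linarith
      then show ?thesis by simp
    qed
    then show "\<exists>N. \<forall>n\<ge>N. norm ((\<integral>x. \<bar>f (x + Z n) - f x\<bar> \<partial>lborel) - 0) < e" by blast
  qed
qed

section \<open>Averaging against a kernel\<close>

definition cv :: "('a::euclidean_space \<Rightarrow> real) \<Rightarrow> ('a \<Rightarrow> real) \<Rightarrow> 'a \<Rightarrow> real" where
  "cv k u x = (\<integral>z. u (x + z) * k z \<partial>lborel)"

lemma cv_measurable [measurable]:
  assumes [measurable]: "k \<in> borel_measurable borel" "u \<in> borel_measurable borel"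
  shows "cv k u \<in> borel_measurable borel"
  unfolding cv_def[abs_def] by measurable

definition kernel :: "real \<Rightarrow> ('a::euclidean_space \<Rightarrow> real) \<Rightarrow> bool" where
  "kernel h k \<longleftrightarrow> k \<in> borel_measurable borel \<and> (\<forall>z. 0 \<le> k z) \<and> (\<exists>B. \<forall>z. k z \<le> B) \<and>
     (\<forall>z. norm z > h \<longrightarrow> k z = 0) \<and> integrable lborel k \<and> (\<integral>z. k z \<partial>lborel) = 1"

text \<open>As k has mass 1, the error is a k-average of u(x + z) - u(x). Fubini moves the integral
  over x inside, and only shifts with |z| \<le> h carry weight. Since the computation uses
  non-negative integrals, integrability of the error comes out of it.\<close>

lemma cv_L1_bound:
  fixes u :: "'a::euclidean_space \<Rightarrow> real"
  assumes k: "kernel h k" and u: "integrable lborel u"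
    and osc: "\<And>z. norm z \<le> h \<Longrightarrow> (\<integral>x. \<bar>u (x + z) - u x\<bar> \<partial>lborel) \<le> e" and e: "e \<ge> 0"
  shows "integrable lborel (\<lambda>x. \<bar>cv k u x - u x\<bar>)" "(\<integral>x. \<bar>cv k u x - u x\<bar> \<partial>lborel) \<le> e"
proof -
  have [measurable]: "k \<in> borel_measurable borel" "u \<in> borel_measurable borel" using k u by (auto simp: kernel_def)
  obtain B where B: "\<And>z. k z \<le> B" using k by (auto simp: kernel_def)
  have k0: "\<And>z. k z \<ge> 0" using k by (auto simp: kernel_def)
  have ik: "integrable lborel k" "(\<integral>z. k z \<partial>lborel) = 1" using k by (auto simp: kernel_def)
  have iz: "integrable lborel (\<lambda>z. u (x + z) * k z)" for x
  proof (rule Bochner_Integration.integrable_bound[where f="\<lambda>z. \<bar>u (z + x)\<bar> * B"])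
    show "integrable lborel (\<lambda>z. \<bar>u (z + x)\<bar> * B)" using u by (auto simp: lborel_translate)
    have "norm (u (x + z) * k z) \<le> norm (\<bar>u (z + x)\<bar> * B)" for z
      using mult_left_mono[OF order_trans[OF B[of z] abs_ge_self], of "\<bar>u (z + x)\<bar>"] k0[of z]
      by (auto simp: abs_mult add.commute)
    then show "AE z in lborel. norm (u (x + z) * k z) \<le> norm (\<bar>u (z + x)\<bar> * B)" by simp
  qed measurable
  have pt: "ennreal \<bar>cv k u x - u x\<bar> \<le> (\<integral>\<^sup>+z. ennreal (\<bar>u (x + z) - u x\<bar> * k z) \<partial>lborel)" for x
  proof -
    have "cv k u x - u x = (\<integral>z. u (x + z) * k z \<partial>lborel) - (\<integral>z. u x * k z \<partial>lborel)"
      using ik by (simp add: cv_def)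
    also have "\<dots> = (\<integral>z. (u (x + z) - u x) * k z \<partial>lborel)"
      using iz ik(1) by (subst Bochner_Integration.integral_diff[symmetric]) (auto simp: left_diff_distrib)
    finally have e1: "cv k u x - u x = (\<integral>z. (u (x + z) - u x) * k z \<partial>lborel)" .
    have int: "integrable lborel (\<lambda>z. (u (x + z) - u x) * k z)"
      using iz ik(1) by (auto simp: left_diff_distrib)
    have "\<bar>cv k u x - u x\<bar> \<le> (\<integral>z. \<bar>(u (x + z) - u x) * k z\<bar> \<partial>lborel)"
      unfolding e1 using integral_norm_bound[of lborel "\<lambda>z. (u (x + z) - u x) * k z"] by simp
    also have "\<dots> = (\<integral>z. \<bar>u (x + z) - u x\<bar> * k z \<partial>lborel)" by (simp add: abs_mult k0)
    finally show ?thesis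
      using integrable_abs[OF int] k0 by (subst nn_integral_eq_integral) (auto simp: abs_mult ennreal_leI)
  qed
  have t: "integrable lborel (\<lambda>x. u (x + z))" for z using u by (simp add: lborel_translate)
  have "(\<integral>\<^sup>+x. ennreal \<bar>cv k u x - u x\<bar> \<partial>lborel) \<le> (\<integral>\<^sup>+x. (\<integral>\<^sup>+z. ennreal (\<bar>u (x + z) - u x\<bar> * k z) \<partial>lborel) \<partial>lborel)"
    by (rule nn_integral_mono) (use pt in auto)
  also have "\<dots> = (\<integral>\<^sup>+z. (\<integral>\<^sup>+x. ennreal (\<bar>u (x + z) - u x\<bar> * k z) \<partial>lborel) \<partial>lborel)"
    by (rule lborel_pair.Fubini'[symmetric]) measurable
  also have "\<dots> \<le> (\<integral>\<^sup>+z. ennreal (e * k z) \<partial>lborel)"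
  proof (rule nn_integral_mono)
    fix z :: 'a
    have "(\<integral>\<^sup>+x. ennreal (\<bar>u (x + z) - u x\<bar> * k z) \<partial>lborel) = ennreal ((\<integral>x. \<bar>u (x + z) - u x\<bar> \<partial>lborel) * k z)"
      using t u k0 by (subst nn_integral_eq_integral) auto
    also have "\<dots> \<le> ennreal (e * k z)"
    proof (cases "norm z \<le> h")
      case True
      then show ?thesis using osc[OF True] k0[of z] by (intro ennreal_leI mult_right_mono)
    next
      case False
      then have "k z = 0" using k by (auto simp: kernel_def)
      then show ?thesis by simp
    qed
    finally show "(\<integral>\<^sup>+x. ennreal (\<bar>u (x + z) - u x\<bar> * k z) \<partial>lborel) \<le> ennreal (e * k z)" .
  qed
  also have "\<dots> = ennreal e" using ik k0 e by (subst nn_integral_eq_integral) auto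
  finally have le: "(\<integral>\<^sup>+x. ennreal \<bar>cv k u x - u x\<bar> \<partial>lborel) \<le> ennreal e" .
  then show int: "integrable lborel (\<lambda>x. \<bar>cv k u x - u x\<bar>)"
    by (intro integrableI_bounded) (auto simp: le_less_trans[OF le])
  show "(\<integral>x. \<bar>cv k u x - u x\<bar> \<partial>lborel) \<le> e"
    using le int e by (subst (asm) nn_integral_eq_integral) auto
qed

lemma cv_L1_tendsto:
  fixes u :: "'a::euclidean_space \<Rightarrow> real"
  assumes k: "\<And>n. kernel (h n) (k n)" and h: "h \<longlonglongrightarrow> 0" and u: "integrable lborel u"
  shows "(\<lambda>n. \<integral>x. \<bar>cv (k n) u x - u x\<bar> \<partial>lborel) \<longlonglongrightarrow> 0"
proof (rule LIMSEQ_I)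
  fix e :: real assume e: "e > 0"
  have "((\<lambda>z. \<integral>x. \<bar>u (x + z) - u x\<bar> \<partial>lborel) \<longlongrightarrow> 0) (at 0)"
    unfolding tendsto_at_iff_sequentially comp_def using translation_continuous_L1[OF u] by blast
  then have "\<forall>\<^sub>F z in at 0. \<bar>\<integral>x. \<bar>u (x + z) - u x\<bar> \<partial>lborel\<bar> < e / 2"
    using tendstoD[of "\<lambda>z. \<integral>x. \<bar>u (x + z) - u x\<bar> \<partial>lborel" 0 "at 0" "e / 2"] e by (simp add: dist_real_def)
  then obtain d where d: "d > 0" "\<And>z. z \<noteq> 0 \<Longrightarrow> norm z < d \<Longrightarrow> \<bar>\<integral>x. \<bar>u (x + z) - u x\<bar> \<partial>lborel\<bar> < e / 2"
    by (auto simp: eventually_at)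
  obtain N where N: "\<And>n. n \<ge> N \<Longrightarrow> \<bar>h n\<bar> < d" using LIMSEQ_D[OF h d(1)] by auto
  have "norm ((\<integral>x. \<bar>cv (k n) u x - u x\<bar> \<partial>lborel) - 0) < e" if "n \<ge> N" for n
  proof -
    have "(\<integral>x. \<bar>cv (k n) u x - u x\<bar> \<partial>lborel) \<le> e / 2"
    proof (rule cv_L1_bound(2)[OF k u])
      fix z :: 'a assume "norm z \<le> h n"
      then show "(\<integral>x. \<bar>u (x + z) - u x\<bar> \<partial>lborel) \<le> e / 2"
        using d(2)[of z] N[OF that] e by (cases "z = 0"; force)
    qed (use e in simp)
    then show ?thesis using e by simp
  qed
  then show "\<exists>N. \<forall>n\<ge>N. norm ((\<integral>x. \<bar>cv (k n) u x - u x\<bar> \<partial>lborel) - 0) < e" by blast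
qed

lemma cv_diff_integrable:
  assumes k: "kernel h k" and u: "integrable lborel u"
  shows "integrable lborel (\<lambda>x. \<bar>cv k u x - u x\<bar>)"
proof (rule cv_L1_bound(1)[OF k u])
  have [measurable]: "u \<in> borel_measurable borel" using u by auto
  have t: "integrable lborel (\<lambda>x. \<bar>u (x + z)\<bar>)" for z using u by (simp add: lborel_translate)
  show "(\<integral>x. \<bar>u (x + z) - u x\<bar> \<partial>lborel) \<le> 2 * (\<integral>x. \<bar>u x\<bar> \<partial>lborel)" for z
  proof -
    have "(\<integral>x. \<bar>u (x + z) - u x\<bar> \<partial>lborel) \<le> (\<integral>x. \<bar>u (x + z)\<bar> + \<bar>u x\<bar> \<partial>lborel)"
      using u t[of z] by (intro integral_mono) (auto simp: lborel_translate)
    also have "\<dots> = (\<integral>x. \<bar>u (x + z)\<bar> \<partial>lborel) + (\<integral>x. \<bar>u x\<bar> \<partial>lborel)" using u t by simp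
    also have "(\<integral>x. \<bar>u (x + z)\<bar> \<partial>lborel) = (\<integral>x. \<bar>u x\<bar> \<partial>lborel)"
      by (rule lborel_translate(2)[of "\<lambda>x. \<bar>u x\<bar>"]) simp
    finally show ?thesis by simp
  qed
qed simp

lemma smooth_kernel_exists:
  fixes h :: real
  assumes "h > 0"
  obtains k :: "'a::euclidean_space \<Rightarrow> real" where "kernel h k" "test_fun k"
proof -
  obtain \<theta> :: "'a \<Rightarrow> real" where t: "test_fun \<theta>" "\<And>y. 0 \<le> \<theta> y \<and> \<theta> y \<le> 1" "\<And>y. dist 0 y \<le> h / 2 \<Longrightarrow> \<theta> y = 1"
    "\<And>y. dist 0 y \<ge> h \<Longrightarrow> \<theta> y = 0"
    using cutoff_exists[of "h / 2" h "0::'a"] assms by auto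
  have [measurable]: "\<theta> \<in> borel_measurable borel"
    using test_fun_continuous[OF t(1)] by (simp add: borel_measurable_continuous_onI)
  have fin: "integrable lborel (indicator (cball 0 h) :: 'a \<Rightarrow> real)"
    using emeasure_bounded_finite[of "cball (0::'a) h"] by simp
  have i: "integrable lborel \<theta>"
    by (rule Bochner_Integration.integrable_bound[OF fin])
      (use t in \<open>auto simp: indicator_def not_le\<close>)
  define c where "c = (\<integral>z. \<theta> z \<partial>lborel)"
  have "measure lborel (cball (0::'a) (h / 2)) \<le> c"
  proof -
    have "(\<integral>z. (indicator (cball (0::'a) (h / 2)) z :: real) \<partial>lborel) \<le> c" unfolding c_def
    proof (rule integral_mono[OF _ i])
      show "integrable lborel (\<lambda>z. indicator (cball (0::'a) (h / 2)) z :: real)"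
        using emeasure_bounded_finite[of "cball (0::'a) (h/2)"] by simp
      show "indicator (cball 0 (h / 2)) z \<le> \<theta> z" for z using t(2,3)[of z] by (auto simp: indicator_def)
    qed
    then show ?thesis by simp
  qed
  moreover have "measure lborel (cball (0::'a) (h / 2)) > 0" using assms by simp
  ultimately have c: "c > 0" by linarith
  show ?thesis
  proof
    show "test_fun (\<lambda>z. (1 / c) * \<theta> z)" by (rule test_fun_mult[OF t(1)]) simp
    show "kernel h (\<lambda>z. (1 / c) * \<theta> z)"
      unfolding kernel_def
      using t i c by (auto simp: divide_simps c_def[symmetric] not_le intro!: exI[of _ "1 / c"])
  qed
qed

section \<open>Weak derivatives\<close>

definition loc_int :: "('a::euclidean_space \<Rightarrow> real) \<Rightarrow> bool" where
  "loc_int u \<longleftrightarrow> u \<in> borel_measurable lebesgue \<and>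
    (\<forall>r. integrable lebesgue (\<lambda>x. indicator (cball 0 r) x * u x))"

lemma loc_int_measurable [measurable_dest]: "loc_int u \<Longrightarrow> u \<in> borel_measurable lebesgue"
  by (simp add: loc_int_def)

lemma borel_imp_lebesgue [simp]: "f \<in> borel_measurable borel \<Longrightarrow> f \<in> borel_measurable lebesgue"
  by (simp add: measurable_completion)

lemma continuous_lebesgue: "continuous_on UNIV f \<Longrightarrow> f \<in> borel_measurable lebesgue"
  for f :: "'a::euclidean_space \<Rightarrow> real"
  by (intro borel_imp_lebesgue borel_measurable_continuous_onI)

lemma cball_lebesgue [measurable]: "cball (x::'a::euclidean_space) r \<in> sets lebesgue"
  by simp

lemma integrable_cball: "integrable lebesgue (indicator (cball (x::'a::euclidean_space) r) :: 'a \<Rightarrow> real)"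
  using emeasure_bounded_finite[of "cball x r"] by simp

lemma integrable_compact_bounded:
  fixes f :: "'a::euclidean_space \<Rightarrow> real"
  assumes "f \<in> borel_measurable lebesgue" "\<And>x. \<bar>f x\<bar> \<le> B" "\<And>x. norm x > r \<Longrightarrow> f x = 0"
  shows "integrable lebesgue f"
proof (rule Bochner_Integration.integrable_bound[where f="\<lambda>x. B * indicator (cball 0 r) x"])
  show "integrable lebesgue (\<lambda>x::'a. B * indicator (cball 0 r) x)" using integrable_cball[of "0::'a" r] by simp
  have "norm (f x) \<le> norm (B * indicator (cball 0 r) x)" for x
    using assms(2)[of x] assms(3)[of x] by (cases "norm x \<le> r") auto
  then show "AE x in lebesgue. norm (f x) \<le> norm (B * indicator (cball 0 r) x)" by simp
qed (rule assms)

lemma loc_int_mult_bounded: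
  assumes u: "loc_int u" and F: "F \<in> borel_measurable lebesgue" "\<And>x. \<bar>F x\<bar> \<le> B" "\<And>x. norm x > r \<Longrightarrow> F x = 0"
  shows "integrable lebesgue (\<lambda>x. u x * F x)"
proof (rule Bochner_Integration.integrable_bound[where f="\<lambda>x. B * (indicator (cball 0 r) x * u x)"])
  show "integrable lebesgue (\<lambda>x. B * (indicator (cball 0 r) x * u x))" using u by (simp add: loc_int_def)
  show "(\<lambda>x. u x * F x) \<in> borel_measurable lebesgue" by (intro borel_measurable_times F(1) loc_int_measurable[OF u])
  have "norm (u x * F x) \<le> norm (B * (indicator (cball 0 r) x * u x))" for x
  proof (cases "norm x \<le> r")
    case True
    have "\<bar>u x\<bar> * \<bar>F x\<bar> \<le> \<bar>u x\<bar> * \<bar>B\<bar>" using F(2)[of x] by (intro mult_left_mono) auto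
    then show ?thesis using True by (simp add: abs_mult mult.commute)
  qed (use F(3)[of x] in auto)
  then show "AE x in lebesgue. norm (u x * F x) \<le> norm (B * (indicator (cball 0 r) x * u x))" by simp
qed

lemma test_fun_borel: "test_fun \<phi> \<Longrightarrow> \<phi> \<in> borel_measurable borel"
  using test_fun_continuous by (blast intro: borel_measurable_continuous_onI)

lemma test_fun_lebesgue: "test_fun \<phi> \<Longrightarrow> \<phi> \<in> borel_measurable lebesgue"
  by (rule borel_imp_lebesgue[OF test_fun_borel])

lemma loc_int_test:
  assumes "loc_int u" "test_fun \<phi>"
  shows "integrable lebesgue (\<lambda>x. u x * \<phi> x)"
proof -
  obtain B where "\<And>x. \<bar>\<phi> x\<bar> \<le> B" using test_fun_bounded[OF assms(2)] by blast
  moreover obtain r where "\<And>x. norm x > r \<Longrightarrow> \<phi> x = 0" using assms(2) by (auto simp: test_fun_iff)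
  ultimately show ?thesis using loc_int_mult_bounded[OF assms(1) test_fun_lebesgue[OF assms(2)]] by blast
qed

lemma loc_int_dominated:
  assumes "loc_int u" "v \<in> borel_measurable lebesgue" "\<And>x. \<bar>v x\<bar> \<le> \<bar>u x\<bar>"
  shows "loc_int v"
  unfolding loc_int_def
proof (intro conjI allI)
  fix r
  show "integrable lebesgue (\<lambda>x. indicator (cball 0 r) x * v x)"
  proof (rule Bochner_Integration.integrable_bound[where f="\<lambda>x. indicator (cball 0 r) x * u x"])
    show "integrable lebesgue (\<lambda>x. indicator (cball 0 r) x * u x)" using assms(1) by (simp add: loc_int_def)
    show "AE x in lebesgue. norm (indicator (cball 0 r) x * v x) \<le> norm (indicator (cball 0 r) x * u x)"
      using assms(3) by (auto simp: abs_mult intro!: AE_I2 mult_left_mono)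
  qed (use assms(2) in measurable)
qed (rule assms)

lemma loc_int_cong_AE:
  assumes "loc_int u" "AE x in lebesgue. u x = v x"
  shows "loc_int v"
proof -
  have m: "v \<in> borel_measurable lebesgue"
    using borel_measurable_AE[OF loc_int_measurable[OF assms(1)] assms(2)] .
  have "integrable lebesgue (\<lambda>x. indicator (cball 0 r) x * v x)" for r
  proof (rule integrable_cong_AE_imp[where g="\<lambda>x. indicator (cball 0 r) x * u x"])
    show "integrable lebesgue (\<lambda>x. indicator (cball 0 r) x * u x)" using assms(1) by (simp add: loc_int_def)
    show "(\<lambda>x. indicator (cball 0 r) x * v x) \<in> borel_measurable lebesgue" using m by measurable
    show "AE x in lebesgue. indicator (cball 0 r) x * u x = indicator (cball 0 r) x * v x"
      using assms(2) by eventually_elim simp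
  qed
  then show ?thesis using m by (simp add: loc_int_def)
qed

lemma loc_int_add: "loc_int u \<Longrightarrow> loc_int v \<Longrightarrow> loc_int (\<lambda>x. u x + v x)"
  unfolding loc_int_def by (auto simp: distrib_left)

lemma loc_int_cmult: "loc_int u \<Longrightarrow> loc_int (\<lambda>x. c * u x)"
  unfolding loc_int_def by (auto simp: mult.left_commute[of _ c])

lemma loc_int_const: "loc_int (\<lambda>x::'a::euclidean_space. c)"
  unfolding loc_int_def using integrable_cball[of "0::'a"] by auto

lemma loc_int_integrable: "integrable lebesgue u \<Longrightarrow> loc_int u"
  unfolding loc_int_def using integrable_mult_indicator[OF _ , of _ lebesgue u] by auto

lemma loc_int_mult_cont:
  assumes "loc_int u" "continuous_on UNIV F"
  shows "loc_int (\<lambda>x. F x * u x)"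
  unfolding loc_int_def
proof (intro conjI allI)
  have m: "F \<in> borel_measurable lebesgue" using assms(2) by (rule continuous_lebesgue)
  show "(\<lambda>x. F x * u x) \<in> borel_measurable lebesgue" using m loc_int_measurable[OF assms(1)] by simp
  fix r
  have "bounded (F ` cball 0 r)"
    by (intro compact_imp_bounded compact_continuous_image continuous_on_subset[OF assms(2)]) auto
  then obtain B where B: "\<And>x. x \<in> cball 0 r \<Longrightarrow> \<bar>F x\<bar> \<le> B"
    unfolding bounded_iff by (metis image_eqI real_norm_def)
  have "integrable lebesgue (\<lambda>x. u x * (indicator (cball 0 r) x * F x))"
  proof (rule loc_int_mult_bounded[OF assms(1), where B="\<bar>B\<bar>" and r=r])
    show "(\<lambda>x. indicator (cball 0 r) x * F x) \<in> borel_measurable lebesgue" using m by measurable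
    show "\<bar>indicator (cball 0 r) x * F x\<bar> \<le> \<bar>B\<bar>" for x using B[of x] by (auto simp: indicator_def)
  qed auto
  then show "integrable lebesgue (\<lambda>x. indicator (cball 0 r) x * (F x * u x))"
    by (simp add: mult_ac)
qed

lemma loc_int_continuous: "continuous_on UNIV F \<Longrightarrow> loc_int F"
  using loc_int_mult_cont[OF loc_int_const[of 1]] by simp

lemma L2_loc_int:
  assumes "L2 u"
  shows "loc_int u"
proof -
  have [measurable]: "u \<in> borel_measurable lebesgue" using assms by (simp add: L2_def)
  have "integrable lebesgue (\<lambda>x. indicator (cball 0 r) x * u x)" for r
  proof (rule Bochner_Integration.integrable_bound[where f="\<lambda>x. indicator (cball 0 r) x + (u x)\<^sup>2"])
    show "integrable lebesgue (\<lambda>x. indicator (cball 0 r) x + (u x)\<^sup>2)"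
      using integrable_cball[of "0::'a" r] assms by (simp add: L2_def)
    have "\<bar>t\<bar> \<le> 1 + t\<^sup>2" for t :: real
      using zero_le_power2[of "\<bar>t\<bar> - 1"] by (simp add: power2_eq_square algebra_simps)
    then show "AE x in lebesgue. norm (indicator (cball 0 r) x * u x) \<le> norm (indicator (cball 0 r) x + (u x)\<^sup>2)"
      by (auto simp: indicator_def intro!: AE_I2)
  qed measurable
  then show ?thesis by (simp add: loc_int_def)
qed

lemma line_diff_quot_bound:
  fixes \<kappa> \<kappa>' :: "'a::euclidean_space \<Rightarrow> real"
  assumes "\<And>y t. ((\<lambda>t. \<kappa> (y + t *\<^sub>R i)) has_real_derivative \<kappa>' (y + t *\<^sub>R i)) (at t)"
    and "\<And>y. \<bar>\<kappa>' y\<bar> \<le> B"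
  shows "\<bar>\<kappa> (y + h *\<^sub>R i) - \<kappa> y\<bar> \<le> B * \<bar>h\<bar>"
  using field_differentiable_bound[of UNIV "\<lambda>t. \<kappa> (y + t *\<^sub>R i)" "\<lambda>t. \<kappa>' (y + t *\<^sub>R i)" B h 0]
    assms by simp

text \<open>Differentiation under the integral sign. The difference quotients of \<kappa> are
  bounded by B through the mean value theorem and live in a common ball, so the locally integrable f
  dominates. No regularity of f is involved.\<close>

lemma line_deriv_integral:
  fixes \<kappa> \<kappa>' :: "'a::euclidean_space \<Rightarrow> real"
  assumes f: "loc_int f"
    and d: "\<And>y t. ((\<lambda>t. \<kappa> (y + t *\<^sub>R i)) has_real_derivative \<kappa>' (y + t *\<^sub>R i)) (at t)"
    and B: "\<And>y. \<bar>\<kappa>' y\<bar> \<le> B" and r: "\<And>y. norm y > r \<Longrightarrow> \<kappa> y = 0"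
    and c: "continuous_on UNIV \<kappa>"
  shows "((\<lambda>t. \<integral>y. f y * \<kappa> (y + t *\<^sub>R i) \<partial>lebesgue) has_real_derivative
      (\<integral>y. f y * \<kappa>' (y + t *\<^sub>R i) \<partial>lebesgue)) (at t)"
  unfolding DERIV_def tendsto_at_iff_sequentially comp_def
proof (intro allI impI)
  fix h :: "nat \<Rightarrow> real" assume h: "\<forall>n. h n \<in> UNIV - {0}" "h \<longlonglongrightarrow> 0"
  obtain H where H: "\<And>n. \<bar>h n\<bar> \<le> H"
    using convergent_imp_Bseq[of h] h(2) by (auto simp: convergent_def Bseq_def)
  have fm: "f \<in> borel_measurable lebesgue" using f by (rule loc_int_measurable)
  have cm: "(\<lambda>y. \<kappa> (y + s *\<^sub>R i)) \<in> borel_measurable lebesgue" for s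
    by (intro continuous_lebesgue continuous_on_compose2[OF c] continuous_intros) auto
  define Q where "Q n y = (\<kappa> (y + t *\<^sub>R i + h n *\<^sub>R i) - \<kappa> (y + t *\<^sub>R i)) / h n" for n y
  have Q: "Q n y = (\<kappa> (y + (t + h n) *\<^sub>R i) - \<kappa> (y + t *\<^sub>R i)) / h n" for n y
    by (simp add: Q_def scaleR_add_left add.assoc)
  have Qm: "Q n \<in> borel_measurable lebesgue" for n unfolding Q using cm by measurable
  have Qb: "\<bar>Q n y\<bar> \<le> B" for n y
    using line_diff_quot_bound[OF d B, of "y + t *\<^sub>R i" "h n"] h(1)[rule_format, of n]
    by (simp add: Q_def divide_simps)
  \<comment> \<open>All shifts along i that occur have size at most |t| + H, so no point beyond this
    radius is moved into the support of \<kappa>.\<close>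
  define \<rho> where "\<rho> = r + (\<bar>t\<bar> + H) * norm i"
  have far: "norm (y + s *\<^sub>R i) > r" if "norm y > \<rho>" "\<bar>s\<bar> \<le> \<bar>t\<bar> + H" for y s
  proof -
    have "norm y \<le> norm (y + s *\<^sub>R i) + norm (s *\<^sub>R i)"
      using norm_triangle_ineq4[of "y + s *\<^sub>R i" "s *\<^sub>R i"] by simp
    moreover have "norm (s *\<^sub>R i) \<le> (\<bar>t\<bar> + H) * norm i" using that(2) by (simp add: mult_right_mono)
    ultimately show ?thesis using that(1) unfolding \<rho>_def by linarith
  qed
  have H0: "H \<ge> 0" using H[of 0] by linarith
  have Qz: "Q n y = 0" if "norm y > \<rho>" for n y
  proof -
    have "\<bar>t + h n\<bar> \<le> \<bar>t\<bar> + H" using H[of n] by linarith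
    then show ?thesis using r[OF far[OF that, of "t + h n"]] r[OF far[OF that, of t]] H0 by (simp add: Q)
  qed
  have lim: "(\<lambda>n. Q n y) \<longlonglongrightarrow> \<kappa>' (y + t *\<^sub>R i)" for y
  proof -
    have "((\<lambda>h. (\<kappa> (y + (t + h) *\<^sub>R i) - \<kappa> (y + t *\<^sub>R i)) / h) \<longlongrightarrow> \<kappa>' (y + t *\<^sub>R i)) (at 0)"
      using d[of y t] by (simp add: DERIV_def)
    then show ?thesis using h unfolding tendsto_at_iff_sequentially comp_def Q by blast
  qed
  have "(\<lambda>n. \<integral>y. f y * Q n y \<partial>lebesgue) \<longlonglongrightarrow> (\<integral>y. f y * \<kappa>' (y + t *\<^sub>R i) \<partial>lebesgue)"
  proof (rule integral_dominated_convergence[where w="\<lambda>y. B * \<bar>indicator (cball 0 \<rho>) y * f y\<bar>"])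
    have "(\<lambda>y. \<kappa>' (y + t *\<^sub>R i)) \<in> borel_measurable lebesgue"
      by (rule borel_measurable_LIMSEQ_real[OF lim Qm])
    then show "(\<lambda>y. f y * \<kappa>' (y + t *\<^sub>R i)) \<in> borel_measurable lebesgue" using fm by measurable
    show "(\<lambda>y. f y * Q n y) \<in> borel_measurable lebesgue" for n using fm Qm by measurable
    show "integrable lebesgue (\<lambda>y. B * \<bar>indicator (cball 0 \<rho>) y * f y\<bar>)"
      using f unfolding loc_int_def by (intro integrable_mult_right integrable_abs) auto
    show "AE y in lebesgue. (\<lambda>n. f y * Q n y) \<longlonglongrightarrow> f y * \<kappa>' (y + t *\<^sub>R i)"
      by (intro AE_I2 tendsto_intros lim)
    have "norm (f y * Q n y) \<le> B * \<bar>indicator (cball 0 \<rho>) y * f y\<bar>" for n y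
    proof (cases "norm y > \<rho>")
      case False
      have "\<bar>f y\<bar> * \<bar>Q n y\<bar> \<le> \<bar>f y\<bar> * B" by (intro mult_left_mono Qb) simp
      then show ?thesis using False by (simp add: abs_mult mult.commute)
    qed (simp add: Qz)
    then show "AE y in lebesgue. norm (f y * Q n y) \<le> B * \<bar>indicator (cball 0 \<rho>) y * f y\<bar>" for n by simp
  qed
  moreover have "(\<integral>y. f y * Q n y \<partial>lebesgue) =
      ((\<integral>y. f y * \<kappa> (y + (t + h n) *\<^sub>R i) \<partial>lebesgue) - (\<integral>y. f y * \<kappa> (y + t *\<^sub>R i) \<partial>lebesgue)) / h n" for n
  proof -
    have cb: "\<exists>C. \<forall>y. \<bar>\<kappa> y\<bar> \<le> C"
    proof -
      have "bounded (\<kappa> ` cball 0 r)"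
        by (intro compact_imp_bounded compact_continuous_image continuous_on_subset[OF c]) auto
      then obtain C where C: "\<And>x. x \<in> cball 0 r \<Longrightarrow> \<bar>\<kappa> x\<bar> \<le> C"
        unfolding bounded_iff by (metis image_eqI real_norm_def)
      have "\<bar>\<kappa> y\<bar> \<le> max C 0" for y using C[of y] r[of y] by (cases "norm y > r") auto
      then show ?thesis by blast
    qed
    then obtain C where C: "\<And>y. \<bar>\<kappa> y\<bar> \<le> C" by blast
    have int: "integrable lebesgue (\<lambda>y. f y * \<kappa> (y + s *\<^sub>R i))" if "\<bar>s\<bar> \<le> \<bar>t\<bar> + H" for s
      by (rule loc_int_mult_bounded[OF f cm C, where r=\<rho>]) (use far[OF _ that] r in auto)
    have "\<bar>t + h n\<bar> \<le> \<bar>t\<bar> + H" using H[of n] by linarith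
    then show ?thesis
      using int[of "t + h n"] int[of t] H0 unfolding Q
      by (simp add: right_diff_distrib diff_divide_distrib)
  qed
  ultimately show "(\<lambda>n. ((\<integral>y. f y * \<kappa> (y + (t + h n) *\<^sub>R i) \<partial>lebesgue) - (\<integral>y. f y * \<kappa> (y + t *\<^sub>R i) \<partial>lebesgue)) / h n)
      \<longlonglongrightarrow> (\<integral>y. f y * \<kappa>' (y + t *\<^sub>R i) \<partial>lebesgue)" by simp
qed

lemma line_deriv_integral_test:
  assumes f: "loc_int f" and \<kappa>: "test_fun \<kappa>" and i: "i \<in> Basis"
  shows "((\<lambda>t. \<integral>y. f y * \<kappa> (y + t *\<^sub>R i) \<partial>lebesgue) has_real_derivative
      (\<integral>y. f y * pd i \<kappa> (y + t *\<^sub>R i) \<partial>lebesgue)) (at t)"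
proof -
  obtain B where B: "\<And>x. \<bar>pd i \<kappa> x\<bar> \<le> B" using test_fun_bounded[OF test_fun_pd[OF \<kappa> i]] by blast
  obtain r where "\<And>x. norm x > r \<Longrightarrow> \<kappa> x = 0" using \<kappa> by (auto simp: test_fun_iff)
  then show ?thesis
    by (intro line_deriv_integral[OF f, of \<kappa> i "pd i \<kappa>", OF _ B] smooth_line_deriv)
      (auto simp: \<kappa> test_fun_smooth test_fun_continuous)
qed

text \<open>The integral of F(y + t i) over y does not depend on t by translation invariance, and
  its derivative at t = 0 is the integral of F'. This replaces integration by parts in
  coordinates.\<close>

lemma integral_line_deriv_zero:
  fixes F F' :: "'a::euclidean_space \<Rightarrow> real"
  assumes d: "\<And>y t. ((\<lambda>t. F (y + t *\<^sub>R i)) has_real_derivative F' (y + t *\<^sub>R i)) (at t)"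
    and c: "continuous_on UNIV F" "continuous_on UNIV F'"
    and r: "\<And>y. norm y > r \<Longrightarrow> F y = 0" "\<And>y. norm y > r \<Longrightarrow> F' y = 0"
  shows "(\<integral>y. F' y \<partial>lebesgue) = 0"
proof -
  have "bounded (F' ` cball 0 r)"
    by (intro compact_imp_bounded compact_continuous_image continuous_on_subset[OF c(2)]) auto
  then obtain C where C: "\<And>x. x \<in> cball 0 r \<Longrightarrow> \<bar>F' x\<bar> \<le> C"
    unfolding bounded_iff by (metis image_eqI real_norm_def)
  have B: "\<bar>F' y\<bar> \<le> max C 0" for y using C[of y] r(2)[of y] by (cases "norm y > r") auto
  have "((\<lambda>t. \<integral>y. 1 * F (y + t *\<^sub>R i) \<partial>lebesgue) has_real_derivative
      (\<integral>y. 1 * F' (y + 0 *\<^sub>R i) \<partial>lebesgue)) (at 0)"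
    by (rule line_deriv_integral[OF loc_int_const d B r(1) c(1)])
  moreover have "(\<integral>y. 1 * F (y + t *\<^sub>R i) \<partial>lebesgue) = (\<integral>y. F y \<partial>lebesgue)" for t
  proof -
    have "(\<lambda>y. F (y + t *\<^sub>R i)) \<in> borel_measurable borel" "F \<in> borel_measurable borel"
      by (auto intro!: borel_measurable_continuous_onI continuous_on_compose2[OF c(1)] continuous_intros)
    then show ?thesis by (simp add: integral_completion lborel_translate(2))
  qed
  ultimately have "((\<lambda>t::real. \<integral>y. F y \<partial>lebesgue) has_real_derivative (\<integral>y. F' y \<partial>lebesgue)) (at 0)" by simp
  then show ?thesis using DERIV_unique DERIV_const by blast
qed

text \<open>One distributional partial derivative, for locally integrable functions: the comparison
  functions used later are in general not in L2 of the whole space, so the notion must be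
  local.\<close>

definition wd :: "'a::euclidean_space \<Rightarrow> ('a \<Rightarrow> real) \<Rightarrow> ('a \<Rightarrow> real) \<Rightarrow> bool" where
  "wd i u v \<longleftrightarrow> loc_int u \<and> loc_int v \<and>
    (\<forall>\<phi>. test_fun \<phi> \<longrightarrow> (\<integral>x. u x * pd i \<phi> x \<partial>lebesgue) = - (\<integral>x. v x * \<phi> x \<partial>lebesgue))"

lemma wdD: "wd i u v \<Longrightarrow> loc_int u" "wd i u v \<Longrightarrow> loc_int v"
  "wd i u v \<Longrightarrow> test_fun \<phi> \<Longrightarrow> (\<integral>x. u x * pd i \<phi> x \<partial>lebesgue) = - (\<integral>x. v x * \<phi> x \<partial>lebesgue)"
  by (auto simp: wd_def)

text \<open>\<open>integral_line_deriv_zero\<close> applied to f times the test function. A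
  continuous derivative along lines in direction i is enough, which matters because the truncated
  profile \<open>Lk\<close> is only C^1.\<close>

lemma wd_C1:
  fixes f f' :: "'a::euclidean_space \<Rightarrow> real"
  assumes d: "\<And>y t. ((\<lambda>t. f (y + t *\<^sub>R i)) has_real_derivative f' (y + t *\<^sub>R i)) (at t)"
    and c: "continuous_on UNIV f" "continuous_on UNIV f'" and i: "i \<in> Basis"
  shows "wd i f f'"
  unfolding wd_def
proof (intro conjI allI impI)
  show l: "loc_int f" "loc_int f'" using c by (auto intro: loc_int_continuous)
  fix \<phi> :: "'a \<Rightarrow> real" assume t: "test_fun \<phi>"
  obtain r where r: "\<And>x. norm x > r \<Longrightarrow> \<phi> x = 0" using t by (auto simp: test_fun_iff)
  have "(\<integral>y. f y * pd i \<phi> y + f' y * \<phi> y \<partial>lebesgue) = 0"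
  proof (rule integral_line_deriv_zero[where F="\<lambda>y. f y * \<phi> y" and i=i and r=r])
    show "((\<lambda>t. f (y + t *\<^sub>R i) * \<phi> (y + t *\<^sub>R i)) has_real_derivative
        f (y + t *\<^sub>R i) * pd i \<phi> (y + t *\<^sub>R i) + f' (y + t *\<^sub>R i) * \<phi> (y + t *\<^sub>R i)) (at t)" for y t
      using DERIV_mult[OF d[of y t] smooth_line_deriv[OF test_fun_smooth[OF t], of y i t]]
      by (simp add: add.commute mult.commute)
    show "continuous_on UNIV (\<lambda>y. f y * \<phi> y)" "continuous_on UNIV (\<lambda>y. f y * pd i \<phi> y + f' y * \<phi> y)"
      using c test_fun_continuous[OF t, of UNIV] test_fun_continuous[OF test_fun_pd[OF t i], of UNIV]
      by (auto intro!: continuous_intros)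
    show "f y * \<phi> y = 0" "f y * pd i \<phi> y + f' y * \<phi> y = 0" if "norm y > r" for y
      using r[OF that] pd_zero_off_support[of r \<phi> y i, OF r that] by auto
  qed
  then show "(\<integral>x. f x * pd i \<phi> x \<partial>lebesgue) = - (\<integral>x. f' x * \<phi> x \<partial>lebesgue)"
    using loc_int_test[OF l(1) test_fun_pd[OF t i]] loc_int_test[OF l(2) t] by simp
qed

lemma wd_smooth: "smooth f \<Longrightarrow> i \<in> Basis \<Longrightarrow> wd i f (pd i f)"
  by (intro wd_C1 smooth_line_deriv smooth_continuous smooth_pd)

lemma wd_mult_smooth:
  assumes w: "wd i u v" and s: "smooth \<eta>" and i: "i \<in> Basis"
  shows "wd i (\<lambda>x. \<eta> x * u x) (\<lambda>x. \<eta> x * v x + pd i \<eta> x * u x)"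
  unfolding wd_def
proof (intro conjI allI impI)
  show "loc_int (\<lambda>x. \<eta> x * u x)" "loc_int (\<lambda>x. \<eta> x * v x + pd i \<eta> x * u x)"
    using w s i by (auto intro!: loc_int_add loc_int_mult_cont smooth_continuous smooth_pd dest: wdD)
  fix \<phi> :: "'a \<Rightarrow> real" assume t: "test_fun \<phi>"
  have t1: "test_fun (\<lambda>x. \<eta> x * \<phi> x)" using t s by (rule test_fun_mult)
  have t2: "test_fun (\<lambda>x. pd i \<eta> x * \<phi> x)" using t smooth_pd[OF s i] by (rule test_fun_mult)
  have t3: "test_fun (\<lambda>x. \<eta> x * pd i \<phi> x)" using test_fun_pd[OF t i] s by (rule test_fun_mult)
  have e: "pd i (\<lambda>x. \<eta> x * \<phi> x) x = \<eta> x * pd i \<phi> x + pd i \<eta> x * \<phi> x" for x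
    by (rule pd_mult[OF s test_fun_smooth[OF t]])
  have "(\<integral>x. u x * (\<eta> x * pd i \<phi> x) + u x * (pd i \<eta> x * \<phi> x) \<partial>lebesgue) = - (\<integral>x. v x * (\<eta> x * \<phi> x) \<partial>lebesgue)"
    using wdD(3)[OF w t1] by (simp add: e distrib_left)
  then have "(\<integral>x. u x * (\<eta> x * pd i \<phi> x) \<partial>lebesgue) =
      - ((\<integral>x. v x * (\<eta> x * \<phi> x) \<partial>lebesgue) + (\<integral>x. u x * (pd i \<eta> x * \<phi> x) \<partial>lebesgue))"
    using loc_int_test[OF wdD(1)[OF w]] t2 t3 by simp
  also have "(\<integral>x. v x * (\<eta> x * \<phi> x) \<partial>lebesgue) + (\<integral>x. u x * (pd i \<eta> x * \<phi> x) \<partial>lebesgue) =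
     (\<integral>x. v x * (\<eta> x * \<phi> x) + u x * (pd i \<eta> x * \<phi> x) \<partial>lebesgue)"
    using loc_int_test[OF wdD(1)[OF w] t2] loc_int_test[OF wdD(2)[OF w] t1] by simp
  finally show "(\<integral>x. \<eta> x * u x * pd i \<phi> x \<partial>lebesgue) = - (\<integral>x. (\<eta> x * v x + pd i \<eta> x * u x) * \<phi> x \<partial>lebesgue)"
    by (simp add: algebra_simps)
qed

lemma wd_add:
  assumes "wd i u v" "wd i u' v'" "i \<in> Basis"
  shows "wd i (\<lambda>x. u x + u' x) (\<lambda>x. v x + v' x)"
  unfolding wd_def
proof (intro conjI allI impI)
  show "loc_int (\<lambda>x. u x + u' x)" "loc_int (\<lambda>x. v x + v' x)"
    using assms by (auto intro!: loc_int_add dest: wdD)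
  fix \<phi> :: "'a \<Rightarrow> real" assume t: "test_fun \<phi>"
  show "(\<integral>x. (u x + u' x) * pd i \<phi> x \<partial>lebesgue) = - (\<integral>x. (v x + v' x) * \<phi> x \<partial>lebesgue)"
    using wdD(3)[OF assms(1) t] wdD(3)[OF assms(2) t]
      loc_int_test[OF wdD(1)[OF assms(1)] test_fun_pd[OF t assms(3)]]
      loc_int_test[OF wdD(1)[OF assms(2)] test_fun_pd[OF t assms(3)]]
      loc_int_test[OF wdD(2)[OF assms(1)] t] loc_int_test[OF wdD(2)[OF assms(2)] t]
    by (simp add: distrib_right)
qed

lemma wd_cmult: "wd i u v \<Longrightarrow> wd i (\<lambda>x. c * u x) (\<lambda>x. c * v x)"
  unfolding wd_def by (auto simp: loc_int_cmult mult.assoc)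

lemma wd_zero: "wd i (\<lambda>x. 0) (\<lambda>x. 0)"
  unfolding wd_def by (auto simp: loc_int_const)

lemma wd_diff:
  assumes "wd i u v" "wd i u' v'" "i \<in> Basis"
  shows "wd i (\<lambda>x. u x - u' x) (\<lambda>x. v x - v' x)"
  using wd_add[OF assms(1) wd_cmult[OF assms(2), of "- 1"] assms(3)] by simp

lemma wd_sum:
  assumes "\<And>k. k \<in> I \<Longrightarrow> wd i (u k) (v k)" "i \<in> Basis"
  shows "wd i (\<lambda>x. \<Sum>k\<in>I. u k x) (\<lambda>x. \<Sum>k\<in>I. v k x)"
  using assms by (induction I rule: infinite_finite_induct) (auto intro: wd_add wd_zero)

lemma wd_cong_AE:
  assumes "wd i u v" "AE x in lebesgue. u x = u' x" "AE x in lebesgue. v x = v' x" "i \<in> Basis"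
  shows "wd i u' v'"
proof -
  have l: "loc_int u'" "loc_int v'" using assms loc_int_cong_AE wdD by blast+
  show ?thesis unfolding wd_def
  proof (intro conjI allI impI l)
    fix \<phi> :: "'a \<Rightarrow> real" assume t: "test_fun \<phi>"
    have [measurable]: "u \<in> borel_measurable lebesgue" "u' \<in> borel_measurable lebesgue"
      "v \<in> borel_measurable lebesgue" "v' \<in> borel_measurable lebesgue"
      "\<phi> \<in> borel_measurable lebesgue" "pd i \<phi> \<in> borel_measurable lebesgue"
      using l assms(1,4) t by (auto intro: loc_int_measurable test_fun_lebesgue test_fun_pd dest: wdD)
    have "(\<integral>x. u' x * pd i \<phi> x \<partial>lebesgue) = (\<integral>x. u x * pd i \<phi> x \<partial>lebesgue)"
      by (rule integral_cong_AE) (use assms(2) in auto)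
    moreover have "(\<integral>x. v' x * \<phi> x \<partial>lebesgue) = (\<integral>x. v x * \<phi> x \<partial>lebesgue)"
      by (rule integral_cong_AE) (use assms(3) in auto)
    ultimately show "(\<integral>x. u' x * pd i \<phi> x \<partial>lebesgue) = - (\<integral>x. v' x * \<phi> x \<partial>lebesgue)"
      using wdD(3)[OF assms(1) t] by simp
  qed
qed

section \<open>The fundamental lemma of the calculus of variations\<close>

lemma borel_version:
  fixes v :: "'a::euclidean_space \<Rightarrow> real"
  assumes "integrable lebesgue v"
  obtains v0 where "v0 \<in> borel_measurable borel" "integrable lborel v0" "AE x in lebesgue. v x = v0 x"
proof -
  have "v \<in> borel_measurable lebesgue" using assms by auto
  then obtain v0 where v0: "v0 \<in> borel_measurable lborel" "AE x in lborel. v x = v0 x"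
    using completion_ex_borel_measurable_real[of v lborel] by blast
  have ae: "AE x in lebesgue. v x = v0 x" using v0(2) by (rule AE_completion)
  have "integrable lebesgue v0"
    by (rule integrable_cong_AE_imp[OF assms]) (use v0(1) ae in \<open>auto intro: borel_imp_lebesgue\<close>)
  then show ?thesis using that v0 ae integrable_completion[of v0 lborel] by simp
qed

text \<open>Averages are formed from a Borel version, for which the integrand is jointly measurable
  in x and z. This identifies them with integrals of the Lebesgue measurable v against a translate
  of k.\<close>

lemma cv_eq_lebesgue:
  fixes v v0 :: "'a::euclidean_space \<Rightarrow> real"
  assumes v: "integrable lebesgue v" and [measurable]: "v0 \<in> borel_measurable borel" "k \<in> borel_measurable borel"
    and ae: "AE x in lebesgue. v x = v0 x"
  shows "cv k v0 x = (\<integral>y. v y * k (y - x) \<partial>lebesgue)"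
proof -
  have "cv k v0 x = (\<integral>z. v0 (z + x) * k (z + x - x) \<partial>lborel)" by (simp add: cv_def add.commute)
  also have "\<dots> = (\<integral>z. v0 z * k (z - x) \<partial>lborel)"
    by (rule lborel_translate(2)[of "\<lambda>z. v0 z * k (z - x)"]) measurable
  also have "\<dots> = (\<integral>z. v0 z * k (z - x) \<partial>lebesgue)"
    by (rule integral_completion[symmetric]) measurable
  also have "\<dots> = (\<integral>z. v z * k (z - x) \<partial>lebesgue)"
  proof (rule integral_cong_AE)
    have m: "(\<lambda>z. k (z - x)) \<in> borel_measurable lebesgue" by (rule borel_imp_lebesgue) measurable
    show "(\<lambda>z. v0 z * k (z - x)) \<in> borel_measurable lebesgue" by (rule borel_imp_lebesgue) measurable
    show "(\<lambda>z. v z * k (z - x)) \<in> borel_measurable lebesgue" by (intro borel_measurable_times m) (use v in auto)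
  qed (use ae in auto)
  finally show ?thesis .
qed

lemma mollifiers:
  obtains k :: "nat \<Rightarrow> 'a::euclidean_space \<Rightarrow> real"
  where "\<And>n. kernel (1 / real (Suc n)) (k n)" "\<And>n. test_fun (k n)"
proof -
  have "\<exists>k :: 'a \<Rightarrow> real. kernel (1 / real (Suc n)) k \<and> test_fun k" for n
    using smooth_kernel_exists[of "1 / real (Suc n)"] by (metis of_nat_0_less_iff zero_less_Suc zero_less_divide_1_iff)
  then show ?thesis using that by metis
qed

text \<open>The mollification of h \<theta> at x is h tested against \<theta> times a translated
  kernel, hence 0. As mollifications converge in L1, h \<theta> = 0 a.e., and \<theta> is 1 on a
  ball of arbitrary integer radius.\<close>

theorem fundamental_lemma:
  assumes h: "loc_int h" and z: "\<And>\<phi>. test_fun \<phi> \<Longrightarrow> (\<integral>x. h x * \<phi> x \<partial>lebesgue) = 0"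
  shows "AE x in lebesgue. h x = 0"
proof -
  obtain k :: "nat \<Rightarrow> 'a \<Rightarrow> real" where k: "\<And>n. kernel (1 / real (Suc n)) (k n)" "\<And>n. test_fun (k n)"
    using mollifiers by blast
  have "AE x in lebesgue. norm x \<le> real N \<longrightarrow> h x = 0" for N
  proof -
    obtain \<theta> :: "'a \<Rightarrow> real" where t: "test_fun \<theta>" "\<And>y. dist 0 y \<le> real N \<Longrightarrow> \<theta> y = 1"
      by (rule cutoff_exists[of "real N" "real N + 1" "0::'a"]) auto
    have int: "integrable lebesgue (\<lambda>x. h x * \<theta> x)" using loc_int_test[OF h t(1)] .
    obtain v0 where v0: "v0 \<in> borel_measurable borel" "integrable lborel v0" "AE x in lebesgue. h x * \<theta> x = v0 x"
      using borel_version[OF int] by blast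
    have "cv (k n) v0 x = 0" for n x
    proof -
      have "test_fun (\<lambda>y. k n (y - x) * \<theta> y)"
        using test_fun_mult[OF t(1) test_fun_smooth[OF test_fun_translate(1)[OF k(2)[of n], of "- x"]]] by simp
      from z[OF this] show ?thesis
        using cv_eq_lebesgue[OF int v0(1) test_fun_borel[OF k(2)] v0(3), of n x] by (simp add: mult_ac)
    qed
    moreover have "(\<lambda>n. 1 / real (Suc n)) \<longlonglongrightarrow> 0" by (rule LIMSEQ_Suc[OF lim_1_over_n])
    ultimately have "(\<lambda>n::nat. \<integral>x. \<bar>0 - v0 x\<bar> \<partial>lborel) \<longlonglongrightarrow> 0"
      using cv_L1_tendsto[OF k(1) _ v0(2)] by simp
    then have "(\<integral>x. \<bar>v0 x\<bar> \<partial>lborel) = 0" by (simp add: LIMSEQ_const_iff)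
    then have "AE x in lborel. v0 x = 0"
      using integral_nonneg_eq_0_iff_AE[of lborel "\<lambda>x. \<bar>v0 x\<bar>"] v0(2) by simp
    then have "AE x in lebesgue. v0 x = 0" by (rule AE_completion)
    with v0(3) show ?thesis by eventually_elim (use t(2) in force)
  qed
  then have "AE x in lebesgue. \<forall>N::nat. norm x \<le> real N \<longrightarrow> h x = 0" by (subst AE_all_countable) blast
  then show ?thesis by eventually_elim (meson real_arch_simple)
qed

lemma wd_unique:
  assumes "wd i u v" "wd i u v'"
  shows "AE x in lebesgue. v x = v' x"
proof -
  have "AE x in lebesgue. v x - v' x = 0"
  proof (rule fundamental_lemma)
    show "loc_int (\<lambda>x. v x - v' x)"
      using loc_int_add[OF wdD(2)[OF assms(1)] loc_int_cmult[OF wdD(2)[OF assms(2)], of "- 1"]] by simp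
    fix \<phi> :: "'a \<Rightarrow> real" assume t: "test_fun \<phi>"
    show "(\<integral>x. (v x - v' x) * \<phi> x \<partial>lebesgue) = 0"
      using wdD(3)[OF assms(1) t] wdD(3)[OF assms(2) t] loc_int_test[OF wdD(2)[OF assms(1)] t]
        loc_int_test[OF wdD(2)[OF assms(2)] t] by (simp add: left_diff_distrib)
  qed
  then show ?thesis by eventually_elim simp
qed

text \<open>Pairing with a test function translated along \<open>i\<close> is constant in the shift and tends to zero
  at infinity.\<close>
lemma wd_zero_integrable:
  assumes w: "wd i u (\<lambda>x. 0)" and u: "integrable lebesgue u" and i: "i \<in> Basis"
  shows "AE x in lebesgue. u x = 0"
proof (rule fundamental_lemma[OF wdD(1)[OF w]])
  fix \<phi> :: "'a \<Rightarrow> real" assume t: "test_fun \<phi>"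
  obtain r where r: "\<And>x. norm x > r \<Longrightarrow> \<phi> x = 0" using t by (auto simp: test_fun_iff)
  obtain B where B: "B > 0" "\<And>x. \<bar>\<phi> x\<bar> \<le> B" using test_fun_bounded[OF t] by blast
  define T where "T s = (\<integral>y. u y * \<phi> (y + s *\<^sub>R i) \<partial>lebesgue)" for s
  have "(T has_real_derivative 0) (at s)" for s
  proof -
    have "(\<integral>y. u y * pd i \<phi> (y + s *\<^sub>R i) \<partial>lebesgue) = 0"
      using wdD(3)[OF w test_fun_translate(1)[OF t, of "s *\<^sub>R i"]] by (simp add: fun_cong[OF test_fun_translate(2)[OF t]])
    then show ?thesis using line_deriv_integral_test[OF wdD(1)[OF w] t i, of s] by (simp add: T_def[abs_def])
  qed
  then have const: "T s = T 0" for s using DERIV_isconst_all[of T] by blast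
  have "(\<lambda>n. T (real n)) \<longlonglongrightarrow> (\<integral>y. 0 \<partial>(lebesgue::'a measure))"
    unfolding T_def
  proof (rule integral_dominated_convergence[where w="\<lambda>y. B * \<bar>u y\<bar>"])
    show "integrable lebesgue (\<lambda>y. B * \<bar>u y\<bar>)" using u by simp
    show "(\<lambda>y. u y * \<phi> (y + real n *\<^sub>R i)) \<in> borel_measurable lebesgue" for n
      using u test_fun_lebesgue[OF test_fun_translate(1)[OF t]] by (intro borel_measurable_times) auto
    show "AE y in lebesgue. (\<lambda>n. u y * \<phi> (y + real n *\<^sub>R i)) \<longlonglongrightarrow> 0"
    proof (rule AE_I2)
      fix y :: 'a
      obtain N :: nat where N: "r + norm y < real N" using reals_Archimedean2 by blast
      have "u y * \<phi> (y + real n *\<^sub>R i) = 0" if "n \<ge> N" for n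
      proof -
        have "real n = norm (real n *\<^sub>R i)" using i by simp
        also have "\<dots> \<le> norm (y + real n *\<^sub>R i) + norm y" using norm_triangle_ineq4[of "y + real n *\<^sub>R i" y] by simp
        finally have "norm (y + real n *\<^sub>R i) > r" using N that by linarith
        then show ?thesis using r by simp
      qed
      then show "(\<lambda>n. u y * \<phi> (y + real n *\<^sub>R i)) \<longlonglongrightarrow> 0"
        by (intro tendsto_eventually) (auto simp: eventually_sequentially)
    qed
    show "AE y in lebesgue. norm (u y * \<phi> (y + real n *\<^sub>R i)) \<le> B * \<bar>u y\<bar>" for n
    proof (rule AE_I2)
      fix y :: 'a
      show "norm (u y * \<phi> (y + real n *\<^sub>R i)) \<le> B * \<bar>u y\<bar>"
        using mult_left_mono[OF B(2)[of "y + real n *\<^sub>R i"], of "\<bar>u y\<bar>"] by (simp add: abs_mult mult.commute)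
    qed
  qed simp
  moreover have "(\<lambda>n. T (real n)) = (\<lambda>n. T 0)" by (rule ext, rule const)
  ultimately have "(\<lambda>n::nat. T 0) \<longlonglongrightarrow> 0" by simp
  then have "T 0 = 0" by (simp add: LIMSEQ_const_iff)
  then show "(\<integral>x. u x * \<phi> x \<partial>lebesgue) = 0" by (simp add: T_def)
qed

section \<open>Chain rule and positive parts\<close>

lemma lipschitz_of_deriv:
  fixes \<Phi> \<Phi>' :: "real \<Rightarrow> real"
  assumes "\<And>t. (\<Phi> has_real_derivative \<Phi>' t) (at t)" "\<And>t. \<bar>\<Phi>' t\<bar> \<le> L"
  shows "\<bar>\<Phi> s - \<Phi> t\<bar> \<le> L * \<bar>s - t\<bar>"
  using field_differentiable_bound[of UNIV \<Phi> \<Phi>' L s t] assms by simp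

lemma loc_int_comp:
  assumes u: "loc_int u" and d: "\<And>t. (\<Phi> has_real_derivative \<Phi>' t) (at t)" and L: "\<And>t. \<bar>\<Phi>' t\<bar> \<le> L"
  shows "loc_int (\<lambda>x. \<Phi> (u x))"
proof (rule loc_int_dominated)
  show "loc_int (\<lambda>x. \<bar>\<Phi> 0\<bar> + L * \<bar>u x\<bar>)"
  proof (intro loc_int_add loc_int_const loc_int_cmult)
    show "loc_int (\<lambda>x. \<bar>u x\<bar>)"
      by (rule loc_int_dominated[OF u]) (use loc_int_measurable[OF u] in auto)
  qed
  have "continuous_on UNIV \<Phi>" using d DERIV_isCont continuous_at_imp_continuous_on by blast
  then have [measurable]: "\<Phi> \<in> borel_measurable borel" by (rule borel_measurable_continuous_onI)
  have [measurable]: "u \<in> borel_measurable lebesgue" using u by (rule loc_int_measurable)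
  show "(\<lambda>x. \<Phi> (u x)) \<in> borel_measurable lebesgue" by measurable
  have "L \<ge> 0" using L[of 0] by linarith
  then show "\<bar>\<Phi> (u x)\<bar> \<le> \<bar>\<bar>\<Phi> 0\<bar> + L * \<bar>u x\<bar>\<bar>" for x
    using lipschitz_of_deriv[OF d L, of "u x" 0] by simp
qed

lemma loc_int_bounded_mult:
  assumes v: "loc_int v" and F: "F \<in> borel_measurable lebesgue" "\<And>x. \<bar>F x\<bar> \<le> L"
  shows "loc_int (\<lambda>x. F x * v x)"
proof (rule loc_int_dominated[OF loc_int_cmult[OF v, of L]])
  show "(\<lambda>x. F x * v x) \<in> borel_measurable lebesgue"
    by (intro borel_measurable_times F(1) loc_int_measurable[OF v])
  show "\<bar>F x * v x\<bar> \<le> \<bar>L * v x\<bar>" for x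
    using F(2)[of x] by (auto simp: abs_mult intro!: mult_right_mono)
qed

lemma continuous_cv:
  fixes k v :: "'a::euclidean_space \<Rightarrow> real"
  assumes v: "integrable lebesgue v" and k: "continuous_on UNIV k" "\<And>z. \<bar>k z\<bar> \<le> B"
  shows "continuous_on UNIV (\<lambda>x. \<integral>y. v y * k (y - x) \<partial>lebesgue)"
  unfolding continuous_on_sequentially
proof (intro allI ballI impI)
  fix X :: "nat \<Rightarrow> 'a" and a assume X: "(\<forall>n. X n \<in> UNIV) \<and> X \<longlonglongrightarrow> a"
  have km: "(\<lambda>y. k (y - x)) \<in> borel_measurable lebesgue" for x
  proof -
    have "continuous_on UNIV (\<lambda>y. k (y - x))"
      by (rule continuous_on_compose2[OF k(1)]) (auto intro!: continuous_intros)
    then show ?thesis by (rule continuous_lebesgue)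
  qed
  have vm: "v \<in> borel_measurable lebesgue" using v by auto
  have "(\<lambda>n. \<integral>y. v y * k (y - X n) \<partial>lebesgue) \<longlonglongrightarrow> (\<integral>y. v y * k (y - a) \<partial>lebesgue)"
  proof (rule integral_dominated_convergence[where w="\<lambda>y. B * \<bar>v y\<bar>"])
    show "AE y in lebesgue. (\<lambda>n. v y * k (y - X n)) \<longlonglongrightarrow> v y * k (y - a)"
    proof (rule AE_I2)
      fix y :: 'a
      have "(\<lambda>n. y - X n) \<longlonglongrightarrow> y - a" using X by (intro tendsto_intros) auto
      then have "(\<lambda>n. k (y - X n)) \<longlonglongrightarrow> k (y - a)"
        by (rule continuous_on_tendsto_compose[OF k(1)]) auto
      then show "(\<lambda>n. v y * k (y - X n)) \<longlonglongrightarrow> v y * k (y - a)" by (intro tendsto_intros)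
    qed
    show "AE y in lebesgue. norm (v y * k (y - X n)) \<le> B * \<bar>v y\<bar>" for n
    proof (rule AE_I2)
      fix y :: 'a
      show "norm (v y * k (y - X n)) \<le> B * \<bar>v y\<bar>"
        using mult_left_mono[OF k(2)[of "y - X n"], of "\<bar>v y\<bar>"] by (simp add: abs_mult mult.commute)
    qed
  qed (use v vm km in \<open>auto intro: borel_measurable_times\<close>)
  then show "((\<lambda>x. \<integral>y. v y * k (y - x) \<partial>lebesgue) \<circ> X) \<longlonglongrightarrow> (\<integral>y. v y * k (y - a) \<partial>lebesgue)"
    by (simp add: comp_def)
qed

text \<open>Mollification commutes with weak derivatives: moving x by t i moves the kernel by - t i,
  and this sign cancels the one from the definition of the weak derivative.\<close>

lemma mollified_line_deriv:
  assumes w: "wd i u v" and k: "test_fun k" and i: "i \<in> Basis"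
  shows "((\<lambda>t. \<integral>y. u y * k (y - (x + t *\<^sub>R i)) \<partial>lebesgue) has_real_derivative
    (\<integral>y. v y * k (y - (x + t *\<^sub>R i)) \<partial>lebesgue)) (at t)"
proof -
  define \<kappa> where "\<kappa> y = k (y + - x)" for y
  have t: "test_fun \<kappa>" using test_fun_translate(1)[OF k, of "- x"] by (simp add: \<kappa>_def[abs_def])
  have "((\<lambda>s. \<integral>y. u y * \<kappa> (y + s *\<^sub>R i) \<partial>lebesgue) has_real_derivative
      (\<integral>y. u y * pd i \<kappa> (y + (- t) *\<^sub>R i) \<partial>lebesgue)) (at (- t))"
    by (rule line_deriv_integral_test[OF wdD(1)[OF w] t i])
  moreover have "(\<integral>y. u y * pd i \<kappa> (y + (- t) *\<^sub>R i) \<partial>lebesgue) = - (\<integral>y. v y * \<kappa> (y + (- t) *\<^sub>R i) \<partial>lebesgue)"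
    using wdD(3)[OF w test_fun_translate(1)[OF t, of "(- t) *\<^sub>R i"]]
    by (simp add: fun_cong[OF test_fun_translate(2)[OF t]] del: scaleR_minus_left)
  ultimately have "((\<lambda>s. \<integral>y. u y * \<kappa> (y + (- s) *\<^sub>R i) \<partial>lebesgue) has_real_derivative
      - (- (\<integral>y. v y * \<kappa> (y + (- t) *\<^sub>R i) \<partial>lebesgue))) (at t)"
    by (simp only: DERIV_mirror[of "\<lambda>s. \<integral>y. u y * \<kappa> (y + s *\<^sub>R i) \<partial>lebesgue"])
  then show ?thesis by (simp add: \<kappa>_def algebra_simps)
qed

text \<open>For the mollifications U n and V n the classical chain rule holds. On the left the limit
  is in L1, as \<Phi> is Lipschitz. On the right V n is first replaced by \<open>v0\<close>, again
  in L1; then \<Phi>', which is merely continuous, requires a.e. convergence of U n and therefore a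
  subsequence.\<close>

lemma wd_chain_integrable:
  fixes u v :: "'a::euclidean_space \<Rightarrow> real"
  assumes w: "wd i u v" and u: "integrable lebesgue u" and v: "integrable lebesgue v" and i: "i \<in> Basis"
    and d: "\<And>t. (\<Phi> has_real_derivative \<Phi>' t) (at t)" and c: "continuous_on UNIV \<Phi>'"
    and L: "\<And>t. \<bar>\<Phi>' t\<bar> \<le> L" and \<phi>: "test_fun \<phi>"
  shows "(\<integral>x. \<Phi> (u x) * pd i \<phi> x \<partial>lebesgue) = - (\<integral>x. \<Phi>' (u x) * v x * \<phi> x \<partial>lebesgue)"
proof -
  have L0: "L \<ge> 0" using L[of 0] by linarith
  have c\<Phi>: "continuous_on UNIV \<Phi>" using d DERIV_isCont continuous_at_imp_continuous_on by blast
  have [measurable]: "\<Phi> \<in> borel_measurable borel" "\<Phi>' \<in> borel_measurable borel"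
    using c\<Phi> c by (auto intro: borel_measurable_continuous_onI)
  have dt: "test_fun (pd i \<phi>)" using test_fun_pd[OF \<phi> i] .
  have [measurable]: "\<phi> \<in> borel_measurable borel" "pd i \<phi> \<in> borel_measurable borel"
    using \<phi> dt by (auto intro: test_fun_borel)
  obtain B1 where B1: "\<And>x. \<bar>\<phi> x\<bar> \<le> B1" using test_fun_bounded[OF \<phi>] by blast
  obtain B2 where B2: "\<And>x. \<bar>pd i \<phi> x\<bar> \<le> B2" using test_fun_bounded[OF dt] by blast
  have B0: "B1 \<ge> 0" "B2 \<ge> 0" using B1[of 0] B2[of 0] by linarith+
  obtain u0 where u0: "u0 \<in> borel_measurable borel" "integrable lborel u0" "AE x in lebesgue. u x = u0 x"
    using borel_version[OF u] by blast
  obtain v0 where v0: "v0 \<in> borel_measurable borel" "integrable lborel v0" "AE x in lebesgue. v x = v0 x"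
    using borel_version[OF v] by blast
  note [measurable] = u0(1) v0(1)
  obtain k :: "nat \<Rightarrow> 'a \<Rightarrow> real" where k: "\<And>n. kernel (1 / real (Suc n)) (k n)" "\<And>n. test_fun (k n)"
    using mollifiers by blast
  have lim: "(\<lambda>n. 1 / real (Suc n)) \<longlonglongrightarrow> 0" by (rule LIMSEQ_Suc[OF lim_1_over_n])
  define U where "U n = cv (k n) u0" for n
  define V where "V n = cv (k n) v0" for n
  have Ue: "U n = (\<lambda>x. \<integral>y. u y * k n (y - x) \<partial>lebesgue)" for n
    unfolding U_def using cv_eq_lebesgue[OF u u0(1) test_fun_borel[OF k(2)] u0(3)] by blast
  have Ve: "V n = (\<lambda>x. \<integral>y. v y * k n (y - x) \<partial>lebesgue)" for n
    unfolding V_def using cv_eq_lebesgue[OF v v0(1) test_fun_borel[OF k(2)] v0(3)] by blast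
  have Vd: "((\<lambda>t. U n (x + t *\<^sub>R i)) has_real_derivative V n (x + t *\<^sub>R i)) (at t)" for n x t
    unfolding Ue Ve by (rule mollified_line_deriv[OF w k(2) i])
  have cU: "continuous_on UNIV (U n)" "continuous_on UNIV (V n)" for n
  proof -
    obtain B where "\<And>x. \<bar>k n x\<bar> \<le> B" using test_fun_bounded[OF k(2)] by blast
    then show "continuous_on UNIV (U n)" "continuous_on UNIV (V n)"
      unfolding Ue Ve using continuous_cv[OF u test_fun_continuous[OF k(2)[of n]]]
        continuous_cv[OF v test_fun_continuous[OF k(2)[of n]]] by blast+
  qed
  have [measurable]: "U n \<in> borel_measurable borel" "V n \<in> borel_measurable borel" for n
    using cU by (auto intro: borel_measurable_continuous_onI)
  have wn: "wd i (\<lambda>x. \<Phi> (U n x)) (\<lambda>x. \<Phi>' (U n x) * V n x)" for n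
  proof (rule wd_C1[OF _ _ _ i])
    show "((\<lambda>t. \<Phi> (U n (y + t *\<^sub>R i))) has_real_derivative
        \<Phi>' (U n (y + t *\<^sub>R i)) * V n (y + t *\<^sub>R i)) (at t)" for y t
      by (rule DERIV_chain2[OF d Vd])
    show "continuous_on UNIV (\<lambda>x. \<Phi> (U n x))" "continuous_on UNIV (\<lambda>x. \<Phi>' (U n x) * V n x)"
      using cU by (auto intro!: continuous_intros continuous_on_compose2[OF c] continuous_on_compose2[OF c\<Phi>])
  qed
  have i1: "integrable lborel (\<lambda>x. \<Phi> (U n x) * pd i \<phi> x)" "integrable lborel (\<lambda>x. \<Phi>' (U n x) * V n x * \<phi> x)" for n
    using loc_int_test[OF wdD(1)[OF wn] dt, of n] loc_int_test[OF wdD(2)[OF wn] \<phi>, of n]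
    by (auto simp: integrable_completion)
  have eqn: "(\<integral>x. \<Phi> (U n x) * pd i \<phi> x \<partial>lborel) = - (\<integral>x. \<Phi>' (U n x) * V n x * \<phi> x \<partial>lborel)" for n
    using wdD(3)[OF wn \<phi>, of n] by (simp add: integral_completion)
  have li: "loc_int u0" "loc_int v0"
    using loc_int_cong_AE[OF loc_int_integrable[OF u] u0(3)] loc_int_cong_AE[OF loc_int_integrable[OF v] v0(3)] by auto
  have lv: "loc_int (\<lambda>x. \<Phi>' (F x) * v0 x)" if "F \<in> borel_measurable borel" for F
    by (rule loc_int_bounded_mult[OF li(2) _ L]) (use that in \<open>intro borel_imp_lebesgue; measurable\<close>)
  have i2: "integrable lborel (\<lambda>x. \<Phi> (u0 x) * pd i \<phi> x)"
    using loc_int_test[OF loc_int_comp[OF li(1) d L] dt] by (simp add: integrable_completion)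
  have i3: "integrable lborel (\<lambda>x. \<Phi>' (F x) * v0 x * \<phi> x)" if [measurable]: "F \<in> borel_measurable borel" for F
    using loc_int_test[OF lv[OF that] \<phi>] by (simp add: integrable_completion)
  have iU: "integrable lborel (\<lambda>x. \<bar>U n x - u0 x\<bar>)" "integrable lborel (\<lambda>x. \<bar>V n x - v0 x\<bar>)" for n
    unfolding U_def V_def using cv_diff_integrable[OF k(1)] u0(2) v0(2) by blast+
  have cvU: "(\<lambda>n. \<integral>x. \<bar>U n x - u0 x\<bar> \<partial>lborel) \<longlonglongrightarrow> 0"
    unfolding U_def by (rule cv_L1_tendsto[OF k(1) lim u0(2)])
  have cvV: "(\<lambda>n. \<integral>x. \<bar>V n x - v0 x\<bar> \<partial>lborel) \<longlonglongrightarrow> 0"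
    unfolding V_def by (rule cv_L1_tendsto[OF k(1) lim v0(2)])
  have lim1: "(\<lambda>n. \<integral>x. \<Phi> (U n x) * pd i \<phi> x \<partial>lborel) \<longlonglongrightarrow> (\<integral>x. \<Phi> (u0 x) * pd i \<phi> x \<partial>lborel)"
  proof (rule LIM_zero_cancel, rule Lim_null_comparison)
    show "\<forall>\<^sub>F n in sequentially. norm ((\<integral>x. \<Phi> (U n x) * pd i \<phi> x \<partial>lborel) - (\<integral>x. \<Phi> (u0 x) * pd i \<phi> x \<partial>lborel))
        \<le> L * B2 * (\<integral>x. \<bar>U n x - u0 x\<bar> \<partial>lborel)"
    proof (rule always_eventually, rule allI)
      fix n
      have "(\<integral>x. \<Phi> (U n x) * pd i \<phi> x \<partial>lborel) - (\<integral>x. \<Phi> (u0 x) * pd i \<phi> x \<partial>lborel) =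
          (\<integral>x. \<Phi> (U n x) * pd i \<phi> x - \<Phi> (u0 x) * pd i \<phi> x \<partial>lborel)"
        using i1 i2 by simp
      also have "norm \<dots> \<le> (\<integral>x. L * B2 * \<bar>U n x - u0 x\<bar> \<partial>lborel)"
      proof -
        have "norm (\<Phi> (U n x) * pd i \<phi> x - \<Phi> (u0 x) * pd i \<phi> x) \<le> L * B2 * \<bar>U n x - u0 x\<bar>" for x
        proof -
          have "\<bar>\<Phi> (U n x) - \<Phi> (u0 x)\<bar> * \<bar>pd i \<phi> x\<bar> \<le> (L * \<bar>U n x - u0 x\<bar>) * B2"
            by (intro mult_mono lipschitz_of_deriv[OF d L] B2) (use L0 in auto)
          then show ?thesis by (simp add: left_diff_distrib[symmetric] abs_mult mult_ac)
        qed
        then show ?thesis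
          using Bochner_Integration.integral_norm_bound_integral[of lborel "\<lambda>x. \<Phi> (U n x) * pd i \<phi> x - \<Phi> (u0 x) * pd i \<phi> x"
            "\<lambda>x. L * B2 * \<bar>U n x - u0 x\<bar>"] i1 i2 iU by auto
      qed
      finally show "norm ((\<integral>x. \<Phi> (U n x) * pd i \<phi> x \<partial>lborel) - (\<integral>x. \<Phi> (u0 x) * pd i \<phi> x \<partial>lborel))
        \<le> L * B2 * (\<integral>x. \<bar>U n x - u0 x\<bar> \<partial>lborel)" by simp
    qed
    show "(\<lambda>n. L * B2 * (\<integral>x. \<bar>U n x - u0 x\<bar> \<partial>lborel)) \<longlonglongrightarrow> 0"
      by (rule tendsto_mult_right_zero[OF cvU])
  qed
  obtain s :: "nat \<Rightarrow> nat" where s: "strict_mono s" "AE x in lborel. (\<lambda>n. U (s n) x - u0 x) \<longlonglongrightarrow> 0"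
  proof -
    have "integrable lborel (\<lambda>x. U n x - u0 x)" for n
      using iU(1)[of n] by (rule integrable_abs_cancel) measurable
    then have "\<exists>r::nat\<Rightarrow>nat. strict_mono r \<and> (AE x in lborel. (\<lambda>n. U (r n) x - u0 x) \<longlonglongrightarrow> 0)"
      using tendsto_L1_AE_subseq[of lborel "\<lambda>n x. U n x - u0 x"] cvU by simp
    then show ?thesis using that by blast
  qed
  have lim2a: "(\<lambda>n. \<integral>x. \<Phi>' (U (s n) x) * v0 x * \<phi> x \<partial>lborel) \<longlonglongrightarrow> (\<integral>x. \<Phi>' (u0 x) * v0 x * \<phi> x \<partial>lborel)"
  proof (rule integral_dominated_convergence[where w="\<lambda>x. (L * B1) * \<bar>v0 x\<bar>"])
    show "AE x in lborel. (\<lambda>n. \<Phi>' (U (s n) x) * v0 x * \<phi> x) \<longlonglongrightarrow> \<Phi>' (u0 x) * v0 x * \<phi> x"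
      using s(2)
    proof eventually_elim
      case (elim x)
      have "(\<lambda>n. \<Phi>' (U (s n) x)) \<longlonglongrightarrow> \<Phi>' (u0 x)"
        by (rule continuous_on_tendsto_compose[OF c LIM_zero_cancel[OF elim]]) auto
      then show ?case by (intro tendsto_intros)
    qed
    show "AE x in lborel. norm (\<Phi>' (U (s n) x) * v0 x * \<phi> x) \<le> (L * B1) * \<bar>v0 x\<bar>" for n
    proof (rule AE_I2)
      fix x
      have "\<bar>\<Phi>' (U (s n) x)\<bar> * \<bar>\<phi> x\<bar> * \<bar>v0 x\<bar> \<le> L * B1 * \<bar>v0 x\<bar>"
        by (intro mult_mono L B1) (use L0 B0 in auto)
      then show "norm (\<Phi>' (U (s n) x) * v0 x * \<phi> x) \<le> (L * B1) * \<bar>v0 x\<bar>" by (simp add: abs_mult mult_ac)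
    qed
  qed (use v0(2) in auto)
  have lim2b: "(\<lambda>n. (\<integral>x. \<Phi>' (U n x) * V n x * \<phi> x \<partial>lborel) - (\<integral>x. \<Phi>' (U n x) * v0 x * \<phi> x \<partial>lborel)) \<longlonglongrightarrow> 0"
  proof (rule Lim_null_comparison)
    show "\<forall>\<^sub>F n in sequentially. norm ((\<integral>x. \<Phi>' (U n x) * V n x * \<phi> x \<partial>lborel) - (\<integral>x. \<Phi>' (U n x) * v0 x * \<phi> x \<partial>lborel))
        \<le> L * B1 * (\<integral>x. \<bar>V n x - v0 x\<bar> \<partial>lborel)"
    proof (rule always_eventually, rule allI)
      fix n
      have "(\<integral>x. \<Phi>' (U n x) * V n x * \<phi> x \<partial>lborel) - (\<integral>x. \<Phi>' (U n x) * v0 x * \<phi> x \<partial>lborel) =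
          (\<integral>x. \<Phi>' (U n x) * V n x * \<phi> x - \<Phi>' (U n x) * v0 x * \<phi> x \<partial>lborel)"
        using i1 i3 by simp
      also have "norm \<dots> \<le> (\<integral>x. L * B1 * \<bar>V n x - v0 x\<bar> \<partial>lborel)"
      proof (rule Bochner_Integration.integral_norm_bound_integral)
        fix x
        have "\<bar>\<Phi>' (U n x)\<bar> * \<bar>\<phi> x\<bar> * \<bar>V n x - v0 x\<bar> \<le> L * B1 * \<bar>V n x - v0 x\<bar>"
          by (intro mult_mono L B1) (use L0 B0 in auto)
        moreover have "\<Phi>' (U n x) * V n x * \<phi> x - \<Phi>' (U n x) * v0 x * \<phi> x = \<Phi>' (U n x) * \<phi> x * (V n x - v0 x)"
          by (simp add: algebra_simps)
        ultimately show "norm (\<Phi>' (U n x) * V n x * \<phi> x - \<Phi>' (U n x) * v0 x * \<phi> x) \<le> L * B1 * \<bar>V n x - v0 x\<bar>"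
          by (simp add: abs_mult)
      qed (use i1 i3 iU in auto)
      finally show "norm ((\<integral>x. \<Phi>' (U n x) * V n x * \<phi> x \<partial>lborel) - (\<integral>x. \<Phi>' (U n x) * v0 x * \<phi> x \<partial>lborel))
        \<le> L * B1 * (\<integral>x. \<bar>V n x - v0 x\<bar> \<partial>lborel)" by simp
    qed
    show "(\<lambda>n. L * B1 * (\<integral>x. \<bar>V n x - v0 x\<bar> \<partial>lborel)) \<longlonglongrightarrow> 0"
      by (rule tendsto_mult_right_zero[OF cvV])
  qed
  have "(\<lambda>n. \<integral>x. \<Phi>' (U (s n) x) * V (s n) x * \<phi> x \<partial>lborel) \<longlonglongrightarrow> (\<integral>x. \<Phi>' (u0 x) * v0 x * \<phi> x \<partial>lborel)"
    using tendsto_add[OF LIMSEQ_subseq_LIMSEQ[OF lim2b s(1)] lim2a] by (simp add: comp_def)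
  then have "(\<lambda>n. \<integral>x. \<Phi> (U (s n) x) * pd i \<phi> x \<partial>lborel) \<longlonglongrightarrow> - (\<integral>x. \<Phi>' (u0 x) * v0 x * \<phi> x \<partial>lborel)"
    unfolding eqn by (rule tendsto_minus)
  moreover have "(\<lambda>n. \<integral>x. \<Phi> (U (s n) x) * pd i \<phi> x \<partial>lborel) \<longlonglongrightarrow> (\<integral>x. \<Phi> (u0 x) * pd i \<phi> x \<partial>lborel)"
    using LIMSEQ_subseq_LIMSEQ[OF lim1 s(1)] by (simp add: comp_def)
  ultimately have "(\<integral>x. \<Phi> (u0 x) * pd i \<phi> x \<partial>lborel) = - (\<integral>x. \<Phi>' (u0 x) * v0 x * \<phi> x \<partial>lborel)"
    using LIMSEQ_unique by blast
  then have e0: "(\<integral>x. \<Phi> (u0 x) * pd i \<phi> x \<partial>lebesgue) = - (\<integral>x. \<Phi>' (u0 x) * v0 x * \<phi> x \<partial>lebesgue)"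
    by (simp add: integral_completion)
  have um: "u \<in> borel_measurable lebesgue" "v \<in> borel_measurable lebesgue" using u v by auto
  have m: "(\<lambda>x. \<Phi> (u x)) \<in> borel_measurable lebesgue" "(\<lambda>x. \<Phi>' (u x)) \<in> borel_measurable lebesgue"
    using um by measurable
  have m0: "(\<lambda>x. \<Phi> (u0 x)) \<in> borel_measurable lebesgue" "(\<lambda>x. \<Phi>' (u0 x)) \<in> borel_measurable lebesgue"
    "v0 \<in> borel_measurable lebesgue"
    by (rule borel_imp_lebesgue, measurable)+
  have "(\<integral>x. \<Phi> (u x) * pd i \<phi> x \<partial>lebesgue) = (\<integral>x. \<Phi> (u0 x) * pd i \<phi> x \<partial>lebesgue)"
    by (rule integral_cong_AE)
      (use u0(3) m m0 test_fun_lebesgue[OF dt] in \<open>auto intro!: borel_measurable_times\<close>)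
  moreover have "(\<integral>x. \<Phi>' (u x) * v x * \<phi> x \<partial>lebesgue) = (\<integral>x. \<Phi>' (u0 x) * v0 x * \<phi> x \<partial>lebesgue)"
    by (rule integral_cong_AE)
      (use u0(3) v0(3) m m0 um test_fun_lebesgue[OF \<phi>] in \<open>auto intro!: borel_measurable_times\<close>)
  ultimately show ?thesis using e0 by simp
qed

text \<open>Only values on the support of the test function matter, so u may be multiplied by a
  cutoff that is 1 near it; this makes u and its derivative integrable.\<close>

theorem wd_chain:
  fixes u v :: "'a::euclidean_space \<Rightarrow> real"
  assumes w: "wd i u v" and i: "i \<in> Basis"
    and d: "\<And>t. (\<Phi> has_real_derivative \<Phi>' t) (at t)" and c: "continuous_on UNIV \<Phi>'"
    and L: "\<And>t. \<bar>\<Phi>' t\<bar> \<le> L"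
  shows "wd i (\<lambda>x. \<Phi> (u x)) (\<lambda>x. \<Phi>' (u x) * v x)"
  unfolding wd_def
proof (intro conjI allI impI)
  have [measurable]: "\<Phi>' \<in> borel_measurable borel" using c by (rule borel_measurable_continuous_onI)
  have [measurable]: "u \<in> borel_measurable lebesgue" using w by (blast intro: loc_int_measurable dest: wdD)
  show "loc_int (\<lambda>x. \<Phi> (u x))" by (rule loc_int_comp[OF wdD(1)[OF w] d L])
  show "loc_int (\<lambda>x. \<Phi>' (u x) * v x)" by (rule loc_int_bounded_mult[OF wdD(2)[OF w] _ L]) measurable
  fix \<phi> :: "'a \<Rightarrow> real" assume t: "test_fun \<phi>"
  obtain r0 where r0: "\<And>x. norm x > r0 \<Longrightarrow> \<phi> x = 0" using t by (auto simp: test_fun_iff)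
  define r where "r = max r0 0"
  have r: "\<phi> x = 0" if "norm x > r" for x using r0 that by (simp add: r_def)
  obtain \<eta> :: "'a \<Rightarrow> real" where e: "test_fun \<eta>" "\<And>y. dist 0 y \<le> r + 1 \<Longrightarrow> \<eta> y = 1"
    by (rule cutoff_exists[of "r + 1" "r + 2" "0::'a"]) (auto simp: r_def)
  have e1: "\<eta> x = 1" "pd i \<eta> x = 0" if "norm x \<le> r" for x
  proof -
    show "\<eta> x = 1" using e(2)[of x] that by simp
    have "((\<lambda>x. 1) has_derivative (\<lambda>h. 0)) (at x)" by simp
    then have "(\<eta> has_derivative (\<lambda>h. 0)) (at x)"
      by (rule has_derivative_transform_within_open[of _ _ _ _ "ball 0 (r + 1)"]) (use that e(2) in auto)
    then show "pd i \<eta> x = 0" by (rule pd_eq)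
  qed
  have "(\<integral>x. \<Phi> (\<eta> x * u x) * pd i \<phi> x \<partial>lebesgue) =
      - (\<integral>x. \<Phi>' (\<eta> x * u x) * (\<eta> x * v x + pd i \<eta> x * u x) * \<phi> x \<partial>lebesgue)"
  proof (rule wd_chain_integrable[OF wd_mult_smooth[OF w test_fun_smooth[OF e(1)] i] _ _ i d c L t])
    show "integrable lebesgue (\<lambda>x. \<eta> x * u x)" "integrable lebesgue (\<lambda>x. \<eta> x * v x + pd i \<eta> x * u x)"
      using loc_int_test[OF wdD(1)[OF w] e(1)] loc_int_test[OF wdD(2)[OF w] e(1)]
        loc_int_test[OF wdD(1)[OF w] test_fun_pd[OF e(1) i]] by (auto simp: mult.commute)
  qed
  moreover have "\<Phi> (\<eta> x * u x) * pd i \<phi> x = \<Phi> (u x) * pd i \<phi> x" for x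
    using e1[of x] pd_zero_off_support[of r \<phi> x i, OF r] by (cases "norm x \<le> r") auto
  moreover have "\<Phi>' (\<eta> x * u x) * (\<eta> x * v x + pd i \<eta> x * u x) * \<phi> x = \<Phi>' (u x) * v x * \<phi> x" for x
    using e1[of x] r[of x] by (cases "norm x \<le> r") auto
  ultimately show "(\<integral>x. \<Phi> (u x) * pd i \<phi> x \<partial>lebesgue) = - (\<integral>x. \<Phi>' (u x) * v x * \<phi> x \<partial>lebesgue)" by simp
qed

lemma max0_sq_deriv: "((\<lambda>t::real. (max 0 t)\<^sup>2) has_real_derivative 2 * max 0 t) (at t)"
proof (cases t "0::real" rule: linorder_cases)
  case less
  have "((\<lambda>t. 0) has_real_derivative 0) (at t)" by simp
  then have "((\<lambda>t. (max 0 t)\<^sup>2) has_real_derivative 0) (at t)"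
    by (rule has_field_derivative_transform_within_open[where S="{..<0}"]) (use less in auto)
  then show ?thesis using less by simp
next
  case equal
  have "((\<lambda>h. ((max 0 (0 + h))\<^sup>2 - (max 0 0)\<^sup>2) / h) \<longlongrightarrow> 0) (at (0::real))"
  proof (rule Lim_null_comparison)
    show "\<forall>\<^sub>F h in at 0. norm (((max 0 (0 + h))\<^sup>2 - (max 0 0)\<^sup>2) / h) \<le> \<bar>h::real\<bar>"
      by (rule always_eventually) (auto simp: max_def power2_eq_square)
    show "((\<lambda>h. \<bar>h::real\<bar>) \<longlongrightarrow> 0) (at 0)" by (rule tendsto_rabs_zero) (rule tendsto_ident_at)
  qed
  then show ?thesis using equal by (simp add: DERIV_def)
next
  case greater
  have "((\<lambda>t. t\<^sup>2) has_real_derivative 2 * t) (at t)" by (auto intro!: derivative_eq_intros)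
  then have "((\<lambda>t. (max 0 t)\<^sup>2) has_real_derivative 2 * t) (at t)"
    by (rule has_field_derivative_transform_within_open[where S="{0<..}"]) (use greater in auto)
  then show ?thesis using greater by simp
qed

text \<open>The chain rule for the approximations sqrt(max(0, s)^2 + e^2) - e of max(0, s). They are
  C^1 because max(0, s)^2 is, and constant for s \<le> 0, so their derivatives vanish at s = 0; this
  decides the value of the limit on the level set u = 0.\<close>

theorem wd_pos:
  fixes u v :: "'a::euclidean_space \<Rightarrow> real"
  assumes w: "wd i u v" and i: "i \<in> Basis"
  shows "wd i (\<lambda>x. max 0 (u x)) (\<lambda>x. if u x > 0 then v x else 0)"
  unfolding wd_def
proof (intro conjI allI impI)
  have [measurable]: "u \<in> borel_measurable lebesgue" "v \<in> borel_measurable lebesgue"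
    using w by (blast intro: loc_int_measurable dest: wdD)+
  show l1: "loc_int (\<lambda>x. max 0 (u x))" by (rule loc_int_dominated[OF wdD(1)[OF w]]) auto
  show l2: "loc_int (\<lambda>x. if u x > 0 then v x else 0)" by (rule loc_int_dominated[OF wdD(2)[OF w]]) auto
  fix \<phi> :: "'a \<Rightarrow> real" assume t: "test_fun \<phi>"
  have [measurable]: "\<phi> \<in> borel_measurable lebesgue" "pd i \<phi> \<in> borel_measurable lebesgue"
    using test_fun_lebesgue[OF t] test_fun_lebesgue[OF test_fun_pd[OF t i]] by auto
  define e where "e n = 1 / real (Suc n)" for n
  have e0: "e n > 0" for n by (simp add: e_def)
  have elim: "e \<longlonglongrightarrow> 0" unfolding e_def by (rule LIMSEQ_Suc[OF lim_1_over_n])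
  define \<Phi> where "\<Phi> n s = sqrt ((max 0 s)\<^sup>2 + (e n)\<^sup>2) - e n" for n s
  define \<Phi>' where "\<Phi>' n s = max 0 s / sqrt ((max 0 s)\<^sup>2 + (e n)\<^sup>2)" for n s
  have pos: "(max 0 s)\<^sup>2 + (e n)\<^sup>2 > 0" for n s using e0[of n] by (simp add: add_nonneg_pos)
  have d: "(\<Phi> n has_real_derivative \<Phi>' n s) (at s)" for n s
  proof -
    have "((\<lambda>s. (max 0 s)\<^sup>2 + (e n)\<^sup>2) has_real_derivative 2 * max 0 s + 0) (at s)"
      by (intro DERIV_add max0_sq_deriv DERIV_const)
    from DERIV_diff[OF DERIV_chain2[OF DERIV_real_sqrt[OF pos] this] DERIV_const[of "e n"]]
    show ?thesis unfolding \<Phi>_def \<Phi>'_def by (simp add: divide_simps)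
  qed
  have c: "continuous_on UNIV (\<Phi>' n)" for n
    unfolding \<Phi>'_def using pos[of _ n] by (intro continuous_intros) (auto simp: less_imp_neq[symmetric])
  have b: "max 0 s \<le> sqrt ((max 0 s)\<^sup>2 + (e n)\<^sup>2)" "sqrt ((max 0 s)\<^sup>2 + (e n)\<^sup>2) \<le> max 0 s + e n" for n s
    using e0[of n] by (auto intro!: real_le_rsqrt real_le_lsqrt simp: power2_sum)
  have L: "\<bar>\<Phi>' n s\<bar> \<le> 1" for n s
    unfolding \<Phi>'_def using b(1)[of s n] pos[of s n] by (auto simp: divide_simps)
  have \<Phi>b: "\<bar>\<Phi> n s\<bar> \<le> \<bar>s\<bar>" for n s
  proof -
    have "e n \<le> sqrt ((max 0 s)\<^sup>2 + (e n)\<^sup>2)" using e0[of n] by (auto intro!: real_le_rsqrt)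
    then show ?thesis using b(2)[of s n] by (auto simp: \<Phi>_def max_def)
  qed
  have [measurable]: "\<Phi> n \<in> borel_measurable borel" "\<Phi>' n \<in> borel_measurable borel" for n
    unfolding \<Phi>_def \<Phi>'_def by measurable
  have eqn: "(\<integral>x. \<Phi> n (u x) * pd i \<phi> x \<partial>lebesgue) = - (\<integral>x. \<Phi>' n (u x) * v x * \<phi> x \<partial>lebesgue)" for n
    by (rule wdD(3)[OF wd_chain[OF w i d c L] t])
  have l\<Phi>: "(\<lambda>n. \<Phi> n s) \<longlonglongrightarrow> max 0 s" for s
  proof -
    have "(\<lambda>n. \<Phi> n s) \<longlonglongrightarrow> sqrt ((max 0 s)\<^sup>2 + 0\<^sup>2) - 0"
      unfolding \<Phi>_def by (intro tendsto_intros elim)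
    then show ?thesis by simp
  qed
  have l\<Phi>': "(\<lambda>n. \<Phi>' n s) \<longlonglongrightarrow> (if s > 0 then 1 else 0)" for s
  proof (cases "s > 0")
    case True
    have "(\<lambda>n. \<Phi>' n s) \<longlonglongrightarrow> max 0 s / sqrt ((max 0 s)\<^sup>2 + 0\<^sup>2)"
      unfolding \<Phi>'_def by (intro tendsto_intros elim) (use True in auto)
    then show ?thesis using True by simp
  qed (simp add: \<Phi>'_def max_def)
  have "(\<lambda>n. \<integral>x. \<Phi> n (u x) * pd i \<phi> x \<partial>lebesgue) \<longlonglongrightarrow> (\<integral>x. max 0 (u x) * pd i \<phi> x \<partial>lebesgue)"
  proof (rule integral_dominated_convergence[where w="\<lambda>x. \<bar>u x * pd i \<phi> x\<bar>"])
    show "integrable lebesgue (\<lambda>x. \<bar>u x * pd i \<phi> x\<bar>)"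
      by (intro integrable_abs loc_int_test[OF wdD(1)[OF w] test_fun_pd[OF t i]])
    show "AE x in lebesgue. norm (\<Phi> n (u x) * pd i \<phi> x) \<le> \<bar>u x * pd i \<phi> x\<bar>" for n
      by (rule AE_I2) (auto simp: abs_mult intro!: mult_right_mono \<Phi>b)
  qed (auto intro!: AE_I2 tendsto_intros l\<Phi>)
  moreover have "(\<lambda>n. \<integral>x. \<Phi>' n (u x) * v x * \<phi> x \<partial>lebesgue) \<longlonglongrightarrow> (\<integral>x. (if u x > 0 then 1 else 0) * v x * \<phi> x \<partial>lebesgue)"
  proof (rule integral_dominated_convergence[where w="\<lambda>x. \<bar>v x * \<phi> x\<bar>"])
    show "integrable lebesgue (\<lambda>x. \<bar>v x * \<phi> x\<bar>)"
      by (intro integrable_abs loc_int_test[OF wdD(2)[OF w] t])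
    show "AE x in lebesgue. norm (\<Phi>' n (u x) * v x * \<phi> x) \<le> \<bar>v x * \<phi> x\<bar>" for n
      by (rule AE_I2) (use L[of n] in \<open>auto simp: abs_mult mult.assoc intro!: mult_left_le_one_le\<close>)
    show "AE x in lebesgue. (\<lambda>n. \<Phi>' n (u x) * v x * \<phi> x) \<longlonglongrightarrow> (if u x > 0 then 1 else 0) * v x * \<phi> x"
      by (intro AE_I2 tendsto_mult tendsto_const l\<Phi>')
  qed auto
  ultimately have "(\<integral>x. max 0 (u x) * pd i \<phi> x \<partial>lebesgue) = - (\<integral>x. (if u x > 0 then 1 else 0) * v x * \<phi> x \<partial>lebesgue)"
    unfolding eqn using LIMSEQ_unique tendsto_minus by blast
  moreover have "(if u x > 0 then 1 else 0) * v x * \<phi> x = (if u x > 0 then v x else 0) * \<phi> x" for x by simp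
  ultimately show "(\<integral>x. max 0 (u x) * pd i \<phi> x \<partial>lebesgue) = - (\<integral>x. (if u x > 0 then v x else 0) * \<phi> x \<partial>lebesgue)"
    by simp
qed

text \<open>u is the difference of its positive and negative parts, whose derivatives both vanish
  where u = 0; uniqueness of weak derivatives transfers this to v.\<close>

lemma wd_level_zero:
  assumes w: "wd i u v" and i: "i \<in> Basis"
  shows "AE x in lebesgue. u x = 0 \<longrightarrow> v x = 0"
proof -
  have "wd i (\<lambda>x. - u x) (\<lambda>x. - v x)" using wd_cmult[OF w, of "- 1"] by simp
  from wd_pos[OF this i] have n: "wd i (\<lambda>x. max 0 (- u x)) (\<lambda>x. if u x < 0 then - v x else 0)" by simp
  have "wd i (\<lambda>x. max 0 (u x) - max 0 (- u x)) (\<lambda>x. (if u x > 0 then v x else 0) - (if u x < 0 then - v x else 0))"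
    by (rule wd_diff[OF wd_pos[OF w i] n i])
  moreover have "(\<lambda>x. max 0 (u x) - max 0 (- u x)) = u" by (auto simp: max_def)
  ultimately have "AE x in lebesgue. v x = (if u x > 0 then v x else 0) - (if u x < 0 then - v x else 0)"
    using wd_unique[OF w] by simp
  then show ?thesis by eventually_elim auto
qed

section \<open>The mollified fundamental solution\<close>

text \<open>Truncating \<open>r powr -n\<close> at \<open>r = a\<close> replaces the point source by the uniform measure on the ball
  of radius \<open>a\<close>. Radial profiles are functions of \<open>s = r\<^sup>2\<close>; the base point \<open>-1\<close> of the primitive keeps
  \<open>s = 0\<close> in the interior of its domain.\<close>
definition hk :: "nat \<Rightarrow> real \<Rightarrow> real \<Rightarrow> real" where
  "hk n a s = max (a\<^sup>2) s powr (- (real n / 2))"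

definition Lk :: "nat \<Rightarrow> real \<Rightarrow> real \<Rightarrow> real" where
  "Lk n a s = - (1 / 2) * integral {-1..s} (hk n a)"

lemma hk_pos: "a > 0 \<Longrightarrow> hk n a s > 0"
  using less_max_iff_disj[of 0 "a\<^sup>2" s] by (simp add: hk_def)

lemma hk_continuous: "a > 0 \<Longrightarrow> continuous_on S (hk n a)"
  unfolding hk_def by (intro continuous_intros) (auto simp: max_def)

lemma hk_antimono:
  assumes "0 < a" "a \<le> b"
  shows "hk n b s \<le> hk n a s"
proof -
  have "a\<^sup>2 \<le> b\<^sup>2" using assms by (intro power_mono) auto
  then have "max (a\<^sup>2) s \<le> max (b\<^sup>2) s" by (intro max.mono) auto
  moreover have "0 < max (a\<^sup>2) s" using assms by (simp add: less_max_iff_disj)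
  ultimately show ?thesis unfolding hk_def by (intro powr_mono2') auto
qed

lemma hk_inside: "a > 0 \<Longrightarrow> s \<le> a\<^sup>2 \<Longrightarrow> hk n a s = 1 / a ^ n"
proof -
  assume a: "a > 0" "s \<le> a\<^sup>2"
  have "(a powr 2) powr (- (real n / 2)) = a powr (- real n)" by (simp add: powr_powr)
  moreover have "a powr 2 = a\<^sup>2" using a by (simp add: powr_numeral)
  moreover have "a powr (- real n) = 1 / a ^ n" using a by (simp add: powr_minus powr_realpow divide_inverse)
  moreover have "max (a\<^sup>2) s = a\<^sup>2" using a by (simp add: max_def)
  ultimately show ?thesis by (simp add: hk_def)
qed

lemma hk_le: "a > 0 \<Longrightarrow> hk n a s \<le> 1 / a ^ n"
proof -
  assume a: "a > 0"
  have "hk n a s \<le> hk n a (min s (a\<^sup>2))"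
    unfolding hk_def using a by (intro powr_mono2') (auto simp: max_def min_def)
  then show ?thesis using hk_inside[OF a, of "min s (a\<^sup>2)"] by simp
qed

lemma hk_outside: "a\<^sup>2 \<le> s \<Longrightarrow> hk n a s = s powr (- (real n / 2))"
  by (simp add: hk_def max_def)

lemma Lk_deriv:
  assumes "a > 0" "s > -1"
  shows "(Lk n a has_real_derivative - hk n a s / 2) (at s)"
proof -
  have "((\<lambda>s. integral {-1..s} (hk n a)) has_real_derivative hk n a s) (at s within {-1..s+1})"
    by (rule integral_has_real_derivative[OF hk_continuous[OF assms(1)]]) (use assms in auto)
  moreover have "at s within {-1..s+1} = at s"
    using assms by (intro at_within_interior) (auto simp: interior_cbox[of "-1::real", simplified])
  ultimately have "((\<lambda>s. integral {-1..s} (hk n a)) has_real_derivative hk n a s) (at s)" by simp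
  from DERIV_cmult[OF this, of "- (1 / 2)"] show ?thesis by (simp add: Lk_def[abs_def])
qed

lemma Lk_diff:
  assumes "a > 0" "-1 \<le> s" "s \<le> t"
  shows "Lk n a s - Lk n a t = integral {s..t} (hk n a) / 2"
proof -
  have "integral {-1..s} (hk n a) + integral {s..t} (hk n a) = integral {-1..t} (hk n a)"
    by (rule Henstock_Kurzweil_Integration.integral_combine)
      (use assms in \<open>auto intro!: integrable_continuous_real hk_continuous\<close>)
  then show ?thesis by (simp add: Lk_def)
qed

lemma hk_int: "a > 0 \<Longrightarrow> hk n a integrable_on {s..t}"
  by (intro integrable_continuous_real hk_continuous)

lemma Lk_diff_antimono:
  assumes "0 < a" "a \<le> b" "-1 \<le> s" "s \<le> t"
  shows "Lk n b s - Lk n b t \<le> Lk n a s - Lk n a t"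
  using assms hk_int[of a n s t] hk_int[of b n s t] hk_antimono[of a b n]
  by (auto simp: Lk_diff intro!: integral_le)

lemma Lk_antimono:
  assumes "0 < a" "-1 \<le> s" "s \<le> t"
  shows "Lk n a t \<le> Lk n a s"
proof -
  have "0 \<le> integral {s..t} (hk n a)"
    using hk_pos[OF assms(1)] by (intro Henstock_Kurzweil_Integration.integral_nonneg hk_int assms) (auto intro: less_imp_le)
  then show ?thesis using Lk_diff[OF assms, of n] by linarith
qed

section \<open>Normalisation and comparison with the profile \<Psi>\<close>

lemma vol_ball_eq: "r \<ge> 0 \<Longrightarrow> vol_ball TYPE('a::euclidean_space) r = unit_ball_vol (real DIM('a)) * r ^ DIM('a)"
  unfolding vol_ball_def by (simp add: content_ball)

lemma vol_ball_scale: "r \<ge> 0 \<Longrightarrow> vol_ball TYPE('a::euclidean_space) r = vol_ball TYPE('a) 1 * r ^ DIM('a)"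
  by (simp add: vol_ball_eq)

lemma vol_ball_pos: "r > 0 \<Longrightarrow> vol_ball TYPE('a::euclidean_space) r > 0"
  by (simp add: vol_ball_eq)

text \<open>The reciprocal of the surface area n |B_1| of the unit sphere: the factor that turns the
  flux of the radial field y / |y|^n into a unit charge.\<close>

definition cn :: "'a::euclidean_space itself \<Rightarrow> real" where
  "cn T = 1 / (real DIM('a) * vol_ball T 1)"

lemma cn_pos: "cn TYPE('a::euclidean_space) > 0"
  by (simp add: cn_def vol_ball_pos)

lemma cn_hk: "a > 0 \<Longrightarrow> cn TYPE('a::euclidean_space) * real DIM('a) / a ^ DIM('a) = 1 / vol_ball TYPE('a) a"
  by (simp add: cn_def vol_ball_scale[of a])

text \<open>In the variable s = r^2 the logarithm and the power have the same derivative, so the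
  comparison of \<Psi> with \<open>Lk\<close> treats n = 2 and n \<ge> 3 alike.\<close>

lemma Psi_deriv:
  assumes n: "DIM('a::euclidean_space) \<ge> 2" and s: "s > 0"
  shows "((\<lambda>s. Psi TYPE('a) (sqrt s)) has_real_derivative
    - cn TYPE('a) / 2 * s powr (- (real DIM('a) / 2))) (at s)"
proof (cases "DIM('a) = 2")
  case True
  have v: "vol_ball TYPE('a) 1 = pi" using True by (simp add: vol_ball_eq unit_ball_vol_2)
  have "((\<lambda>s. - ln (sqrt s) / (2 * pi)) has_real_derivative - (1 / sqrt s * (inverse (sqrt s) / 2)) / (2 * pi)) (at s)"
    using s by (auto intro!: derivative_eq_intros)
  moreover have "- (1 / sqrt s * (inverse (sqrt s) / 2)) / (2 * pi) = - cn TYPE('a) / 2 * s powr (- (real DIM('a) / 2))"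
    using s by (simp add: cn_def True v powr_minus divide_simps)
  ultimately show ?thesis using True by (simp add: Psi_def)
next
  case False
  define m where "m = DIM('a) - 2"
  have m: "m \<ge> 1" "DIM('a) = m + 2" using n False by (auto simp: m_def)
  define K where "K = real DIM('a) * (real DIM('a) - 2) * vol_ball TYPE('a) 1"
  have K: "K > 0" using m vol_ball_pos[of 1, where 'a='a] by (simp add: K_def)
  have "((\<lambda>s. 1 / K * s powr (- (real m / 2))) has_real_derivative 1 / K * (- (real m / 2) * s powr (- (real m / 2) - 1))) (at s)"
    using s K by (auto intro!: derivative_eq_intros)
  moreover have "1 / K * (- (real m / 2) * s powr (- (real m / 2) - 1)) = - cn TYPE('a) / 2 * s powr (- (real DIM('a) / 2))"
  proof -
    have e: "- (real m / 2) - 1 = - (real DIM('a) / 2)" by (simp add: m field_simps)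
    show ?thesis unfolding e using m vol_ball_pos[of 1, where 'a='a] by (simp add: K_def cn_def)
  qed
  ultimately have d: "((\<lambda>s. 1 / K * s powr (- (real m / 2))) has_real_derivative
      - cn TYPE('a) / 2 * s powr (- (real DIM('a) / 2))) (at s)" by (rule DERIV_cong)
  have e: "Psi TYPE('a) (sqrt s) = 1 / K * s powr (- (real m / 2))" if "s > 0" for s
  proof -
    have "s powr (- (real m / 2)) = (s powr (1 / 2)) powr (- real m)" by (simp add: powr_powr)
    also have "\<dots> = sqrt s powr (- real m)" using that by (simp only: powr_half_sqrt less_imp_le)
    also have "\<dots> = 1 / sqrt s ^ m" using powr_realpow[of "sqrt s" m] powr_minus[of "sqrt s" "real m"] that
      by (simp add: divide_inverse)
    finally show ?thesis using False by (simp add: Psi_def K_def m_def)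
  qed
  show ?thesis
    by (rule has_field_derivative_transform_within_open[OF d, of "{0<..}"]) (use s e in auto)
qed

text \<open>Newton's theorem: outside the ball of radius a the averaged fundamental solution agrees
  with \<Psi> up to a constant. For s \<ge> a^2 the truncation in \<open>hk\<close> is inactive, and
  the two derivatives coincide.\<close>

lemma Lk_Psi:
  assumes n: "DIM('a::euclidean_space) \<ge> 2" and a: "a > 0" "a \<le> r" "r \<le> r'"
  shows "cn TYPE('a) * (Lk DIM('a) a (r\<^sup>2) - Lk DIM('a) a (r'\<^sup>2)) = Psi TYPE('a) r - Psi TYPE('a) r'"
proof (cases "r = r'")
  case False
  define D where "D s = cn TYPE('a) * Lk DIM('a) a s - Psi TYPE('a) (sqrt s)" for s
  have d: "(D has_real_derivative cn TYPE('a) * (- hk DIM('a) a s / 2) - (- cn TYPE('a) / 2 * s powr (- (real DIM('a) / 2)))) (at s)"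
    if "s > 0" for s
    unfolding D_def by (intro DERIV_diff DERIV_cmult Lk_deriv Psi_deriv n) (use that a in auto)
  have sq: "r\<^sup>2 < r'\<^sup>2" using False a by (intro power_strict_mono) auto
  have r0: "r\<^sup>2 > 0" using a by simp
  have ar: "a\<^sup>2 \<le> r\<^sup>2" using a by (intro power_mono) auto
  have "D (r'\<^sup>2) = D (r\<^sup>2)"
  proof (rule DERIV_isconst_end[OF sq])
    show "continuous_on {r\<^sup>2..r'\<^sup>2} D"
    proof (intro continuous_at_imp_continuous_on ballI)
      fix s assume "s \<in> {r\<^sup>2..r'\<^sup>2}"
      then have "s > 0" using r0 by (meson atLeastAtMost_iff less_le_trans)
      from DERIV_isCont[OF d[OF this]] show "isCont D s" .
    qed
    show "(D has_real_derivative 0) (at s)" if "r\<^sup>2 < s" "s < r'\<^sup>2" for s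
    proof -
      have s: "s > 0" "a\<^sup>2 \<le> s" using that(1) r0 ar by linarith+
      from d[OF s(1)] show ?thesis unfolding hk_outside[OF s(2)] by simp
    qed
  qed
  then show ?thesis using a by (simp add: D_def algebra_simps)
qed simp

lemma Psi_antimono:
  assumes n: "DIM('a::euclidean_space) \<ge> 2" and r: "0 < r" "r \<le> r'"
  shows "Psi TYPE('a) r' \<le> Psi TYPE('a) r"
proof -
  have "r\<^sup>2 \<le> r'\<^sup>2" using r by (intro power_mono) auto
  then have "Lk DIM('a) r (r'\<^sup>2) \<le> Lk DIM('a) r (r\<^sup>2)" using r by (intro Lk_antimono) (auto intro: order_trans[of _ 0])
  then have "0 \<le> cn TYPE('a) * (Lk DIM('a) r (r\<^sup>2) - Lk DIM('a) r (r'\<^sup>2))"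
    using cn_pos[where 'a='a] by simp
  then show ?thesis using Lk_Psi[OF n, of r r r'] r by simp
qed

section \<open>Radial functions and the divergence of the radial field\<close>

lemma Lk_radial_line_deriv:
  fixes z :: "'a::euclidean_space"
  assumes a: "a > 0"
  shows "((\<lambda>t. Lk n a ((y + t *\<^sub>R i - z) \<bullet> (y + t *\<^sub>R i - z))) has_real_derivative
    - ((y + t *\<^sub>R i - z) \<bullet> i) * hk n a ((y + t *\<^sub>R i - z) \<bullet> (y + t *\<^sub>R i - z))) (at t)"
proof -
  have d: "((\<lambda>t. (y + t *\<^sub>R i - z) \<bullet> (y + t *\<^sub>R i - z)) has_real_derivative 2 * ((y + t *\<^sub>R i - z) \<bullet> i)) (at t)"
    unfolding has_field_derivative_def
    by (auto intro!: derivative_eq_intros simp: fun_eq_iff inner_commute)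
  have "((y + t *\<^sub>R i - z) \<bullet> (y + t *\<^sub>R i - z)) > -1" using inner_ge_zero[of "y + t *\<^sub>R i - z"] by linarith
  from DERIV_chain2[OF Lk_deriv[OF a this] d] show ?thesis by (simp add: mult.commute)
qed

lemma continuous_Lk_radial:
  fixes z :: "'a::euclidean_space"
  assumes a: "a > 0"
  shows "continuous_on UNIV (\<lambda>y. Lk n a ((y - z) \<bullet> (y - z)))"
proof -
  have "continuous_on {0..} (Lk n a)"
    by (intro continuous_at_imp_continuous_on ballI DERIV_isCont[OF Lk_deriv[OF a]]) auto
  then show ?thesis
    by (rule continuous_on_compose2) (auto intro!: continuous_intros)
qed

lemma wd_Lk:
  fixes z :: "'a::euclidean_space"
  assumes a: "a > 0" and i: "i \<in> Basis"
  shows "wd i (\<lambda>y. Lk n a ((y - z) \<bullet> (y - z))) (\<lambda>y. - ((y - z) \<bullet> i) * hk n a ((y - z) \<bullet> (y - z)))"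
proof (rule wd_C1[OF Lk_radial_line_deriv[OF a] continuous_Lk_radial[OF a] _ i])
  show "continuous_on UNIV (\<lambda>y. - ((y - z) \<bullet> i) * hk n a ((y - z) \<bullet> (y - z)))"
    by (intro continuous_intros continuous_on_compose2[OF hk_continuous[OF a, of UNIV]]) auto
qed

text \<open>Smooth approximations of the profile: \<open>(a\<^sup>2\<^sup>p + s\<^sup>p) powr (1/p) \<rightarrow> max (a\<^sup>2) s\<close>.\<close>
definition hp :: "nat \<Rightarrow> real \<Rightarrow> nat \<Rightarrow> real \<Rightarrow> real" where
  "hp n a p s = (a ^ (2 * p) + s ^ p) powr (- (real n / (2 * real p)))"

text \<open>With m = max(a^2, s) one has m^p \<le> a^(2p) + s^p \<le> 2 m^p. The bound by
  \<open>hk\<close> also provides the dominating function for the limit p to infinity.\<close>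

lemma hp_bounds:
  assumes "a > 0" "s \<ge> 0" "p \<ge> 1"
  shows "hp n a p s \<le> hk n a s" "2 powr (- (real n / (2 * real p))) * hk n a s \<le> hp n a p s"
proof -
  define m where "m = max (a\<^sup>2) s"
  have m: "m > 0" using assms by (simp add: m_def less_max_iff_disj)
  have e: "hk n a s = (m ^ p) powr (- (real n / (2 * real p)))"
    using m assms(3) by (simp add: hk_def m_def[symmetric] powr_realpow[symmetric] powr_powr)
  have ap: "a ^ (2 * p) = (a\<^sup>2) ^ p" by (simp add: power_mult)
  have "m ^ p \<le> a ^ (2 * p) + s ^ p" using assms unfolding ap m_def max_def by auto
  then show "hp n a p s \<le> hk n a s" unfolding e hp_def using m by (intro powr_mono2') auto
  have "(a\<^sup>2) ^ p \<le> m ^ p" "s ^ p \<le> m ^ p" using assms by (auto simp: m_def intro!: power_mono)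
  then have "a ^ (2 * p) + s ^ p \<le> 2 * m ^ p" unfolding ap by simp
  moreover have "0 < a ^ (2 * p) + s ^ p" using assms by (intro add_pos_nonneg) auto
  ultimately have "(2 * m ^ p) powr (- (real n / (2 * real p))) \<le> hp n a p s"
    unfolding hp_def by (intro powr_mono2') auto
  then show "2 powr (- (real n / (2 * real p))) * hk n a s \<le> hp n a p s"
    unfolding e using m by (simp add: powr_mult)
qed

lemma hp_tendsto:
  assumes "a > 0" "s \<ge> 0"
  shows "(\<lambda>p. hp n a p s) \<longlonglongrightarrow> hk n a s"
proof (rule tendsto_sandwich)
  show "\<forall>\<^sub>F p in sequentially. 2 powr (- (real n / (2 * real p))) * hk n a s \<le> hp n a p s"
    "\<forall>\<^sub>F p in sequentially. hp n a p s \<le> hk n a s"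
    using hp_bounds[OF assms] by (auto intro!: eventually_sequentiallyI[of 1])
  have "(\<lambda>p. - (real n / 2 * (1 / real p))) \<longlonglongrightarrow> - (real n / 2 * 0)"
    by (intro tendsto_intros lim_1_over_n)
  then have "(\<lambda>p. - (real n / (2 * real p))) \<longlonglongrightarrow> 0" by simp
  then have "(\<lambda>p. 2 powr (- (real n / (2 * real p))) * hk n a s) \<longlonglongrightarrow> 2 powr 0 * hk n a s"
    by (intro tendsto_intros) auto
  then show "(\<lambda>p. 2 powr (- (real n / (2 * real p))) * hk n a s) \<longlonglongrightarrow> hk n a s" by simp
qed simp

lemma smooth_hp:
  assumes "a > 0"
  shows "smooth (\<lambda>y::'a::euclidean_space. hp n a p ((y - z) \<bullet> (y - z)))"
  unfolding hp_def
proof (rule smooth_powr)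
  show "smooth (\<lambda>y::'a. a ^ (2 * p) + ((y - z) \<bullet> (y - z)) ^ p)"
    by (intro smooth_add smooth_const smooth_power smooth_sqdist)
  show "0 < a ^ (2 * p) + ((y - z) \<bullet> (y - z)) ^ p" for y :: 'a
    using assms by (intro add_pos_nonneg) auto
qed

text \<open>Component of a smooth substitute for the field (y - z) \<open>hk\<close> = - grad
  \<open>Lk\<close>, whose kink on the sphere of radius a rules out a classical divergence.\<close>

definition fld :: "real \<Rightarrow> nat \<Rightarrow> 'a::euclidean_space \<Rightarrow> 'a \<Rightarrow> 'a \<Rightarrow> real" where
  "fld a p z i y = ((y - z) \<bullet> i) * hp DIM('a) a p ((y - z) \<bullet> (y - z))"

lemma smooth_fld: "a > 0 \<Longrightarrow> smooth (fld a p z i)"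
proof -
  have "smooth (\<lambda>y. y \<bullet> i - z \<bullet> i)" by (intro smooth_diff smooth_inner smooth_const)
  then show "a > 0 \<Longrightarrow> smooth (fld a p z i)"
    unfolding fld_def[abs_def] inner_diff_left[of _ z i] by (intro smooth_mult smooth_hp)
qed

text \<open>With P = a^(2p) + s^p and q = -n/(2p) the divergence is n P^q - n s^p P^(q-1). The
  exponent is such that the two terms combine to n a^(2p) P^(q-1), which concentrates on the ball of
  radius a as p grows.\<close>

lemma fld_div:
  fixes y z :: "'a::euclidean_space"
  assumes a: "a > 0" and p: "p \<ge> 1"
  shows "(\<Sum>i\<in>Basis. pd i (fld a p z i) y) = real DIM('a) * (a ^ (2 * p) / (a ^ (2 * p) + ((y - z) \<bullet> (y - z)) ^ p))
     * hp DIM('a) a p ((y - z) \<bullet> (y - z))"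
proof -
  define n where "n = real DIM('a)"
  define s where "s = (y - z) \<bullet> (y - z)"
  define P where "P = a ^ (2 * p) + s ^ p"
  define q where "q = - (n / (2 * real p))"
  have s0: "s \<ge> 0" by (simp add: s_def)
  have P0: "P > 0" unfolding P_def using a s0 by (intro add_pos_nonneg) auto
  have hq: "hp DIM('a) a p s = P powr q" by (simp add: hp_def P_def q_def n_def)
  have pdv: "pd i (fld a p z i) y = P powr q + ((y - z) \<bullet> i)\<^sup>2 * (2 * real p * q * P powr (q - 1) * s ^ (p - 1))"
    if i: "i \<in> Basis" for i
  proof -
    have d: "((\<lambda>y. (y - z) \<bullet> (y - z)) has_derivative (\<lambda>h. 2 * ((y - z) \<bullet> h))) (at y)"
      by (auto intro!: derivative_eq_intros simp: fun_eq_iff inner_commute)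
    have d1: "((\<lambda>s. (a ^ (2 * p) + s ^ p) powr q) has_real_derivative q * P powr (q - 1) * (real p * s ^ (p - 1))) (at s)"
      using P0 unfolding P_def by (auto intro!: derivative_eq_intros)
    have d2: "((\<lambda>y. (a ^ (2 * p) + ((y - z) \<bullet> (y - z)) ^ p) powr q) has_derivative
        (\<lambda>h. q * P powr (q - 1) * (real p * s ^ (p - 1)) * (2 * ((y - z) \<bullet> h)))) (at y)"
      using has_derivative_compose[OF d d1[unfolded has_field_derivative_def s_def]] by (simp add: s_def)
    have d3: "((\<lambda>y. (y - z) \<bullet> i) has_derivative (\<lambda>h. h \<bullet> i)) (at y)"
      by (auto intro!: derivative_eq_intros)
    have "(fld a p z i has_derivative (\<lambda>h. ((y - z) \<bullet> i) * (q * P powr (q - 1) * (real p * s ^ (p - 1)) * (2 * ((y - z) \<bullet> h)))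
        + (h \<bullet> i) * P powr q)) (at y)"
      using has_derivative_mult[OF d3 d2] by (simp add: fld_def[abs_def] hp_def P_def q_def n_def s_def)
    from pd_eq[OF this] show ?thesis using i by (simp add: power2_eq_square mult_ac)
  qed
  have "(\<Sum>i\<in>Basis. pd i (fld a p z i) y) =
      n * P powr q + (\<Sum>i\<in>Basis. ((y - z) \<bullet> i)\<^sup>2) * (2 * real p * q * P powr (q - 1) * s ^ (p - 1))"
    by (simp add: pdv sum.distrib sum_distrib_right n_def)
  also have "(\<Sum>i\<in>Basis. ((y - z) \<bullet> i)\<^sup>2) = s"
    unfolding s_def by (subst euclidean_inner) (simp add: power2_eq_square)
  also have "s * (2 * real p * q * P powr (q - 1) * s ^ (p - 1)) = - n * P powr (q - 1) * s ^ p"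
    using p by (cases p) (auto simp: q_def)
  also have "n * P powr q + - n * P powr (q - 1) * s ^ p = n * (a ^ (2 * p) / P) * P powr q"
  proof -
    have "P powr (q - 1) = P powr q / P" using P0 by (simp add: powr_diff)
    moreover have "s ^ p = P - a ^ (2 * p)" by (simp add: P_def)
    moreover have "n * W + - n * (W / P) * (P - A) = n * (A / P) * W" for W A
      using P0 by (simp add: field_simps)
    ultimately show ?thesis by simp
  qed
  finally have "(\<Sum>i\<in>Basis. pd i (fld a p z i) y) = n * (a ^ (2 * p) / P) * hp DIM('a) a p s" unfolding hq .
  then show ?thesis by (simp only: P_def s_def n_def)
qed

lemma ratio_tendsto:
  fixes a s :: real
  assumes a: "a > 0" and s: "s \<ge> 0" "s \<noteq> a\<^sup>2"
  shows "(\<lambda>p. a ^ (2 * p) / (a ^ (2 * p) + s ^ p)) \<longlonglongrightarrow> (if s < a\<^sup>2 then 1 else 0)"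
proof (cases "s < a\<^sup>2")
  case True
  have l: "(\<lambda>p. (s / a\<^sup>2) ^ p) \<longlonglongrightarrow> 0" using True a s by (intro LIMSEQ_realpow_zero) auto
  then have "(\<lambda>p. 1 / (1 + (s / a\<^sup>2) ^ p)) \<longlonglongrightarrow> 1 / (1 + 0)"
    by (intro tendsto_divide tendsto_add tendsto_const l) auto
  moreover have "a ^ (2 * p) / (a ^ (2 * p) + s ^ p) = 1 / (1 + (s / a\<^sup>2) ^ p)" for p
    unfolding power_mult power_divide using a by (simp add: field_simps)
  ultimately show ?thesis using True by simp
next
  case False
  then have s0: "s > a\<^sup>2" using s by simp
  moreover have "a\<^sup>2 > 0" using a by simp
  ultimately have s1: "s > 0" by (rule less_trans[rotated])
  have l: "(\<lambda>p. (a\<^sup>2 / s) ^ p) \<longlonglongrightarrow> 0" using s0 s1 a by (intro LIMSEQ_realpow_zero) auto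
  then have "(\<lambda>p. (a\<^sup>2 / s) ^ p / ((a\<^sup>2 / s) ^ p + 1)) \<longlonglongrightarrow> 0 / (0 + 1)"
    by (intro tendsto_divide tendsto_add tendsto_const l) auto
  moreover have "a ^ (2 * p) / (a ^ (2 * p) + s ^ p) = (a\<^sup>2 / s) ^ p / ((a\<^sup>2 / s) ^ p + 1)" for p
    unfolding power_mult power_divide using s1 by (simp add: field_simps)
  ultimately show ?thesis using False by simp
qed

text \<open>Here \<zeta> rather than F has compact support. Multiplying F by a cutoff that is 1 on
  the support makes it a test function and changes none of the integrands.\<close>

lemma wd_test_local:
  assumes w: "wd i \<zeta> Z" and i: "i \<in> Basis" and F: "smooth F"
    and r: "\<And>y. norm y > r \<Longrightarrow> \<zeta> y = 0" "\<And>y. norm y > r \<Longrightarrow> Z y = 0"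
  shows "(\<integral>y. \<zeta> y * pd i F y \<partial>lebesgue) = - (\<integral>y. Z y * F y \<partial>lebesgue)"
    and "integrable lebesgue (\<lambda>y. \<zeta> y * F y)" "integrable lebesgue (\<lambda>y. Z y * F y)"
    "integrable lebesgue (\<lambda>y. \<zeta> y * pd i F y)"
proof -
  obtain \<theta> :: "'a \<Rightarrow> real" where t: "test_fun \<theta>" "\<And>y. dist 0 y \<le> \<bar>r\<bar> + 1 \<Longrightarrow> \<theta> y = 1"
    by (rule cutoff_exists[of "\<bar>r\<bar> + 1" "\<bar>r\<bar> + 2" "0::'a"]) auto
  have e: "\<theta> x = 1" "pd i \<theta> x = 0" if "norm x \<le> r" for x
  proof -
    show "\<theta> x = 1" using t(2)[of x] that by simp
    have "((\<lambda>x. 1) has_derivative (\<lambda>h. 0)) (at x)" by simp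
    then have "(\<theta> has_derivative (\<lambda>h. 0)) (at x)"
      by (rule has_derivative_transform_within_open[of _ _ _ _ "ball 0 (\<bar>r\<bar> + 1)"]) (use that t(2) in auto)
    then show "pd i \<theta> x = 0" by (rule pd_eq)
  qed
  have tf: "test_fun (\<lambda>y. F y * \<theta> y)" using test_fun_mult[OF t(1) F] .
  have tp: "test_fun (\<lambda>y. pd i F y * \<theta> y)" using test_fun_mult[OF t(1) smooth_pd[OF F i]] .
  have z: "\<zeta> y = 0 \<and> Z y = 0 \<or> \<theta> y = 1 \<and> pd i \<theta> y = 0" for y
    using e(1)[of y] e(2)[of y] r(1)[of y] r(2)[of y] by linarith
  have 1: "\<zeta> y * (F y * \<theta> y) = \<zeta> y * F y" "Z y * (F y * \<theta> y) = Z y * F y"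
     "\<zeta> y * (pd i F y * \<theta> y) = \<zeta> y * pd i F y" for y
    using z[of y] by auto
  have 2: "\<zeta> y * pd i (\<lambda>y. F y * \<theta> y) y = \<zeta> y * pd i F y" for y
    unfolding pd_mult[OF F test_fun_smooth[OF t(1)]] using z[of y] by auto
  show "(\<integral>y. \<zeta> y * pd i F y \<partial>lebesgue) = - (\<integral>y. Z y * F y \<partial>lebesgue)"
    using wdD(3)[OF w tf] by (simp only: 1 2)
  show "integrable lebesgue (\<lambda>y. \<zeta> y * F y)" "integrable lebesgue (\<lambda>y. Z y * F y)"
    "integrable lebesgue (\<lambda>y. \<zeta> y * pd i F y)"
    using loc_int_test[OF wdD(1)[OF w] tf] loc_int_test[OF wdD(2)[OF w] tf] loc_int_test[OF wdD(1)[OF w] tp]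
    by (simp_all only: 1)
qed

text \<open>Weak form of the statement that (y - z) \<open>hk\<close> has divergence n / a^n in the
  ball and 0 outside, so that \<open>Lk\<close> is the potential of a uniformly charged ball. It is
  the limit p to infinity of \<open>fld_div\<close>.\<close>

theorem radial_field_divergence:
  fixes \<zeta> :: "'a::euclidean_space \<Rightarrow> real"
  assumes a: "a > 0" and w: "\<And>i. i \<in> Basis \<Longrightarrow> wd i \<zeta> (Z i)"
    and r: "\<And>y. norm y > r \<Longrightarrow> \<zeta> y = 0" "\<And>i y. i \<in> Basis \<Longrightarrow> norm y > r \<Longrightarrow> Z i y = 0"
  shows "(\<Sum>i\<in>Basis. \<integral>y. Z i y * (((y - z) \<bullet> i) * hk DIM('a) a ((y - z) \<bullet> (y - z))) \<partial>lebesgue) =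
    - (real DIM('a) / a ^ DIM('a)) * (\<integral>y. \<zeta> y * indicator (ball z a) y \<partial>lebesgue)"
proof -
  define s where "s y = (y - z) \<bullet> (y - z)" for y
  have s0: "s y \<ge> 0" for y by (simp add: s_def)
  have sm: "s \<in> borel_measurable borel"
    unfolding s_def[abs_def] by (intro borel_measurable_continuous_onI continuous_intros)
  obtain i0 :: 'a where i0: "i0 \<in> Basis" using nonempty_Basis by blast
  have \<zeta>m: "\<zeta> \<in> borel_measurable lebesgue" using w[OF i0] by (blast intro: loc_int_measurable dest: wdD)
  have Zm: "Z i \<in> borel_measurable lebesgue" if "i \<in> Basis" for i
    using w[OF that] by (blast intro: loc_int_measurable dest: wdD)
  have i\<zeta>: "integrable lebesgue \<zeta>"
    using wd_test_local(2)[OF w[OF i0] i0 smooth_const[of 1] r(1) r(2)[OF i0]] by simp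
  have iZ: "integrable lebesgue (Z i)" if "i \<in> Basis" for i
    using wd_test_local(3)[OF w[OF that] that smooth_const[of 1] r(1) r(2)[OF that]] by simp
  \<comment> \<open>\<open>Suc p\<close>, since \<open>fld_div\<close> and \<open>hp_bounds\<close>
    require p \<ge> 1.\<close>
  have eqn: "(\<integral>y. \<zeta> y * (\<Sum>i\<in>Basis. pd i (fld a (Suc p) z i) y) \<partial>lebesgue) =
      - (\<Sum>i\<in>Basis. \<integral>y. Z i y * fld a (Suc p) z i y \<partial>lebesgue)" for p
  proof -
    note L = wd_test_local[OF w _ smooth_fld[OF a] r(1) r(2)]
    have "(\<integral>y. \<zeta> y * (\<Sum>i\<in>Basis. pd i (fld a (Suc p) z i) y) \<partial>lebesgue) =
        (\<Sum>i\<in>Basis. \<integral>y. \<zeta> y * pd i (fld a (Suc p) z i) y \<partial>lebesgue)"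
      unfolding sum_distrib_left by (rule Bochner_Integration.integral_sum) (auto intro: L(4))
    also have "\<dots> = (\<Sum>i\<in>Basis. - (\<integral>y. Z i y * fld a (Suc p) z i y \<partial>lebesgue))"
      by (rule sum.cong[OF refl]) (auto intro: L(1))
    finally show ?thesis by (simp add: sum_negf)
  qed
  \<comment> \<open>On the sphere the ratio in \<open>ratio_tendsto\<close> stays 1/2; being a null
    set, it does not disturb dominated convergence.\<close>
  have sphere: "AE y in lebesgue. s y \<noteq> a\<^sup>2"
  proof -
    have "negligible (sphere z a)" by (rule negligible_sphere)
    then have "AE y in lebesgue. y \<notin> sphere z a"
      using AE_not_in negligible_iff_null_sets by blast
    then show ?thesis
    proof eventually_elim
      case (elim y)
      have "s y = (dist z y)\<^sup>2" by (simp add: s_def dist_norm power2_norm_eq_inner[symmetric] norm_minus_commute)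
      then show ?case using elim a by simp
    qed
  qed
  have inb: "s y < a\<^sup>2 \<longleftrightarrow> y \<in> ball z a" for y
  proof -
    have "s y = (dist z y)\<^sup>2" by (simp add: s_def dist_norm power2_norm_eq_inner[symmetric] norm_minus_commute)
    moreover have "a\<^sup>2 \<le> (dist z y)\<^sup>2 \<longleftrightarrow> a \<le> dist z y" using a by (intro power_mono_iff) auto
    ultimately show ?thesis by (auto simp: not_le[symmetric])
  qed
  have fm: "fld a p z i \<in> borel_measurable lebesgue" for p i
    by (rule continuous_lebesgue[OF smooth_continuous[OF smooth_fld[OF a]]])
  have lim1: "(\<lambda>p. \<integral>y. \<zeta> y * (\<Sum>i\<in>Basis. pd i (fld a (Suc p) z i) y) \<partial>lebesgue) \<longlonglongrightarrow>
      (\<integral>y. \<zeta> y * (real DIM('a) / a ^ DIM('a) * indicator (ball z a) y) \<partial>lebesgue)"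
  proof (rule integral_dominated_convergence[where w="\<lambda>y. \<bar>\<zeta> y\<bar> * (real DIM('a) / a ^ DIM('a))"])
    show "(\<lambda>y. \<zeta> y * (\<Sum>i\<in>Basis. pd i (fld a (Suc p) z i) y)) \<in> borel_measurable lebesgue" for p
      by (intro borel_measurable_times \<zeta>m borel_measurable_sum continuous_lebesgue smooth_continuous smooth_pd smooth_fld a)
    have "(\<lambda>y. real DIM('a) / a ^ DIM('a) * indicator (ball z a) y) \<in> borel_measurable lebesgue"
      by (intro borel_imp_lebesgue borel_measurable_times borel_measurable_const borel_measurable_indicator) simp
    then show "(\<lambda>y. \<zeta> y * (real DIM('a) / a ^ DIM('a) * indicator (ball z a) y)) \<in> borel_measurable lebesgue"
      by (rule borel_measurable_times[OF \<zeta>m])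
    show "integrable lebesgue (\<lambda>y. \<bar>\<zeta> y\<bar> * (real DIM('a) / a ^ DIM('a)))" using i\<zeta> by simp
    show "AE y in lebesgue. (\<lambda>p. \<zeta> y * (\<Sum>i\<in>Basis. pd i (fld a (Suc p) z i) y)) \<longlonglongrightarrow>
        \<zeta> y * (real DIM('a) / a ^ DIM('a) * indicator (ball z a) y)"
      using sphere
    proof eventually_elim
      case (elim y)
      have "(\<lambda>p. real DIM('a) * (a ^ (2 * p) / (a ^ (2 * p) + (s y) ^ p)) * hp DIM('a) a p (s y)) \<longlonglongrightarrow>
          real DIM('a) * (if s y < a\<^sup>2 then 1 else 0) * hk DIM('a) a (s y)"
        by (intro tendsto_mult tendsto_const ratio_tendsto hp_tendsto a s0 elim)
      moreover have "real DIM('a) * (if s y < a\<^sup>2 then 1 else 0) * hk DIM('a) a (s y)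
          = real DIM('a) / a ^ DIM('a) * indicator (ball z a) y"
        using hk_inside[OF a, of "s y"] inb[of y] by (auto simp: indicator_def)
      ultimately have "(\<lambda>p. real DIM('a) * (a ^ (2 * Suc p) / (a ^ (2 * Suc p) + (s y) ^ Suc p)) * hp DIM('a) a (Suc p) (s y)) \<longlonglongrightarrow>
          real DIM('a) / a ^ DIM('a) * indicator (ball z a) y"
        using LIMSEQ_Suc by fastforce
      then show ?case using fld_div[OF a, of "Suc _" z y] by (intro tendsto_intros) (simp add: s_def)
    qed
    show "AE y in lebesgue. norm (\<zeta> y * (\<Sum>i\<in>Basis. pd i (fld a (Suc p) z i) y)) \<le> \<bar>\<zeta> y\<bar> * (real DIM('a) / a ^ DIM('a))" for p
    proof (rule AE_I2)
      fix y
      define q where "q = a ^ (2 * Suc p) / (a ^ (2 * Suc p) + (s y) ^ Suc p)"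
      define h where "h = hp DIM('a) a (Suc p) (s y)"
      have pp: "a ^ (2 * Suc p) > 0" "(s y) ^ Suc p \<ge> 0" using a s0[of y] by auto
      have q: "0 \<le> q" "q \<le> 1" unfolding q_def using pp by (auto simp: divide_simps)
      have h: "0 \<le> h" "h \<le> 1 / a ^ DIM('a)"
        unfolding h_def using hp_bounds(1)[OF a s0, of "Suc p" "DIM('a)" y] hk_le[OF a, of "DIM('a)" "s y"]
        by (auto simp: hp_def)
      have "q * h \<le> 1 * (1 / a ^ DIM('a))" using q h by (intro mult_mono) auto
      then have "real DIM('a) * (q * h) \<le> real DIM('a) * (1 * (1 / a ^ DIM('a)))" by (intro mult_left_mono) auto
      moreover have "(\<Sum>i\<in>Basis. pd i (fld a (Suc p) z i) y) = real DIM('a) * (q * h)"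
        using fld_div[OF a, of "Suc p" z y] by (simp add: q_def h_def s_def)
      ultimately have "\<bar>\<Sum>i\<in>Basis. pd i (fld a (Suc p) z i) y\<bar> \<le> real DIM('a) / a ^ DIM('a)" using q h by simp
      then show "norm (\<zeta> y * (\<Sum>i\<in>Basis. pd i (fld a (Suc p) z i) y)) \<le> \<bar>\<zeta> y\<bar> * (real DIM('a) / a ^ DIM('a))"
        unfolding real_norm_def abs_mult by (rule mult_left_mono) simp
    qed
  qed
  have lim2: "(\<lambda>p. \<integral>y. Z i y * fld a (Suc p) z i y \<partial>lebesgue) \<longlonglongrightarrow>
      (\<integral>y. Z i y * (((y - z) \<bullet> i) * hk DIM('a) a (s y)) \<partial>lebesgue)" if i: "i \<in> Basis" for i
  proof (rule integral_dominated_convergence[where w="\<lambda>y. \<bar>Z i y\<bar> * ((\<bar>r\<bar> + norm z) * (1 / a ^ DIM('a)))"])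
    have pt: "(\<lambda>p. fld a (Suc p) z i y) \<longlonglongrightarrow> ((y - z) \<bullet> i) * hk DIM('a) a (s y)" for y
      unfolding fld_def s_def[symmetric] by (intro tendsto_intros LIMSEQ_Suc[OF hp_tendsto[OF a s0]])
    show "(\<lambda>y. Z i y * (((y - z) \<bullet> i) * hk DIM('a) a (s y))) \<in> borel_measurable lebesgue"
      by (intro borel_measurable_times[OF Zm[OF i] borel_measurable_LIMSEQ_real[OF pt fm]])
    show "(\<lambda>y. Z i y * fld a (Suc p) z i y) \<in> borel_measurable lebesgue" for p
      by (intro borel_measurable_times Zm i fm)
    show "integrable lebesgue (\<lambda>y. \<bar>Z i y\<bar> * ((\<bar>r\<bar> + norm z) * (1 / a ^ DIM('a))))" using iZ[OF i] by simp
    show "AE y in lebesgue. (\<lambda>p. Z i y * fld a (Suc p) z i y) \<longlonglongrightarrow> Z i y * (((y - z) \<bullet> i) * hk DIM('a) a (s y))"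
      by (intro AE_I2 tendsto_intros pt)
    show "AE y in lebesgue. norm (Z i y * fld a (Suc p) z i y) \<le> \<bar>Z i y\<bar> * ((\<bar>r\<bar> + norm z) * (1 / a ^ DIM('a)))" for p
    proof (rule AE_I2)
      fix y
      show "norm (Z i y * fld a (Suc p) z i y) \<le> \<bar>Z i y\<bar> * ((\<bar>r\<bar> + norm z) * (1 / a ^ DIM('a)))"
      proof (cases "norm y > r")
        case False
        have "\<bar>(y - z) \<bullet> i\<bar> \<le> norm (y - z)" using i by (rule Basis_le_norm)
        also have "\<dots> \<le> \<bar>r\<bar> + norm z" using norm_triangle_ineq4[of y z] False by linarith
        finally have 1: "\<bar>(y - z) \<bullet> i\<bar> \<le> \<bar>r\<bar> + norm z" .
        have 2: "\<bar>hp DIM('a) a (Suc p) (s y)\<bar> \<le> 1 / a ^ DIM('a)"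
          using hp_bounds(1)[OF a s0, of "Suc p" "DIM('a)" y] hk_le[OF a, of "DIM('a)" "s y"]
          by (auto simp: hp_def)
        have "\<bar>fld a (Suc p) z i y\<bar> \<le> (\<bar>r\<bar> + norm z) * (1 / a ^ DIM('a))"
          unfolding fld_def s_def[symmetric] abs_mult using 1 2 by (intro mult_mono) auto
        then show ?thesis unfolding real_norm_def abs_mult by (rule mult_left_mono) simp
      qed (simp add: r(2)[OF i])
    qed
  qed
  have "(\<lambda>p. - (\<Sum>i\<in>Basis. \<integral>y. Z i y * fld a (Suc p) z i y \<partial>lebesgue)) \<longlonglongrightarrow>
      - (\<Sum>i\<in>Basis. \<integral>y. Z i y * (((y - z) \<bullet> i) * hk DIM('a) a (s y)) \<partial>lebesgue)"
    by (intro tendsto_minus tendsto_sum lim2)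
  then have "(\<integral>y. \<zeta> y * (real DIM('a) / a ^ DIM('a) * indicator (ball z a) y) \<partial>lebesgue) =
      - (\<Sum>i\<in>Basis. \<integral>y. Z i y * (((y - z) \<bullet> i) * hk DIM('a) a (s y)) \<partial>lebesgue)"
    using lim1 unfolding eqn using LIMSEQ_unique by blast
  moreover have "(\<integral>y. \<zeta> y * (real DIM('a) / a ^ DIM('a) * indicator (ball z a) y) \<partial>lebesgue) =
     real DIM('a) / a ^ DIM('a) * (\<integral>y. \<zeta> y * indicator (ball z a) y \<partial>lebesgue)"
    by (subst integral_mult_right_zero[symmetric]) (simp add: mult_ac)
  ultimately show ?thesis by (simp add: s_def)
qed

section \<open>Sobolev pairs and energies\<close>

lemma L2_dominated:
  assumes "L2 u" "v \<in> borel_measurable lebesgue" "AE x in lebesgue. \<bar>v x\<bar> \<le> \<bar>u x\<bar>"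
  shows "L2 v"
  unfolding L2_def
proof (intro conjI assms)
  show "integrable lebesgue (\<lambda>x. (v x)\<^sup>2)"
  proof (rule Bochner_Integration.integrable_bound[where f="\<lambda>x. (u x)\<^sup>2"])
    show "integrable lebesgue (\<lambda>x. (u x)\<^sup>2)" using assms(1) by (simp add: L2_def)
    show "AE x in lebesgue. norm ((v x)\<^sup>2) \<le> norm ((u x)\<^sup>2)"
      using assms(3) by eventually_elim (simp add: abs_le_square_iff)
  qed (use assms(2) in measurable)
qed

lemma L2_measurable: "L2 u \<Longrightarrow> u \<in> borel_measurable lebesgue"
  by (simp add: L2_def)

lemma L2_integrable_mult:
  assumes "L2 u" "L2 v"
  shows "integrable lebesgue (\<lambda>x. u x * v x)"
proof (rule Bochner_Integration.integrable_bound[where f="\<lambda>x. (u x)\<^sup>2 + (v x)\<^sup>2"])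
  have [measurable]: "u \<in> borel_measurable lebesgue" "v \<in> borel_measurable lebesgue"
    using assms by (auto simp: L2_def)
  show "(\<lambda>x. u x * v x) \<in> borel_measurable lebesgue" by measurable
  show "integrable lebesgue (\<lambda>x. (u x)\<^sup>2 + (v x)\<^sup>2)" using assms by (simp add: L2_def)
  have "\<bar>s * t\<bar> \<le> s\<^sup>2 + t\<^sup>2" for s t :: real
  proof -
    have "0 \<le> (\<bar>s\<bar> - \<bar>t\<bar>)\<^sup>2" by simp
    then have "2 * (\<bar>s\<bar> * \<bar>t\<bar>) \<le> s\<^sup>2 + t\<^sup>2" by (simp add: power2_diff)
    moreover have "0 \<le> \<bar>s\<bar> * \<bar>t\<bar>" by simp
    ultimately show ?thesis unfolding abs_mult by linarith
  qed
  then show "AE x in lebesgue. norm (u x * v x) \<le> norm ((u x)\<^sup>2 + (v x)\<^sup>2)" by simp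
qed

lemma L2_add:
  assumes "L2 u" "L2 v"
  shows "L2 (\<lambda>x. u x + v x)"
  using assms L2_integrable_mult[OF assms] by (auto simp: L2_def power2_sum mult.assoc)

lemma L2_cmult: "L2 u \<Longrightarrow> L2 (\<lambda>x. c * u x)"
  by (auto simp: L2_def power_mult_distrib)

lemma L2_diff: "L2 u \<Longrightarrow> L2 v \<Longrightarrow> L2 (\<lambda>x. u x - v x)"
  using L2_add[of u "\<lambda>x. - 1 * v x"] L2_cmult[of v "- 1"] by simp

lemma L2_zero: "L2 (\<lambda>x. 0)"
  by (simp add: L2_def)

lemma L2_sum: "(\<And>k. k \<in> I \<Longrightarrow> L2 (u k)) \<Longrightarrow> L2 (\<lambda>x. \<Sum>k\<in>I. u k x)"
  by (induction I rule: infinite_finite_induct) (auto intro: L2_add L2_zero)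

lemma L2_mult_bounded:
  assumes u: "L2 u" and F: "F \<in> borel_measurable lebesgue" "\<And>x. \<bar>F x\<bar> \<le> B"
  shows "L2 (\<lambda>x. F x * u x)"
proof (rule L2_dominated[OF L2_cmult[OF u, of B]])
  show "(\<lambda>x. F x * u x) \<in> borel_measurable lebesgue" by (intro borel_measurable_times F L2_measurable u)
  have "\<bar>F x * u x\<bar> \<le> \<bar>B * u x\<bar>" for x
    unfolding abs_mult using F(2)[of x] by (intro mult_right_mono) auto
  then show "AE x in lebesgue. \<bar>F x * u x\<bar> \<le> \<bar>B * u x\<bar>" by simp
qed

lemma L2_bounded_integrable:
  assumes "integrable lebesgue u" "\<And>x. \<bar>u x\<bar> \<le> B"
  shows "L2 u"
  unfolding L2_def
proof (intro conjI)
  show m: "u \<in> borel_measurable lebesgue" using assms by auto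
  show "integrable lebesgue (\<lambda>x. (u x)\<^sup>2)"
  proof (rule Bochner_Integration.integrable_bound[where f="\<lambda>x. B * \<bar>u x\<bar>"])
    show "integrable lebesgue (\<lambda>x. B * \<bar>u x\<bar>)" using assms(1) by simp
    have "norm ((u x)\<^sup>2) \<le> norm (B * \<bar>u x\<bar>)" for x
    proof -
      have "\<bar>u x\<bar> * \<bar>u x\<bar> \<le> \<bar>B\<bar> * \<bar>u x\<bar>" using assms(2)[of x] by (intro mult_right_mono) auto
      then show ?thesis by (simp add: power2_eq_square abs_mult)
    qed
    then show "AE x in lebesgue. norm ((u x)\<^sup>2) \<le> norm (B * \<bar>u x\<bar>)" by simp
  qed (use m in measurable)
qed

text \<open>Carries the gradient as data: \<open>wgrad\<close> is a choice determined only almost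
  everywhere, while competitors are built together with explicit gradients.\<close>

definition H1p :: "('a::euclidean_space \<Rightarrow> real) \<Rightarrow> ('a \<Rightarrow> 'a) \<Rightarrow> bool" where
  "H1p u G \<longleftrightarrow> L2 u \<and> G \<in> borel_measurable lebesgue \<and>
    (\<forall>i\<in>Basis. wd i u (\<lambda>x. G x \<bullet> i) \<and> L2 (\<lambda>x. G x \<bullet> i))"

lemma H1p_D:
  assumes "H1p u G"
  shows "L2 u" "G \<in> borel_measurable lebesgue" "i \<in> Basis \<Longrightarrow> wd i u (\<lambda>x. G x \<bullet> i)"
    "i \<in> Basis \<Longrightarrow> L2 (\<lambda>x. G x \<bullet> i)"
  using assms by (auto simp: H1p_def)

lemma H1p_weak_gradient: "H1p u G \<longleftrightarrow> L2 u \<and> weak_gradient u G \<and> (\<forall>i\<in>Basis. L2 (\<lambda>x. G x \<bullet> i))"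
proof
  assume h: "H1p u G"
  show "L2 u \<and> weak_gradient u G \<and> (\<forall>i\<in>Basis. L2 (\<lambda>x. G x \<bullet> i))"
    unfolding weak_gradient_def
  proof (intro conjI ballI allI impI)
    fix \<phi> :: "'a \<Rightarrow> real" and i :: 'a assume t: "test_fun \<phi>" and i: "i \<in> Basis"
    have w: "wd i u (\<lambda>x. G x \<bullet> i)" using h i by (simp add: H1p_def)
    show "integrable lebesgue (\<lambda>x. u x * pd i \<phi> x)" by (rule loc_int_test[OF wdD(1)[OF w] test_fun_pd[OF t i]])
    show "integrable lebesgue (\<lambda>x. (G x \<bullet> i) * \<phi> x)" by (rule loc_int_test[OF wdD(2)[OF w] t])
    show "(\<integral>x. u x * pd i \<phi> x \<partial>lebesgue) = - (\<integral>x. (G x \<bullet> i) * \<phi> x \<partial>lebesgue)" by (rule wdD(3)[OF w t])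
  qed (use h in \<open>auto simp: H1p_def\<close>)
next
  assume "L2 u \<and> weak_gradient u G \<and> (\<forall>i\<in>Basis. L2 (\<lambda>x. G x \<bullet> i))"
  then show "H1p u G" unfolding H1p_def weak_gradient_def wd_def
    by (auto intro: L2_loc_int)
qed

lemma H1_H1p: "H1p u G \<Longrightarrow> H1 u" and H1_wgrad: "H1 u \<Longrightarrow> H1p u (wgrad u)"
proof -
  show "H1p u G \<Longrightarrow> H1 u" unfolding H1p_weak_gradient H1_def by blast
  assume h: "H1 u"
  then have "\<exists>g. weak_gradient u g \<and> (\<forall>i\<in>Basis. L2 (\<lambda>x. g x \<bullet> i))" by (simp add: H1_def)
  from someI_ex[OF this] show "H1p u (wgrad u)"
    using h unfolding H1p_weak_gradient wgrad_def H1_def by blast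
qed

lemma gradient_unique:
  assumes "\<And>i. i \<in> Basis \<Longrightarrow> wd i u (\<lambda>x. G x \<bullet> i)" "\<And>i. i \<in> Basis \<Longrightarrow> wd i u (\<lambda>x. G' x \<bullet> i)"
  shows "AE x in lebesgue. G x = G' x"
proof -
  have "\<forall>i\<in>Basis. AE x in lebesgue. G x \<bullet> i = G' x \<bullet> i" using wd_unique assms by blast
  then have "AE x in lebesgue. \<forall>i\<in>Basis. G x \<bullet> i = G' x \<bullet> i"
    by (simp add: AE_ball_countable countable_finite)
  then show ?thesis by eventually_elim (rule euclidean_eqI, blast)
qed

lemma norm2_eq: "(norm (G::'a::euclidean_space))\<^sup>2 = (\<Sum>i\<in>Basis. (G \<bullet> i)\<^sup>2)"
  unfolding power2_norm_eq_inner by (subst euclidean_inner) (simp add: power2_eq_square)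

lemma integrable_norm2:
  assumes "\<And>i. i \<in> Basis \<Longrightarrow> L2 (\<lambda>x. G x \<bullet> i)"
  shows "integrable lebesgue (\<lambda>x. (norm (G x :: 'a::euclidean_space))\<^sup>2)"
  unfolding norm2_eq using assms by (auto simp: L2_def)

lemma integrable_inner2:
  assumes "\<And>i. i \<in> Basis \<Longrightarrow> L2 (\<lambda>x. G x \<bullet> i)" "\<And>i. i \<in> Basis \<Longrightarrow> L2 (\<lambda>x. Z x \<bullet> i)"
  shows "integrable lebesgue (\<lambda>x. (G x :: 'a::euclidean_space) \<bullet> Z x)"
  by (subst euclidean_inner) (auto intro!: L2_integrable_mult assms)

lemma measurable_of_components:
  fixes G :: "'b \<Rightarrow> 'a::euclidean_space"
  assumes "\<And>i. i \<in> Basis \<Longrightarrow> (\<lambda>x. G x \<bullet> i) \<in> borel_measurable M"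
  shows "G \<in> borel_measurable M"
  using assms borel_measurable_euclidean_space[of G M] by blast

definition En :: "('a::euclidean_space \<Rightarrow> real) \<Rightarrow> ('a \<Rightarrow> real) \<Rightarrow> ('a \<Rightarrow> 'a) \<Rightarrow> real" where
  "En f u G = (\<integral>x. (norm (G x))\<^sup>2 - 2 * f x * u x \<partial>lebesgue)"

lemma integrable_Linf_mult:
  assumes "f \<in> borel_measurable lebesgue" "AE x in lebesgue. \<bar>f x\<bar> \<le> B" "integrable lebesgue u"
  shows "integrable lebesgue (\<lambda>x. f x * u x :: real)"
proof (rule Bochner_Integration.integrable_bound[where f="\<lambda>x. B * \<bar>u x\<bar>"])
  have [measurable]: "u \<in> borel_measurable lebesgue" using assms(3) by auto
  show "(\<lambda>x. f x * u x) \<in> borel_measurable lebesgue" using assms(1) by measurable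
  show "integrable lebesgue (\<lambda>x. B * \<bar>u x\<bar>)" using assms(3) by simp
  show "AE x in lebesgue. norm (f x * u x) \<le> norm (B * \<bar>u x\<bar>)" using assms(2)
    by eventually_elim (auto simp: abs_mult intro!: mult_right_mono)
qed

text \<open>\<open>wgrad v\<close> equals G a.e. by uniqueness, and integrability of v makes both
  parts of the extended difference finite.\<close>

lemma J_eq_En:
  assumes h: "H1p v G" and v: "integrable lebesgue v"
    and f: "f \<in> borel_measurable lebesgue" "AE x in lebesgue. \<bar>f x\<bar> \<le> B"
  shows "J f v = ereal (En f v G)"
proof -
  define h where "h x = (norm (wgrad v x))\<^sup>2 - 2 * f x * v x" for x
  have w: "H1p v (wgrad v)" using h H1_H1p H1_wgrad by blast
  have ae: "AE x in lebesgue. wgrad v x = G x"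
    by (rule gradient_unique[OF H1p_D(3)[OF w] H1p_D(3)[OF h]])
  have int: "integrable lebesgue h"
    unfolding h_def using integrable_norm2[OF H1p_D(4)[OF w]] integrable_Linf_mult[OF f v]
    by (auto simp: mult.assoc)
  have int': "integrable lebesgue (\<lambda>x. (norm (G x))\<^sup>2 - 2 * f x * v x)"
    using integrable_norm2[OF H1p_D(4)[OF h]] integrable_Linf_mult[OF f v]
    by (auto simp: mult.assoc)
  have fin: "(\<integral>\<^sup>+x. ennreal (h x) \<partial>lebesgue) < \<infinity>" "(\<integral>\<^sup>+x. ennreal (- h x) \<partial>lebesgue) < \<infinity>"
    using int unfolding real_integrable_def by (auto simp: less_top)
  have "J f v = enn2ereal (\<integral>\<^sup>+x. ennreal (h x) \<partial>lebesgue) - enn2ereal (\<integral>\<^sup>+x. ennreal (- h x) \<partial>lebesgue)"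
    by (simp add: J_def h_def)
  also have "\<dots> = ereal (enn2real (\<integral>\<^sup>+x. ennreal (h x) \<partial>lebesgue)) - ereal (enn2real (\<integral>\<^sup>+x. ennreal (- h x) \<partial>lebesgue))"
    using fin by (metis enn2ereal_ennreal enn2real_nonneg ennreal_enn2real_if infinity_ennreal_def less_irrefl)
  also have "\<dots> = ereal (integral\<^sup>L lebesgue h)" by (simp add: real_lebesgue_integral_def[OF int])
  also have "integral\<^sup>L lebesgue h = En f v G"
    unfolding En_def
    by (rule integral_cong_AE) (use int int' ae in \<open>auto simp: h_def\<close>)
  finally show ?thesis .
qed

text \<open>A function in H1 need not be integrable, so \<open>J\<close> can be infinite. As u \<ge>
  0, the negative part of the integrand is at most 2 |f u|, hence finite. A finite \<open>J\<close>
  then bounds the positive part as well, and u is recovered as a combination of integrable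
  functions.\<close>

lemma J_finite_integrable:
  assumes h: "H1 u" and pos: "AE x in lebesgue. u x \<ge> 0" and f: "f \<in> borel_measurable lebesgue"
    and fu: "integrable lebesgue (\<lambda>x. f x * u x)" and fin: "J (\<lambda>x. f x - 1) u \<noteq> \<infinity>"
  shows "integrable lebesgue u"
proof -
  define h where "h x = (norm (wgrad u x))\<^sup>2 - 2 * (f x - 1) * u x" for x
  have w: "H1p u (wgrad u)" using assms(1) H1_wgrad by blast
  have um: "u \<in> borel_measurable lebesgue" using H1p_D(1)[OF w] by (rule L2_measurable)
  have gm: "(\<lambda>x. (norm (wgrad u x))\<^sup>2) \<in> borel_measurable lebesgue"
    using integrable_norm2[OF H1p_D(4)[OF w]] by auto
  have hm: "h \<in> borel_measurable lebesgue"
    unfolding h_def[abs_def]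
    by (intro borel_measurable_diff borel_measurable_times borel_measurable_const f um gm)
  have "(\<integral>\<^sup>+x. ennreal (- h x) \<partial>lebesgue) \<le> (\<integral>\<^sup>+x. ennreal (2 * (f x * u x)) \<partial>lebesgue)"
  proof (rule nn_integral_mono_AE)
    show "AE x in lebesgue. ennreal (- h x) \<le> ennreal (2 * (f x * u x))"
      using pos by eventually_elim (auto simp: h_def algebra_simps intro!: ennreal_leI add_increasing)
  qed
  also have "\<dots> < \<infinity>"
    using integrable_mult_right[OF fu, of 2] unfolding real_integrable_def by (auto simp: less_top)
  finally have n: "(\<integral>\<^sup>+x. ennreal (- h x) \<partial>lebesgue) < \<infinity>" .
  have "J (\<lambda>x. f x - 1) u = enn2ereal (\<integral>\<^sup>+x. ennreal (h x) \<partial>lebesgue) - enn2ereal (\<integral>\<^sup>+x. ennreal (- h x) \<partial>lebesgue)"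
    by (simp add: J_def h_def)
  moreover have "enn2ereal (\<integral>\<^sup>+x. ennreal (- h x) \<partial>lebesgue) \<noteq> \<infinity>" "enn2ereal (\<integral>\<^sup>+x. ennreal (- h x) \<partial>lebesgue) \<noteq> -\<infinity>"
    using n enn2ereal_nonneg[of "\<integral>\<^sup>+x. ennreal (- h x) \<partial>lebesgue"] by (auto simp: enn2ereal_eq_top_iff simp del: enn2ereal_nonneg)
  ultimately have "(\<integral>\<^sup>+x. ennreal (h x) \<partial>lebesgue) \<noteq> \<infinity>" using fin by auto
  then have int: "integrable lebesgue h" using hm n by (auto simp: real_integrable_def)
  have "integrable lebesgue (\<lambda>x. (1 / 2) * (h x - (norm (wgrad u x))\<^sup>2 + 2 * (f x * u x)))"
    using int integrable_norm2[OF H1p_D(4)[OF w]] fu by auto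
  moreover have "(\<lambda>x. (1 / 2) * (h x - (norm (wgrad u x))\<^sup>2 + 2 * (f x * u x))) = u"
    by (auto simp: h_def algebra_simps)
  ultimately show ?thesis by simp
qed

lemma H1p_test:
  assumes "test_fun \<phi>"
  shows "H1p \<phi> (\<lambda>x. \<Sum>i\<in>Basis. pd i \<phi> x *\<^sub>R i)" "integrable lebesgue \<phi>"
proof -
  have int: "integrable lebesgue \<psi> \<and> L2 \<psi>" if t: "test_fun \<psi>" for \<psi> :: "'a \<Rightarrow> real"
  proof -
    have i: "integrable lebesgue \<psi>" using loc_int_test[OF loc_int_const[of 1] t] by simp
    obtain B where "\<And>x. \<bar>\<psi> x\<bar> \<le> B" using test_fun_bounded[OF t] by blast
    then show ?thesis using i L2_bounded_integrable[OF i] by blast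
  qed
  have c: "(\<Sum>i\<in>Basis. pd i \<phi> x *\<^sub>R i) \<bullet> k = pd k \<phi> x" if "k \<in> Basis" for k x
    using that by (simp add: inner_sum_left inner_Basis if_distrib sum.delta cong: if_cong)
  show "integrable lebesgue \<phi>" using int[OF assms] by blast
  show "H1p \<phi> (\<lambda>x. \<Sum>i\<in>Basis. pd i \<phi> x *\<^sub>R i)"
    unfolding H1p_def
  proof (intro conjI ballI)
    show "L2 \<phi>" using int[OF assms] by blast
    show "(\<lambda>x. \<Sum>i\<in>Basis. pd i \<phi> x *\<^sub>R i) \<in> borel_measurable lebesgue"
      by (rule measurable_of_components) (simp add: c test_fun_lebesgue test_fun_pd assms)
    fix k :: 'a assume k: "k \<in> Basis"
    show "wd k \<phi> (\<lambda>x. (\<Sum>i\<in>Basis. pd i \<phi> x *\<^sub>R i) \<bullet> k)"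
      using wd_smooth[OF test_fun_smooth[OF assms] k] by (simp add: c[OF k])
    show "L2 (\<lambda>x. (\<Sum>i\<in>Basis. pd i \<phi> x *\<^sub>R i) \<bullet> k)"
      using int[OF test_fun_pd[OF assms k]] by (simp add: c[OF k])
  qed
qed

text \<open>By compactness finitely many balls of radius e/3 cover K; the sum of the corresponding
  cutoffs is positive on K and reaches less than e beyond it.\<close>

lemma bump_near_compact:
  fixes K :: "'a::euclidean_space set"
  assumes "compact K" "e > 0"
  obtains v where "test_fun v" "\<And>y. v y \<ge> 0" "\<And>y. y \<in> K \<Longrightarrow> v y > 0" "\<And>y. v y \<noteq> 0 \<Longrightarrow> \<exists>z\<in>K. dist z y < e"
proof -
  have "\<exists>\<theta>. test_fun \<theta> \<and> (\<forall>y. 0 \<le> \<theta> y) \<and> (\<forall>y. dist z y \<le> e / 3 \<longrightarrow> \<theta> y = 1) \<and> (\<forall>y. dist z y \<ge> e / 2 \<longrightarrow> \<theta> y = 0)" for z :: 'a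
    by (rule cutoff_exists[of "e / 3" "e / 2" z]) (use assms(2) in auto)
  then obtain \<theta> where t: "\<And>z :: 'a. test_fun (\<theta> z)" "\<And>z y. 0 \<le> \<theta> z y" "\<And>z y. dist z y \<le> e / 3 \<Longrightarrow> \<theta> z y = (1::real)"
    "\<And>z y. dist z y \<ge> e / 2 \<Longrightarrow> \<theta> z y = 0" by metis
  have "K \<subseteq> (\<Union>z\<in>K. ball z (e / 3))" using assms(2) by auto
  then obtain F where F: "F \<subseteq> K" "finite F" "K \<subseteq> (\<Union>z\<in>F. ball z (e / 3))"
    using compactE_image[OF assms(1), of K "\<lambda>z. ball z (e / 3)"] by auto
  have r: "\<exists>r. \<forall>x. norm x > r \<longrightarrow> (\<Sum>z\<in>F. \<theta> z x) = 0"
  proof -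
    have "\<exists>r. \<forall>x. norm x > r \<longrightarrow> \<theta> z x = 0" for z using t(1)[of z] by (simp add: test_fun_iff)
    then obtain \<rho> where \<rho>: "\<And>z x. norm x > \<rho> z \<Longrightarrow> \<theta> z x = 0" by metis
    have "(\<Sum>z\<in>F. \<theta> z x) = 0" if "norm x > (\<Sum>z\<in>F. \<bar>\<rho> z\<bar>)" for x
    proof (rule sum.neutral, rule ballI)
      fix z assume "z \<in> F"
      then have "\<bar>\<rho> z\<bar> \<le> (\<Sum>z\<in>F. \<bar>\<rho> z\<bar>)" using F(2) by (intro member_le_sum) auto
      then show "\<theta> z x = 0" using that \<rho> by (meson abs_ge_self le_less_trans)
    qed
    then show ?thesis by blast
  qed
  show ?thesis
  proof
    show "test_fun (\<lambda>y. \<Sum>z\<in>F. \<theta> z y)"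
      unfolding test_fun_iff by (intro conjI r smooth_sum test_fun_smooth t)
    show "(\<Sum>z\<in>F. \<theta> z y) \<ge> 0" for y by (intro sum_nonneg t)
    show "(\<Sum>z\<in>F. \<theta> z y) > 0" if "y \<in> K" for y
    proof -
      obtain z where z: "z \<in> F" "dist z y < e / 3" using F(3) \<open>y \<in> K\<close> by auto
      then have "\<theta> z y = 1" using t(3) by simp
      moreover have "\<theta> z y \<le> (\<Sum>z\<in>F. \<theta> z y)" using z F(2) t(2) by (intro member_le_sum) auto
      ultimately show ?thesis by simp
    qed
    show "\<exists>z\<in>K. dist z y < e" if "(\<Sum>z\<in>F. \<theta> z y) \<noteq> 0" for y
    proof -
      obtain z where z: "z \<in> F" "\<theta> z y \<noteq> 0" using \<open>(\<Sum>z\<in>F. \<theta> z y) \<noteq> 0\<close> by (meson sum.neutral)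
      then have "dist z y < e / 2" using t(4)[of z y] by linarith
      then show ?thesis using z F(1) assms(2) by (intro bexI[of _ z]) auto
    qed
  qed
qed

section \<open>The minimizer\<close>

locale segregated_minimizer =
  fixes \<mu> :: "nat \<Rightarrow> 'a::euclidean_space \<Rightarrow> real" and A :: "nat \<Rightarrow> 'a set"
    and m :: nat and c :: real and u :: "nat \<Rightarrow> 'a \<Rightarrow> real"
  assumes mu_Linf: "\<forall>i\<in>{1..m}. Linf (\<mu> i)"
    and mu_nonneg: "\<forall>i\<in>{1..m}. AE y in lebesgue. \<mu> i y \<ge> 0"
    and mu_cpt: "\<forall>i\<in>{1..m}. compact (supp (\<mu> i))"
    and mu_disj: "\<forall>i\<in>{1..m}. \<forall>l\<in>{1..m}. i \<noteq> l \<longrightarrow> supp (\<mu> i) \<inter> supp (\<mu> l) = {}"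
    and c_gt: "c > 1"
    and A_open: "\<forall>i\<in>{1..m}. open (A i) \<and> bounded (A i) \<and> A i \<noteq> {}"
    and A_bounds: "\<forall>i\<in>{1..m}. AE y in lebesgue.
        c * indicator (A i) y \<le> \<mu> i y \<and> \<mu> i y \<le> Linf_norm (\<mu> i) * indicator (A i) y"
    and u_S: "u \<in> S_m_mu m \<mu>"
    and u_min: "\<forall>v\<in>S_m_mu m \<mu>. JJ m (\<lambda>i y. \<mu> i y - 1) u \<le> JJ m (\<lambda>i y. \<mu> i y - 1) v"
begin

lemma mu_measurable: "i \<in> {1..m} \<Longrightarrow> \<mu> i \<in> borel_measurable lebesgue"
  using mu_Linf by (auto simp: Linf_def)

lemma mu_bound:
  assumes "i \<in> {1..m}"
  obtains B where "B \<ge> 0" "AE y in lebesgue. \<bar>\<mu> i y\<bar> \<le> B"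
proof -
  obtain B where B: "AE y in lebesgue. \<bar>\<mu> i y\<bar> \<le> B" using bspec[OF mu_Linf assms] unfolding Linf_def by blast
  then have "AE y in lebesgue. \<bar>\<mu> i y\<bar> \<le> max B 0" by eventually_elim simp
  then show ?thesis using that[of "max B 0"] by simp
qed

lemma mu_on_A: "i \<in> {1..m} \<Longrightarrow> AE y in lebesgue. (y \<in> A i \<longrightarrow> \<mu> i y \<ge> c) \<and> (y \<notin> A i \<longrightarrow> \<mu> i y = 0)"
proof -
  assume i: "i \<in> {1..m}"
  have "AE y in lebesgue. c * indicator (A i) y \<le> \<mu> i y \<and> \<mu> i y \<le> Linf_norm (\<mu> i) * indicator (A i) y"
    using A_bounds i by blast
  moreover have "AE y in lebesgue. \<mu> i y \<ge> 0" using mu_nonneg i by blast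
  ultimately show ?thesis by eventually_elim (auto simp: indicator_def)
qed

lemma A_radius:
  assumes "i \<in> {1..m}"
  obtains r where "\<And>y. y \<in> A i \<Longrightarrow> norm y \<le> r"
  using A_open assms unfolding bounded_iff by blast

lemma A_sub_supp: "i \<in> {1..m} \<Longrightarrow> A i \<subseteq> supp (\<mu> i)"
proof
  fix y assume i: "i \<in> {1..m}" and y: "y \<in> A i"
  show "y \<in> supp (\<mu> i)"
    unfolding supp_def
  proof (intro CollectI allI impI notI)
    fix r :: real assume r: "r > 0" and ae: "AE x in lebesgue. x \<in> ball y r \<longrightarrow> \<mu> i x = 0"
    have op: "open (A i \<inter> ball y r)" using A_open i by auto
    have "AE x in lebesgue. x \<notin> A i \<inter> ball y r"
      using ae mu_on_A[OF i] by eventually_elim (use c_gt in auto)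
    then have "A i \<inter> ball y r \<in> null_sets lebesgue"
      unfolding completion.null_sets_iff_AE by simp
    then have "negligible (A i \<inter> ball y r)" by (simp add: negligible_iff_null_sets)
    moreover have "y \<in> A i \<inter> ball y r" using y r by simp
    ultimately show False using open_not_negligible[OF op] by blast
  qed
qed

lemma mu_mult_integrable:
  assumes i: "i \<in> {1..m}" and v: "loc_int v"
  shows "integrable lebesgue (\<lambda>x. \<mu> i x * v x)"
proof -
  obtain B where B: "B \<ge> 0" "AE y in lebesgue. \<bar>\<mu> i y\<bar> \<le> B" by (rule mu_bound[OF i])
  obtain r where r: "\<And>y. y \<in> A i \<Longrightarrow> norm y \<le> r" by (rule A_radius[OF i]) blast
  show ?thesis
  proof (rule Bochner_Integration.integrable_bound[where f="\<lambda>x. B * (indicator (cball 0 r) x * v x)"])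
    show "integrable lebesgue (\<lambda>x. B * (indicator (cball 0 r) x * v x))"
      using v by (simp add: loc_int_def)
    show "(\<lambda>x. \<mu> i x * v x) \<in> borel_measurable lebesgue"
      by (intro borel_measurable_times mu_measurable i loc_int_measurable v)
    show "AE x in lebesgue. norm (\<mu> i x * v x) \<le> norm (B * (indicator (cball 0 r) x * v x))"
      using B(2) mu_on_A[OF i]
    proof eventually_elim
      case (elim x)
      show ?case
      proof (cases "x \<in> A i")
        case True
        then show ?thesis using r[OF True] elim(1) B(1) by (auto simp: abs_mult intro!: mult_right_mono)
      qed (use elim in simp)
    qed
  qed
qed

lemma mu_integrable: "i \<in> {1..m} \<Longrightarrow> integrable lebesgue (\<mu> i)"
  using mu_mult_integrable[OF _ loc_int_const[of 1]] by simp

text \<open>The integrand is non-negative, so its integral vanishes only if it does almost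
  everywhere. In this pointwise form the constraint can be checked for competitors.\<close>

lemma constraint_iff:
  fixes v :: "'a \<Rightarrow> real"
  assumes i: "i \<in> {1..m}" and v: "v \<in> borel_measurable lebesgue"
  shows "set_lebesgue_integral lebesgue {x. v x = 0} (\<mu> i) = 0 \<longleftrightarrow> (AE x in lebesgue. v x = 0 \<longrightarrow> \<mu> i x = 0)"
proof -
  have S: "{x. v x = 0} \<in> sets lebesgue"
  proof -
    have "{0::real} \<in> sets borel" by measurable
    from measurable_sets[OF v this] show ?thesis by (simp add: vimage_def)
  qed
  have int: "integrable lebesgue (\<lambda>x. indicator {x. v x = 0} x *\<^sub>R \<mu> i x)"
    by (rule integrable_mult_indicator[OF S mu_integrable[OF i]])
  have nn: "AE x in lebesgue. 0 \<le> indicator {x. v x = 0} x *\<^sub>R \<mu> i x"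
    using mu_nonneg[rule_format, OF i] by eventually_elim simp
  have "set_lebesgue_integral lebesgue {x. v x = 0} (\<mu> i) = 0 \<longleftrightarrow>
      (AE x in lebesgue. indicator {x. v x = 0} x *\<^sub>R \<mu> i x = 0)"
    unfolding set_lebesgue_integral_def by (rule integral_nonneg_eq_0_iff_AE[OF int nn])
  also have "\<dots> \<longleftrightarrow> (AE x in lebesgue. v x = 0 \<longrightarrow> \<mu> i x = 0)"
    by (rule AE_cong) (auto simp: indicator_def)
  finally show ?thesis .
qed

lemma u_facts:
  assumes i: "i \<in> {1..m}"
  shows "H1p (u i) (wgrad (u i))" "AE y in lebesgue. u i y \<ge> 0" "u i \<in> borel_measurable lebesgue"
    "AE y in lebesgue. u i y = 0 \<longrightarrow> \<mu> i y = 0"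
    "l \<in> {1..m} \<Longrightarrow> i \<noteq> l \<Longrightarrow> AE y in lebesgue. u i y * u l y = 0"
proof -
  have S: "u \<in> S_m m" using u_S by (simp add: S_m_mu_def)
  have "H1 (u i)" using S i unfolding S_m_def by blast
  then show h: "H1p (u i) (wgrad (u i))" by (rule H1_wgrad)
  show "AE y in lebesgue. u i y \<ge> 0" using S i by (auto simp: S_m_def)
  show um: "u i \<in> borel_measurable lebesgue" using h by (blast intro: L2_measurable dest: H1p_D)
  show "AE y in lebesgue. u i y = 0 \<longrightarrow> \<mu> i y = 0"
    using u_S i constraint_iff[OF i um] by (auto simp: S_m_mu_def)
  show "l \<in> {1..m} \<Longrightarrow> i \<noteq> l \<Longrightarrow> AE y in lebesgue. u i y * u l y = 0"
    using S i by (auto simp: S_m_def)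
qed

text \<open>Competitors with integrability built in, so that their energy is the real number
  \<open>En\<close>; the constraint appears in the form of \<open>constraint_iff\<close>.\<close>

definition admissible :: "(nat \<Rightarrow> 'a \<Rightarrow> real) \<Rightarrow> (nat \<Rightarrow> 'a \<Rightarrow> 'a) \<Rightarrow> bool" where
  "admissible v G \<longleftrightarrow> (\<forall>i\<in>{1..m}. H1p (v i) (G i) \<and> integrable lebesgue (v i) \<and>
      (AE y in lebesgue. v i y \<ge> 0) \<and> (AE y in lebesgue. v i y = 0 \<longrightarrow> \<mu> i y = 0) \<and>
      (\<forall>l\<in>{1..m}. i \<noteq> l \<longrightarrow> (AE y in lebesgue. v i y * v l y = 0)))"

lemma admissible_S: "admissible v G \<Longrightarrow> v \<in> S_m_mu m \<mu>"
  unfolding admissible_def S_m_mu_def S_m_def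
  using constraint_iff H1_H1p H1p_D(1) L2_measurable by blast

lemma admissible_JJ:
  assumes "admissible v G"
  shows "JJ m (\<lambda>i y. \<mu> i y - 1) v = ereal (\<Sum>i\<in>{1..m}. En (\<lambda>y. \<mu> i y - 1) (v i) (G i))"
proof -
  have "J (\<lambda>y. \<mu> i y - 1) (v i) = ereal (En (\<lambda>y. \<mu> i y - 1) (v i) (G i))" if i: "i \<in> {1..m}" for i
  proof -
    obtain B where B: "B \<ge> 0" "AE y in lebesgue. \<bar>\<mu> i y\<bar> \<le> B" by (rule mu_bound[OF i])
    have ae: "AE y in lebesgue. \<bar>\<mu> i y - 1\<bar> \<le> B + 1" using B(2) by eventually_elim linarith
    have ms: "(\<lambda>y. \<mu> i y - 1) \<in> borel_measurable lebesgue"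
      by (intro borel_measurable_diff mu_measurable i borel_measurable_const)
    show ?thesis using assms i by (intro J_eq_En[OF _ _ ms ae]) (auto simp: admissible_def)
  qed
  then show ?thesis by (simp add: JJ_def)
qed

text \<open>Serves to show that the minimal energy is not infinite. Disjoint compact supports have a
  positive distance d, and bumps reaching less than d/2 beyond them do not overlap.\<close>

lemma admissible_exists: "\<exists>v G. admissible v G"
proof -
  define I where "I = {1..m}"
  have "\<forall>p\<in>I\<times>I. \<exists>d>0. fst p \<noteq> snd p \<longrightarrow> (\<forall>x\<in>supp (\<mu> (fst p)). \<forall>y\<in>supp (\<mu> (snd p)). d \<le> dist x y)"
  proof
    fix p assume p: "p \<in> I \<times> I"
    show "\<exists>d>0. fst p \<noteq> snd p \<longrightarrow> (\<forall>x\<in>supp (\<mu> (fst p)). \<forall>y\<in>supp (\<mu> (snd p)). d \<le> dist x y)"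
    proof (cases "fst p = snd p")
      case False
      have "compact (supp (\<mu> (fst p)))" "closed (supp (\<mu> (snd p)))" "supp (\<mu> (fst p)) \<inter> supp (\<mu> (snd p)) = {}"
        using mu_cpt mu_disj False mem_Times_iff[of p I I, THEN iffD1, OF p] unfolding I_def
        by (blast intro: compact_imp_closed)+
      from separate_compact_closed[OF this] show ?thesis by blast
    qed (auto intro: exI[of _ 1])
  qed
  then obtain D where D: "\<And>p. p \<in> I \<times> I \<Longrightarrow> D p > 0 \<and> (fst p \<noteq> snd p \<longrightarrow>
      (\<forall>x\<in>supp (\<mu> (fst p)). \<forall>y\<in>supp (\<mu> (snd p)). D p \<le> dist x y))"
    using bchoice[of "I \<times> I"] by metis
  \<comment> \<open>The element 1 keeps the set non-empty even without pairs of indices.\<close>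
  define d where "d = Min (insert 1 (D ` (I \<times> I)))"
  have fin: "finite (insert 1 (D ` (I \<times> I)))" by (simp add: I_def)
  have d0: "d > 0" unfolding d_def using D by (subst Min_gr_iff[OF fin]) auto
  have d: "d \<le> dist x y" if "i \<in> I" "l \<in> I" "i \<noteq> l" "x \<in> supp (\<mu> i)" "y \<in> supp (\<mu> l)" for i l x y
  proof -
    have "d \<le> D (i, l)" unfolding d_def using that by (intro Min_le fin) auto
    also have "\<dots> \<le> dist x y" using D[of "(i, l)"] that by auto
    finally show ?thesis .
  qed
  have "\<exists>v. test_fun v \<and> (\<forall>y. v y \<ge> 0) \<and> (\<forall>y\<in>supp (\<mu> i). v y > 0) \<and> (\<forall>y. v y \<noteq> 0 \<longrightarrow> (\<exists>z\<in>supp (\<mu> i). dist z y < d / 2))"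
    if "i \<in> I" for i
    by (rule bump_near_compact[of "supp (\<mu> i)" "d / 2"]) (use mu_cpt that d0 in \<open>auto simp: I_def\<close>)
  then obtain v where v: "\<And>i. i \<in> I \<Longrightarrow> test_fun (v i) \<and> (\<forall>y. v i y \<ge> 0) \<and> (\<forall>y\<in>supp (\<mu> i). v i y > 0) \<and>
      (\<forall>y. v i y \<noteq> 0 \<longrightarrow> (\<exists>z\<in>supp (\<mu> i). dist z y < d / 2))" by metis
  have "admissible v (\<lambda>i x. \<Sum>k\<in>Basis. pd k (v i) x *\<^sub>R k)"
    unfolding admissible_def I_def[symmetric]
  proof (intro ballI conjI impI)
    fix i assume i: "i \<in> I"
    then have i': "i \<in> {1..m}" by (simp add: I_def)
    show "H1p (v i) (\<lambda>x. \<Sum>k\<in>Basis. pd k (v i) x *\<^sub>R k)" "integrable lebesgue (v i)"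
      using H1p_test v[OF i] by blast+
    show "AE y in lebesgue. 0 \<le> v i y" using v[OF i] by simp
    show "AE y in lebesgue. v i y = 0 \<longrightarrow> \<mu> i y = 0"
      using mu_on_A[OF i']
    proof eventually_elim
      case (elim y)
      then show ?case using A_sub_supp[OF i'] v[OF i] by (metis less_irrefl subsetD)
    qed
    fix l assume l: "l \<in> I" "i \<noteq> l"
    have "v i y * v l y = 0" for y
    proof (rule ccontr)
      assume "v i y * v l y \<noteq> 0"
      then obtain z w where zw: "z \<in> supp (\<mu> i)" "dist z y < d / 2" "w \<in> supp (\<mu> l)" "dist w y < d / 2"
        using v[OF i] v[OF l(1)] by (metis mult_eq_0_iff)
      have "dist z w < d" using dist_triangle_half_r[of y z d w] zw by (simp add: dist_commute)
      then show False using d[OF i l(1) l(2) zw(1,3)] by linarith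
    qed
    then show "AE y in lebesgue. v i y * v l y = 0" by simp
  qed
  then show ?thesis by blast
qed

text \<open>Some competitor has finite energy, so the minimizer has; a sum of extended reals is
  infinite once one summand is, hence each phase has finite \<open>J\<close> and
  \<open>J_finite_integrable\<close> applies.\<close>

lemma u_integrable:
  assumes i: "i \<in> {1..m}"
  shows "integrable lebesgue (u i)"
proof -
  obtain v G where v: "admissible v G" using admissible_exists by blast
  have "JJ m (\<lambda>i y. \<mu> i y - 1) u \<le> ereal (\<Sum>i\<in>{1..m}. En (\<lambda>y. \<mu> i y - 1) (v i) (G i))"
    using bspec[OF u_min admissible_S[OF v]] unfolding admissible_JJ[OF v] .
  then have "JJ m (\<lambda>i y. \<mu> i y - 1) u \<noteq> \<infinity>" by auto
  then have "J (\<lambda>y. \<mu> i y - 1) (u i) \<noteq> \<infinity>" using i by (auto simp: JJ_def sum_Pinfty)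
  then show ?thesis
    using u_facts[OF i] mu_nonneg i mu_measurable[OF i]
      mu_mult_integrable[OF i L2_loc_int[OF H1p_D(1)[OF u_facts(1)[OF i]]]]
    by (intro J_finite_integrable[of "u i" "\<mu> i"]) (auto intro: H1_H1p[OF u_facts(1)[OF i]])
qed

lemma u_admissible: "admissible u (\<lambda>i. wgrad (u i))"
  unfolding admissible_def using u_facts u_integrable by blast

lemma minimality:
  assumes "admissible v G"
  shows "(\<Sum>i\<in>{1..m}. En (\<lambda>y. \<mu> i y - 1) (u i) (wgrad (u i))) \<le> (\<Sum>i\<in>{1..m}. En (\<lambda>y. \<mu> i y - 1) (v i) (G i))"
  using bspec[OF u_min admissible_S[OF assms]] unfolding admissible_JJ[OF assms] admissible_JJ[OF u_admissible] by simp

end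

section \<open>Potentials of bounded densities\<close>

text \<open>\<open>Vk a b\<close> is the difference of the mollified fundamental solutions for the radii \<open>a\<close> and \<open>b\<close>,
  and \<open>Kk a b i\<close> is its partial derivative in direction \<open>i\<close>.\<close>
definition Vk :: "real \<Rightarrow> real \<Rightarrow> 'a::euclidean_space \<Rightarrow> real" where
  "Vk a b y = cn TYPE('a) * ((Lk DIM('a) a (y \<bullet> y) - Lk DIM('a) a (b\<^sup>2)) - (Lk DIM('a) b (y \<bullet> y) - Lk DIM('a) b (b\<^sup>2)))"

definition Kk :: "real \<Rightarrow> real \<Rightarrow> 'a::euclidean_space \<Rightarrow> 'a \<Rightarrow> real" where
  "Kk a b i y = cn TYPE('a) * (- (y \<bullet> i) * hk DIM('a) a (y \<bullet> y) - - (y \<bullet> i) * hk DIM('a) b (y \<bullet> y))"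

lemma inner_self_gt: "- 1 \<le> (y::'a::euclidean_space) \<bullet> y"
  using inner_ge_zero[of y] by linarith

text \<open>Beyond radius b both truncations are inactive, so the two profiles differ by a constant
  there, and the normalisation at b^2 makes this constant 0. The kernel has compact support, also
  for n = 2.\<close>

lemma Vk_zero:
  assumes "0 < a" "a \<le> b" "b \<le> norm (y::'a::euclidean_space)"
  shows "Vk a b y = 0"
proof -
  have b: "b\<^sup>2 \<le> y \<bullet> y" unfolding power2_norm_eq_inner[symmetric] using assms by (intro power_mono) auto
  have ab: "a\<^sup>2 \<le> b\<^sup>2" using assms by (intro power_mono) auto
  have "-1 \<le> b\<^sup>2" using zero_le_power2[of b] by linarith
  then have d: "Lk n c (b\<^sup>2) - Lk n c (y \<bullet> y) = integral {b\<^sup>2..y \<bullet> y} (hk n c) / 2" if "c > 0" for n c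
    by (rule Lk_diff[OF that _ b])
  have "integral {b\<^sup>2..y \<bullet> y} (hk n a) = integral {b\<^sup>2..y \<bullet> y} (hk n b)" for n
    using ab by (intro Henstock_Kurzweil_Integration.integral_cong) (simp add: hk_outside)
  then have "Lk n a (b\<^sup>2) - Lk n a (y \<bullet> y) = Lk n b (b\<^sup>2) - Lk n b (y \<bullet> y)" for n
    using d[of a n] d[of b n] assms by simp
  from this[of "DIM('a)"] show ?thesis by (simp add: Vk_def)
qed

text \<open>A smaller a enlarges \<open>hk\<close>, hence the increment up to the sphere of radius
  b. The potentials therefore increase as a decreases, and the case a' = b gives their
  non-negativity.\<close>

lemma Vk_antimono:
  assumes "0 < a" "a \<le> a'" "a' \<le> b"
  shows "Vk a' b (y::'a::euclidean_space) \<le> Vk a b y"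
proof (cases "norm y \<le> b")
  case True
  have b: "y \<bullet> y \<le> b\<^sup>2" unfolding power2_norm_eq_inner[symmetric] using True by (intro power_mono) auto
  show ?thesis unfolding Vk_def
    using Lk_diff_antimono[OF assms(1,2) inner_self_gt b] cn_pos[where 'a='a]
    by (intro mult_left_mono diff_right_mono) auto
next
  case False
  then show ?thesis using Vk_zero[of a b y] Vk_zero[of a' b y] assms by simp
qed

lemma Vk_nonneg:
  assumes "0 < a" "a \<le> b"
  shows "0 \<le> Vk a b (y::'a::euclidean_space)"
  using Vk_antimono[OF assms order_refl, of y] by (simp add: Vk_def)

lemma Vk_le:
  assumes n: "DIM('a::euclidean_space) \<ge> 2" and a: "0 < a" "a \<le> norm (y::'a)" "a \<le> b"
  shows "Vk a b y \<le> max 0 (Psi TYPE('a) (norm y) - Psi TYPE('a) b)"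
proof (cases "norm y \<le> b")
  case True
  have b: "y \<bullet> y \<le> b\<^sup>2" unfolding power2_norm_eq_inner[symmetric] using True by (intro power_mono) auto
  have "Lk DIM('a) b (b\<^sup>2) \<le> Lk DIM('a) b (y \<bullet> y)" by (rule Lk_antimono) (use a inner_self_gt b in auto)
  then have "Vk a b y \<le> cn TYPE('a) * (Lk DIM('a) a (y \<bullet> y) - Lk DIM('a) a (b\<^sup>2))"
    unfolding Vk_def using cn_pos[where 'a='a] by (intro mult_left_mono) auto
  also have "\<dots> = Psi TYPE('a) (norm y) - Psi TYPE('a) b"
    using Lk_Psi[OF n a(1,2) True] by (simp add: power2_norm_eq_inner)
  finally show ?thesis by simp
next
  case False
  then show ?thesis using Vk_zero[of a b y] a by simp
qed

lemma Kk_zero: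
  assumes "0 < a" "a \<le> b" "b \<le> norm (y::'a::euclidean_space)"
  shows "Kk a b i y = 0"
proof -
  have "b\<^sup>2 \<le> y \<bullet> y" unfolding power2_norm_eq_inner[symmetric] using assms by (intro power_mono) auto
  moreover have "a\<^sup>2 \<le> b\<^sup>2" using assms by (intro power_mono) auto
  ultimately show ?thesis by (simp add: Kk_def hk_outside)
qed

lemma continuous_Vk: "0 < a \<Longrightarrow> 0 < b \<Longrightarrow> continuous_on UNIV (Vk a b :: 'a::euclidean_space \<Rightarrow> real)"
  unfolding Vk_def[abs_def]
  using continuous_Lk_radial[of a "DIM('a)" "0::'a"] continuous_Lk_radial[of b "DIM('a)" "0::'a"]
  by (auto intro!: continuous_intros)

lemma continuous_Kk: "0 < a \<Longrightarrow> 0 < b \<Longrightarrow> continuous_on UNIV (Kk a b i :: 'a::euclidean_space \<Rightarrow> real)"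
  unfolding Kk_def[abs_def]
  by (intro continuous_intros continuous_on_compose2[OF hk_continuous[of a UNIV]]
      continuous_on_compose2[OF hk_continuous[of b UNIV]]) auto

lemma continuous_compact_bounded:
  fixes F :: "'a::euclidean_space \<Rightarrow> real"
  assumes "continuous_on UNIV F" "\<And>y. norm y \<ge> r \<Longrightarrow> F y = 0"
  obtains B where "\<And>y. \<bar>F y\<bar> \<le> B"
proof -
  have "bounded (F ` cball 0 r)"
    by (intro compact_imp_bounded compact_continuous_image continuous_on_subset[OF assms(1)]) auto
  then obtain C where C: "\<And>x. x \<in> cball 0 r \<Longrightarrow> \<bar>F x\<bar> \<le> C"
    unfolding bounded_iff by (metis image_eqI real_norm_def)
  have "\<bar>F y\<bar> \<le> max C 0" for y using C[of y] assms(2)[of y] by (cases "norm y \<ge> r") auto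
  then show ?thesis using that by blast
qed

lemma wd_Vk:
  fixes z :: "'a::euclidean_space"
  assumes ab: "0 < a" "0 < b" and i: "i \<in> Basis"
  shows "wd i (\<lambda>y. Vk a b (y - z)) (\<lambda>y. Kk a b i (y - z))"
proof -
  let ?n = "DIM('a)"
  have c: "wd i (\<lambda>y. d) (\<lambda>y. 0)" for d
    using wd_smooth[OF smooth_const[of d] i] by (simp add: frechet_derivative_const)
  have "wd i (\<lambda>y. cn TYPE('a) * ((Lk ?n a ((y - z) \<bullet> (y - z)) - Lk ?n a (b\<^sup>2)) - (Lk ?n b ((y - z) \<bullet> (y - z)) - Lk ?n b (b\<^sup>2))))
     (\<lambda>y. cn TYPE('a) * ((- ((y - z) \<bullet> i) * hk ?n a ((y - z) \<bullet> (y - z)) - 0) - (- ((y - z) \<bullet> i) * hk ?n b ((y - z) \<bullet> (y - z)) - 0)))"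
    by (intro wd_cmult wd_diff wd_Lk ab i c)
  then show ?thesis by (simp add: Vk_def Kk_def)
qed

text \<open>Says that -Laplace of \<open>Vk\<close> is the uniform probability on the ball of radius
  a minus that on the ball of radius b; \<open>cn_hk\<close> supplies the normalisation.\<close>

lemma Kk_divergence:
  fixes \<zeta> :: "'a::euclidean_space \<Rightarrow> real"
  assumes ab: "0 < a" "0 < b" and w: "\<And>i. i \<in> Basis \<Longrightarrow> wd i \<zeta> (Z i)"
    and r: "\<And>y. norm y > r \<Longrightarrow> \<zeta> y = 0" "\<And>i y. i \<in> Basis \<Longrightarrow> norm y > r \<Longrightarrow> Z i y = 0"
  shows "(\<Sum>i\<in>Basis. \<integral>y. Kk a b i (y - z) * Z i y \<partial>lebesgue) =
    (\<integral>y. (indicator (ball z a) y / vol_ball TYPE('a) a - indicator (ball z b) y / vol_ball TYPE('a) b) * \<zeta> y \<partial>lebesgue)"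
proof -
  let ?n = "DIM('a)"
  obtain i0 :: 'a where i0: "i0 \<in> Basis" using nonempty_Basis by blast
  have cb: "\<exists>B. \<forall>y\<in>cball 0 r. \<bar>F y\<bar> \<le> B" if "continuous_on UNIV F" for F :: "'a \<Rightarrow> real"
  proof -
    have "bounded (F ` cball 0 r)"
      by (intro compact_imp_bounded compact_continuous_image continuous_on_subset[OF that]) auto
    then show ?thesis unfolding bounded_iff by (metis image_eqI real_norm_def)
  qed
  have int: "integrable lebesgue (\<lambda>y. Z i y * (((y - z) \<bullet> i) * hk ?n c ((y - z) \<bullet> (y - z))))"
    if i: "i \<in> Basis" and c: "c > 0" for i c
  proof -
    let ?F = "\<lambda>y. ((y - z) \<bullet> i) * hk ?n c ((y - z) \<bullet> (y - z))"
    have cF: "continuous_on UNIV ?F"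
      by (intro continuous_intros continuous_on_compose2[OF hk_continuous[OF c, of UNIV]]) auto
    obtain B where B: "\<forall>y\<in>cball 0 r. \<bar>?F y\<bar> \<le> B" using cb[OF cF] by blast
    have "integrable lebesgue (\<lambda>y. Z i y * (indicator (cball 0 r) y * ?F y))"
    proof (rule loc_int_mult_bounded[OF wdD(2)[OF w[OF i]], where B="\<bar>B\<bar>" and r=r])
      show "(\<lambda>y. indicator (cball 0 r) y * ?F y) \<in> borel_measurable lebesgue"
        using continuous_lebesgue[OF cF] by measurable
      show "\<bar>indicator (cball 0 r) y * ?F y\<bar> \<le> \<bar>B\<bar>" for y
        using B by (cases "y \<in> cball 0 r") (auto intro: order_trans[OF _ abs_ge_self])
    qed auto
    moreover have "Z i y * (indicator (cball 0 r) y * ?F y) = Z i y * ?F y" for y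
      using r(2)[OF i, of y] by (cases "norm y > r") auto
    ultimately show ?thesis by simp
  qed
  have i\<zeta>: "integrable lebesgue (\<lambda>y. \<zeta> y * indicator (ball z c) y)" for c
  proof -
    have "integrable lebesgue \<zeta>"
      using wd_test_local(2)[OF w[OF i0] i0 smooth_const[of 1] r(1) r(2)[OF i0]] by simp
    from integrable_mult_indicator[of "ball z c", OF _ this] show ?thesis by (simp add: mult.commute)
  qed
  have k: "(\<integral>y. Kk a b i (y - z) * Z i y \<partial>lebesgue) = cn TYPE('a) *
      ((\<integral>y. Z i y * (((y - z) \<bullet> i) * hk ?n b ((y - z) \<bullet> (y - z))) \<partial>lebesgue)
       - (\<integral>y. Z i y * (((y - z) \<bullet> i) * hk ?n a ((y - z) \<bullet> (y - z))) \<partial>lebesgue))" if i: "i \<in> Basis" for i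
  proof -
    have "(\<integral>y. Kk a b i (y - z) * Z i y \<partial>lebesgue) = (\<integral>y. cn TYPE('a) *
       (Z i y * (((y - z) \<bullet> i) * hk ?n b ((y - z) \<bullet> (y - z))) - Z i y * (((y - z) \<bullet> i) * hk ?n a ((y - z) \<bullet> (y - z)))) \<partial>lebesgue)"
      by (rule Bochner_Integration.integral_cong) (auto simp: Kk_def algebra_simps)
    then show ?thesis using int[OF i ab(1)] int[OF i ab(2)] by simp
  qed
  have "(\<Sum>i\<in>Basis. \<integral>y. Kk a b i (y - z) * Z i y \<partial>lebesgue) = cn TYPE('a) *
      ((\<Sum>i\<in>Basis. \<integral>y. Z i y * (((y - z) \<bullet> i) * hk ?n b ((y - z) \<bullet> (y - z))) \<partial>lebesgue)
      - (\<Sum>i\<in>Basis. \<integral>y. Z i y * (((y - z) \<bullet> i) * hk ?n a ((y - z) \<bullet> (y - z))) \<partial>lebesgue))"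
    by (simp add: k sum_distrib_left[symmetric] sum_subtractf)
  also have "\<dots> = cn TYPE('a) * (- (real ?n / b ^ ?n) * (\<integral>y. \<zeta> y * indicator (ball z b) y \<partial>lebesgue)
      - - (real ?n / a ^ ?n) * (\<integral>y. \<zeta> y * indicator (ball z a) y \<partial>lebesgue))"
    using radial_field_divergence[OF ab(1) w r, where z=z] radial_field_divergence[OF ab(2) w r, where z=z] by simp
  also have "\<dots> = (cn TYPE('a) * real ?n / a ^ ?n) * (\<integral>y. \<zeta> y * indicator (ball z a) y \<partial>lebesgue)
     - (cn TYPE('a) * real ?n / b ^ ?n) * (\<integral>y. \<zeta> y * indicator (ball z b) y \<partial>lebesgue)"
    by (simp add: algebra_simps)
  also have "\<dots> = (\<integral>y. (1 / vol_ball TYPE('a) a) * (\<zeta> y * indicator (ball z a) y) - (1 / vol_ball TYPE('a) b) * (\<zeta> y * indicator (ball z b) y) \<partial>lebesgue)"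
    unfolding cn_hk[OF ab(1)] cn_hk[OF ab(2)] using i\<zeta>[of a] i\<zeta>[of b] by simp
  also have "\<dots> = (\<integral>y. (indicator (ball z a) y / vol_ball TYPE('a) a - indicator (ball z b) y / vol_ball TYPE('a) b) * \<zeta> y \<partial>lebesgue)"
    by (rule Bochner_Integration.integral_cong) (auto simp: algebra_simps)
  finally show ?thesis .
qed

section \<open>Convolution of kernels with a density\<close>

definition cnv :: "('a::euclidean_space \<Rightarrow> real) \<Rightarrow> ('a \<Rightarrow> real) \<Rightarrow> 'a \<Rightarrow> real" where
  "cnv V \<nu> y = (\<integral>z. V (y - z) * \<nu> z \<partial>lborel)"

lemma cnv_measurable [measurable]:
  assumes [measurable]: "V \<in> borel_measurable borel" "\<nu> \<in> borel_measurable borel"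
  shows "cnv V \<nu> \<in> borel_measurable borel"
  unfolding cnv_def[abs_def] by measurable

lemma cnv_integrable:
  fixes V :: "'a::euclidean_space \<Rightarrow> real"
  assumes [measurable]: "V \<in> borel_measurable borel" and B: "\<And>y. \<bar>V y\<bar> \<le> B" and \<nu>: "integrable lborel \<nu>"
  shows "integrable lborel (\<lambda>z. V (y - z) * \<nu> z)"
proof (rule Bochner_Integration.integrable_bound[where f="\<lambda>z. B * \<bar>\<nu> z\<bar>"])
  have [measurable]: "\<nu> \<in> borel_measurable borel" using \<nu> by auto
  show "(\<lambda>z. V (y - z) * \<nu> z) \<in> borel_measurable lborel" by measurable
  show "integrable lborel (\<lambda>z. B * \<bar>\<nu> z\<bar>)" using \<nu> by simp
  have "norm (V (y - z) * \<nu> z) \<le> norm (B * \<bar>\<nu> z\<bar>)" for z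
  proof -
    have "\<bar>V (y - z)\<bar> * \<bar>\<nu> z\<bar> \<le> \<bar>B\<bar> * \<bar>\<nu> z\<bar>" using B[of "y - z"] by (intro mult_right_mono) auto
    then show ?thesis by (simp add: abs_mult)
  qed
  then show "AE z in lborel. norm (V (y - z) * \<nu> z) \<le> norm (B * \<bar>\<nu> z\<bar>)" by simp
qed

lemma cnv_bounded:
  fixes V :: "'a::euclidean_space \<Rightarrow> real"
  assumes V: "V \<in> borel_measurable borel" and B: "\<And>y. \<bar>V y\<bar> \<le> B" and \<nu>: "integrable lborel \<nu>"
  shows "\<bar>cnv V \<nu> y\<bar> \<le> B * (\<integral>z. \<bar>\<nu> z\<bar> \<partial>lborel)"
proof -
  have "norm (\<integral>z. V (y - z) * \<nu> z \<partial>lborel) \<le> (\<integral>z. B * \<bar>\<nu> z\<bar> \<partial>lborel)"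
  proof (rule Bochner_Integration.integral_norm_bound_integral)
    show "norm (V (y - z) * \<nu> z) \<le> B * \<bar>\<nu> z\<bar>" for z
      unfolding real_norm_def abs_mult by (intro mult_right_mono B) simp
  qed (use \<nu> in \<open>auto intro: cnv_integrable[OF V B \<nu>]\<close>)
  then show ?thesis by (simp add: cnv_def)
qed

lemma cnv_fubini:
  fixes V :: "'a::euclidean_space \<Rightarrow> real"
  assumes V [measurable]: "V \<in> borel_measurable borel" and B: "\<And>y. \<bar>V y\<bar> \<le> B"
    and \<nu>: "integrable lborel \<nu>" and F: "integrable lborel F"
  shows "(\<integral>y. cnv V \<nu> y * F y \<partial>lborel) = (\<integral>z. (\<integral>y. V (y - z) * F y \<partial>lborel) * \<nu> z \<partial>lborel)"
    and "integrable lborel (\<lambda>z. (\<integral>y. V (y - z) * F y \<partial>lborel) * \<nu> z)"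
proof -
  have [measurable]: "\<nu> \<in> borel_measurable borel" "F \<in> borel_measurable borel" using \<nu> F by auto
  define f where "f = (\<lambda>(y, z). V (y - z) * \<nu> z * F y)"
  have fm: "f \<in> borel_measurable (lborel \<Otimes>\<^sub>M lborel)" unfolding f_def by measurable
  have iz: "integrable lborel (\<lambda>z. f (y, z))" for y
    using cnv_integrable[OF V B \<nu>, of y] by (simp add: f_def)
  have "integrable lborel (\<lambda>y. \<integral>z. norm (f (y, z)) \<partial>lborel)"
  proof (rule Bochner_Integration.integrable_bound[where f="\<lambda>y. (B * (\<integral>z. \<bar>\<nu> z\<bar> \<partial>lborel)) * \<bar>F y\<bar>"])
    show "integrable lborel (\<lambda>y. (B * (\<integral>z. \<bar>\<nu> z\<bar> \<partial>lborel)) * \<bar>F y\<bar>)" using F by simp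
    show "(\<lambda>y. \<integral>z. norm (f (y, z)) \<partial>lborel) \<in> borel_measurable lborel" using fm by measurable
    have "norm (\<integral>z. norm (f (y, z)) \<partial>lborel) \<le> norm ((B * (\<integral>z. \<bar>\<nu> z\<bar> \<partial>lborel)) * \<bar>F y\<bar>)" for y
    proof -
      have "(\<integral>z. norm (f (y, z)) \<partial>lborel) \<le> (\<integral>z. (B * \<bar>F y\<bar>) * \<bar>\<nu> z\<bar> \<partial>lborel)"
      proof (rule integral_mono)
        show "integrable lborel (\<lambda>z. norm (f (y, z)))" using iz by (rule integrable_norm)
        show "integrable lborel (\<lambda>z. (B * \<bar>F y\<bar>) * \<bar>\<nu> z\<bar>)" using \<nu> by simp
        fix z
        have "\<bar>V (y - z)\<bar> * (\<bar>\<nu> z\<bar> * \<bar>F y\<bar>) \<le> B * (\<bar>\<nu> z\<bar> * \<bar>F y\<bar>)" by (intro mult_right_mono B) simp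
        then show "norm (f (y, z)) \<le> (B * \<bar>F y\<bar>) * \<bar>\<nu> z\<bar>" by (simp add: f_def abs_mult mult_ac)
      qed
      then have "(\<integral>z. norm (f (y, z)) \<partial>lborel) \<le> (B * (\<integral>z. \<bar>\<nu> z\<bar> \<partial>lborel)) * \<bar>F y\<bar>" by (simp add: mult_ac)
      moreover have "0 \<le> (\<integral>z. norm (f (y, z)) \<partial>lborel)" by (rule Bochner_Integration.integral_nonneg) simp
      ultimately show ?thesis by simp
    qed
    then show "AE y in lborel. norm (\<integral>z. norm (f (y, z)) \<partial>lborel) \<le> norm ((B * (\<integral>z. \<bar>\<nu> z\<bar> \<partial>lborel)) * \<bar>F y\<bar>)" by simp
  qed
  then have int: "integrable (lborel \<Otimes>\<^sub>M lborel) f"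
    using lborel_pair.Fubini_integrable[OF fm] iz by simp
  have int2: "integrable (lborel \<Otimes>\<^sub>M lborel) (\<lambda>(y, z). V (y - z) * \<nu> z * F y)" using int by (simp add: f_def)
  have "(\<integral>y. cnv V \<nu> y * F y \<partial>lborel) = (\<integral>y. (\<integral>z. V (y - z) * \<nu> z * F y \<partial>lborel) \<partial>lborel)"
    by (simp add: cnv_def)
  also have "\<dots> = (\<integral>z. (\<integral>y. V (y - z) * \<nu> z * F y \<partial>lborel) \<partial>lborel)"
    using lborel_pair.Fubini_integral[OF int2] by simp
  also have e: "(\<lambda>z. (\<integral>y. V (y - z) * \<nu> z * F y \<partial>lborel)) = (\<lambda>z. (\<integral>y. V (y - z) * F y \<partial>lborel) * \<nu> z)"
  proof
    fix z
    have "(\<integral>y. V (y - z) * \<nu> z * F y \<partial>lborel) = (\<integral>y. (V (y - z) * F y) * \<nu> z \<partial>lborel)"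
      by (rule Bochner_Integration.integral_cong) (auto simp: mult_ac)
    then show "(\<integral>y. V (y - z) * \<nu> z * F y \<partial>lborel) = (\<integral>y. V (y - z) * F y \<partial>lborel) * \<nu> z" by simp
  qed
  finally show "(\<integral>y. cnv V \<nu> y * F y \<partial>lborel) = (\<integral>z. (\<integral>y. V (y - z) * F y \<partial>lborel) * \<nu> z \<partial>lborel)" .
  show "integrable lborel (\<lambda>z. (\<integral>y. V (y - z) * F y \<partial>lborel) * \<nu> z)"
    using lborel_pair.integrable_snd[OF int2] unfolding e .
qed

lemma loc_int_bounded: "F \<in> borel_measurable lebesgue \<Longrightarrow> (\<And>y. \<bar>F y\<bar> \<le> B) \<Longrightarrow> loc_int F"
  using loc_int_bounded_mult[OF loc_int_const[of 1], of F B] by simp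

text \<open>The defining identity holds for every translate of V; integrating it against \<nu> and
  exchanging the integrals gives it for the convolution.\<close>

lemma wd_cnv:
  fixes V K :: "'a::euclidean_space \<Rightarrow> real"
  assumes V: "V \<in> borel_measurable borel" "\<And>y. \<bar>V y\<bar> \<le> B" and K: "K \<in> borel_measurable borel" "\<And>y. \<bar>K y\<bar> \<le> C"
    and w: "\<And>z. wd i (\<lambda>y. V (y - z)) (\<lambda>y. K (y - z))" and \<nu>: "integrable lborel \<nu>" and i: "i \<in> Basis"
  shows "wd i (cnv V \<nu>) (cnv K \<nu>)"
  unfolding wd_def
proof (intro conjI allI impI)
  have [measurable]: "\<nu> \<in> borel_measurable borel" using \<nu> by auto
  note [measurable] = V(1) K(1)
  show "loc_int (cnv V \<nu>)" by (rule loc_int_bounded[OF _ cnv_bounded[OF V \<nu>]]) simp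
  show "loc_int (cnv K \<nu>)" by (rule loc_int_bounded[OF _ cnv_bounded[OF K \<nu>]]) simp
  fix \<phi> :: "'a \<Rightarrow> real" assume t: "test_fun \<phi>"
  have [measurable]: "\<phi> \<in> borel_measurable borel" "pd i \<phi> \<in> borel_measurable borel"
    using t test_fun_pd[OF t i] by (auto intro: test_fun_borel)
  have it: "integrable lborel \<phi>" "integrable lborel (pd i \<phi>)"
    using loc_int_test[OF loc_int_const[of 1] t] loc_int_test[OF loc_int_const[of 1] test_fun_pd[OF t i]]
    by (simp_all add: integrable_completion)
  have "(\<integral>y. V (y - z) * pd i \<phi> y \<partial>lborel) = - (\<integral>y. K (y - z) * \<phi> y \<partial>lborel)" for z
    using wdD(3)[OF w[of z] t] by (simp add: integral_completion)
  then have "(\<integral>y. cnv V \<nu> y * pd i \<phi> y \<partial>lborel) = - (\<integral>y. cnv K \<nu> y * \<phi> y \<partial>lborel)"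
    by (simp add: cnv_fubini(1)[OF V \<nu> it(2)] cnv_fubini(1)[OF K \<nu> it(1)])
  then show "(\<integral>y. cnv V \<nu> y * pd i \<phi> y \<partial>lebesgue) = - (\<integral>y. cnv K \<nu> y * \<phi> y \<partial>lebesgue)"
    by (simp add: integral_completion)
qed

lemma Vk_bounds:
  assumes "0 < a" "a \<le> b"
  obtains B where "\<And>y::'a::euclidean_space. \<bar>Vk a b y\<bar> \<le> B"
proof -
  obtain B where "\<And>y::'a. \<bar>Vk a b y\<bar> \<le> B"
    by (rule continuous_compact_bounded[of "Vk a b :: 'a \<Rightarrow> real" b])
      (use assms in \<open>auto intro: continuous_Vk Vk_zero\<close>)
  then show ?thesis using that by blast
qed

lemma Kk_bounds:
  assumes "0 < a" "a \<le> b"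
  obtains B where "\<And>y::'a::euclidean_space. \<bar>Kk a b i y\<bar> \<le> B"
proof -
  obtain B where "\<And>y::'a. \<bar>Kk a b i y\<bar> \<le> B"
    by (rule continuous_compact_bounded[of "Kk a b i :: 'a \<Rightarrow> real" b])
      (use assms in \<open>auto intro: continuous_Kk Kk_zero\<close>)
  then show ?thesis using that by blast
qed

lemma Vk_borel: "0 < a \<Longrightarrow> 0 < b \<Longrightarrow> (Vk a b :: 'a::euclidean_space \<Rightarrow> real) \<in> borel_measurable borel"
  and Kk_borel: "0 < a \<Longrightarrow> 0 < b \<Longrightarrow> (Kk a b i :: 'a::euclidean_space \<Rightarrow> real) \<in> borel_measurable borel"
  by (auto intro: borel_measurable_continuous_onI continuous_Vk continuous_Kk)

lemma wd_potential:
  assumes ab: "0 < a" "a \<le> b" and \<nu>: "integrable lborel \<nu>" and i: "i \<in> Basis"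
  shows "wd i (cnv (Vk a b) \<nu>) (cnv (Kk a b i) \<nu>)"
proof -
  obtain B where B: "\<And>y::'a. \<bar>Vk a b y\<bar> \<le> B" by (rule Vk_bounds[OF ab, where 'a='a]) blast
  obtain C where C: "\<And>y::'a. \<bar>Kk a b i y\<bar> \<le> C" by (rule Kk_bounds[OF ab, where 'a='a and i=i]) blast
  show ?thesis
    by (rule wd_cnv[OF Vk_borel B Kk_borel C wd_Vk \<nu> i]) (use ab i in auto)
qed

definition avk :: "real \<Rightarrow> 'a::euclidean_space \<Rightarrow> real" where
  "avk a y = indicator (ball 0 a) y / vol_ball TYPE('a) a"

lemma avk_borel [measurable]: "avk a \<in> borel_measurable borel"
  unfolding avk_def[abs_def]
  by (intro borel_measurable_divide borel_measurable_indicator borel_measurable_const) simp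

lemma avk_bound: "0 < a \<Longrightarrow> \<bar>avk a (y::'a::euclidean_space)\<bar> \<le> 1 / vol_ball TYPE('a) a"
  using vol_ball_pos[of a, where 'a='a] by (auto simp: avk_def indicator_def)

text \<open>\<open>Kk_divergence\<close> integrated against \<nu>. Fubini is applied to Borel
  versions of \<zeta> and Z, which \<open>tr\<close> exchanges for the originals.\<close>

lemma potential_laplacian:
  fixes \<zeta> :: "'a::euclidean_space \<Rightarrow> real"
  assumes ab: "0 < a" "a \<le> b" and \<nu>: "integrable lborel \<nu>" and w: "\<And>i. i \<in> Basis \<Longrightarrow> wd i \<zeta> (Z i)"
    and r: "\<And>y. norm y > r \<Longrightarrow> \<zeta> y = 0" "\<And>i y. i \<in> Basis \<Longrightarrow> norm y > r \<Longrightarrow> Z i y = 0"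
  shows "(\<Sum>i\<in>Basis. \<integral>y. cnv (Kk a b i) \<nu> y * Z i y \<partial>lebesgue) =
    (\<integral>y. (cnv (avk a) \<nu> y - cnv (avk b) \<nu> y) * \<zeta> y \<partial>lebesgue)"
proof -
  have b0: "b > 0" using ab by simp
  have [measurable]: "\<nu> \<in> borel_measurable borel" using \<nu> by auto
  obtain i0 :: 'a where i0: "i0 \<in> Basis" using nonempty_Basis by blast
  have i\<zeta>: "integrable lebesgue \<zeta>"
    using wd_test_local(2)[OF w[OF i0] i0 smooth_const[of 1] r(1) r(2)[OF i0]] by simp
  have iZ: "integrable lebesgue (Z i)" if "i \<in> Basis" for i
    using wd_test_local(3)[OF w[OF that] that smooth_const[of 1] r(1) r(2)[OF that]] by simp
  obtain \<zeta>0 where z0: "\<zeta>0 \<in> borel_measurable borel" "integrable lborel \<zeta>0" "AE x in lebesgue. \<zeta> x = \<zeta>0 x"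
    using borel_version[OF i\<zeta>] by blast
  have "\<forall>i\<in>Basis. \<exists>Z0. Z0 \<in> borel_measurable borel \<and> integrable lborel Z0 \<and> (AE x in lebesgue. Z i x = Z0 x)"
    using borel_version[OF iZ] by metis
  then obtain Z0 where Z0: "\<And>i. i \<in> Basis \<Longrightarrow> Z0 i \<in> borel_measurable borel" "\<And>i. i \<in> Basis \<Longrightarrow> integrable lborel (Z0 i)"
    "\<And>i. i \<in> Basis \<Longrightarrow> AE x in lebesgue. Z i x = Z0 i x" by metis
  note [measurable] = z0(1)
  have tr: "(\<integral>y. H y * v y \<partial>lebesgue) = (\<integral>y. H y * v0 y \<partial>lborel)"
    if [measurable]: "H \<in> borel_measurable borel" "v0 \<in> borel_measurable borel" and v: "v \<in> borel_measurable lebesgue"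
      and ae: "AE x in lebesgue. v x = v0 x" for H v v0 :: "'a \<Rightarrow> real"
  proof -
    have "(\<integral>y. H y * v y \<partial>lebesgue) = (\<integral>y. H y * v0 y \<partial>lebesgue)"
    proof (rule integral_cong_AE)
      show "(\<lambda>y. H y * v y) \<in> borel_measurable lebesgue"
        by (rule borel_measurable_times[OF borel_imp_lebesgue v]) measurable
      show "(\<lambda>y. H y * v0 y) \<in> borel_measurable lebesgue" by (rule borel_imp_lebesgue) measurable
    qed (use ae in auto)
    then show ?thesis by (simp add: integral_completion)
  qed
  have \<zeta>m: "\<zeta> \<in> borel_measurable lebesgue" and Zm: "\<And>i. i \<in> Basis \<Longrightarrow> Z i \<in> borel_measurable lebesgue"
    using i\<zeta> iZ by auto
  note Km [measurable] = Kk_borel[OF ab(1) b0]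
  define Dk :: "'a \<Rightarrow> real" where "Dk y = avk a y - avk b y" for y
  have Dm [measurable]: "Dk \<in> borel_measurable borel" unfolding Dk_def[abs_def] by measurable
  have Db: "\<bar>Dk y\<bar> \<le> 1 / vol_ball TYPE('a) a + 1 / vol_ball TYPE('a) b" for y
    unfolding Dk_def using avk_bound[OF ab(1), of y] avk_bound[OF b0, of y] by linarith
  have "(\<Sum>i\<in>Basis. \<integral>y. cnv (Kk a b i) \<nu> y * Z i y \<partial>lebesgue) = (\<Sum>i\<in>Basis. \<integral>z. (\<integral>y. Kk a b i (y - z) * Z0 i y \<partial>lborel) * \<nu> z \<partial>lborel)"
  proof (rule sum.cong[OF refl])
    fix i :: 'a assume i: "i \<in> Basis"
    obtain C where C: "\<And>y::'a. \<bar>Kk a b i y\<bar> \<le> C" by (rule Kk_bounds[OF ab, where 'a='a and i=i]) blast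
    have "(\<integral>y. cnv (Kk a b i) \<nu> y * Z i y \<partial>lebesgue) = (\<integral>y. cnv (Kk a b i) \<nu> y * Z0 i y \<partial>lborel)"
      by (rule tr[OF _ Z0(1)[OF i] Zm[OF i] Z0(3)[OF i]]) measurable
    then show "(\<integral>y. cnv (Kk a b i) \<nu> y * Z i y \<partial>lebesgue) = (\<integral>z. (\<integral>y. Kk a b i (y - z) * Z0 i y \<partial>lborel) * \<nu> z \<partial>lborel)"
      using cnv_fubini(1)[OF Km C \<nu> Z0(2)[OF i]] by simp
  qed
  also have "\<dots> = (\<integral>z. (\<Sum>i\<in>Basis. (\<integral>y. Kk a b i (y - z) * Z0 i y \<partial>lborel) * \<nu> z) \<partial>lborel)"
  proof (rule Bochner_Integration.integral_sum[symmetric])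
    fix i :: 'a assume i: "i \<in> Basis"
    obtain C where C: "\<And>y::'a. \<bar>Kk a b i y\<bar> \<le> C" by (rule Kk_bounds[OF ab, where 'a='a and i=i]) blast
    show "integrable lborel (\<lambda>z. (\<integral>y. Kk a b i (y - z) * Z0 i y \<partial>lborel) * \<nu> z)"
      by (rule cnv_fubini(2)[OF Km C \<nu> Z0(2)[OF i]])
  qed
  also have "\<dots> = (\<integral>z. (\<integral>y. Dk (y - z) * \<zeta>0 y \<partial>lborel) * \<nu> z \<partial>lborel)"
  proof (rule Bochner_Integration.integral_cong[OF refl])
    fix z :: 'a
    have "(\<Sum>i\<in>Basis. \<integral>y. Kk a b i (y - z) * Z0 i y \<partial>lborel) = (\<Sum>i\<in>Basis. \<integral>y. Kk a b i (y - z) * Z i y \<partial>lebesgue)"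
    proof (rule sum.cong[OF refl])
      fix i :: 'a assume i: "i \<in> Basis"
      show "(\<integral>y. Kk a b i (y - z) * Z0 i y \<partial>lborel) = (\<integral>y. Kk a b i (y - z) * Z i y \<partial>lebesgue)"
        by (rule tr[OF _ Z0(1)[OF i] Zm[OF i] Z0(3)[OF i], symmetric]) measurable
    qed
    also have "\<dots> = (\<integral>y. (indicator (ball z a) y / vol_ball TYPE('a) a - indicator (ball z b) y / vol_ball TYPE('a) b) * \<zeta> y \<partial>lebesgue)"
      by (rule Kk_divergence[OF ab(1) b0 w r])
    also have "\<dots> = (\<integral>y. Dk (y - z) * \<zeta> y \<partial>lebesgue)"
      by (rule Bochner_Integration.integral_cong) (auto simp: Dk_def avk_def indicator_def dist_norm norm_minus_commute)
    also have "\<dots> = (\<integral>y. Dk (y - z) * \<zeta>0 y \<partial>lborel)"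
      by (rule tr[OF _ z0(1) \<zeta>m z0(3)]) measurable
    finally show "(\<Sum>i\<in>Basis. (\<integral>y. Kk a b i (y - z) * Z0 i y \<partial>lborel) * \<nu> z) = (\<integral>y. Dk (y - z) * \<zeta>0 y \<partial>lborel) * \<nu> z"
      by (simp add: sum_distrib_right[symmetric])
  qed
  also have "\<dots> = (\<integral>y. cnv Dk \<nu> y * \<zeta>0 y \<partial>lborel)"
    by (rule cnv_fubini(1)[OF Dm Db \<nu> z0(2), symmetric])
  also have "\<dots> = (\<integral>y. cnv Dk \<nu> y * \<zeta> y \<partial>lebesgue)"
    by (rule tr[OF _ z0(1) \<zeta>m z0(3), symmetric]) measurable
  also have "cnv Dk \<nu> = (\<lambda>y. cnv (avk a) \<nu> y - cnv (avk b) \<nu> y)"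
  proof
    fix y
    show "cnv Dk \<nu> y = cnv (avk a) \<nu> y - cnv (avk b) \<nu> y"
      using cnv_integrable[OF avk_borel avk_bound[OF ab(1)] \<nu>, of y] cnv_integrable[OF avk_borel avk_bound[OF b0] \<nu>, of y]
      unfolding cnv_def Dk_def left_diff_distrib by (rule Bochner_Integration.integral_diff)
  qed
  finally show ?thesis .
qed

lemma avk_kernel: "0 < a \<Longrightarrow> kernel a (avk a :: 'a::euclidean_space \<Rightarrow> real)"
proof -
  assume a: "0 < a"
  have v: "vol_ball TYPE('a) a > 0" using vol_ball_pos[OF a] .
  have i: "integrable lborel (indicator (ball (0::'a) a) :: 'a \<Rightarrow> real)"
    using emeasure_bounded_finite[of "ball (0::'a) a"] by simp
  have "(\<integral>z. avk a (z::'a) \<partial>lborel) = measure lborel (ball (0::'a) a) / vol_ball TYPE('a) a"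
    unfolding avk_def by simp
  also have "\<dots> = 1" using v by (simp add: vol_ball_def)
  finally have 1: "(\<integral>z. avk a (z::'a) \<partial>lborel) = 1" .
  show ?thesis unfolding kernel_def
  proof (intro conjI)
    show "\<exists>B. \<forall>z::'a. avk a z \<le> B" using avk_bound[OF a] abs_le_D1 by blast
    show "integrable lborel (avk a :: 'a \<Rightarrow> real)" unfolding avk_def[abs_def] using i by simp
    show "(\<integral>z. avk a (z::'a) \<partial>lborel) = 1" by (rule 1)
  qed (use v in \<open>auto simp: avk_def\<close>)
qed

text \<open>\<open>avk\<close> is even, so the two sign conventions agree and the L1 theory of
  \<open>cv\<close> applies to the means over balls.\<close>

lemma cnv_avk: "\<nu> \<in> borel_measurable borel \<Longrightarrow> cnv (avk a) \<nu> = cv (avk a) \<nu>"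
proof
  fix y :: 'a assume [measurable]: "\<nu> \<in> borel_measurable borel"
  have "cv (avk a) \<nu> y = (\<integral>z. \<nu> (z + y) * avk a (z + y - y) \<partial>lborel)" by (simp add: cv_def add.commute)
  also have "\<dots> = (\<integral>z. \<nu> z * avk a (z - y) \<partial>lborel)"
    by (rule lborel_translate(2)[of "\<lambda>z. \<nu> z * avk a (z - y)"]) measurable
  also have "\<dots> = cnv (avk a) \<nu> y"
    unfolding cnv_def by (rule Bochner_Integration.integral_cong) (auto simp: avk_def indicator_def norm_minus_commute)
  finally show "cnv (avk a) \<nu> y = cv (avk a) \<nu> y" by simp
qed

text \<open>Provides cutoffs at infinity: with small c the support is large, and the factor c makes
  the gradient small.\<close>

lemma test_fun_scale:
  assumes t: "test_fun \<phi>" and c: "c > 0"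
  shows "test_fun (\<lambda>x. \<phi> (c *\<^sub>R x))" and "pd i (\<lambda>x. \<phi> (c *\<^sub>R x)) x = c * pd i \<phi> (c *\<^sub>R x)"
proof -
  have hd: "((\<lambda>x. \<psi> (c *\<^sub>R x)) has_derivative (\<lambda>h. frechet_derivative \<psi> (at (c *\<^sub>R x)) (c *\<^sub>R h))) (at x)"
    if "\<psi> differentiable (at (c *\<^sub>R x))" for \<psi> :: "'a \<Rightarrow> real" and x
  proof -
    have "((\<lambda>x. c *\<^sub>R x) has_derivative (\<lambda>h. c *\<^sub>R h)) (at x)" by (auto intro!: derivative_eq_intros)
    from has_derivative_compose[OF this that[unfolded frechet_derivative_works]] show ?thesis .
  qed
  have pd: "pd i (\<lambda>x. \<psi> (c *\<^sub>R x)) = (\<lambda>x. c * pd i \<psi> (c *\<^sub>R x))"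
    if "\<And>x. \<psi> differentiable (at x)" for \<psi> :: "'a \<Rightarrow> real" and i
  proof
    fix x
    show "pd i (\<lambda>x. \<psi> (c *\<^sub>R x)) x = c * pd i \<psi> (c *\<^sub>R x)"
      using pd_eq[OF hd[OF that], where i=i and x=x] linear_frechet_derivative[OF that, of "c *\<^sub>R x"] by (simp add: linear_cmul)
  qed
  show "pd i (\<lambda>x. \<phi> (c *\<^sub>R x)) x = c * pd i \<phi> (c *\<^sub>R x)"
    by (rule fun_cong[OF pd[OF smooth_differentiable[OF test_fun_smooth[OF t]]]])
  have "\<forall>\<psi> :: 'a \<Rightarrow> real. \<psi> \<in> Ck k \<longrightarrow> (\<lambda>x. \<psi> (c *\<^sub>R x)) \<in> Ck k" for k
  proof (induction k)
    case 0
    then show ?case by (auto intro!: continuous_on_compose2[of UNIV _ _ "\<lambda>x. c *\<^sub>R x"] continuous_intros)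
  next
    case (Suc k)
    have "(\<lambda>x. \<psi> (c *\<^sub>R x)) differentiable (at x)" if "\<And>x. \<psi> differentiable (at x)" for \<psi> :: "'a \<Rightarrow> real" and x
      using hd[of \<psi> x] that unfolding differentiable_def by blast
    moreover have "pd i (\<lambda>x. \<psi> (c *\<^sub>R x)) \<in> Ck k" if "\<And>x. \<psi> differentiable (at x)" "pd i \<psi> \<in> Ck k"
      for \<psi> :: "'a \<Rightarrow> real" and i
      unfolding pd[OF that(1)] by (intro Ck_mult Ck_const Suc.IH[rule_format, OF that(2)])
    ultimately show ?case by simp
  qed
  then have "smooth (\<lambda>x. \<phi> (c *\<^sub>R x))" using t by (auto simp: test_fun_def smooth_def)
  moreover obtain r where r: "\<And>x. norm x > r \<Longrightarrow> \<phi> x = 0" using t by (auto simp: test_fun_iff)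
  have "\<phi> (c *\<^sub>R x) = 0" if "norm x > r / c" for x
    by (rule r) (use that c in \<open>simp add: divide_simps mult.commute\<close>)
  ultimately show "test_fun (\<lambda>x. \<phi> (c *\<^sub>R x))" by (rule test_funI)
qed

lemma norm2_add_scaled: "(norm (p + t *\<^sub>R q))\<^sup>2 = (norm p)\<^sup>2 + 2 * t * (p \<bullet> q) + t\<^sup>2 * (norm q)\<^sup>2"
  for p q :: "'a::real_inner"
  unfolding power2_norm_eq_inner power2_eq_square[of t]
  by (simp add: inner_add_left inner_add_right inner_commute[of q p] algebra_simps)

lemma H1p_add_scaled:
  assumes u: "H1p u G" and v: "H1p v Z"
  shows "H1p (\<lambda>x. u x + t * v x) (\<lambda>x. G x + t *\<^sub>R Z x)"
  unfolding H1p_def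
proof (intro conjI ballI)
  have [measurable]: "G \<in> borel_measurable lebesgue" "Z \<in> borel_measurable lebesgue"
    using u v by (auto simp: H1p_def)
  show "L2 (\<lambda>x. u x + t * v x)" using u v by (intro L2_add L2_cmult) (auto dest: H1p_D)
  show "(\<lambda>x. G x + t *\<^sub>R Z x) \<in> borel_measurable lebesgue" by measurable
  fix i :: 'a assume i: "i \<in> Basis"
  show "wd i (\<lambda>x. u x + t * v x) (\<lambda>x. (G x + t *\<^sub>R Z x) \<bullet> i)"
    using wd_add[OF H1p_D(3)[OF u i] wd_cmult[OF H1p_D(3)[OF v i]] i] by (simp add: inner_add_left)
  show "L2 (\<lambda>x. (G x + t *\<^sub>R Z x) \<bullet> i)"
    using L2_add[OF H1p_D(4)[OF u i] L2_cmult[OF H1p_D(4)[OF v i]]] by (simp add: inner_add_left)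
qed

lemma inner_sum_Basis: "k \<in> Basis \<Longrightarrow> (\<Sum>i\<in>Basis. f i *\<^sub>R i) \<bullet> k = f k" for k :: "'a::euclidean_space"
  by (simp add: inner_sum_left inner_Basis if_distrib sum.delta cong: if_cong)

lemma H1p_components:
  assumes "L2 v" "\<And>i. i \<in> Basis \<Longrightarrow> wd i v (Z i)" "\<And>i. i \<in> Basis \<Longrightarrow> L2 (Z i)"
  shows "H1p v (\<lambda>x. \<Sum>i\<in>Basis. Z i x *\<^sub>R i)"
  unfolding H1p_def
proof (intro conjI ballI)
  show "(\<lambda>x. \<Sum>i\<in>Basis. Z i x *\<^sub>R i) \<in> borel_measurable lebesgue"
    by (rule measurable_of_components) (simp add: inner_sum_Basis L2_measurable assms)
qed (use assms in \<open>auto simp: inner_sum_Basis\<close>)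

section \<open>Comparison from above\<close>

context segregated_minimizer
begin

text \<open>For 0 < t < 1 the function u l - t \<zeta> lies between (1 - t) u l and u l, so it has
  the zero set of u l; segregation and constraint survive. Only lowering is possible in this way,
  hence an inequality.\<close>

lemma first_variation:
  assumes l: "l \<in> {1..m}" and \<zeta>: "H1p \<zeta> Z" "integrable lebesgue \<zeta>"
    and b: "AE y in lebesgue. 0 \<le> \<zeta> y \<and> \<zeta> y \<le> u l y"
  shows "(\<integral>y. wgrad (u l) y \<bullet> Z y \<partial>lebesgue) \<le> (\<integral>y. (\<mu> l y - 1) * \<zeta> y \<partial>lebesgue)"
proof -
  define g where "g = wgrad (u l)"
  define f where "f y = \<mu> l y - 1" for y
  have ug: "H1p (u l) g" using u_facts(1)[OF l] by (simp add: g_def)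
  have i1: "integrable lebesgue (\<lambda>y. (norm (g y))\<^sup>2)" by (rule integrable_norm2[OF H1p_D(4)[OF ug]])
  have i2: "integrable lebesgue (\<lambda>y. (norm (Z y))\<^sup>2)" by (rule integrable_norm2[OF H1p_D(4)[OF \<zeta>(1)]])
  have i3: "integrable lebesgue (\<lambda>y. g y \<bullet> Z y)" by (rule integrable_inner2[OF H1p_D(4)[OF ug] H1p_D(4)[OF \<zeta>(1)]])
  have fi: "integrable lebesgue (\<lambda>y. f y * v y)" if "integrable lebesgue v" for v
    using mu_mult_integrable[OF l loc_int_integrable[OF that]] that by (auto simp: f_def left_diff_distrib)
  define N where "N = (\<integral>y. (norm (Z y))\<^sup>2 \<partial>lebesgue)"
  define d where "d = (\<integral>y. g y \<bullet> Z y \<partial>lebesgue) - (\<integral>y. f y * \<zeta> y \<partial>lebesgue)"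
  have key: "2 * d \<le> t * N" if t: "0 < t" "t < 1" for t
  proof -
    define v where "v i = (if i = l then (\<lambda>y. u l y + (- t) * \<zeta> y) else u i)" for i
    define G where "G i = (if i = l then (\<lambda>y. g y + (- t) *\<^sub>R Z y) else wgrad (u i))" for i
    have vl: "AE y in lebesgue. (1 - t) * u l y \<le> v l y \<and> v l y \<le> u l y"
      using b
    proof eventually_elim
      case (elim y)
      then have "t * \<zeta> y \<le> t * u l y" "0 \<le> t * \<zeta> y" using t by (auto intro: mult_left_mono)
      then show ?case by (simp add: v_def algebra_simps)
    qed
    have vpos: "AE y in lebesgue. v i y \<ge> 0 \<and> (v i y = 0 \<longleftrightarrow> u i y = 0)" if i: "i \<in> {1..m}" for i
    proof (cases "i = l")
      case True
      show ?thesis using vl u_facts(2)[OF l]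
      proof eventually_elim
        case (elim y)
        have "0 \<le> (1 - t) * u l y" using t elim by simp
        moreover have "u l y = 0" if "v l y = 0"
        proof -
          have "(1 - t) * u l y \<le> 0" using elim that by simp
          then show ?thesis using t elim by (simp add: mult_le_0_iff)
        qed
        moreover have "v l y = 0" if "u l y = 0" using elim that by simp
        ultimately show ?case using True elim by auto
      qed
    next
      case False
      then show ?thesis using u_facts(2)[OF i] by (simp add: v_def)
    qed
    have "admissible v G"
      unfolding admissible_def
    proof (intro ballI conjI impI)
      fix i assume i: "i \<in> {1..m}"
      show "H1p (v i) (G i)"
        using H1p_add_scaled[OF ug \<zeta>(1), of "- t"] u_facts(1)[OF i] by (auto simp: v_def G_def)
      show "integrable lebesgue (v i)" using u_integrable[OF i] \<zeta>(2) u_integrable[OF l] by (auto simp: v_def)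
      show "AE y in lebesgue. 0 \<le> v i y" using vpos[OF i] by eventually_elim simp
      show "AE y in lebesgue. v i y = 0 \<longrightarrow> \<mu> i y = 0"
        using vpos[OF i] u_facts(4)[OF i] by eventually_elim simp
      fix k assume k: "k \<in> {1..m}" "i \<noteq> k"
      show "AE y in lebesgue. v i y * v k y = 0"
        using vpos[OF i] vpos[OF k(1)] u_facts(5)[OF i k] by eventually_elim auto
    qed
    from minimality[OF this] have
      "En f (u l) g + (\<Sum>i\<in>{1..m} - {l}. En (\<lambda>y. \<mu> i y - 1) (u i) (wgrad (u i))) \<le>
       En f (v l) (G l) + (\<Sum>i\<in>{1..m} - {l}. En (\<lambda>y. \<mu> i y - 1) (v i) (G i))"
      unfolding sum.remove[OF finite_atLeastAtMost l] by (simp add: f_def[abs_def] g_def)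
    moreover have "(\<Sum>i\<in>{1..m} - {l}. En (\<lambda>y. \<mu> i y - 1) (v i) (G i)) = (\<Sum>i\<in>{1..m} - {l}. En (\<lambda>y. \<mu> i y - 1) (u i) (wgrad (u i)))"
      by (rule sum.cong) (auto simp: v_def G_def)
    ultimately have le: "En f (u l) g \<le> En f (v l) (G l)" by linarith
    have "En f (v l) (G l) = (\<integral>y. ((norm (g y))\<^sup>2 - 2 * (f y * u l y)) + (t\<^sup>2 * (norm (Z y))\<^sup>2 - 2 * t * (g y \<bullet> Z y) + 2 * t * (f y * \<zeta> y)) \<partial>lebesgue)"
      unfolding En_def v_def G_def
      by (rule Bochner_Integration.integral_cong)
        (simp_all only: refl if_True norm2_add_scaled, simp add: algebra_simps)
    also have "\<dots> = En f (u l) g + (t\<^sup>2 * N - 2 * t * (\<integral>y. g y \<bullet> Z y \<partial>lebesgue) + 2 * t * (\<integral>y. f y * \<zeta> y \<partial>lebesgue))"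
      unfolding En_def N_def using i1 i2 i3 fi[OF \<zeta>(2)] fi[OF u_integrable[OF l]]
      by (simp add: mult.assoc)
    finally have "0 \<le> t * (t * N - 2 * d)" using le by (simp add: d_def power2_eq_square algebra_simps)
    then show ?thesis using t by (simp add: zero_le_mult_iff)
  qed
  have N: "N \<ge> 0" unfolding N_def by (rule Bochner_Integration.integral_nonneg) simp
  have "d \<le> 0"
  proof (rule ccontr)
    assume "\<not> d \<le> 0"
    then have d: "d > 0" by simp
    \<comment> \<open>Gives t N \<le> d, against 2 d \<le> t N and d > 0. The denominator is N + 1
      because N may be 0.\<close>
    define t where "t = min (1 / 2) (d / (N + 1))"
    have t: "0 < t" "t < 1" using d N by (auto simp: t_def)
    have "t * N \<le> d / (N + 1) * N" using N by (intro mult_right_mono) (auto simp: t_def)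
    also have "\<dots> \<le> d" using d N by (simp add: divide_simps)
    finally show False using key[OF t] d by linarith
  qed
  then show ?thesis by (simp add: d_def g_def f_def)
qed

theorem upper_bound:
  assumes n: "DIM('a) \<ge> 2" and l: "l \<in> {1..m}" and R: "R > 0" and b: "b > 0"
    and vol: "(\<integral>y. \<mu> l y \<partial>lebesgue) \<le> vol_ball TYPE('a) b"
    and far: "AE z in lebesgue. \<mu> l z \<noteq> 0 \<longrightarrow> 2 * R \<le> dist x z"
    and \<kappa>: "0 \<le> \<kappa>" "Psi TYPE('a) R - Psi TYPE('a) b \<le> \<kappa>"
  shows "AE y in lebesgue. y \<in> ball x R \<longrightarrow> u l y \<le> \<kappa> * (\<integral>y. \<mu> l y \<partial>lebesgue)"
proof -
  define U where "U = u l"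
  define g where "g = wgrad U"
  have ug: "H1p U g" using u_facts(1)[OF l] by (simp add: g_def U_def)
  have U_int: "integrable lebesgue U" using u_integrable[OF l] by (simp add: U_def)
  have U_L2: "L2 U" using H1p_D(1)[OF ug] .
  have Um: "U \<in> borel_measurable lebesgue" using U_L2 by (rule L2_measurable)
  have U0: "AE y in lebesgue. U y \<ge> 0" using u_facts(2)[OF l] by (simp add: U_def)
  obtain \<Lambda> where \<Lambda>: "\<Lambda> \<ge> 0" "AE y in lebesgue. \<bar>\<mu> l y\<bar> \<le> \<Lambda>" by (rule mu_bound[OF l])
  obtain \<nu>1 where \<nu>1: "\<nu>1 \<in> borel_measurable borel" "integrable lborel \<nu>1" "AE y in lebesgue. \<mu> l y = \<nu>1 y"
    using borel_version[OF mu_integrable[OF l]] by blast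
  \<comment> \<open>A Borel version of the density, clipped so that 0 \<le> \<nu> \<le> \<Lambda>
    holds everywhere and not only almost everywhere.\<close>
  define \<nu> where "\<nu> y = min \<Lambda> (max 0 (\<nu>1 y))" for y
  have \<nu>m [measurable]: "\<nu> \<in> borel_measurable borel" using \<nu>1(1) unfolding \<nu>_def[abs_def] by measurable
  have \<nu>b: "0 \<le> \<nu> y" "\<nu> y \<le> \<Lambda>" for y using \<Lambda>(1) by (auto simp: \<nu>_def)
  have \<nu>: "integrable lborel \<nu>"
    by (rule Bochner_Integration.integrable_bound[OF \<nu>1(2)]) (use \<Lambda>(1) in \<open>auto simp: \<nu>_def intro!: AE_I2\<close>)
  have \<nu>ae: "AE y in lebesgue. \<mu> l y = \<nu> y"
    using \<nu>1(3) \<Lambda>(2) mu_nonneg[rule_format, OF l] by eventually_elim (auto simp: \<nu>_def)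
  have \<nu>I: "(\<integral>z. \<nu> z \<partial>lborel) = (\<integral>y. \<mu> l y \<partial>lebesgue)"
  proof -
    have "(\<integral>z. \<nu> z \<partial>lborel) = (\<integral>z. \<nu> z \<partial>lebesgue)" by (simp add: integral_completion)
    also have "\<dots> = (\<integral>y. \<mu> l y \<partial>lebesgue)"
      by (rule integral_cong_AE) (use \<nu>ae mu_measurable[OF l] borel_imp_lebesgue[OF \<nu>m] in auto)
    finally show ?thesis .
  qed
  \<comment> \<open>Radii tending to 0 with a \<le> b, as the kernel requires, and a \<le> R, so
    that points at distance at least R lie outside the averaging ball.\<close>
  define a' where "a' k = min R b / real (Suc k)" for k
  have a'0: "a' k > 0" for k using R b by (simp add: a'_def)
  have a'le: "a' k \<le> R" "a' k \<le> b" for k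
  proof -
    have "a' k \<le> min R b / 1" unfolding a'_def using R b by (intro divide_left_mono) auto
    then show "a' k \<le> R" "a' k \<le> b" by auto
  qed
  have a'anti: "a' k' \<le> a' k" if "k \<le> k'" for k k'
    unfolding a'_def using R b that by (intro divide_left_mono) auto
  have a'lim: "a' \<longlonglongrightarrow> 0"
  proof -
    have "(\<lambda>k. min R b * (1 / real (Suc k))) \<longlonglongrightarrow> min R b * 0"
      by (intro tendsto_mult tendsto_const LIMSEQ_Suc[OF lim_1_over_n])
    then show ?thesis by (simp add: a'_def[abs_def])
  qed
  have "(\<lambda>k. \<integral>y. norm (\<bar>cv (avk (a' k)) \<nu> y - \<nu> y\<bar>) \<partial>lborel) \<longlonglongrightarrow> 0"
    using cv_L1_tendsto[OF avk_kernel[OF a'0] a'lim \<nu>] by simp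
  \<comment> \<open>Means over balls converge in L1, hence a.e. along a subsequence; this takes the
    place of the Lebesgue differentiation theorem.\<close>
  then obtain s :: "nat \<Rightarrow> nat" where s: "strict_mono s" "AE y in lborel. (\<lambda>k. \<bar>cv (avk (a' (s k))) \<nu> y - \<nu> y\<bar>) \<longlonglongrightarrow> 0"
    using tendsto_L1_AE_subseq[of lborel "\<lambda>k y. \<bar>cv (avk (a' k)) \<nu> y - \<nu> y\<bar>", OF cv_diff_integrable[OF avk_kernel[OF a'0] \<nu>]]
    by blast
  define a where "a k = a' (s k)" for k
  have a: "a k > 0" "a k \<le> R" "a k \<le> b" for k using a'0 a'le by (auto simp: a_def)
  have aanti: "a (Suc k) \<le> a k" for k unfolding a_def using s(1) by (intro a'anti) (simp add: strict_mono_less_eq)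
  define E where "E k y = \<bar>cv (avk (a k)) \<nu> y - \<nu> y\<bar>" for k y
  have Em [measurable]: "E k \<in> borel_measurable borel" for k unfolding E_def[abs_def] by measurable
  have cvb: "\<bar>cv (avk (a k)) \<nu> y\<bar> \<le> \<Lambda>" for k y
  proof -
    have "norm (\<integral>z. \<nu> (y + z) * avk (a k) z \<partial>lborel) \<le> (\<integral>z. \<Lambda> * avk (a k) (z::'a) \<partial>lborel)"
    proof (rule Bochner_Integration.integral_norm_bound_integral)
      have k: "kernel (a k) (avk (a k) :: 'a \<Rightarrow> real)" using avk_kernel[OF a(1)] .
      then show i: "integrable lborel (\<lambda>z::'a. \<Lambda> * avk (a k) z)" by (simp add: kernel_def)
      show nb: "norm (\<nu> (y + z) * avk (a k) z) \<le> \<Lambda> * avk (a k) z" for z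
        using \<nu>b[of "y + z"] k by (auto simp: abs_mult kernel_def intro!: mult_right_mono)
      have "norm (\<nu> (y + z) * avk (a k) z) \<le> norm (\<Lambda> * avk (a k) z)" for z
        using nb[of z] by (rule order_trans) simp
      then show "integrable lborel (\<lambda>z. \<nu> (y + z) * avk (a k) z)"
        by (intro Bochner_Integration.integrable_bound[OF i]) auto
    qed
    also have "(\<integral>z. \<Lambda> * avk (a k) (z::'a) \<partial>lborel) = \<Lambda>" using avk_kernel[OF a(1)[of k], where 'a='a] by (simp add: kernel_def)
    finally show ?thesis by (simp add: cv_def)
  qed
  have Eb: "0 \<le> E k y" "E k y \<le> 2 * \<Lambda>" for k y
    using cvb[of k y] \<nu>b[of y] by (auto simp: E_def)
  have EU_int: "integrable lebesgue (\<lambda>y. E k y * U y)" for k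
  proof (rule Bochner_Integration.integrable_bound[where f="\<lambda>y. (2 * \<Lambda>) * \<bar>U y\<bar>"])
    show "(\<lambda>y. E k y * U y) \<in> borel_measurable lebesgue"
      by (intro borel_measurable_times Um borel_imp_lebesgue Em)
    show "AE y in lebesgue. norm (E k y * U y) \<le> norm ((2 * \<Lambda>) * \<bar>U y\<bar>)"
      using Eb[of k] \<Lambda>(1) by (auto simp: abs_mult intro!: AE_I2 mult_right_mono)
  qed (use U_int in simp)
  \<comment> \<open>The total error caused by averaging. All means are bounded by \<Lambda>, so 2
    \<Lambda> |U| dominates.\<close>
  have EU: "(\<lambda>k. \<integral>y. E k y * U y \<partial>lebesgue) \<longlonglongrightarrow> 0"
  proof -
    have "(\<lambda>k. \<integral>y. E k y * U y \<partial>lebesgue) \<longlonglongrightarrow> (\<integral>y. 0 \<partial>(lebesgue :: 'a measure))"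
    proof (rule integral_dominated_convergence[where w="\<lambda>y. (2 * \<Lambda>) * \<bar>U y\<bar>"])
      show "(\<lambda>y. E k y * U y) \<in> borel_measurable lebesgue" for k using EU_int by auto
      show "AE y in lebesgue. (\<lambda>k. E k y * U y) \<longlonglongrightarrow> 0"
        using AE_completion[OF s(2)] by eventually_elim (auto simp: E_def a_def intro!: tendsto_mult_left_zero)
      show "AE y in lebesgue. norm (E k y * U y) \<le> (2 * \<Lambda>) * \<bar>U y\<bar>" for k
        using Eb[of k] by (auto simp: abs_mult intro!: AE_I2 mult_right_mono)
    qed (use U_int in auto)
    then show ?thesis by simp
  qed
  define \<psi> where "\<psi> k = cnv (Vk (a k) b) \<nu>" for k
  define X where "X k i = cnv (Kk (a k) b i) \<nu>" for k i
  have wX: "wd i (\<psi> k) (X k i)" if "i \<in> Basis" for i k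
    unfolding \<psi>_def X_def by (rule wd_potential[OF a(1,3) \<nu> that])
  have Xm: "X k i \<in> borel_measurable borel" for k i
    unfolding X_def by (intro cnv_measurable Kk_borel \<nu>m a b)
  have Xb: "\<exists>B. \<forall>y. \<bar>X k i y\<bar> \<le> B" for k i
  proof -
    obtain C where C: "\<And>y::'a. \<bar>Kk (a k) b i y\<bar> \<le> C" by (rule Kk_bounds[OF a(1,3), where 'a='a and i=i]) blast
    show ?thesis unfolding X_def using cnv_bounded[OF Kk_borel[OF a(1) b] C \<nu>] by blast
  qed
  have \<psi>i: "integrable lborel (\<lambda>z. Vk (a k) b (y - z) * \<nu> z)" for k y
  proof -
    obtain B where B: "\<And>y::'a. \<bar>Vk (a k) b y\<bar> \<le> B" by (rule Vk_bounds[OF a(1,3), where 'a='a]) blast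
    show ?thesis by (rule cnv_integrable[OF Vk_borel[OF a(1) b] B \<nu>])
  qed
  have \<psi>m: "\<psi> k \<in> borel_measurable borel" for k unfolding \<psi>_def by (intro cnv_measurable Vk_borel \<nu>m a b)
  have \<psi>0: "0 \<le> \<psi> k y" for k y
    unfolding \<psi>_def cnv_def by (intro Bochner_Integration.integral_nonneg mult_nonneg_nonneg Vk_nonneg a \<nu>b)
  have \<psi>mono: "\<psi> k y \<le> \<psi> (Suc k) y" for k y
    unfolding \<psi>_def cnv_def
    by (intro integral_mono \<psi>i mult_right_mono Vk_antimono a aanti \<nu>b)
  \<comment> \<open>If |y - x| < R and \<nu> does not vanish at z, then z has distance at least 2 R
    from x, so |y - z| \<ge> R; in that range \<open>Vk\<close> is controlled by \<Psi>.\<close>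
  have \<psi>le: "\<psi> k y \<le> \<kappa> * (\<integral>y. \<mu> l y \<partial>lebesgue)" if y: "y \<in> ball x R" for k y
  proof -
    have "\<psi> k y = (\<integral>z. Vk (a k) b (y - z) * \<nu> z \<partial>lebesgue)"
      unfolding \<psi>_def cnv_def using \<psi>i[of k y] by (subst integral_completion) auto
    also have "\<dots> \<le> (\<integral>z. \<kappa> * \<nu> z \<partial>lebesgue)"
    proof (rule integral_mono_AE)
      show "integrable lebesgue (\<lambda>z. Vk (a k) b (y - z) * \<nu> z)"
        using \<psi>i[of k y] by (subst integrable_completion) auto
      show "integrable lebesgue (\<lambda>z. \<kappa> * \<nu> z)" using \<nu> by (simp add: integrable_completion)
      show "AE z in lebesgue. Vk (a k) b (y - z) * \<nu> z \<le> \<kappa> * \<nu> z"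
        using far \<nu>ae
      proof eventually_elim
        case (elim z)
        show ?case
        proof (cases "\<nu> z = 0")
          case False
          then have "2 * R \<le> dist x z" using elim by simp
          moreover have "dist x y < R" using y by simp
          ultimately have nz: "R \<le> norm (y - z)" using dist_triangle[of x z y] by (simp add: dist_norm)
          have "Vk (a k) b (y - z) \<le> max 0 (Psi TYPE('a) (norm (y - z)) - Psi TYPE('a) b)"
            by (rule Vk_le[OF n a(1) _ a(3)]) (use a(2)[of k] nz in linarith)
          also have "\<dots> \<le> \<kappa>" using \<kappa> Psi_antimono[OF n R nz] by simp
          finally show ?thesis using \<nu>b by (intro mult_right_mono) auto
        qed simp
      qed
    qed
    also have "\<dots> = \<kappa> * (\<integral>y. \<mu> l y \<partial>lebesgue)" using \<nu>I by (simp add: integral_completion)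
    finally show ?thesis .
  qed
  define \<phi> where "\<phi> k y = max 0 (U y - \<psi> k y)" for k y
  define P where "P k i y = (if 0 < U y - \<psi> k y then g y \<bullet> i - X k i y else 0)" for k i y
  have w\<phi>: "wd i (\<phi> k) (P k i)" if "i \<in> Basis" for i k
    unfolding \<phi>_def[abs_def] P_def[abs_def]
    by (rule wd_pos[OF wd_diff[OF H1p_D(3)[OF ug that] wX[OF that] that] that])
  have \<phi>m: "\<phi> k \<in> borel_measurable lebesgue" for k
    unfolding \<phi>_def[abs_def] using Um borel_imp_lebesgue[OF \<psi>m[of k]] by measurable
  have Pm: "P k i \<in> borel_measurable lebesgue" if "i \<in> Basis" for k i
    using w\<phi>[OF that] by (blast intro: loc_int_measurable dest: wdD)
  have \<phi>0: "0 \<le> \<phi> k y" for k y by (simp add: \<phi>_def)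
  have \<phi>U: "\<phi> k y \<le> \<bar>U y\<bar>" for k y using \<psi>0[of k y] by (auto simp: \<phi>_def)
  have \<phi>L2: "L2 (\<phi> k)" for k by (rule L2_dominated[OF U_L2 \<phi>m]) (use \<phi>0 \<phi>U in auto)
  obtain \<theta>1 :: "'a \<Rightarrow> real" where \<theta>1: "test_fun \<theta>1" "\<And>y. 0 \<le> \<theta>1 y \<and> \<theta>1 y \<le> 1" "\<And>y. dist 0 y \<le> 1 \<Longrightarrow> \<theta>1 y = 1"
    "\<And>y. dist 0 y \<ge> 2 \<Longrightarrow> \<theta>1 y = 0"
    by (rule cutoff_exists[of 1 2 "0::'a"]) auto
  have "\<forall>i\<in>Basis. \<exists>B. \<forall>y. \<bar>pd i \<theta>1 y\<bar> \<le> B" using test_fun_bounded[OF test_fun_pd[OF \<theta>1(1)]] by metis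
  then obtain B where B: "\<And>i y. i \<in> Basis \<Longrightarrow> \<bar>pd i \<theta>1 y\<bar> \<le> B i" by metis
  define e where "e k = 1 / real (Suc k)" for k
  have e0: "e k > 0" for k by (simp add: e_def)
  have elim0: "e \<longlonglongrightarrow> 0" unfolding e_def by (rule LIMSEQ_Suc[OF lim_1_over_n])
  \<comment> \<open>Cutoffs that are 1 on the ball of radius 1 / e k = k + 1, with gradient of order
    e k. They share the index k with the averaging radii, so a single limit removes both.\<close>
  define \<theta> where "\<theta> k y = \<theta>1 (e k *\<^sub>R y)" for k y
  have t\<theta>: "test_fun (\<theta> k)" for k unfolding \<theta>_def[abs_def] by (rule test_fun_scale(1)[OF \<theta>1(1) e0])
  have pd\<theta>: "pd i (\<theta> k) y = e k * pd i \<theta>1 (e k *\<^sub>R y)" for i k y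
    unfolding \<theta>_def[abs_def] by (rule test_fun_scale(2)[OF \<theta>1(1) e0])
  have \<theta>b: "0 \<le> \<theta> k y" "\<theta> k y \<le> 1" for k y using \<theta>1(2) by (auto simp: \<theta>_def)
  have \<theta>z: "\<theta> k y = 0" if "norm y > 2 / e k" for k y
    unfolding \<theta>_def using that e0[of k] by (intro \<theta>1(4)) (simp add: divide_simps mult.commute)
  have \<theta>one: "\<theta> k y = 1" if "norm y \<le> 1 / e k" for k y
    unfolding \<theta>_def using that e0[of k] by (intro \<theta>1(3)) (simp add: divide_simps mult.commute)
  have \<theta>m: "\<theta> k \<in> borel_measurable lebesgue" "pd i (\<theta> k) \<in> borel_measurable lebesgue" if "i \<in> Basis" for k i
    using t\<theta> test_fun_pd[OF t\<theta> that] by (auto intro: test_fun_lebesgue)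
  have pdb: "\<bar>pd i (\<theta> k) y\<bar> \<le> e k * B i" if "i \<in> Basis" for i k y
    unfolding pd\<theta> abs_mult using B[OF that] e0[of k] by (simp add: mult_left_mono)
  \<comment> \<open>The squared cutoff of a Caccioppoli estimate. Since 0 \<le> \<zeta> k \<le>
    \<phi> k \<le> U almost everywhere, it is a legitimate direction in
    \<open>first_variation\<close>.\<close>
  define \<zeta> where "\<zeta> k y = (\<theta> k y * \<theta> k y) * \<phi> k y" for k y
  define Z where "Z k i y = (\<theta> k y * \<theta> k y) * P k i y + (2 * \<theta> k y * pd i (\<theta> k) y) * \<phi> k y" for k i y
  have w\<zeta>: "wd i (\<zeta> k) (Z k i)" if i: "i \<in> Basis" for i k
  proof -
    have sm: "smooth (\<lambda>y. \<theta> k y * \<theta> k y)" by (intro smooth_mult test_fun_smooth t\<theta>)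
    have "pd i (\<lambda>y. \<theta> k y * \<theta> k y) y = 2 * \<theta> k y * pd i (\<theta> k) y" for y
      by (simp add: pd_mult[OF test_fun_smooth[OF t\<theta>] test_fun_smooth[OF t\<theta>]] mult_ac)
    then show ?thesis using wd_mult_smooth[OF w\<phi>[OF i] sm i, of k] unfolding \<zeta>_def[abs_def] Z_def[abs_def] by simp
  qed
  have \<theta>PL2: "L2 (\<lambda>y. \<theta> k y * P k i y)" if i: "i \<in> Basis" for k i
  proof -
    obtain C where C: "\<And>y. \<bar>X k i y\<bar> \<le> C" using Xb by blast
    have "L2 (\<lambda>y. X k i y * \<theta> k y)"
      using H1p_D(1)[OF H1p_test(1)[OF t\<theta>]] by (rule L2_mult_bounded) (use C borel_imp_lebesgue[OF Xm] in auto)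
    moreover have "L2 (\<lambda>y. \<theta> k y * (g y \<bullet> i))"
      by (rule L2_mult_bounded[OF H1p_D(4)[OF ug i] \<theta>m(1)[OF i], of k 1]) (use \<theta>b in auto)
    ultimately have "L2 (\<lambda>y. \<theta> k y * (g y \<bullet> i) - X k i y * \<theta> k y)" by (intro L2_diff)
    then show ?thesis
    proof (rule L2_dominated)
      show "(\<lambda>y. \<theta> k y * P k i y) \<in> borel_measurable lebesgue" by (intro borel_measurable_times \<theta>m(1)[OF i] Pm i)
      show "AE y in lebesgue. \<bar>\<theta> k y * P k i y\<bar> \<le> \<bar>\<theta> k y * (g y \<bullet> i) - X k i y * \<theta> k y\<bar>"
        by (rule AE_I2) (auto simp: P_def algebra_simps)
    qed
  qed
  have \<theta>\<phi>L2: "L2 (\<lambda>y. pd i (\<theta> k) y * \<phi> k y)" if i: "i \<in> Basis" for k i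
    by (rule L2_mult_bounded[OF \<phi>L2 \<theta>m(2)[OF i] pdb[OF i]])
  have ZL2: "L2 (Z k i)" if i: "i \<in> Basis" for k i
  proof -
    have "L2 (\<lambda>y. \<theta> k y * (\<theta> k y * P k i y) + \<theta> k y * (2 * (pd i (\<theta> k) y * \<phi> k y)))"
      by (intro L2_add L2_mult_bounded[where B=1 and F="\<theta> k"] \<theta>PL2 \<theta>\<phi>L2 L2_cmult i \<theta>m(1)[OF i]) (use \<theta>b in auto)
    then show ?thesis by (simp add: Z_def[abs_def] algebra_simps)
  qed
  have \<zeta>b: "0 \<le> \<zeta> k y" "\<zeta> k y \<le> \<phi> k y" for k y
  proof -
    have t: "0 \<le> \<theta> k y * \<theta> k y" "\<theta> k y * \<theta> k y \<le> 1" using \<theta>b[of k y] by (auto intro: mult_le_one)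
    show "0 \<le> \<zeta> k y" unfolding \<zeta>_def using t(1) \<phi>0 by (rule mult_nonneg_nonneg)
    show "\<zeta> k y \<le> \<phi> k y" unfolding \<zeta>_def using t \<phi>0[of k y] by (simp add: mult_left_le_one_le)
  qed
  have \<zeta>m: "\<zeta> k \<in> borel_measurable lebesgue" for k
    unfolding \<zeta>_def[abs_def] by (intro borel_measurable_times \<phi>m test_fun_lebesgue t\<theta>)
  have \<zeta>L2: "L2 (\<zeta> k)" for k by (rule L2_dominated[OF \<phi>L2[of k] \<zeta>m]) (use \<zeta>b \<phi>0 in auto)
  have \<zeta>int: "integrable lebesgue (\<zeta> k)" for k
    by (rule Bochner_Integration.integrable_bound[OF U_int \<zeta>m])
      (use \<zeta>b order_trans[OF \<zeta>b(2) \<phi>U] in auto)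
  have H\<zeta>: "H1p (\<zeta> k) (\<lambda>y. \<Sum>i\<in>Basis. Z k i y *\<^sub>R i)" for k
    by (rule H1p_components[OF \<zeta>L2 w\<zeta> ZL2])
  have fv: "(\<integral>y. g y \<bullet> (\<Sum>i\<in>Basis. Z k i y *\<^sub>R i) \<partial>lebesgue) \<le> (\<integral>y. (\<mu> l y - 1) * \<zeta> k y \<partial>lebesgue)" for k
    unfolding g_def U_def
  proof (rule first_variation[OF l H\<zeta> \<zeta>int])
    show "AE y in lebesgue. 0 \<le> \<zeta> k y \<and> \<zeta> k y \<le> u l y"
      using U0
    proof eventually_elim
      case (elim y)
      then show ?case using \<zeta>b[of k y] \<phi>U[of k y] by (simp add: U_def)
    qed
  qed
  have iPZ: "integrable lebesgue (\<lambda>y. P k i y * Z k i y)" if i: "i \<in> Basis" for k i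
  proof -
    have "integrable lebesgue (\<lambda>y. (\<theta> k y * P k i y) * (\<theta> k y * P k i y) + 2 * ((\<theta> k y * P k i y) * (pd i (\<theta> k) y * \<phi> k y)))"
      by (intro Bochner_Integration.integrable_add integrable_mult_right L2_integrable_mult \<theta>PL2 \<theta>\<phi>L2 i)
    then show ?thesis by (simp add: Z_def algebra_simps)
  qed
  have Z0: "Z k i y = 0" "\<zeta> k y = 0" if "norm y > 2 / e k" for k i y
    using \<theta>z[OF that] by (auto simp: Z_def \<zeta>_def)
  have Zint: "integrable lebesgue (Z k i)" if i: "i \<in> Basis" for k i
    using wd_test_local(3)[OF w\<zeta>[OF i] i smooth_const[of 1] Z0(2) Z0(1)] by simp
  have iXZ: "integrable lebesgue (\<lambda>y. X k i y * Z k i y)" if i: "i \<in> Basis" for k i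
  proof -
    obtain C where C: "\<And>y. \<bar>X k i y\<bar> \<le> C" using Xb by blast
    show ?thesis by (rule integrable_Linf_mult[OF borel_imp_lebesgue[OF Xm] _ Zint[OF i]]) (use C in auto)
  qed
  have avm: "cnv (avk c) \<nu> \<in> borel_measurable lebesgue" for c :: real
    by (rule borel_imp_lebesgue) measurable
  have avb: "\<bar>cnv (avk c) \<nu> y\<bar> \<le> 1 / vol_ball TYPE('a) c * (\<integral>z. \<bar>\<nu> z\<bar> \<partial>lborel)" if "c > 0" for c y
    by (rule cnv_bounded[OF avk_borel avk_bound[OF that] \<nu>])
  \<comment> \<open>Test with \<zeta> k and subtract the equation of the potential. The density
    cancels up to the error E k, and the mean over balls of radius b, which enters with a plus sign,
    is at most 1 and is absorbed by the - 1.\<close>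
  have step: "(\<Sum>i\<in>Basis. \<integral>y. P k i y * Z k i y \<partial>lebesgue) \<le> (\<integral>y. E k y * U y \<partial>lebesgue)" for k
  proof -
    \<comment> \<open>Z k i vanishes where U \<le> \<psi> k, and on the remaining set g is the sum
      of P and X.\<close>
    have gZ: "g y \<bullet> (\<Sum>i\<in>Basis. Z k i y *\<^sub>R i) = (\<Sum>i\<in>Basis. P k i y * Z k i y + X k i y * Z k i y)" for y
      unfolding inner_sum_right
      by (rule sum.cong[OF refl]) (auto simp: P_def Z_def \<phi>_def algebra_simps)
    have "(\<integral>y. g y \<bullet> (\<Sum>i\<in>Basis. Z k i y *\<^sub>R i) \<partial>lebesgue) =
        (\<Sum>i\<in>Basis. \<integral>y. P k i y * Z k i y \<partial>lebesgue) + (\<Sum>i\<in>Basis. \<integral>y. X k i y * Z k i y \<partial>lebesgue)"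
      unfolding gZ using iPZ iXZ by (simp add: sum.distrib)
    also have "(\<Sum>i\<in>Basis. \<integral>y. X k i y * Z k i y \<partial>lebesgue) =
        (\<integral>y. (cnv (avk (a k)) \<nu> y - cnv (avk b) \<nu> y) * \<zeta> k y \<partial>lebesgue)"
      unfolding X_def by (rule potential_laplacian[OF a(1,3) \<nu> w\<zeta> Z0(2) Z0(1)])
    finally have 1: "(\<Sum>i\<in>Basis. \<integral>y. P k i y * Z k i y \<partial>lebesgue) \<le>
        (\<integral>y. (\<mu> l y - 1) * \<zeta> k y \<partial>lebesgue) - (\<integral>y. (cnv (avk (a k)) \<nu> y - cnv (avk b) \<nu> y) * \<zeta> k y \<partial>lebesgue)"
      using fv[of k] by linarith
    have i1: "integrable lebesgue (\<lambda>y. (\<mu> l y - 1) * \<zeta> k y)"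
      using mu_mult_integrable[OF l loc_int_integrable[OF \<zeta>int]] \<zeta>int by (simp add: left_diff_distrib)
    have i2: "integrable lebesgue (\<lambda>y. (cnv (avk (a k)) \<nu> y - cnv (avk b) \<nu> y) * \<zeta> k y)"
    proof (rule integrable_Linf_mult[OF _ _ \<zeta>int])
      show "(\<lambda>y. cnv (avk (a k)) \<nu> y - cnv (avk b) \<nu> y) \<in> borel_measurable lebesgue"
        by (intro borel_measurable_diff avm)
      show "AE y in lebesgue. \<bar>cnv (avk (a k)) \<nu> y - cnv (avk b) \<nu> y\<bar> \<le> 1 / vol_ball TYPE('a) (a k) * (\<integral>z. \<bar>\<nu> z\<bar> \<partial>lborel)
          + 1 / vol_ball TYPE('a) b * (\<integral>z. \<bar>\<nu> z\<bar> \<partial>lborel)"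
        using avb[OF a(1)[of k]] avb[OF b] by (intro AE_I2) (smt (verit))
    qed
    have "(\<integral>y. (\<mu> l y - 1) * \<zeta> k y \<partial>lebesgue) - (\<integral>y. (cnv (avk (a k)) \<nu> y - cnv (avk b) \<nu> y) * \<zeta> k y \<partial>lebesgue) =
        (\<integral>y. (\<mu> l y - 1) * \<zeta> k y - (cnv (avk (a k)) \<nu> y - cnv (avk b) \<nu> y) * \<zeta> k y \<partial>lebesgue)"
      using i1 i2 by simp
    also have "\<dots> \<le> (\<integral>y. E k y * U y \<partial>lebesgue)"
    proof (rule integral_mono_AE[OF _ EU_int])
      show "integrable lebesgue (\<lambda>y. (\<mu> l y - 1) * \<zeta> k y - (cnv (avk (a k)) \<nu> y - cnv (avk b) \<nu> y) * \<zeta> k y)"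
        using i1 i2 by simp
      show "AE y in lebesgue. (\<mu> l y - 1) * \<zeta> k y - (cnv (avk (a k)) \<nu> y - cnv (avk b) \<nu> y) * \<zeta> k y \<le> E k y * U y"
        using \<nu>ae U0
      proof eventually_elim
        case (elim y)
        have v: "vol_ball TYPE('a) b > 0" using vol_ball_pos[OF b] .
        have "1 / vol_ball TYPE('a) b * (\<integral>z. \<bar>\<nu> z\<bar> \<partial>lborel) \<le> 1"
          using vol v \<nu>I \<nu>b by (simp add: divide_simps)
        then have av1: "cnv (avk b) \<nu> y \<le> 1" using avb[OF b, of y] by linarith
        have "\<mu> l y - 1 - (cnv (avk (a k)) \<nu> y - cnv (avk b) \<nu> y) \<le> E k y"
          using av1 elim(1) unfolding E_def cnv_avk[OF \<nu>m] by linarith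
        then have "(\<mu> l y - 1 - (cnv (avk (a k)) \<nu> y - cnv (avk b) \<nu> y)) * \<zeta> k y \<le> E k y * \<zeta> k y"
          using \<zeta>b(1) by (intro mult_right_mono) auto
        also have "\<dots> \<le> E k y * U y"
          using \<zeta>b(2)[of k y] \<phi>U[of k y] elim(2) Eb(1) by (intro mult_left_mono) auto
        finally show ?case by (simp add: left_diff_distrib)
      qed
    qed
    finally show ?thesis using 1 by linarith
  qed
  obtain i0 :: 'a where i0: "i0 \<in> Basis" using nonempty_Basis by blast
  \<comment> \<open>A single direction suffices, because \<open>wd_zero_integrable\<close> needs
    only one vanishing partial derivative.\<close>
  define T where "T k = (\<integral>y. (\<theta> k y * P k i0 y)\<^sup>2 \<partial>lebesgue)" for k
  define c2 where "c2 = (\<integral>y. (U y)\<^sup>2 \<partial>lebesgue)"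
  have T0: "T k \<ge> 0" for k unfolding T_def by (rule Bochner_Integration.integral_nonneg) simp
  have Tle: "T k \<le> 2 * (\<integral>y. E k y * U y \<partial>lebesgue) + 4 * ((\<Sum>i\<in>Basis. (e k * B i)\<^sup>2) * c2)" for k
  proof -
    have one: "(\<integral>y. (\<theta> k y * P k i y)\<^sup>2 \<partial>lebesgue) \<le> 2 * (\<integral>y. P k i y * Z k i y \<partial>lebesgue) + 4 * ((e k * B i)\<^sup>2 * c2)"
      if i: "i \<in> Basis" for i
    proof -
      have q: "integrable lebesgue (\<lambda>y. (\<theta> k y * P k i y)\<^sup>2)" "integrable lebesgue (\<lambda>y. (pd i (\<theta> k) y * \<phi> k y)\<^sup>2)"
        using \<theta>PL2[OF i] \<theta>\<phi>L2[OF i] by (auto simp: L2_def)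
      have "(\<integral>y. (\<theta> k y * P k i y)\<^sup>2 \<partial>lebesgue) \<le> (\<integral>y. 2 * (P k i y * Z k i y) + 4 * (pd i (\<theta> k) y * \<phi> k y)\<^sup>2 \<partial>lebesgue)"
      proof (rule integral_mono)
        fix y
        \<comment> \<open>Absorbs the mixed term contained in P Z: the difference of the two sides
          of the estimate is exactly this square.\<close>
        have "0 \<le> (\<theta> k y * P k i y + 2 * (pd i (\<theta> k) y * \<phi> k y))\<^sup>2" by simp
        then show "(\<theta> k y * P k i y)\<^sup>2 \<le> 2 * (P k i y * Z k i y) + 4 * (pd i (\<theta> k) y * \<phi> k y)\<^sup>2"
          by (simp add: Z_def power2_eq_square algebra_simps)
      qed (use q iPZ[OF i] in auto)
      also have "\<dots> = 2 * (\<integral>y. P k i y * Z k i y \<partial>lebesgue) + 4 * (\<integral>y. (pd i (\<theta> k) y * \<phi> k y)\<^sup>2 \<partial>lebesgue)"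
        using q iPZ[OF i] by simp
      also have "(\<integral>y. (pd i (\<theta> k) y * \<phi> k y)\<^sup>2 \<partial>lebesgue) \<le> (\<integral>y. (e k * B i)\<^sup>2 * (U y)\<^sup>2 \<partial>lebesgue)"
      proof (rule integral_mono)
        show "integrable lebesgue (\<lambda>y. (e k * B i)\<^sup>2 * (U y)\<^sup>2)" using U_L2 by (simp add: L2_def)
        fix y
        have "\<bar>pd i (\<theta> k) y * \<phi> k y\<bar> \<le> (e k * B i) * \<bar>U y\<bar>"
          unfolding abs_mult using pdb[OF i, of k y] \<phi>U[of k y] \<phi>0[of k y] by (intro mult_mono) auto
        then have "(pd i (\<theta> k) y * \<phi> k y)\<^sup>2 \<le> ((e k * B i) * \<bar>U y\<bar>)\<^sup>2" by (rule abs_le_square_iff[THEN iffD1, OF order_trans[OF _ abs_ge_self]])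
        then show "(pd i (\<theta> k) y * \<phi> k y)\<^sup>2 \<le> (e k * B i)\<^sup>2 * (U y)\<^sup>2" by (simp add: power_mult_distrib)
      qed (use q in auto)
      finally show ?thesis by (simp add: c2_def)
    qed
    have "T k \<le> (\<Sum>i\<in>Basis. \<integral>y. (\<theta> k y * P k i y)\<^sup>2 \<partial>lebesgue)"
      unfolding T_def by (rule member_le_sum[OF i0]) (auto intro: Bochner_Integration.integral_nonneg)
    also have "\<dots> \<le> (\<Sum>i\<in>Basis. 2 * (\<integral>y. P k i y * Z k i y \<partial>lebesgue) + 4 * ((e k * B i)\<^sup>2 * c2))"
      by (rule sum_mono) (rule one)
    also have "\<dots> = 2 * (\<Sum>i\<in>Basis. \<integral>y. P k i y * Z k i y \<partial>lebesgue) + 4 * ((\<Sum>i\<in>Basis. (e k * B i)\<^sup>2) * c2)"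
      by (simp add: sum.distrib sum_distrib_left sum_distrib_right)
    finally show ?thesis using step[of k] by linarith
  qed
  have Tlim: "T \<longlonglongrightarrow> 0"
  proof (rule tendsto_sandwich[OF _ _ tendsto_const])
    have "(\<lambda>k. 2 * (\<integral>y. E k y * U y \<partial>lebesgue) + 4 * ((\<Sum>i\<in>Basis. (e k * B i)\<^sup>2) * c2)) \<longlonglongrightarrow>
        2 * 0 + 4 * ((\<Sum>i\<in>(Basis::'a set). (0 * B i)\<^sup>2) * c2)"
      by (intro tendsto_intros EU elim0)
    then show "(\<lambda>k. 2 * (\<integral>y. E k y * U y \<partial>lebesgue) + 4 * ((\<Sum>i\<in>Basis. (e k * B i)\<^sup>2) * c2)) \<longlonglongrightarrow> 0" by simp
  qed (use T0 Tle in auto)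
  \<comment> \<open>As a k decreases, \<psi> k increases and \<phi> k decreases. The pointwise limit
    thus exists by monotonicity, without a compactness argument.\<close>
  have "\<exists>L. (\<lambda>k. \<phi> k y) \<longlonglongrightarrow> L" for y
  proof -
    have "decseq (\<lambda>k. \<phi> k y)"
      unfolding decseq_Suc_iff using \<psi>mono[of _ y] by (auto simp: \<phi>_def max_def) (smt (verit))+
    then show ?thesis using decseq_convergent[of "\<lambda>k. \<phi> k y" 0] \<phi>0 by metis
  qed
  then obtain \<Phi> where \<Phi>: "\<And>y. (\<lambda>k. \<phi> k y) \<longlonglongrightarrow> \<Phi> y" by metis
  have \<Phi>m: "\<Phi> \<in> borel_measurable lebesgue" by (rule borel_measurable_LIMSEQ_real[OF \<Phi> \<phi>m])
  have \<Phi>U: "\<bar>\<Phi> y\<bar> \<le> \<bar>U y\<bar>" for y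
  proof -
    have "0 \<le> \<Phi> y" by (rule LIMSEQ_le_const[OF \<Phi>]) (use \<phi>0 in auto)
    moreover have "\<Phi> y \<le> \<bar>U y\<bar>" by (rule LIMSEQ_le_const2[OF \<Phi>]) (use \<phi>U in auto)
    ultimately show ?thesis by simp
  qed
  have \<Phi>int: "integrable lebesgue \<Phi>"
    by (rule Bochner_Integration.integrable_bound[OF U_int \<Phi>m]) (use \<Phi>U in auto)
  have "wd i0 \<Phi> (\<lambda>y. 0)"
    unfolding wd_def
  proof (intro conjI allI impI)
    show "loc_int \<Phi>" by (rule loc_int_integrable[OF \<Phi>int])
    show "loc_int (\<lambda>y::'a. 0)" by (rule loc_int_const)
    fix \<eta> :: "'a \<Rightarrow> real" assume t: "test_fun \<eta>"
    obtain r where r: "\<And>y. norm y > r \<Longrightarrow> \<eta> y = 0" using t by (auto simp: test_fun_iff)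
    have tp: "test_fun (pd i0 \<eta>)" using test_fun_pd[OF t i0] .
    have lim: "(\<lambda>k. \<integral>y. \<phi> k y * pd i0 \<eta> y \<partial>lebesgue) \<longlonglongrightarrow> (\<integral>y. \<Phi> y * pd i0 \<eta> y \<partial>lebesgue)"
    proof (rule integral_dominated_convergence[where w="\<lambda>y. \<bar>U y * pd i0 \<eta> y\<bar>"])
      show "integrable lebesgue (\<lambda>y. \<bar>U y * pd i0 \<eta> y\<bar>)"
        by (intro integrable_abs loc_int_test[OF loc_int_integrable[OF U_int] tp])
      show "AE y in lebesgue. norm (\<phi> k y * pd i0 \<eta> y) \<le> \<bar>U y * pd i0 \<eta> y\<bar>" for k
        by (rule AE_I2) (use \<phi>0[of k] \<phi>U[of k] in \<open>auto simp: abs_mult intro!: mult_right_mono\<close>)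
    qed (auto intro!: AE_I2 tendsto_intros \<Phi> borel_measurable_times \<phi>m \<Phi>m test_fun_lebesgue[OF tp])
    define H where "H = (\<integral>y. (\<eta> y)\<^sup>2 \<partial>lebesgue)"
    have \<eta>L2: "L2 \<eta>" using H1p_D(1)[OF H1p_test(1)[OF t]] .
    have bnd: "norm (\<integral>y. \<phi> k y * pd i0 \<eta> y \<partial>lebesgue) \<le> sqrt (T k) + (sqrt (T k) + e k) * H" if k: "r \<le> 1 / e k" for k
    proof -
      \<comment> \<open>Weight in |p q| \<le> p^2 / \<tau> + \<tau> q^2, of the size that balances
        both terms; the summand e k prevents division by 0 when T k = 0.\<close>
      define \<tau> where "\<tau> = sqrt (T k) + e k"
      have \<tau>: "\<tau> > 0" "sqrt (T k) \<le> \<tau>" unfolding \<tau>_def using e0[of k] T0[of k] by (auto intro: add_nonneg_pos)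
      have "norm (\<integral>y. \<phi> k y * pd i0 \<eta> y \<partial>lebesgue) = norm (\<integral>y. P k i0 y * \<eta> y \<partial>lebesgue)"
        using wdD(3)[OF w\<phi>[OF i0] t, of k] by simp
      also have "\<dots> \<le> (\<integral>y. (\<theta> k y * P k i0 y)\<^sup>2 / \<tau> + \<tau> * (\<eta> y)\<^sup>2 \<partial>lebesgue)"
      proof (rule Bochner_Integration.integral_norm_bound_integral)
        show "integrable lebesgue (\<lambda>y. P k i0 y * \<eta> y)" by (rule loc_int_test[OF wdD(2)[OF w\<phi>[OF i0]] t])
        show "integrable lebesgue (\<lambda>y. (\<theta> k y * P k i0 y)\<^sup>2 / \<tau> + \<tau> * (\<eta> y)\<^sup>2)"
          using \<theta>PL2[OF i0, of k] \<eta>L2 by (auto simp: L2_def)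
        fix y
        have am: "\<bar>p * q\<bar> \<le> p\<^sup>2 / \<tau> + \<tau> * q\<^sup>2" for p q :: real
        proof -
          have "0 \<le> (\<bar>p\<bar> - \<tau> * \<bar>q\<bar>)\<^sup>2" by simp
          then have "2 * \<tau> * (\<bar>p\<bar> * \<bar>q\<bar>) \<le> p\<^sup>2 + \<tau>\<^sup>2 * q\<^sup>2" by (simp add: power2_diff power_mult_distrib algebra_simps)
          moreover have "0 \<le> \<tau> * (\<bar>p\<bar> * \<bar>q\<bar>)" using \<tau>(1) by simp
          ultimately have "\<tau> * \<bar>p * q\<bar> \<le> p\<^sup>2 + \<tau>\<^sup>2 * q\<^sup>2" unfolding abs_mult by linarith
          then show ?thesis using \<tau>(1) by (simp add: field_simps power2_eq_square)
        qed
        show "norm (P k i0 y * \<eta> y) \<le> (\<theta> k y * P k i0 y)\<^sup>2 / \<tau> + \<tau> * (\<eta> y)\<^sup>2"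
        proof (cases "norm y > r")
          case True
          then show ?thesis using r[OF True] \<tau>(1) by simp
        next
          case False
          then have "\<theta> k y = 1" using \<theta>one[of y k] k by simp
          then show ?thesis using am[of "P k i0 y" "\<eta> y"] by simp
        qed
      qed
      also have "\<dots> = T k / \<tau> + \<tau> * H"
        unfolding T_def H_def using \<theta>PL2[OF i0, of k] \<eta>L2 by (simp add: L2_def)
      also have "T k / \<tau> \<le> sqrt (T k)"
      proof -
        have "T k = sqrt (T k) * sqrt (T k)" using T0[of k] by simp
        also have "\<dots> \<le> sqrt (T k) * \<tau>" using \<tau>(2) T0[of k] by (intro mult_left_mono) auto
        finally show ?thesis using \<tau>(1) by (simp add: divide_simps)
      qed
      finally show ?thesis by (simp add: \<tau>_def)
    qed
    have "(\<lambda>k. \<integral>y. \<phi> k y * pd i0 \<eta> y \<partial>lebesgue) \<longlonglongrightarrow> 0"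
    proof (rule Lim_null_comparison)
      obtain N where N: "r \<le> real N" using real_arch_simple by blast
      show "\<forall>\<^sub>F k in sequentially. norm (\<integral>y. \<phi> k y * pd i0 \<eta> y \<partial>lebesgue) \<le> sqrt (T k) + (sqrt (T k) + e k) * H"
        using eventually_ge_at_top[of N]
      proof eventually_elim
        case (elim k)
        show ?case by (rule bnd) (use N elim in \<open>simp add: e_def\<close>)
      qed
      have "(\<lambda>k. sqrt (T k) + (sqrt (T k) + e k) * H) \<longlonglongrightarrow> sqrt 0 + (sqrt 0 + 0) * H"
        by (intro tendsto_intros Tlim elim0)
      then show "(\<lambda>k. sqrt (T k) + (sqrt (T k) + e k) * H) \<longlonglongrightarrow> 0" by simp
    qed
    then have "(\<integral>y. \<Phi> y * pd i0 \<eta> y \<partial>lebesgue) = 0" using lim LIMSEQ_unique by blast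
    then show "(\<integral>y. \<Phi> y * pd i0 \<eta> y \<partial>lebesgue) = - (\<integral>y. 0 * \<eta> y \<partial>lebesgue)" by simp
  qed
  from wd_zero_integrable[OF this \<Phi>int i0] have "AE y in lebesgue. \<Phi> y = 0" .
  then show ?thesis
  proof eventually_elim
    case (elim y)
    show ?case
    proof
      assume y: "y \<in> ball x R"
      have "U y - \<kappa> * (\<integral>y. \<mu> l y \<partial>lebesgue) \<le> \<Phi> y"
      proof (rule LIMSEQ_le_const[OF \<Phi>], intro exI allI impI)
        fix k show "U y - \<kappa> * (\<integral>y. \<mu> l y \<partial>lebesgue) \<le> \<phi> k y" using \<psi>le[OF y, of k] by (auto simp: \<phi>_def)
      qed
      then show "u l y \<le> \<kappa> * (\<integral>y. \<mu> l y \<partial>lebesgue)" using elim by (simp add: U_def)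
    qed
  qed
qed

end

section \<open>Positive parts, sums and level sets of Sobolev functions\<close>

lemma H1p_pos:
  assumes h: "H1p u G"
  shows "H1p (\<lambda>x. max 0 (u x)) (\<lambda>x. if u x > 0 then G x else 0)"
  unfolding H1p_def
proof (intro conjI ballI)
  have um [measurable]: "u \<in> borel_measurable lebesgue" "G \<in> borel_measurable lebesgue"
    using h by (auto intro: L2_measurable simp: H1p_def)
  show "L2 (\<lambda>x. max 0 (u x))" by (rule L2_dominated[OF H1p_D(1)[OF h]]) auto
  show "(\<lambda>x. if u x > 0 then G x else 0) \<in> borel_measurable lebesgue" by measurable
  fix i :: 'a assume i: "i \<in> Basis"
  have e: "(\<lambda>x. (if u x > 0 then G x else 0) \<bullet> i) = (\<lambda>x. if u x > 0 then G x \<bullet> i else 0)" by auto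
  show "wd i (\<lambda>x. max 0 (u x)) (\<lambda>x. (if u x > 0 then G x else 0) \<bullet> i)"
    unfolding e by (rule wd_pos[OF H1p_D(3)[OF h i] i])
  have "(\<lambda>x. if u x > 0 then G x \<bullet> i else 0) \<in> borel_measurable lebesgue" by measurable
  then show "L2 (\<lambda>x. (if u x > 0 then G x else 0) \<bullet> i)"
    unfolding e by (rule L2_dominated[OF H1p_D(4)[OF h i]]) auto
qed

lemma H1p_sum:
  fixes u :: "'k \<Rightarrow> 'a::euclidean_space \<Rightarrow> real"
  assumes "finite I" "\<And>k. k \<in> I \<Longrightarrow> H1p (u k) (G k)"
  shows "H1p (\<lambda>x. \<Sum>k\<in>I. u k x) (\<lambda>x. \<Sum>k\<in>I. G k x)"
  unfolding H1p_def
proof (intro conjI ballI)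
  show "L2 (\<lambda>x. \<Sum>k\<in>I. u k x)" using assms by (intro L2_sum) (auto dest: H1p_D)
  show "(\<lambda>x. \<Sum>k\<in>I. G k x) \<in> borel_measurable lebesgue"
    using assms by (intro borel_measurable_sum) (auto dest: H1p_D)
  fix i :: 'a assume i: "i \<in> Basis"
  show "wd i (\<lambda>x. \<Sum>k\<in>I. u k x) (\<lambda>x. (\<Sum>k\<in>I. G k x) \<bullet> i)"
    unfolding inner_sum_left using assms i by (intro wd_sum) (auto dest: H1p_D)
  show "L2 (\<lambda>x. (\<Sum>k\<in>I. G k x) \<bullet> i)"
    unfolding inner_sum_left using assms i by (intro L2_sum) (auto dest: H1p_D)
qed

lemma gradient_level_zero:
  assumes "H1p u G"
  shows "AE x in lebesgue. u x = 0 \<longrightarrow> G x = 0"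
proof -
  have "\<forall>i\<in>Basis. AE x in lebesgue. u x = 0 \<longrightarrow> G x \<bullet> i = 0"
    using wd_level_zero H1p_D(3)[OF assms] by blast
  then have "AE x in lebesgue. \<forall>i\<in>Basis. u x = 0 \<longrightarrow> G x \<bullet> i = 0"
    unfolding AE_ball_countable[OF countable_finite[OF finite_Basis]] .
  then show ?thesis by eventually_elim (auto intro: euclidean_eqI)
qed

lemma L2_test_continuous:
  assumes "test_fun \<theta>" "continuous_on UNIV F"
  shows "L2 (\<lambda>y. \<theta> y * F y)"
proof -
  obtain r where r: "\<And>x. norm x > r \<Longrightarrow> \<theta> x = 0" using assms(1) by (auto simp: test_fun_iff)
  have c: "continuous_on UNIV (\<lambda>y. \<theta> y * F y)"
    by (intro continuous_intros assms test_fun_continuous)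
  obtain B where B: "\<And>y. \<bar>\<theta> y * F y\<bar> \<le> B"
    by (rule continuous_compact_bounded[OF c, of "r + 1"]) (use r in auto)
  have "integrable lebesgue (\<lambda>y. \<theta> y * F y)"
    by (rule integrable_compact_bounded[OF continuous_lebesgue[OF c] B, of r]) (use r in auto)
  then show ?thesis using B by (rule L2_bounded_integrable)
qed

lemma sum_single:
  fixes f :: "'k \<Rightarrow> 'b::comm_monoid_add"
  assumes "finite F" "k \<in> F" "\<And>l. l \<in> F \<Longrightarrow> l \<noteq> k \<Longrightarrow> f l = 0"
  shows "(\<Sum>l\<in>F. f l) = f k"
  using assms by (subst sum.remove[of F k]) auto

section \<open>Comparison from below\<close>

text \<open>Let \<open>w = u j - \<Sum>u l\<close> be the signed density, so that \<open>\<Sum>|\<nabla>u i|\<^sup>2 = |\<nabla>w|\<^sup>2\<close>. The competitor replaces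
  \<open>w\<close> by \<open>w + \<phi>\<close>, and \<open>q = w + \<phi>\<close> is the comparison function wherever \<open>\<phi> > 0\<close>.\<close>
lemma pointwise_energy:
  fixes u \<mu> :: "nat \<Rightarrow> real" and g :: "nat \<Rightarrow> 'a::euclidean_space"
  assumes I: "finite I" "j \<in> I"
    and u: "\<And>i. i \<in> I \<Longrightarrow> u i \<ge> 0" "\<And>i l. i \<in> I \<Longrightarrow> l \<in> I \<Longrightarrow> i \<noteq> l \<Longrightarrow> u i * u l = 0"
      "\<And>i. i \<in> I \<Longrightarrow> u i = 0 \<Longrightarrow> g i = 0"
    and w: "w = u j - (\<Sum>l\<in>I - {j}. u l)" and wg: "wg = g j - (\<Sum>l\<in>I - {j}. g l)"
    and \<phi>: "\<phi> = 0 \<and> \<Phi> = 0 \<or> \<phi> > 0 \<and> w + \<phi> = q \<and> \<Phi> = G - wg \<and> (\<forall>l\<in>I - {j}. \<mu> l = 0) \<and>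
      (b\<delta> \<longrightarrow> u j > 0 \<and> \<mu> j \<ge> C) \<and> \<mu> j \<ge> 0 \<and> (q > 0 \<longrightarrow> b\<rho>)"
    and v: "v j = max 0 (w + \<phi>)" "\<And>l. l \<in> I - {j} \<Longrightarrow> v l = max 0 (u l - \<phi>)"
    and Gv: "Gv j = (if w + \<phi> > 0 then wg + \<Phi> else 0)" "\<And>l. l \<in> I - {j} \<Longrightarrow> Gv l = (if u l - \<phi> > 0 then g l - \<Phi> else 0)"
  shows "(\<Sum>i\<in>I. (norm (Gv i))\<^sup>2 - 2 * (\<mu> i - 1) * v i) \<le>
    (\<Sum>i\<in>I. (norm (g i))\<^sup>2 - 2 * (\<mu> i - 1) * u i) + (2 * (G \<bullet> \<Phi>) - (norm \<Phi>)\<^sup>2)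
      - 2 * (((if b\<delta> then C else 0) - (if b\<rho> then 1 else 0)) * \<phi>)"
    and "\<forall>i\<in>I. \<forall>l\<in>I. i \<noteq> l \<longrightarrow> v i * v l = 0" and "u j > 0 \<longrightarrow> v j > 0"
proof -
  let ?F = "I - {j}"
  have fF: "finite ?F" using I by simp
  have split: "(\<Sum>i\<in>I. f i) = f j + (\<Sum>l\<in>?F. f l)" for f :: "nat \<Rightarrow> real" using I by (rule sum.remove)
  \<comment> \<open>Segregation at one point: either all foreign phases vanish, or exactly one is
    positive and then u j vanishes too. Gradients vanish together with their phases.\<close>
  have cases: "(\<forall>l\<in>?F. u l = 0 \<and> g l = 0) \<or> (\<exists>k\<in>?F. u k > 0 \<and> u j = 0 \<and> g j = 0 \<and> (\<forall>l\<in>?F. l \<noteq> k \<longrightarrow> u l = 0 \<and> g l = 0))"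
  proof (cases "\<forall>l\<in>?F. u l = 0")
    case True
    then show ?thesis using u(3) by auto
  next
    case False
    then obtain k where k: "k \<in> ?F" "u k \<noteq> 0" by auto
    have "u k > 0" using k u(1)[of k] by auto
    moreover have "u i = 0" if "i \<in> I" "i \<noteq> k" for i using u(2)[of i k] k that by auto
    ultimately show ?thesis using k u(3) I by (intro disjI2 bexI[of _ k]) auto
  qed
  \<comment> \<open>For a = wg and G - a = \<Phi> this writes the new Dirichlet density as the old
    one, plus a linear term that the equation for q will cancel, minus the gain |\<Phi>|^2.\<close>
  have polar: "(norm G)\<^sup>2 = (norm a)\<^sup>2 + (2 * (G \<bullet> (G - a)) - (norm (G - a))\<^sup>2)" for a :: 'a
    by (simp add: power2_norm_eq_inner inner_diff_left inner_diff_right inner_commute)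
  consider (zero) "\<phi> = 0" "\<Phi> = 0" | (own) "\<phi> > 0" "\<forall>l\<in>?F. u l = 0 \<and> g l = 0"
    | (other) k where "\<phi> > 0" "k \<in> ?F" "u k > 0" "u j = 0" "g j = 0" "\<forall>l\<in>?F. l \<noteq> k \<longrightarrow> u l = 0 \<and> g l = 0"
    using \<phi> cases by blast
  then have "(\<Sum>i\<in>I. (norm (Gv i))\<^sup>2 - 2 * (\<mu> i - 1) * v i) \<le>
    (\<Sum>i\<in>I. (norm (g i))\<^sup>2 - 2 * (\<mu> i - 1) * u i) + (2 * (G \<bullet> \<Phi>) - (norm \<Phi>)\<^sup>2)
      - 2 * (((if b\<delta> then C else 0) - (if b\<rho> then 1 else 0)) * \<phi>) \<and>
    (\<forall>i\<in>I. \<forall>l\<in>I. i \<noteq> l \<longrightarrow> v i * v l = 0) \<and> (u j > 0 \<longrightarrow> v j > 0)"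
  proof cases
    case zero
    have vl: "v l = u l" "Gv l = g l" if "l \<in> ?F" for l
      using v(2)[OF that] Gv(2)[OF that] zero u(1)[of l] u(3)[of l] that by auto
    have vj: "v j = u j \<and> Gv j = g j"
      using cases
    proof
      assume c: "\<forall>l\<in>?F. u l = 0 \<and> g l = 0"
      then have "w = u j" "wg = g j" by (simp_all add: w wg)
      then show ?thesis using v(1) Gv(1) zero u(1)[OF I(2)] u(3)[OF I(2)] by auto
    next
      assume "\<exists>k\<in>?F. u k > 0 \<and> u j = 0 \<and> g j = 0 \<and> (\<forall>l\<in>?F. l \<noteq> k \<longrightarrow> u l = 0 \<and> g l = 0)"
      then have c: "u j = 0" "g j = 0" by auto
      have "(\<Sum>l\<in>?F. u l) \<ge> 0" using u(1) by (intro sum_nonneg) auto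
      then show ?thesis using v(1) Gv(1) zero c w by auto
    qed
    have vi: "v i = u i \<and> Gv i = g i" if "i \<in> I" for i using vl[of i] vj that by (cases "i = j") auto
    have "(\<Sum>i\<in>I. (norm (Gv i))\<^sup>2 - 2 * (\<mu> i - 1) * v i) = (\<Sum>i\<in>I. (norm (g i))\<^sup>2 - 2 * (\<mu> i - 1) * u i)"
      by (rule sum.cong) (simp_all add: vi)
    moreover have "\<forall>i\<in>I. \<forall>l\<in>I. i \<noteq> l \<longrightarrow> v i * v l = 0" using vi u(2) by simp
    ultimately show ?thesis using zero vj by simp
  next
    case own
    then have ph: "w + \<phi> = q" "\<Phi> = G - wg" "b\<delta> \<longrightarrow> u j > 0 \<and> \<mu> j \<ge> C" "\<mu> j \<ge> 0" "q > 0 \<longrightarrow> b\<rho>"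
      using \<phi> by auto
    have ww: "w = u j" "wg = g j" using own(2) by (simp_all add: w wg)
    have q: "q > 0" using ph(1) ww own(1) u(1)[OF I(2)] by simp
    have vj: "v j = q" "Gv j = G" using v(1) Gv(1) q ph ww by auto
    have vl: "v l = 0" "Gv l = 0" if "l \<in> ?F" for l using v(2)[OF that] Gv(2)[OF that] own that by auto
    have bl: "b\<rho>" using ph(5) q by simp
    have kc: "t * \<phi> \<le> \<mu> j * \<phi> \<Longrightarrow> - (\<mu> j - 1) * q \<le> - (\<mu> j - 1) * u j - (t - 1) * \<phi>" for t
      unfolding ph(1)[symmetric] ww by (simp add: algebra_simps)
    have "(if b\<delta> then C else 0) * \<phi> \<le> \<mu> j * \<phi>" using ph(3,4) own(1) by (intro mult_right_mono) auto
    then have "- (\<mu> j - 1) * q \<le> - (\<mu> j - 1) * u j - ((if b\<delta> then C else 0) - 1) * \<phi>" by (rule kc)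
    then have "(norm (Gv j))\<^sup>2 - 2 * (\<mu> j - 1) * v j \<le>
      ((norm (g j))\<^sup>2 - 2 * (\<mu> j - 1) * u j) + (2 * (G \<bullet> \<Phi>) - (norm \<Phi>)\<^sup>2) - 2 * (((if b\<delta> then C else 0) - (if b\<rho> then 1 else 0)) * \<phi>)"
      using polar[of "g j"] bl by (simp only: vj ph(2) ww if_True)
    then have 1: "(\<Sum>i\<in>I. (norm (Gv i))\<^sup>2 - 2 * (\<mu> i - 1) * v i) \<le>
    (\<Sum>i\<in>I. (norm (g i))\<^sup>2 - 2 * (\<mu> i - 1) * u i) + (2 * (G \<bullet> \<Phi>) - (norm \<Phi>)\<^sup>2)
      - 2 * (((if b\<delta> then C else 0) - (if b\<rho> then 1 else 0)) * \<phi>)"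
      unfolding split using vl own(2) by simp
    have "v i * v l = 0" if "i \<in> I" "l \<in> I" "i \<noteq> l" for i l
      using vl(1)[of i] vl(1)[of l] that by (cases "i = j") auto
    then show ?thesis using 1 vj q by auto
  next
    case (other k)
    then have ph: "w + \<phi> = q" "\<Phi> = G - wg" "b\<delta> \<longrightarrow> u j > 0 \<and> \<mu> j \<ge> C" "\<mu> j \<ge> 0" "q > 0 \<longrightarrow> b\<rho>" "\<mu> k = 0"
      using \<phi> by auto
    have "(\<Sum>l\<in>?F. u l) = u k" "(\<Sum>l\<in>?F. g l) = g k"
      using other by (auto intro!: sum_single[OF fF])
    then have ww: "w = - u k" "wg = - g k" using other by (simp_all add: w wg)
    \<comment> \<open>On the ball of radius \<delta> the phase u j is positive where a change
      happens, so with a foreign phase present the term with C does not occur.\<close>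
    have nb: "\<not> b\<delta>" using ph(3) other(4) by simp
    have vl: "v l = 0" "Gv l = 0" if "l \<in> ?F" "l \<noteq> k" for l
      using v(2)[OF that(1)] Gv(2)[OF that(1)] other that by auto
    have s1: "(\<Sum>l\<in>?F. (norm (Gv l))\<^sup>2 - 2 * (\<mu> l - 1) * v l) = (norm (Gv k))\<^sup>2 + 2 * v k"
      using sum_single[OF fF other(2), of "\<lambda>l. (norm (Gv l))\<^sup>2 - 2 * (\<mu> l - 1) * v l"] vl ph(6) by simp
    have s2: "(\<Sum>l\<in>?F. (norm (g l))\<^sup>2 - 2 * (\<mu> l - 1) * u l) = (norm (g k))\<^sup>2 + 2 * u k"
      using sum_single[OF fF other(2), of "\<lambda>l. (norm (g l))\<^sup>2 - 2 * (\<mu> l - 1) * u l"] other(6) ph(6) by simp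
    \<comment> \<open>The new phases are the positive and the negative part of q, so at most one of
      the two gradients is non-zero, and it is G up to sign.\<close>
    have gp: "(norm (Gv j))\<^sup>2 + (norm (Gv k))\<^sup>2 \<le> (norm (g k))\<^sup>2 + (2 * (G \<bullet> \<Phi>) - (norm \<Phi>)\<^sup>2)"
    proof -
      have "(norm (Gv j))\<^sup>2 + (norm (Gv k))\<^sup>2 \<le> (norm G)\<^sup>2"
        using Gv(1) Gv(2)[OF other(2)] ph ww by auto
      then show ?thesis using polar[of "- g k"] ph(2) ww(2) by simp
    qed
    \<comment> \<open>Where q > 0 the new mass v j = q = \<phi> - u k is at most \<phi>, and this
      cost is covered by the density - 1 of the comparison function on the ball of radius \<rho>,
      the only place where q > 0. Otherwise the foreign mass just shrinks.\<close>
    have vp: "- 2 * (\<mu> j - 1) * v j + 2 * v k \<le> 2 * u k + 2 * ((if b\<rho> then 1 else 0) * \<phi>)"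
    proof (cases "q > 0")
      case True
      have "v j = q" "v k = 0" using v(1) v(2)[OF other(2)] ph(1) ww True by auto
      moreover have "(1 - \<mu> j) * q \<le> 1 * q" using ph(4) True by (intro mult_right_mono) auto
      ultimately show ?thesis using True ph(1,5) ww other(3) by (simp add: algebra_simps)
    next
      case False
      then have "v j = 0" "v k = u k - \<phi>" using v(1) v(2)[OF other(2)] ph(1) ww by auto
      then show ?thesis using other(1) by simp
    qed
    have "(\<Sum>i\<in>I. (norm (Gv i))\<^sup>2 - 2 * (\<mu> i - 1) * v i) \<le>
    (\<Sum>i\<in>I. (norm (g i))\<^sup>2 - 2 * (\<mu> i - 1) * u i) + (2 * (G \<bullet> \<Phi>) - (norm \<Phi>)\<^sup>2)
      - 2 * (((if b\<delta> then C else 0) - (if b\<rho> then 1 else 0)) * \<phi>)"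
      unfolding split s1 s2 using gp vp nb other(4,5) by (cases b\<rho>) (simp_all add: algebra_simps)
    moreover have "v j * v k = 0" using v(1) v(2)[OF other(2)] ph(1) ww by (auto simp: max_def)
    then have "v i * v l = 0" if "i \<in> I" "l \<in> I" "i \<noteq> l" for i l
      using vl(1)[of i] vl(1)[of l] that by (cases "i = j"; cases "l = j"; cases "i = k"; cases "l = k") (auto simp: mult.commute)
    ultimately show ?thesis using other(4) by auto
  qed
  then show "(\<Sum>i\<in>I. (norm (Gv i))\<^sup>2 - 2 * (\<mu> i - 1) * v i) \<le>
    (\<Sum>i\<in>I. (norm (g i))\<^sup>2 - 2 * (\<mu> i - 1) * u i) + (2 * (G \<bullet> \<Phi>) - (norm \<Phi>)\<^sup>2)
      - 2 * (((if b\<delta> then C else 0) - (if b\<rho> then 1 else 0)) * \<phi>)"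
    "\<forall>i\<in>I. \<forall>l\<in>I. i \<noteq> l \<longrightarrow> v i * v l = 0" "u j > 0 \<longrightarrow> v j > 0" by blast+
qed

text \<open>The radial comparison function: \<open>- \<Delta> q = C \<cdot> 1\<close> on the ball of radius \<open>\<delta>\<close> minus \<open>1\<close> on the ball of
  radius \<open>\<rho>\<close>, normalised to vanish on the sphere of radius \<open>\<rho>\<close>.\<close>
definition cmp :: "real \<Rightarrow> real \<Rightarrow> real \<Rightarrow> 'a::euclidean_space \<Rightarrow> 'a \<Rightarrow> real" where
  "cmp C \<delta> \<rho> x y = cn TYPE('a) * (C * vol_ball TYPE('a) \<delta> * (Lk DIM('a) \<delta> ((y - x) \<bullet> (y - x)) - Lk DIM('a) \<delta> (\<rho>\<^sup>2))
     - vol_ball TYPE('a) \<rho> * (Lk DIM('a) \<rho> ((y - x) \<bullet> (y - x)) - Lk DIM('a) \<rho> (\<rho>\<^sup>2)))"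

definition cmpd :: "real \<Rightarrow> real \<Rightarrow> real \<Rightarrow> 'a::euclidean_space \<Rightarrow> 'a \<Rightarrow> 'a \<Rightarrow> real" where
  "cmpd C \<delta> \<rho> x i y = cn TYPE('a) * (C * vol_ball TYPE('a) \<delta> * (- ((y - x) \<bullet> i) * hk DIM('a) \<delta> ((y - x) \<bullet> (y - x)))
     - vol_ball TYPE('a) \<rho> * (- ((y - x) \<bullet> i) * hk DIM('a) \<rho> ((y - x) \<bullet> (y - x))))"

lemma continuous_cmp: "0 < \<delta> \<Longrightarrow> 0 < \<rho> \<Longrightarrow> continuous_on UNIV (cmp C \<delta> \<rho> x)"
  unfolding cmp_def[abs_def] by (intro continuous_intros continuous_Lk_radial)

lemma continuous_cmpd: "0 < \<delta> \<Longrightarrow> 0 < \<rho> \<Longrightarrow> continuous_on UNIV (cmpd C \<delta> \<rho> x i)"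
  unfolding cmpd_def[abs_def]
  by (intro continuous_intros continuous_on_compose2[OF hk_continuous[of \<delta> UNIV]]
      continuous_on_compose2[OF hk_continuous[of \<rho> UNIV]]) auto

lemma wd_cmp:
  assumes ab: "0 < \<delta>" "0 < \<rho>" and i: "i \<in> Basis"
  shows "wd i (cmp C \<delta> \<rho> x) (cmpd C \<delta> \<rho> x i)"
proof -
  let ?n = "DIM('a)"
  have c: "wd i (\<lambda>y. d) (\<lambda>y. 0)" for d
    using wd_smooth[OF smooth_const[of d] i] by (simp add: frechet_derivative_const)
  have "wd i (\<lambda>y. cn TYPE('a) * (C * vol_ball TYPE('a) \<delta> * (Lk ?n \<delta> ((y - x) \<bullet> (y - x)) - Lk ?n \<delta> (\<rho>\<^sup>2))
     - vol_ball TYPE('a) \<rho> * (Lk ?n \<rho> ((y - x) \<bullet> (y - x)) - Lk ?n \<rho> (\<rho>\<^sup>2))))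
     (\<lambda>y. cn TYPE('a) * (C * vol_ball TYPE('a) \<delta> * (- ((y - x) \<bullet> i) * hk ?n \<delta> ((y - x) \<bullet> (y - x)) - 0)
     - vol_ball TYPE('a) \<rho> * (- ((y - x) \<bullet> i) * hk ?n \<rho> ((y - x) \<bullet> (y - x)) - 0)))"
    by (intro wd_cmult wd_diff wd_Lk ab i c)
  then show ?thesis by (simp add: cmp_def[abs_def] cmpd_def[abs_def])
qed

text \<open>The charge C |B_\<delta>| spread uniformly over the ball of radius \<delta> has density
  C, and |B_\<rho>| spread over the ball of radius \<rho> has density 1; both come from
  \<open>radial_field_divergence\<close> and \<open>cn_hk\<close>.\<close>

lemma cmp_laplacian:
  fixes \<phi> :: "'a::euclidean_space \<Rightarrow> real"
  assumes ab: "0 < \<delta>" "0 < \<rho>" and w: "\<And>i. i \<in> Basis \<Longrightarrow> wd i \<phi> (P i)"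
    and r: "\<And>y. norm y > r \<Longrightarrow> \<phi> y = 0" "\<And>i y. i \<in> Basis \<Longrightarrow> norm y > r \<Longrightarrow> P i y = 0"
  shows "(\<Sum>i\<in>Basis. \<integral>y. cmpd C \<delta> \<rho> x i y * P i y \<partial>lebesgue) =
    (\<integral>y. ((if y \<in> ball x \<delta> then C else 0) - (if y \<in> ball x \<rho> then 1 else 0)) * \<phi> y \<partial>lebesgue)"
    and "i \<in> Basis \<Longrightarrow> integrable lebesgue (\<lambda>y. cmpd C \<delta> \<rho> x i y * P i y)"
    and "integrable lebesgue (\<lambda>y. ((if y \<in> ball x \<delta> then C else 0) - (if y \<in> ball x \<rho> then 1 else 0)) * \<phi> y)"
proof -
  let ?n = "DIM('a)"
  obtain i0 :: 'a where i0: "i0 \<in> Basis" using nonempty_Basis by blast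
  have int: "integrable lebesgue (\<lambda>y. P i y * F y)"
    if i: "i \<in> Basis" and cF: "continuous_on UNIV F" for i and F :: "'a \<Rightarrow> real"
  proof -
    have "bounded (F ` cball 0 r)"
      by (intro compact_imp_bounded compact_continuous_image continuous_on_subset[OF cF]) auto
    then obtain B where B: "\<forall>y\<in>cball 0 r. \<bar>F y\<bar> \<le> B" unfolding bounded_iff by (metis image_eqI real_norm_def)
    have "integrable lebesgue (\<lambda>y. P i y * (indicator (cball 0 r) y * F y))"
    proof (rule loc_int_mult_bounded[OF wdD(2)[OF w[OF i]], where B="\<bar>B\<bar>" and r=r])
      show "(\<lambda>y. indicator (cball 0 r) y * F y) \<in> borel_measurable lebesgue"
        using continuous_lebesgue[OF cF] by measurable
      show "\<bar>indicator (cball 0 r) y * F y\<bar> \<le> \<bar>B\<bar>" for y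
        using B by (cases "y \<in> cball 0 r") (auto intro: order_trans[OF _ abs_ge_self])
    qed auto
    moreover have "P i y * (indicator (cball 0 r) y * F y) = P i y * F y" for y
      using r(2)[OF i, of y] by (cases "norm y > r") auto
    ultimately show ?thesis by simp
  qed
  have int2: "integrable lebesgue (\<lambda>y. P i y * (((y - x) \<bullet> i) * hk ?n c ((y - x) \<bullet> (y - x))))" if "i \<in> Basis" "c > 0" for i c
    by (rule int[OF that(1)]) (intro continuous_intros continuous_on_compose2[OF hk_continuous[OF that(2), of UNIV]], auto)
  show "i \<in> Basis \<Longrightarrow> integrable lebesgue (\<lambda>y. cmpd C \<delta> \<rho> x i y * P i y)" for i
    using int[OF _ continuous_cmpd[OF ab]] by (simp add: mult.commute)
  have i\<phi>: "integrable lebesgue \<phi>"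
    using wd_test_local(2)[OF w[OF i0] i0 smooth_const[of 1] r(1) r(2)[OF i0]] by simp
  have ib: "integrable lebesgue (\<lambda>y. \<phi> y * indicator (ball x c) y)" for c
    using integrable_mult_indicator[of "ball x c", OF _ i\<phi>] by (simp add: mult.commute)
  have e: "((if y \<in> ball x \<delta> then C else 0) - (if y \<in> ball x \<rho> then 1 else 0)) * \<phi> y =
      C * (\<phi> y * indicator (ball x \<delta>) y) - \<phi> y * indicator (ball x \<rho>) y" for y by (auto simp: indicator_def algebra_simps)
  show "integrable lebesgue (\<lambda>y. ((if y \<in> ball x \<delta> then C else 0) - (if y \<in> ball x \<rho> then 1 else 0)) * \<phi> y)"
    unfolding e using ib by simp
  have k: "(\<integral>y. cmpd C \<delta> \<rho> x i y * P i y \<partial>lebesgue) = cn TYPE('a) *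
      (vol_ball TYPE('a) \<rho> * (\<integral>y. P i y * (((y - x) \<bullet> i) * hk ?n \<rho> ((y - x) \<bullet> (y - x))) \<partial>lebesgue)
       - C * vol_ball TYPE('a) \<delta> * (\<integral>y. P i y * (((y - x) \<bullet> i) * hk ?n \<delta> ((y - x) \<bullet> (y - x))) \<partial>lebesgue))" if i: "i \<in> Basis" for i
  proof -
    have "(\<integral>y. cmpd C \<delta> \<rho> x i y * P i y \<partial>lebesgue) = (\<integral>y. cn TYPE('a) *
       (vol_ball TYPE('a) \<rho> * (P i y * (((y - x) \<bullet> i) * hk ?n \<rho> ((y - x) \<bullet> (y - x))))
        - C * vol_ball TYPE('a) \<delta> * (P i y * (((y - x) \<bullet> i) * hk ?n \<delta> ((y - x) \<bullet> (y - x))))) \<partial>lebesgue)"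
      by (rule Bochner_Integration.integral_cong) (auto simp: cmpd_def algebra_simps)
    then show ?thesis using int2[OF i ab(1)] int2[OF i ab(2)] by simp
  qed
  have "(\<Sum>i\<in>Basis. \<integral>y. cmpd C \<delta> \<rho> x i y * P i y \<partial>lebesgue) = cn TYPE('a) *
      (vol_ball TYPE('a) \<rho> * (\<Sum>i\<in>Basis. \<integral>y. P i y * (((y - x) \<bullet> i) * hk ?n \<rho> ((y - x) \<bullet> (y - x))) \<partial>lebesgue)
      - C * vol_ball TYPE('a) \<delta> * (\<Sum>i\<in>Basis. \<integral>y. P i y * (((y - x) \<bullet> i) * hk ?n \<delta> ((y - x) \<bullet> (y - x))) \<partial>lebesgue))"
    by (simp add: k sum_distrib_left[symmetric] sum_subtractf)
  also have "\<dots> = cn TYPE('a) * (vol_ball TYPE('a) \<rho> * (- (real ?n / \<rho> ^ ?n) * (\<integral>y. \<phi> y * indicator (ball x \<rho>) y \<partial>lebesgue))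
      - C * vol_ball TYPE('a) \<delta> * (- (real ?n / \<delta> ^ ?n) * (\<integral>y. \<phi> y * indicator (ball x \<delta>) y \<partial>lebesgue)))"
    using radial_field_divergence[OF ab(1) w r, where z=x] radial_field_divergence[OF ab(2) w r, where z=x] by simp
  also have "\<dots> = C * ((cn TYPE('a) * real ?n / \<delta> ^ ?n) * vol_ball TYPE('a) \<delta>) * (\<integral>y. \<phi> y * indicator (ball x \<delta>) y \<partial>lebesgue)
     - ((cn TYPE('a) * real ?n / \<rho> ^ ?n) * vol_ball TYPE('a) \<rho>) * (\<integral>y. \<phi> y * indicator (ball x \<rho>) y \<partial>lebesgue)"
    by (simp add: algebra_simps)
  also have "\<dots> = C * (\<integral>y. \<phi> y * indicator (ball x \<delta>) y \<partial>lebesgue) - (\<integral>y. \<phi> y * indicator (ball x \<rho>) y \<partial>lebesgue)"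
    unfolding cn_hk[OF ab(1)] cn_hk[OF ab(2)]
    using vol_ball_pos[OF ab(1), where 'a='a] vol_ball_pos[OF ab(2), where 'a='a] by simp
  also have "\<dots> = (\<integral>y. ((if y \<in> ball x \<delta> then C else 0) - (if y \<in> ball x \<rho> then 1 else 0)) * \<phi> y \<partial>lebesgue)"
    unfolding e using ib by simp
  finally show "(\<Sum>i\<in>Basis. \<integral>y. cmpd C \<delta> \<rho> x i y * P i y \<partial>lebesgue) =
    (\<integral>y. ((if y \<in> ball x \<delta> then C else 0) - (if y \<in> ball x \<rho> then 1 else 0)) * \<phi> y \<partial>lebesgue)" .
qed

context segregated_minimizer
begin

theorem lower_bound:
  assumes j: "j \<in> {1..m}" and pos: "0 < \<delta>" "\<delta> < \<rho>" "\<rho> < R0" "R0 < R"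
    and sep: "\<And>l. l \<in> {1..m} \<Longrightarrow> l \<noteq> j \<Longrightarrow> AE y in lebesgue. y \<in> ball x R \<longrightarrow> \<mu> l y = 0"
    and up: "\<And>l. l \<in> {1..m} \<Longrightarrow> l \<noteq> j \<Longrightarrow> AE y in lebesgue. y \<in> ball x R \<longrightarrow> u l y \<le> K" and K: "K \<ge> 0"
    and A: "ball x \<delta> \<subseteq> A j" and C: "AE y in lebesgue. y \<in> ball x \<delta> \<longrightarrow> \<mu> j y \<ge> C"
    and q0: "\<And>y. dist x y \<ge> \<rho> \<Longrightarrow> cmp C \<delta> \<rho> x y \<le> 0" and qK: "\<And>y. dist x y \<ge> R0 \<Longrightarrow> cmp C \<delta> \<rho> x y \<le> - K"
  shows "AE y in lebesgue. y \<in> ball x R0 \<longrightarrow> cmp C \<delta> \<rho> x y \<le> u j y"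
proof -
  define I where "I = {1..m}"
  have fI: "finite I" "j \<in> I" using j by (auto simp: I_def)
  have \<rho>0: "\<rho> > 0" using pos by simp
  define q where "q = cmp C \<delta> \<rho> x"
  define g where "g i = wgrad (u i)" for i
  have ug: "H1p (u i) (g i)" if "i \<in> I" for i using u_facts(1) that by (simp add: g_def I_def)
  define w where "w y = u j y - (\<Sum>l\<in>I - {j}. u l y)" for y
  define wg where "wg y = g j y - (\<Sum>l\<in>I - {j}. g l y)" for y
  have Hw: "H1p w wg"
  proof -
    have "H1p (\<lambda>y. \<Sum>l\<in>I - {j}. u l y) (\<lambda>y. \<Sum>l\<in>I - {j}. g l y)" by (rule H1p_sum) (use fI ug in auto)
    from H1p_add_scaled[OF ug[OF fI(2)] this, of "- 1"] show ?thesis by (simp add: w_def[abs_def] wg_def[abs_def])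
  qed
  have wint: "integrable lebesgue w"
    unfolding w_def[abs_def] using u_integrable j by (intro Bochner_Integration.integrable_diff Bochner_Integration.integrable_sum) (auto simp: I_def)
  have wm: "w \<in> borel_measurable lebesgue" using wint by auto
  \<comment> \<open>The cutoff falls from 1 to 0 between R0 and b < R. There q \<le> -K \<le> w
    almost everywhere, so D already vanishes: multiplying by \<theta> merely extends (q - w)^+ from
    the ball of radius R0 by 0.\<close>
  define b where "b = (R0 + R) / 2"
  have b: "R0 < b" "b < R" using pos by (auto simp: b_def)
  obtain \<theta> :: "'a \<Rightarrow> real" where \<theta>: "test_fun \<theta>" "\<And>y. 0 \<le> \<theta> y \<and> \<theta> y \<le> 1" "\<And>y. dist x y \<le> R0 \<Longrightarrow> \<theta> y = 1"
    "\<And>y. dist x y \<ge> b \<Longrightarrow> \<theta> y = 0"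
    by (rule cutoff_exists[of R0 b x]) (use pos b in auto)
  have pd\<theta>: "pd i \<theta> y = 0" if "dist x y < R0 \<or> dist x y \<ge> R" for i y
  proof -
    define S where "S = (if dist x y < R0 then ball x R0 else - cball x b)"
    have S: "open S" "y \<in> S" using that b by (auto simp: S_def)
    have c: "\<exists>c. \<forall>z\<in>S. \<theta> z = c" using \<theta>(3,4) by (auto simp: S_def)
    then obtain c where c: "\<And>z. z \<in> S \<Longrightarrow> \<theta> z = c" by blast
    have "((\<lambda>z. c) has_derivative (\<lambda>h. 0)) (at y)" by simp
    then have "(\<theta> has_derivative (\<lambda>h. 0)) (at y)"
      by (rule has_derivative_transform_within_open[OF _ S]) (use c in auto)
    then show ?thesis by (rule pd_eq)
  qed
  define D where "D y = max 0 (q y - w y)" for y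
  define Dg where "Dg i y = (if 0 < q y - w y then cmpd C \<delta> \<rho> x i y - wg y \<bullet> i else 0)" for i y
  have wD: "wd i D (Dg i)" if i: "i \<in> Basis" for i
    unfolding D_def[abs_def] Dg_def[abs_def] q_def
    by (rule wd_pos[OF wd_diff[OF wd_cmp[OF pos(1) \<rho>0 i] H1p_D(3)[OF Hw i] i] i])
  have cq: "continuous_on UNIV q" unfolding q_def by (rule continuous_cmp[OF pos(1) \<rho>0])
  define \<phi> where "\<phi> y = \<theta> y * D y" for y
  define P where "P i y = \<theta> y * Dg i y + pd i \<theta> y * D y" for i y
  have wP: "wd i \<phi> (P i)" if i: "i \<in> Basis" for i
    unfolding \<phi>_def[abs_def] P_def[abs_def] by (rule wd_mult_smooth[OF wD[OF i] test_fun_smooth[OF \<theta>(1)] i])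
  have Dm: "D \<in> borel_measurable lebesgue"
    unfolding D_def[abs_def] using continuous_lebesgue[OF cq] wm by measurable
  have \<phi>m: "\<phi> \<in> borel_measurable lebesgue"
    unfolding \<phi>_def[abs_def] by (intro borel_measurable_times Dm test_fun_lebesgue \<theta>)
  have tD: "L2 (\<lambda>y. \<eta> y * D y)" if t: "test_fun \<eta>" for \<eta>
  proof -
    obtain B where B: "\<And>y. \<bar>\<eta> y\<bar> \<le> B" using test_fun_bounded[OF t] by blast
    have "L2 (\<lambda>y. \<eta> y * q y - \<eta> y * w y)"
      by (intro L2_diff L2_test_continuous[OF t cq] L2_mult_bounded[OF H1p_D(1)[OF Hw] test_fun_lebesgue[OF t] B])
    then show ?thesis
    proof (rule L2_dominated)
      show "(\<lambda>y. \<eta> y * D y) \<in> borel_measurable lebesgue"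
        by (intro borel_measurable_times Dm test_fun_lebesgue t)
      show "AE y in lebesgue. \<bar>\<eta> y * D y\<bar> \<le> \<bar>\<eta> y * q y - \<eta> y * w y\<bar>"
        by (rule AE_I2) (auto simp: D_def max_def algebra_simps)
    qed
  qed
  have tDg: "L2 (\<lambda>y. \<theta> y * Dg i y)" if i: "i \<in> Basis" for i
  proof -
    have "L2 (\<lambda>y. \<theta> y * cmpd C \<delta> \<rho> x i y - \<theta> y * (wg y \<bullet> i))"
      by (intro L2_diff L2_test_continuous[OF \<theta>(1) continuous_cmpd[OF pos(1) \<rho>0]]
          L2_mult_bounded[OF H1p_D(4)[OF Hw i] test_fun_lebesgue[OF \<theta>(1)], of 1]) (use \<theta>(2) in auto)
    then show ?thesis
    proof (rule L2_dominated)
      show "(\<lambda>y. \<theta> y * Dg i y) \<in> borel_measurable lebesgue"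
        by (intro borel_measurable_times test_fun_lebesgue \<theta> loc_int_measurable[OF wdD(2)[OF wD[OF i]]])
      show "AE y in lebesgue. \<bar>\<theta> y * Dg i y\<bar> \<le> \<bar>\<theta> y * cmpd C \<delta> \<rho> x i y - \<theta> y * (wg y \<bullet> i)\<bar>"
        by (rule AE_I2) (auto simp: Dg_def algebra_simps)
    qed
  qed
  have PL2: "L2 (P i)" if i: "i \<in> Basis" for i
    unfolding P_def[abs_def] by (intro L2_add tDg tD test_fun_pd \<theta> i)
  define \<Phi> where "\<Phi> y = (\<Sum>i\<in>Basis. P i y *\<^sub>R i)" for y
  have \<phi>L2: "L2 \<phi>" unfolding \<phi>_def[abs_def] by (rule tD[OF \<theta>(1)])
  have H\<phi>: "H1p \<phi> \<Phi>" unfolding \<Phi>_def[abs_def] by (rule H1p_components[OF \<phi>L2 wP PL2])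
  have \<Phi>c: "\<Phi> y \<bullet> i = P i y" if "i \<in> Basis" for i y unfolding \<Phi>_def using that by (rule inner_sum_Basis)
  define r where "r = norm x + R"
  have far: "dist x y > R" if "norm y > r" for y
    using that norm_triangle_ineq2[of y x] by (simp add: r_def dist_norm norm_minus_commute)
  have rz: "\<phi> y = 0" "P i y = 0" if "norm y > r" for i y
  proof -
    have "\<theta> y = 0" using \<theta>(4)[of y] far[OF that] b by simp
    moreover have "pd i \<theta> y = 0" using pd\<theta>[of y i] far[OF that] by simp
    ultimately show "\<phi> y = 0" "P i y = 0" by (simp_all add: \<phi>_def P_def)
  qed
  obtain i0 :: 'a where i0: "i0 \<in> Basis" using nonempty_Basis by blast
  have \<phi>int: "integrable lebesgue \<phi>"
    using wd_test_local(2)[OF wP[OF i0] i0 smooth_const[of 1] rz(1) rz(2)] by simp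
  have \<phi>0: "\<phi> y \<ge> 0" for y using \<theta>(2)[of y] by (simp add: \<phi>_def D_def)
  have AEI: "AE y in lebesgue. \<forall>i\<in>I. Q i y" if "\<And>i. i \<in> I \<Longrightarrow> AE y in lebesgue. Q i y" for Q :: "nat \<Rightarrow> 'a \<Rightarrow> bool"
    unfolding AE_ball_countable[OF countable_finite[OF fI(1)]] using that by blast
  have a1: "AE y in lebesgue. \<forall>i\<in>I. u i y \<ge> 0" by (rule AEI) (use u_facts(2) in \<open>simp add: I_def\<close>)
  have a2: "AE y in lebesgue. \<forall>i\<in>I. \<forall>l\<in>I. i \<noteq> l \<longrightarrow> u i y * u l y = 0"
    by (intro AEI) (use u_facts(5) in \<open>simp add: I_def\<close>)
  have a3: "AE y in lebesgue. \<forall>i\<in>I. u i y = 0 \<longrightarrow> g i y = 0" by (rule AEI) (rule gradient_level_zero[OF ug])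
  have a4: "AE y in lebesgue. \<forall>l\<in>I. l \<noteq> j \<longrightarrow> y \<in> ball x R \<longrightarrow> \<mu> l y = 0 \<and> u l y \<le> K"
  proof (rule AEI)
    fix l assume l: "l \<in> I"
    show "AE y in lebesgue. l \<noteq> j \<longrightarrow> y \<in> ball x R \<longrightarrow> \<mu> l y = 0 \<and> u l y \<le> K"
    proof (cases "l = j")
      case False
      then show ?thesis using sep[of l] up[of l] l by (auto simp: I_def)
    qed simp
  qed
  \<comment> \<open>The ball of radius \<delta> lies in A j, where the density is at least c > 0, so
    the constraint excludes u j = 0 there.\<close>
  have a5: "AE y in lebesgue. \<mu> j y \<ge> 0 \<and> (y \<in> ball x \<delta> \<longrightarrow> \<mu> j y \<ge> C \<and> u j y \<noteq> 0)"
    using mu_nonneg[rule_format, OF j] C u_facts(4)[OF j] mu_on_A[OF j]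
    by eventually_elim (use A c_gt in auto)
  have a6: "AE y in lebesgue. \<forall>i\<in>I. u i y = 0 \<longrightarrow> \<mu> i y = 0" by (rule AEI) (use u_facts(4) in \<open>simp add: I_def\<close>)
  \<comment> \<open>The dichotomy that \<open>pointwise_energy\<close> expects: either nothing
    changes at y, or y lies in the ball of radius R0 and the signed density is raised exactly to
    q.\<close>
  have alt: "AE y in lebesgue. \<phi> y = 0 \<and> \<Phi> y = 0 \<or> \<phi> y > 0 \<and> w y + \<phi> y = q y \<and>
      \<Phi> y = (\<Sum>i\<in>Basis. cmpd C \<delta> \<rho> x i y *\<^sub>R i) - wg y \<and> (\<forall>l\<in>I - {j}. \<mu> l y = 0) \<and>
      (y \<in> ball x \<delta> \<longrightarrow> u j y > 0 \<and> \<mu> j y \<ge> C) \<and> \<mu> j y \<ge> 0 \<and> (q y > 0 \<longrightarrow> y \<in> ball x \<rho>)"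
    using a1 a2 a4 a5
  proof eventually_elim
    case (elim y)
    show ?case
    proof (cases "dist x y < R0 \<and> D y > 0")
      case True
      have t: "\<theta> y = 1" using \<theta>(3)[of y] True by simp
      have dq: "D y = q y - w y" "0 < q y - w y" using True by (auto simp: D_def max_def split: if_splits)
      have "P i y = cmpd C \<delta> \<rho> x i y - wg y \<bullet> i" for i
        using t pd\<theta>[of y i] True dq(2) by (simp add: P_def Dg_def)
      then have "\<Phi> y = (\<Sum>i\<in>Basis. cmpd C \<delta> \<rho> x i y *\<^sub>R i) - wg y"
        by (intro euclidean_eqI[of "\<Phi> y"]) (simp add: \<Phi>c inner_diff_left inner_sum_Basis)
      moreover have "y \<in> ball x \<rho>" if "q y > 0" using q0[of y] that by (auto simp: q_def not_le[symmetric])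
      moreover have "\<forall>l\<in>I - {j}. \<mu> l y = 0" using elim(3) True pos by auto
      moreover have "y \<in> ball x \<delta> \<longrightarrow> u j y > 0 \<and> \<mu> j y \<ge> C" using elim(1,4) fI(2) by force
      ultimately show ?thesis using t dq True elim(4) by (simp add: \<phi>_def)
    next
      case False
      have "D y = 0 \<or> \<theta> y = 0 \<and> (\<forall>i. pd i \<theta> y = 0)"
      proof (cases "dist x y \<ge> R")
        case True
        then show ?thesis using \<theta>(4)[of y] pd\<theta>[of y] b by auto
      next
        case R: False
        show ?thesis
        proof (cases "dist x y < R0")
          case True
          then show ?thesis using False by (auto simp: D_def max_def split: if_splits)
        next
          case R0: False
          \<comment> \<open>At most one foreign phase is non-zero at y, so the bound K on each of
            them bounds their sum.\<close>
          have "(\<Sum>l\<in>I - {j}. u l y) \<le> K"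
          proof (cases "\<exists>k\<in>I - {j}. u k y \<noteq> 0")
            case True
            then obtain k where k: "k \<in> I - {j}" "u k y \<noteq> 0" by blast
            have "(\<Sum>l\<in>I - {j}. u l y) = u k y"
              by (rule sum_single) (use fI k elim(2) in auto)
            then show ?thesis using elim(3) k R by auto
          next
            case False
            then show ?thesis using K by simp
          qed
          then have "- K \<le> w y" using elim(1) fI(2) by (auto simp: w_def)
          moreover have "q y \<le> - K" using qK[of y] R0 by (simp add: q_def)
          ultimately show ?thesis by (simp add: D_def)
        qed
      qed
      then have "\<phi> y = 0 \<and> (\<forall>i. P i y = 0)"
        by (auto simp: \<phi>_def P_def D_def Dg_def max_def split: if_splits)
      then show ?thesis by (simp add: \<Phi>_def)
    qed
  qed
  define v where "v i = (if i = j then (\<lambda>y. max 0 (w y + \<phi> y)) else (\<lambda>y. max 0 (u i y - \<phi> y)))" for i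
  define Gv where "Gv i = (if i = j then (\<lambda>y. if w y + \<phi> y > 0 then wg y + \<Phi> y else 0)
      else (\<lambda>y. if u i y - \<phi> y > 0 then g i y - \<Phi> y else 0))" for i
  have pe: "AE y in lebesgue. (\<Sum>i\<in>I. (norm (Gv i y))\<^sup>2 - 2 * (\<mu> i y - 1) * v i y) \<le>
      (\<Sum>i\<in>I. (norm (g i y))\<^sup>2 - 2 * (\<mu> i y - 1) * u i y)
        + (2 * ((\<Sum>i\<in>Basis. cmpd C \<delta> \<rho> x i y *\<^sub>R i) \<bullet> \<Phi> y) - (norm (\<Phi> y))\<^sup>2)
        - 2 * (((if y \<in> ball x \<delta> then C else 0) - (if y \<in> ball x \<rho> then 1 else 0)) * \<phi> y) \<and>
      (\<forall>i\<in>I. \<forall>l\<in>I. i \<noteq> l \<longrightarrow> v i y * v l y = 0) \<and> (u j y > 0 \<longrightarrow> v j y > 0)"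
    using a1 a2 a3 alt
  proof eventually_elim
    case (elim y)
    show ?case
      using pointwise_energy[of I j "\<lambda>i. u i y" "\<lambda>i. g i y" "w y" "wg y" "\<phi> y" "\<Phi> y" "q y" "\<Sum>i\<in>Basis. cmpd C \<delta> \<rho> x i y *\<^sub>R i"
          "\<lambda>i. \<mu> i y" "y \<in> ball x \<delta>" C "y \<in> ball x \<rho>" "\<lambda>i. v i y" "\<lambda>i. Gv i y"] fI elim
      by (simp add: w_def wg_def v_def Gv_def)
  qed
  have adm: "admissible v Gv"
    unfolding admissible_def I_def[symmetric]
  proof (intro ballI conjI impI)
    fix i assume i: "i \<in> I"
    have H1: "H1p (\<lambda>y. w y + \<phi> y) (\<lambda>y. wg y + \<Phi> y)" using H1p_add_scaled[OF Hw H\<phi>, of 1] by simp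
    have H2: "H1p (\<lambda>y. u i y - \<phi> y) (\<lambda>y. g i y - \<Phi> y)" using H1p_add_scaled[OF ug[OF i] H\<phi>, of "- 1"] by simp
    show "H1p (v i) (Gv i)" using H1p_pos[OF H1] H1p_pos[OF H2] by (auto simp: v_def Gv_def)
    show "integrable lebesgue (v i)"
      using wint \<phi>int u_integrable[of i] i by (auto simp: v_def I_def)
    show "AE y in lebesgue. 0 \<le> v i y" by (rule AE_I2) (auto simp: v_def)
    \<comment> \<open>Foreign phases are lowered only inside the ball of radius R, where their
      densities vanish. The phase v j remains positive wherever u j is.\<close>
    show "AE y in lebesgue. v i y = 0 \<longrightarrow> \<mu> i y = 0"
      using pe a1 a4 a6
    proof eventually_elim
      case (elim y)
      show ?case
      proof
        assume v0: "v i y = 0"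
        show "\<mu> i y = 0"
        proof (cases "i = j")
          case True
          then have "u i y = 0" using elim(1,2) v0 i by force
          then show ?thesis using elim(4) i by simp
        next
          case False
          show ?thesis
          proof (cases "y \<in> ball x R")
            case True
            then show ?thesis using elim(3) i False by blast
          next
            case out: False
            then have "\<phi> y = 0" using \<theta>(4)[of y] b by (simp add: \<phi>_def)
            then have "u i y = 0" using v0 False elim(2) i by (auto simp: v_def max_def split: if_splits)
            then show ?thesis using elim(4) i by simp
          qed
        qed
      qed
    qed
    fix l assume l: "l \<in> I" "i \<noteq> l"
    show "AE y in lebesgue. v i y * v l y = 0" using pe by eventually_elim (use i l in blast)
  qed
  define Q where "Q y = (\<Sum>i\<in>Basis. cmpd C \<delta> \<rho> x i y *\<^sub>R i)" for y
  have QP: "Q y \<bullet> \<Phi> y = (\<Sum>i\<in>Basis. cmpd C \<delta> \<rho> x i y * P i y)" for y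
    by (subst inner_commute) (simp add: Q_def inner_sum_right \<Phi>c)
  note L = cmp_laplacian[OF pos(1) \<rho>0 wP rz(1) rz(2), where C=C and x=x]
  have iQ: "integrable lebesgue (\<lambda>y. Q y \<bullet> \<Phi> y)" unfolding QP by (rule Bochner_Integration.integrable_sum) (rule L(2))
  \<comment> \<open>The equation of q tested with \<phi>: it cancels the linear part of the energy
    difference, so that only - |\<Phi>|^2 is left and minimality forces \<Phi> = 0.\<close>
  have eQ: "(\<integral>y. Q y \<bullet> \<Phi> y \<partial>lebesgue) =
      (\<integral>y. ((if y \<in> ball x \<delta> then C else 0) - (if y \<in> ball x \<rho> then 1 else 0)) * \<phi> y \<partial>lebesgue)"
    unfolding QP using L(1) L(2) by (subst Bochner_Integration.integral_sum) auto
  have i\<Phi>: "integrable lebesgue (\<lambda>y. (norm (\<Phi> y))\<^sup>2)" by (rule integrable_norm2[OF H1p_D(4)[OF H\<phi>]])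
  have iE: "integrable lebesgue (\<lambda>y. (norm (G y))\<^sup>2 - 2 * (\<mu> i y - 1) * z y)"
    if "H1p z G" "integrable lebesgue z" "i \<in> I" for z G i
    using integrable_norm2[OF H1p_D(4)[OF that(1)]] mu_mult_integrable[OF _ loc_int_integrable[OF that(2)], of i] that
    by (auto simp: I_def mult.assoc left_diff_distrib right_diff_distrib)
  have iu: "integrable lebesgue (\<lambda>y. (norm (g i y))\<^sup>2 - 2 * (\<mu> i y - 1) * u i y)" if "i \<in> I" for i
    using iE[OF ug[OF that] _ that] u_integrable that by (simp add: I_def)
  have iv: "integrable lebesgue (\<lambda>y. (norm (Gv i y))\<^sup>2 - 2 * (\<mu> i y - 1) * v i y)" if "i \<in> I" for i
    using iE[of "v i" "Gv i" i] adm that by (auto simp: admissible_def I_def)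
  have "(\<Sum>i\<in>I. En (\<lambda>y. \<mu> i y - 1) (u i) (g i)) \<le> (\<Sum>i\<in>I. En (\<lambda>y. \<mu> i y - 1) (v i) (Gv i))"
    using minimality[OF adm] by (simp add: I_def g_def)
  also have "\<dots> = (\<integral>y. (\<Sum>i\<in>I. (norm (Gv i y))\<^sup>2 - 2 * (\<mu> i y - 1) * v i y) \<partial>lebesgue)"
    unfolding En_def by (rule Bochner_Integration.integral_sum[symmetric]) (rule iv)
  also have "\<dots> \<le> (\<integral>y. (\<Sum>i\<in>I. (norm (g i y))\<^sup>2 - 2 * (\<mu> i y - 1) * u i y)
        + (2 * (Q y \<bullet> \<Phi> y) - (norm (\<Phi> y))\<^sup>2)
        - 2 * (((if y \<in> ball x \<delta> then C else 0) - (if y \<in> ball x \<rho> then 1 else 0)) * \<phi> y) \<partial>lebesgue)"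
  proof (rule integral_mono_AE)
    show "AE y in lebesgue. (\<Sum>i\<in>I. (norm (Gv i y))\<^sup>2 - 2 * (\<mu> i y - 1) * v i y) \<le>
      (\<Sum>i\<in>I. (norm (g i y))\<^sup>2 - 2 * (\<mu> i y - 1) * u i y) + (2 * (Q y \<bullet> \<Phi> y) - (norm (\<Phi> y))\<^sup>2)
        - 2 * (((if y \<in> ball x \<delta> then C else 0) - (if y \<in> ball x \<rho> then 1 else 0)) * \<phi> y)"
      using pe by eventually_elim (simp only: Q_def)
  qed (use iu iv iQ i\<Phi> L(3) in \<open>auto intro!: Bochner_Integration.integrable_sum Bochner_Integration.integrable_add Bochner_Integration.integrable_diff\<close>)
  also have "\<dots> = (\<Sum>i\<in>I. En (\<lambda>y. \<mu> i y - 1) (u i) (g i)) + (2 * (\<integral>y. Q y \<bullet> \<Phi> y \<partial>lebesgue) - (\<integral>y. (norm (\<Phi> y))\<^sup>2 \<partial>lebesgue))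
      - 2 * (\<integral>y. ((if y \<in> ball x \<delta> then C else 0) - (if y \<in> ball x \<rho> then 1 else 0)) * \<phi> y \<partial>lebesgue)"
  proof -
    have s: "integrable lebesgue (\<lambda>y. \<Sum>i\<in>I. (norm (g i y))\<^sup>2 - 2 * (\<mu> i y - 1) * u i y)"
      "(\<integral>y. (\<Sum>i\<in>I. (norm (g i y))\<^sup>2 - 2 * (\<mu> i y - 1) * u i y) \<partial>lebesgue) = (\<Sum>i\<in>I. En (\<lambda>y. \<mu> i y - 1) (u i) (g i))"
      unfolding En_def using iu by (auto intro!: Bochner_Integration.integrable_sum Bochner_Integration.integral_sum)
    define S where "S y = (\<Sum>i\<in>I. (norm (g i y))\<^sup>2 - 2 * (\<mu> i y - 1) * u i y)" for y
    define T where "T y = ((if y \<in> ball x \<delta> then C else 0) - (if y \<in> ball x \<rho> then 1 else 0)) * \<phi> y" for y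
    have iS: "integrable lebesgue S" "integrable lebesgue T" using s(1) L(3) by (simp_all add: S_def[abs_def] T_def[abs_def])
    have "(\<integral>y. S y + (2 * (Q y \<bullet> \<Phi> y) - (norm (\<Phi> y))\<^sup>2) - 2 * T y \<partial>lebesgue) =
      (\<integral>y. S y \<partial>lebesgue) + (2 * (\<integral>y. Q y \<bullet> \<Phi> y \<partial>lebesgue) - (\<integral>y. (norm (\<Phi> y))\<^sup>2 \<partial>lebesgue)) - 2 * (\<integral>y. T y \<partial>lebesgue)"
      using iS iQ i\<Phi> by simp
    then show ?thesis unfolding S_def T_def s(2) .
  qed
  finally have "(\<integral>y. (norm (\<Phi> y))\<^sup>2 \<partial>lebesgue) \<le> 0" using eQ by linarith
  moreover have "0 \<le> (\<integral>y. (norm (\<Phi> y))\<^sup>2 \<partial>lebesgue)" by (rule Bochner_Integration.integral_nonneg) simp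
  ultimately have "AE y in lebesgue. (norm (\<Phi> y))\<^sup>2 = 0"
    using integral_nonneg_eq_0_iff_AE[OF i\<Phi>] by simp
  then have "AE y in lebesgue. \<Phi> y \<bullet> i0 = 0" by eventually_elim simp
  then have "wd i0 \<phi> (\<lambda>y. 0)"
    using wd_cong_AE[OF H1p_D(3)[OF H\<phi> i0] _ _ i0, of \<phi> "\<lambda>y. 0"] by simp
  from wd_zero_integrable[OF this \<phi>int i0] have "AE y in lebesgue. \<phi> y = 0" .
  then show ?thesis using a1
  proof eventually_elim
    case (elim y)
    show ?case
    proof
      assume "y \<in> ball x R0"
      then have "\<theta> y = 1" using \<theta>(3)[of y] by simp
      then have "q y \<le> w y" using elim(1) by (auto simp: \<phi>_def D_def)
      also have "w y \<le> u j y" unfolding w_def using elim(2) by (auto intro!: sum_nonneg)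
      finally show "cmp C \<delta> \<rho> x y \<le> u j y" by (simp add: q_def)
    qed
  qed
qed

end

section \<open>Choice of the radii\<close>

lemma Psi_strict_antimono:
  assumes n: "DIM('a::euclidean_space) \<ge> 2" and r: "0 < r" "r < r'"
  shows "Psi TYPE('a) r' < Psi TYPE('a) r"
proof -
  let ?n = "DIM('a)"
  have sq: "r\<^sup>2 < r'\<^sup>2" using r by (intro power_strict_mono) auto
  have m1: "-1 \<le> r\<^sup>2" using zero_le_power2[of r] by linarith
  have pos: "hk ?n r (r'\<^sup>2) > 0" using r by (intro hk_pos)
  have "integral {r\<^sup>2..r'\<^sup>2} (\<lambda>s. hk ?n r (r'\<^sup>2)) \<le> integral {r\<^sup>2..r'\<^sup>2} (hk ?n r)"
  proof (rule integral_le)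
    show "hk ?n r integrable_on {r\<^sup>2..r'\<^sup>2}" by (rule hk_int[OF r(1)])
    fix s assume "s \<in> {r\<^sup>2..r'\<^sup>2}"
    then have "max (r\<^sup>2) s \<le> max (r\<^sup>2) (r'\<^sup>2)" by (intro max.mono) auto
    moreover have "0 < max (r\<^sup>2) s" unfolding less_max_iff_disj using r by simp
    ultimately show "hk ?n r (r'\<^sup>2) \<le> hk ?n r s" unfolding hk_def by (intro powr_mono2') auto
  qed auto
  moreover have "integral {r\<^sup>2..r'\<^sup>2} (\<lambda>s. hk ?n r (r'\<^sup>2)) = (r'\<^sup>2 - r\<^sup>2) * hk ?n r (r'\<^sup>2)"
    using integral_const_real[of "r\<^sup>2" "r'\<^sup>2" "hk ?n r (r'\<^sup>2)"] less_imp_le[OF sq] by (simp only: content_real real_scaleR_def)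
  moreover have "(r'\<^sup>2 - r\<^sup>2) * hk ?n r (r'\<^sup>2) > 0" using sq pos by simp
  ultimately have "Lk ?n r (r\<^sup>2) - Lk ?n r (r'\<^sup>2) > 0"
    using Lk_diff[OF r(1) m1 less_imp_le[OF sq], of ?n] by linarith
  then have "cn TYPE('a) * (Lk ?n r (r\<^sup>2) - Lk ?n r (r'\<^sup>2)) > 0" using cn_pos[where 'a='a] by simp
  then show ?thesis using Lk_Psi[OF n r(1) order_refl less_imp_le[OF r(2)]] by simp
qed

lemma Psi_isCont:
  assumes n: "DIM('a::euclidean_space) \<ge> 2" and r: "r > 0"
  shows "isCont (Psi TYPE('a)) r"
proof (cases "DIM('a) = 2")
  case True
  then show ?thesis using r unfolding Psi_def[abs_def] by (auto intro!: continuous_intros)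
next
  case False
  have "real DIM('a) * (real DIM('a) - 2) * vol_ball TYPE('a) 1 * r ^ (DIM('a) - 2) \<noteq> 0"
    using n False r vol_ball_pos[of 1, where 'a='a] by auto
  then show ?thesis using False unfolding Psi_def[abs_def] by (auto intro!: continuous_intros)
qed

text \<open>Newton's theorem for both balls: seen from outside, only the total charge C |B_\<delta>|
  - |B_\<rho>| counts, and the potential is normalised to vanish at radius \<rho>.\<close>

lemma cmp_outside:
  fixes x y :: "'a::euclidean_space"
  assumes n: "DIM('a) \<ge> 2" and d: "0 < \<delta>" "\<delta> \<le> \<rho>" "\<rho> \<le> dist x y"
  shows "cmp C \<delta> \<rho> x y = - ((C * vol_ball TYPE('a) \<delta> - vol_ball TYPE('a) \<rho>) * (Psi TYPE('a) \<rho> - Psi TYPE('a) (dist x y)))"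
proof -
  have s: "(y - x) \<bullet> (y - x) = (dist x y)\<^sup>2" by (simp add: dist_norm power2_norm_eq_inner[symmetric] norm_minus_commute)
  have 1: "cn TYPE('a) * (Lk DIM('a) \<delta> ((dist x y)\<^sup>2) - Lk DIM('a) \<delta> (\<rho>\<^sup>2)) = - (Psi TYPE('a) \<rho> - Psi TYPE('a) (dist x y))"
    using Lk_Psi[OF n d] unfolding right_diff_distrib by linarith
  have \<rho>: "0 < \<rho>" using d by simp
  have 2: "cn TYPE('a) * (Lk DIM('a) \<rho> ((dist x y)\<^sup>2) - Lk DIM('a) \<rho> (\<rho>\<^sup>2)) = - (Psi TYPE('a) \<rho> - Psi TYPE('a) (dist x y))"
    using Lk_Psi[OF n \<rho> order_refl d(3)] unfolding right_diff_distrib by linarith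
  have "cmp C \<delta> \<rho> x y = C * vol_ball TYPE('a) \<delta> * (cn TYPE('a) * (Lk DIM('a) \<delta> ((dist x y)\<^sup>2) - Lk DIM('a) \<delta> (\<rho>\<^sup>2)))
     - vol_ball TYPE('a) \<rho> * (cn TYPE('a) * (Lk DIM('a) \<rho> ((dist x y)\<^sup>2) - Lk DIM('a) \<rho> (\<rho>\<^sup>2)))"
    unfolding cmp_def s by (simp add: right_diff_distrib mult.left_commute)
  then show ?thesis unfolding 1 2 by (simp add: algebra_simps)
qed

text \<open>The concentrated charge has the larger potential difference to the sphere, by
  \<open>Lk_diff_antimono\<close>, and by assumption it is also the larger charge. The difference X
  for the spread charge is positive because \<open>hk\<close> is a positive constant within radius
  \<rho>.\<close>

lemma cmp_inside:
  fixes x y :: "'a::euclidean_space"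
  assumes d: "0 < \<delta>" "\<delta> \<le> \<rho>" "dist x y < \<rho>" and C: "vol_ball TYPE('a) \<rho> < C * vol_ball TYPE('a) \<delta>"
  shows "cmp C \<delta> \<rho> x y > 0"
proof -
  let ?n = "DIM('a)"
  have s: "(y - x) \<bullet> (y - x) = (dist x y)\<^sup>2" by (simp add: dist_norm power2_norm_eq_inner[symmetric] norm_minus_commute)
  define t where "t = (dist x y)\<^sup>2"
  have t0: "0 \<le> t" by (simp add: t_def)
  have t: "-1 \<le> t" "t < \<rho>\<^sup>2" using t0 power_strict_mono[OF d(3), of 2] by (simp_all add: t_def[symmetric])
  define X where "X = Lk ?n \<rho> t - Lk ?n \<rho> (\<rho>\<^sup>2)"
  have "integral {t..\<rho>\<^sup>2} (hk ?n \<rho>) = integral {t..\<rho>\<^sup>2} (\<lambda>s. 1 / \<rho> ^ ?n)"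
    using d by (intro Henstock_Kurzweil_Integration.integral_cong hk_inside) auto
  then have "X = (\<rho>\<^sup>2 - t) * (1 / \<rho> ^ ?n) / 2" unfolding X_def using Lk_diff[of \<rho> t "\<rho>\<^sup>2" ?n] t d by simp
  then have X: "X > 0" using t d by simp
  have Y: "X \<le> Lk ?n \<delta> t - Lk ?n \<delta> (\<rho>\<^sup>2)" unfolding X_def by (rule Lk_diff_antimono[OF d(1,2)]) (use t in auto)
  have v: "vol_ball TYPE('a) \<rho> > 0" using d by (intro vol_ball_pos) auto
  have "vol_ball TYPE('a) \<rho> * X < C * vol_ball TYPE('a) \<delta> * X" using C X by (intro mult_strict_right_mono)
  also have "\<dots> \<le> C * vol_ball TYPE('a) \<delta> * (Lk ?n \<delta> t - Lk ?n \<delta> (\<rho>\<^sup>2))" using Y C v by (intro mult_left_mono) auto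
  finally show ?thesis unfolding cmp_def s t_def[symmetric] X_def[symmetric] using cn_pos[where 'a='a] by simp
qed

text \<open>Turns an almost everywhere bound on a ball into a bound at its centre: the essential
  infimum over this one ball is below the supremum over all radii, which is the value of the
  representative.\<close>

lemma ess_liminf_ge:
  assumes rep: "ess_liminf_rep v" and v: "v \<in> borel_measurable lebesgue" and r: "r > 0"
    and ae: "AE y in lebesgue. y \<in> ball z r \<longrightarrow> \<epsilon> \<le> v y"
  shows "\<epsilon> \<le> v z"
proof -
  let ?M = "restrict_space lebesgue (ball z r)"
  have "esssup ?M (\<lambda>y. - ereal (v y)) \<le> - ereal \<epsilon>"
  proof (rule esssup_I)
    show "(\<lambda>y. - ereal (v y)) \<in> borel_measurable ?M"
      by (rule measurable_restrict_space1) (use v in measurable)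
    show "AE y in ?M. - ereal (v y) \<le> - ereal \<epsilon>"
      using ae by (subst AE_restrict_space_iff) (auto elim: eventually_mono)
  qed
  then have "ereal \<epsilon> \<le> - esssup ?M (\<lambda>y. - ereal (v y))" by (metis ereal_minus_le_minus ereal_uminus_uminus)
  also have "\<dots> \<le> (SUP r\<in>{0<..}. - esssup (restrict_space lebesgue (ball z r)) (\<lambda>y. - ereal (v y)))"
    by (rule SUP_upper) (use r in simp)
  also have "\<dots> = ereal (v z)" using rep[unfolded ess_liminf_rep_def, rule_format, of z] by (rule sym)
  finally show ?thesis by simp
qed

text \<open>The strict inequality for K is the limiting case \<rho> = \<delta>, R0 = R. Volume and
  \<Psi> are continuous, so it survives for \<delta> + e and R - e with small e > 0. The room
  between \<delta> and \<rho> later yields positivity on the closed ball.\<close>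

lemma radii_exist:
  assumes n: "DIM('a::euclidean_space) \<ge> 2" and d: "0 < \<delta>" "\<delta> < R" and C: "C > 1"
    and K: "K < (C - 1) * vol_ball TYPE('a) \<delta> * (Psi TYPE('a) \<delta> - Psi TYPE('a) R)"
  obtains \<rho> R0 where "\<delta> < \<rho>" "\<rho> < R0" "R0 < R" "vol_ball TYPE('a) \<rho> < C * vol_ball TYPE('a) \<delta>"
    "K < (C * vol_ball TYPE('a) \<delta> - vol_ball TYPE('a) \<rho>) * (Psi TYPE('a) \<rho> - Psi TYPE('a) R0)"
proof -
  define e where "e k = (R - \<delta>) * (1 / real (Suc k))" for k
  have "e \<longlonglongrightarrow> (R - \<delta>) * 0"
    unfolding e_def by (intro tendsto_mult tendsto_const LIMSEQ_Suc[OF lim_1_over_n])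
  then have e: "e \<longlonglongrightarrow> 0" by simp
  have e0: "e k > 0" for k using d by (simp add: e_def)
  have l1: "(\<lambda>k. \<delta> + e k) \<longlonglongrightarrow> \<delta>" using tendsto_add[OF tendsto_const e, of \<delta>] by simp
  have l2: "(\<lambda>k. R - e k) \<longlonglongrightarrow> R" using tendsto_diff[OF tendsto_const e, of R] by simp
  have v: "vol_ball TYPE('a) (\<delta> + e k) = vol_ball TYPE('a) 1 * (\<delta> + e k) ^ DIM('a)" for k
    using d e0[of k] by (intro vol_ball_scale) simp
  have "(\<lambda>k. vol_ball TYPE('a) 1 * (\<delta> + e k) ^ DIM('a)) \<longlonglongrightarrow> vol_ball TYPE('a) 1 * \<delta> ^ DIM('a)"
    by (intro tendsto_intros l1)
  then have l3: "(\<lambda>k. vol_ball TYPE('a) (\<delta> + e k)) \<longlonglongrightarrow> vol_ball TYPE('a) \<delta>"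
    using d vol_ball_scale[of \<delta>, where 'a='a] by (simp add: v)
  have l4: "(\<lambda>k. Psi TYPE('a) (\<delta> + e k)) \<longlonglongrightarrow> Psi TYPE('a) \<delta>" by (rule isCont_tendsto_compose[OF Psi_isCont[OF n d(1)] l1])
  have l5: "(\<lambda>k. Psi TYPE('a) (R - e k)) \<longlonglongrightarrow> Psi TYPE('a) R" by (rule isCont_tendsto_compose[OF Psi_isCont[OF n] l2]) (use d in simp)
  have v0: "vol_ball TYPE('a) \<delta> > 0" using vol_ball_pos[OF d(1)] .
  have E1: "\<forall>\<^sub>F k in sequentially. vol_ball TYPE('a) (\<delta> + e k) < C * vol_ball TYPE('a) \<delta>"
    by (rule order_tendstoD(2)[OF l3]) (use C v0 in simp)
  have "(\<lambda>k. (C * vol_ball TYPE('a) \<delta> - vol_ball TYPE('a) (\<delta> + e k)) * (Psi TYPE('a) (\<delta> + e k) - Psi TYPE('a) (R - e k)))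
      \<longlonglongrightarrow> (C * vol_ball TYPE('a) \<delta> - vol_ball TYPE('a) \<delta>) * (Psi TYPE('a) \<delta> - Psi TYPE('a) R)"
    by (intro tendsto_intros l3 l4 l5)
  then have E2: "\<forall>\<^sub>F k in sequentially. K < (C * vol_ball TYPE('a) \<delta> - vol_ball TYPE('a) (\<delta> + e k)) * (Psi TYPE('a) (\<delta> + e k) - Psi TYPE('a) (R - e k))"
    by (rule order_tendstoD(1)) (use K in \<open>simp add: left_diff_distrib\<close>)
  have E3: "\<forall>\<^sub>F k in sequentially. e k < (R - \<delta>) / 2" by (rule order_tendstoD(2)[OF e]) (use d in simp)
  obtain k where k: "vol_ball TYPE('a) (\<delta> + e k) < C * vol_ball TYPE('a) \<delta>"
    "K < (C * vol_ball TYPE('a) \<delta> - vol_ball TYPE('a) (\<delta> + e k)) * (Psi TYPE('a) (\<delta> + e k) - Psi TYPE('a) (R - e k))"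
    "e k < (R - \<delta>) / 2"
    using eventually_happens'[OF sequentially_bot eventually_conj[OF E1 eventually_conj[OF E2 E3]]] by blast
  show ?thesis by (rule that[of "\<delta> + e k" "R - e k"]) (use k e0[of k] in auto)
qed

theorem mainTheorem17:
  fixes \<mu> :: "nat \<Rightarrow> 'a::euclidean_space \<Rightarrow> real"
    and A :: "nat \<Rightarrow> 'a set"
    and m :: nat and c :: real
    and u :: "nat \<Rightarrow> 'a \<Rightarrow> real"
    and R1 M R2 R \<delta> C :: real
    and j :: nat and x :: 'a
  assumes dim: "DIM('a) \<ge> 2"
    and mu_Linf: "\<forall>i\<in>{1..m}. Linf (\<mu> i)"
    and mu_nonneg: "\<forall>i\<in>{1..m}. AE y in lebesgue. \<mu> i y \<ge> 0"
    and mu_cpt: "\<forall>i\<in>{1..m}. compact (supp (\<mu> i))"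
    and mu_disj: "\<forall>i\<in>{1..m}. \<forall>l\<in>{1..m}. i \<noteq> l \<longrightarrow> supp (\<mu> i) \<inter> supp (\<mu> l) = {}"
    and c_gt: "c > 1"
    and A_open: "\<forall>i\<in>{1..m}. open (A i) \<and> bounded (A i) \<and> A i \<noteq> {}"
    and A_bounds: "\<forall>i\<in>{1..m}. AE y in lebesgue.
        c * indicator (A i) y \<le> \<mu> i y \<and> \<mu> i y \<le> Linf_norm (\<mu> i) * indicator (A i) y"
    and u_S: "u \<in> S_m_mu m \<mu>"
    and u_min: "\<forall>v\<in>S_m_mu m \<mu>. JJ m (\<lambda>i y. \<mu> i y - 1) u \<le> JJ m (\<lambda>i y. \<mu> i y - 1) v"
    and u_rep: "\<forall>i\<in>{1..m}. lsc (u i) \<and> ess_liminf_rep (u i)"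
    and u_vanish: "\<forall>i\<in>{1..m}. \<forall>l\<in>{1..m}. l \<noteq> i \<longrightarrow> (\<forall>y\<in>supp (\<mu> l). u i y = 0)"
    and R1_gt: "R1 > diameter (\<Union>i\<in>{1..m}. supp (\<mu> i))"
    and M_def: "M = Max ((\<lambda>i. meas_of (\<mu> i) UNIV) ` {1..m})"
    and R2_def: "R2 = R1 + (M / vol_ball TYPE('a) 1) powr (1 / real DIM('a))"
    and j_in: "j \<in> {1..m}"
    and x_in: "x \<in> supp (\<mu> j)"
    and R_pos: "R > 0"
    and R_sep: "\<forall>l\<in>{1..m}. l \<noteq> j \<longrightarrow> meas_of (\<mu> l) (ball x (2 * R)) = 0"
    and \<delta>_pos: "0 < \<delta>" and \<delta>_lt: "\<delta> < R"
    and ball_A: "ball x \<delta> \<subseteq> A j"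
    and mu_ge_C: "AE y in lebesgue. y \<in> ball x \<delta> \<longrightarrow> \<mu> j y \<ge> C"
    and C_big: "C > 1 + M * (Psi TYPE('a) R - Psi TYPE('a) (2 * R2))
                       / (Psi TYPE('a) \<delta> - Psi TYPE('a) R) * (1 / vol_ball TYPE('a) \<delta>)"
  shows "cball x \<delta> \<subseteq> {y. u j y > 0}"
proof -
  interpret segregated_minimizer \<mu> A m c u
    by unfold_locales (fact mu_Linf mu_nonneg mu_cpt mu_disj c_gt A_open A_bounds u_S u_min)+
  let ?\<Psi> = "Psi TYPE('a)" and ?V = "vol_ball TYPE('a)"
  have mo: "meas_of (\<mu> i) UNIV = (\<integral>y. \<mu> i y \<partial>lebesgue)" for i
    by (simp add: meas_of_def set_lebesgue_integral_def)
  have M_ge: "(\<integral>y. \<mu> i y \<partial>lebesgue) \<le> M" if "i \<in> {1..m}" for i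
    unfolding M_def mo[symmetric] using that by (intro Max_ge) auto
  have mass_nonneg: "0 \<le> (\<integral>y. \<mu> i y \<partial>lebesgue)" if "i \<in> {1..m}" for i
    using mu_nonneg that by (intro integral_nonneg_AE) blast
  have M_pos: "M > 0"
  proof -
    have "(\<integral>y. \<mu> j y \<partial>lebesgue) \<noteq> 0"
    proof
      assume "(\<integral>y. \<mu> j y \<partial>lebesgue) = 0"
      then have "AE y in lebesgue. \<mu> j y = 0"
        using integral_nonneg_eq_0_iff_AE[OF mu_integrable[OF j_in] bspec[OF mu_nonneg j_in]] by simp
      then have "AE y in lebesgue. y \<in> ball x 1 \<longrightarrow> \<mu> j y = 0" by eventually_elim simp
      then show False using x_in by (auto simp: supp_def)
    qed
    then show ?thesis using mass_nonneg[OF j_in] M_ge[OF j_in] by linarith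
  qed
  \<comment> \<open>If j is the only phase, R may exceed 2 R2 and the lower bound for C may lie
    below 1; then c, which bounds the density from below on A j, takes over.\<close>
  define C' where "C' = max C c"
  have C': "C' > 1" using c_gt by (simp add: C'_def)
  have V\<delta>: "?V \<delta> > 0" using vol_ball_pos[OF \<delta>_pos] .
  have \<Psi>\<delta>: "?\<Psi> \<delta> - ?\<Psi> R > 0" using Psi_strict_antimono[OF dim \<delta>_pos \<delta>_lt] by simp
  have far: "AE z in lebesgue. \<mu> l z \<noteq> 0 \<longrightarrow> 2 * R \<le> dist x z" if l: "l \<in> {1..m}" "l \<noteq> j" for l
  proof -
    have int: "integrable lebesgue (\<lambda>z. indicator (ball x (2 * R)) z *\<^sub>R \<mu> l z)"
      by (rule integrable_mult_indicator[OF _ mu_integrable[OF l(1)]]) simp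
    have nn: "AE z in lebesgue. 0 \<le> indicator (ball x (2 * R)) z *\<^sub>R \<mu> l z"
      using bspec[OF mu_nonneg l(1)] by eventually_elim simp
    have "(\<integral>z. indicator (ball x (2 * R)) z *\<^sub>R \<mu> l z \<partial>lebesgue) = 0"
      using R_sep l by (simp add: meas_of_def set_lebesgue_integral_def)
    then have "AE z in lebesgue. indicator (ball x (2 * R)) z *\<^sub>R \<mu> l z = 0"
      using integral_nonneg_eq_0_iff_AE[OF int nn] by simp
    then show ?thesis by eventually_elim (auto simp: indicator_def split: if_splits)
  qed
  obtain K where K: "K \<ge> 0" "K < (C' - 1) * ?V \<delta> * (?\<Psi> \<delta> - ?\<Psi> R)"
    "\<And>l. l \<in> {1..m} \<Longrightarrow> l \<noteq> j \<Longrightarrow> AE y in lebesgue. y \<in> ball x R \<longrightarrow> u l y \<le> K"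
  proof (cases "\<exists>l\<in>{1..m}. l \<noteq> j")
    case False
    then show ?thesis using that[of 0] C' V\<delta> \<Psi>\<delta> by auto
  next
    case True
    then obtain l0 where l0: "l0 \<in> {1..m}" "l0 \<noteq> j" by blast
    \<comment> \<open>Chosen so that |B_b| = M, which makes the mean of each density over a ball of
      radius b at most 1. As R2 = R1 + b, the radius b is at most 2 R2, and the bound with \<Psi>(b)
      passes to the one with \<Psi>(2 R2).\<close>
    define b where "b = (M / ?V 1) powr (1 / real DIM('a))"
    have V1: "?V 1 > 0" by (rule vol_ball_pos) simp
    have b: "b > 0" using M_pos V1 by (simp add: b_def)
    have Vb: "?V b = M"
    proof -
      have "b ^ DIM('a) = M / ?V 1" using M_pos V1 by (simp add: b_def powr_realpow[symmetric] powr_powr)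
      then show ?thesis using vol_ball_scale[of b, where 'a='a] b V1 by simp
    qed
    \<comment> \<open>x and any point in the support of another density are at least 2 R apart, yet
      both lie in the union of the supports, whose diameter is below R1. Hence R \<le> 2 R2 and
      \<Psi>(R) - \<Psi>(2 R2) \<ge> 0.\<close>
    have RR: "2 * R < R1"
    proof -
      obtain z where z: "z \<in> A l0" using A_open l0 by blast
      then have zs: "z \<in> supp (\<mu> l0)" using A_sub_supp l0 by blast
      have "2 * R \<le> dist x z"
      proof (rule ccontr)
        assume "\<not> 2 * R \<le> dist x z"
        then have d: "2 * R - dist x z > 0" by simp
        have "AE y in lebesgue. y \<in> ball z (2 * R - dist x z) \<longrightarrow> \<mu> l0 y = 0"
          using far[OF l0]
        proof eventually_elim
          case (elim y)
          show ?case
          proof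
            assume "y \<in> ball z (2 * R - dist x z)"
            then have "dist x y < 2 * R" using dist_triangle[of x y z] by simp
            then show "\<mu> l0 y = 0" using elim by force
          qed
        qed
        then show False using zs d by (auto simp: supp_def)
      qed
      also have "dist x z \<le> diameter (\<Union>i\<in>{1..m}. supp (\<mu> i))"
      proof (rule diameter_bounded_bound)
        show "bounded (\<Union>i\<in>{1..m}. supp (\<mu> i))" using mu_cpt by (auto intro: compact_imp_bounded)
      qed (use x_in j_in zs l0 in auto)
      finally show ?thesis using R1_gt by linarith
    qed
    have R2: "R2 = R1 + b" by (simp add: R2_def b_def)
    have le: "R \<le> 2 * R2" "b \<le> 2 * R2" using RR R_pos b by (auto simp: R2)
    define \<kappa> where "\<kappa> = ?\<Psi> R - ?\<Psi> (2 * R2)"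
    have \<kappa>: "\<kappa> \<ge> 0" using Psi_antimono[OF dim R_pos le(1)] by (simp add: \<kappa>_def)
    have \<kappa>b: "?\<Psi> R - ?\<Psi> b \<le> \<kappa>" using Psi_antimono[OF dim b le(2)] by (simp add: \<kappa>_def)
    show ?thesis
    proof (rule that[of "M * \<kappa>"])
      show "0 \<le> M * \<kappa>" using M_pos \<kappa> by simp
      have "M * \<kappa> / (?\<Psi> \<delta> - ?\<Psi> R) * (1 / ?V \<delta>) < C - 1" using C_big by (simp add: \<kappa>_def)
      then have "M * \<kappa> / ((?\<Psi> \<delta> - ?\<Psi> R) * ?V \<delta>) < C' - 1" by (simp add: C'_def)
      then show "M * \<kappa> < (C' - 1) * ?V \<delta> * (?\<Psi> \<delta> - ?\<Psi> R)"
        using V\<delta> \<Psi>\<delta> by (simp add: pos_divide_less_eq mult_ac)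
      fix l assume l: "l \<in> {1..m}" "l \<noteq> j"
      have "AE y in lebesgue. y \<in> ball x R \<longrightarrow> u l y \<le> \<kappa> * (\<integral>y. \<mu> l y \<partial>lebesgue)"
        by (rule upper_bound[OF dim l(1) R_pos b _ far[OF l] \<kappa> \<kappa>b]) (use M_ge[OF l(1)] Vb in simp)
      then show "AE y in lebesgue. y \<in> ball x R \<longrightarrow> u l y \<le> M * \<kappa>"
      proof eventually_elim
        case (elim y)
        have "\<kappa> * (\<integral>y. \<mu> l y \<partial>lebesgue) \<le> M * \<kappa>"
          using mult_left_mono[OF M_ge[OF l(1)] \<kappa>] by (simp add: mult.commute)
        then show ?case using elim by linarith
      qed
    qed
  qed
  obtain \<rho> R0 where r: "\<delta> < \<rho>" "\<rho> < R0" "R0 < R" and Cv: "?V \<rho> < C' * ?V \<delta>"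
    and gap: "K < (C' * ?V \<delta> - ?V \<rho>) * (?\<Psi> \<rho> - ?\<Psi> R0)"
    by (rule radii_exist[OF dim \<delta>_pos \<delta>_lt C' K(2)])
  have \<rho>0: "\<rho> > 0" "R0 > 0" using r \<delta>_pos by auto
  have out: "cmp C' \<delta> \<rho> x y = - ((C' * ?V \<delta> - ?V \<rho>) * (?\<Psi> \<rho> - ?\<Psi> (dist x y)))" if "\<rho> \<le> dist x y" for y
    by (rule cmp_outside[OF dim \<delta>_pos _ that]) (use r in simp)
  have lb: "AE y in lebesgue. y \<in> ball x R0 \<longrightarrow> cmp C' \<delta> \<rho> x y \<le> u j y"
  proof (rule lower_bound[OF j_in \<delta>_pos r _ K(3) K(1) ball_A])
    show "AE y in lebesgue. y \<in> ball x R \<longrightarrow> \<mu> l y = 0" if "l \<in> {1..m}" "l \<noteq> j" for l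
      using far[OF that] by eventually_elim (use R_pos in auto)
    show "AE y in lebesgue. y \<in> ball x \<delta> \<longrightarrow> C' \<le> \<mu> j y"
      using mu_ge_C mu_on_A[OF j_in] by eventually_elim (use ball_A in \<open>auto simp: C'_def\<close>)
    show "cmp C' \<delta> \<rho> x y \<le> 0" if "\<rho> \<le> dist x y" for y
      using out[OF that] Cv Psi_antimono[OF dim \<rho>0(1) that] by simp
    show "cmp C' \<delta> \<rho> x y \<le> - K" if y: "R0 \<le> dist x y" for y
    proof -
      have "(C' * ?V \<delta> - ?V \<rho>) * (?\<Psi> \<rho> - ?\<Psi> R0) \<le> (C' * ?V \<delta> - ?V \<rho>) * (?\<Psi> \<rho> - ?\<Psi> (dist x y))"
        using Psi_antimono[OF dim \<rho>0(2) y] Cv by (intro mult_left_mono) auto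
      then show ?thesis using out[of y] y r gap by linarith
    qed
  qed
  show ?thesis
  proof
    fix z assume z: "z \<in> cball x \<delta>"
    \<comment> \<open>z is at distance at most \<delta> from x, so the closed ball of radius s
      around z stays within distance (\<delta> + \<rho>) / 2 < \<rho> of x. There the comparison
      function is positive, and by compactness it attains its minimum.\<close>
    define s where "s = (\<rho> - \<delta>) / 2"
    have s: "s > 0" using r by (simp add: s_def)
    have sub: "dist x y < \<rho>" if "y \<in> cball z s" for y
      using that z dist_triangle[of x y z] r by (simp add: s_def field_simps)
    have "continuous_on (cball z s) (cmp C' \<delta> \<rho> x)"
      by (rule continuous_on_subset[OF continuous_cmp[OF \<delta>_pos \<rho>0(1)]]) simp
    then obtain y0 where y0: "y0 \<in> cball z s" "\<forall>y\<in>cball z s. cmp C' \<delta> \<rho> x y0 \<le> cmp C' \<delta> \<rho> x y"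
      using continuous_attains_inf[of "cball z s" "cmp C' \<delta> \<rho> x"] s by auto
    have pos: "cmp C' \<delta> \<rho> x y0 > 0" by (rule cmp_inside[OF \<delta>_pos _ sub[OF y0(1)] Cv]) (use r in simp)
    have "cmp C' \<delta> \<rho> x y0 \<le> u j z"
    proof (rule ess_liminf_ge[OF _ u_facts(3)[OF j_in] s])
      show "ess_liminf_rep (u j)" using u_rep j_in by blast
      show "AE y in lebesgue. y \<in> ball z s \<longrightarrow> cmp C' \<delta> \<rho> x y0 \<le> u j y"
        using lb
      proof eventually_elim
        case (elim y)
        show ?case
        proof
          assume y: "y \<in> ball z s"
          then have "y \<in> ball x R0" using sub[of y] r by simp
          then have "cmp C' \<delta> \<rho> x y \<le> u j y" using elim by blast
          moreover have "cmp C' \<delta> \<rho> x y0 \<le> cmp C' \<delta> \<rho> x y" using y0(2) y by simp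
          ultimately show "cmp C' \<delta> \<rho> x y0 \<le> u j y" by linarith
        qed
      qed
    qed
    then show "z \<in> {y. u j y > 0}" using pos by simp
  qed
qed

end
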